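(* Let $d\ge2$, and let $s,\ell,\kappa$, $\varphi$ and $P_{0,\varphi}(\tau)$ be as in the context. Let $\psi\in C_0^\infty(\mathbb{R}^d)$ be such that $\psi(x)=1$ for $|x|\le1$. Given any $\delta>0$, there are positive constants $C$, $A_0$ and $\tau_0$ such that if $A=A_0\tau^{2/(1+2\ell-2s)}$, then for all $\tau\ge\tau_0$, $\lambda\ge\delta$, $0<\varepsilon\le1$, and for all functions $f\in H^2(\mathbb{R}^d)$ satisfying $\langle x\rangle^s(P_{0,\varphi}(\tau)-\lambda^2\pm i\varepsilon)(1-\psi)f\in L^2(\mathbb{R}^d)$, we have $$\|\langle x\rangle^{-s}(1-\psi)f\|_{H^1_h}\le Ch\tau^{-1/2}\|\langle x\rangle^s(P_{0,\varphi}(\tau)-\lambda^2\pm i\varepsilon)(1-\psi)f\|_{L^2}+CA^\ell(\varepsilon h)^{1/2}\|f\|_{L^2},$$ where $h=(\lambda+\tau)^{-1}$. If $d\ge3$, then for all functions $f\in H^2(\mathbb{R}^d)$ satisfying $\langle x\rangle^s(P_{0,\varphi}(\tau)-\lambda^2\pm i\varepsilon)f\in L^2(\mathbb{R}^d)$ we have $$\|\langle x\rangle^{-s}f\|_{H^1_h}\le Ch\tau^{-1/2}\|\langle x\rangle^s(P_{0,\varphi}(\tau)-\lambda^2\pm i\varepsilon)f\|_{L^2}+CA^\ell(\varepsilon h)^{1/2}\|f\|_{L^2}.$$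
   Context: $\langle x\rangle=(|x|^2+1)^{1/2}$, $r=|x|$. The parameters satisfy $0<s-\frac12<\ell<\frac{2s}3<\frac23$, $0<\kappa<2s-1$ and $\kappa<1-\ell$. For a parameter $A\gg1$, $\varphi\in C^1([0,+\infty))$ is the function with $\varphi(0)=0$ and $$\varphi'(r)=\begin{cases}(r+1)^{-\ell}(2-(r+1)^{-\kappa}),&0\le r\le A,\\ K_A(r+1)^{-2s},&r\ge A,\end{cases}\qquad K_A=(A+1)^{2s-\ell}(2-(A+1)^{-\kappa}),$$ regarded as the radial function $\varphi(|x|)$ on $\mathbb{R}^d$; it depends on $A$, hence on $\tau$ once $A=A_0\tau^{2/(1+2\ell-2s)}$. For $\tau>0$, $P_{0,\varphi}(\tau)=-e^{\tau\varphi}\Delta e^{-\tau\varphi}$. For $0<h\le1$, $\|f\|_{H^1_h}^2=\|f\|_{L^2}^2+h^2\|\nabla f\|_{L^2}^2$. The constants $C,A_0,\tau_0$ do not depend on $\tau,\lambda,\varepsilon,f$. *)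

theory Defs
  imports "HOL-Analysis.Analysis"
begin

section \<open>Smooth functions and test functions\<close>

definition pderiv_dir :: "'a::euclidean_space \<Rightarrow> ('a \<Rightarrow> complex) \<Rightarrow> 'a \<Rightarrow> complex" where
  "pderiv_dir b f x = frechet_derivative f (at x) b"

fun Ck :: "nat \<Rightarrow> ('a::euclidean_space \<Rightarrow> complex) \<Rightarrow> bool" where
  "Ck 0 f \<longleftrightarrow> continuous_on UNIV f"
| "Ck (Suc k) f \<longleftrightarrow> (\<forall>x. f differentiable (at x)) \<and> (\<forall>b\<in>Basis. Ck k (pderiv_dir b f))"

definition test_function :: "('a::euclidean_space \<Rightarrow> complex) \<Rightarrow> bool" where
  "test_function \<eta> \<longleftrightarrow> (\<forall>k. Ck k \<eta>) \<and> compact (closure {x. \<eta> x \<noteq> 0})"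

definition laplacian :: "('a::euclidean_space \<Rightarrow> complex) \<Rightarrow> 'a \<Rightarrow> complex" where
  "laplacian \<eta> x = (\<Sum>b\<in>Basis. pderiv_dir b (pderiv_dir b \<eta>) x)"

section \<open>Square-integrable functions, weak derivatives and Sobolev spaces\<close>

text \<open>Elements of $L^2$ and $H^k$ are represented by pointwise defined, Lebesgue-measurable
  functions; all notions below are invariant under changes on null sets.\<close>

definition L2_fun :: "('a::euclidean_space \<Rightarrow> complex) \<Rightarrow> bool" where
  "L2_fun f \<longleftrightarrow> f \<in> borel_measurable lebesgue \<and> integrable lebesgue (\<lambda>x. (cmod (f x))\<^sup>2)"

text \<open>Only meaningful under \<^const>\<open>L2_fun\<close>: the Bochner integral of a non-integrable function
  is \<open>0\<close>.\<close>

definition L2_norm :: "('a::euclidean_space \<Rightarrow> complex) \<Rightarrow> real" where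
  "L2_norm f = sqrt (LINT x|lebesgue. (cmod (f x))\<^sup>2)"

definition locally_integrable :: "('a::euclidean_space \<Rightarrow> complex) \<Rightarrow> bool" where
  "locally_integrable u \<longleftrightarrow> (\<forall>K. compact K \<longrightarrow> set_integrable lebesgue K u)"

definition has_weak_partial ::
  "'a::euclidean_space \<Rightarrow> ('a \<Rightarrow> complex) \<Rightarrow> ('a \<Rightarrow> complex) \<Rightarrow> bool" where
  "has_weak_partial b u g \<longleftrightarrow>
     locally_integrable u \<and> locally_integrable g \<and>
     (\<forall>\<eta>. test_function \<eta> \<longrightarrow>
        (LINT x|lebesgue. u x * pderiv_dir b \<eta> x) = - (LINT x|lebesgue. g x * \<eta> x))"

definition has_weak_laplacian ::
  "('a::euclidean_space \<Rightarrow> complex) \<Rightarrow> ('a \<Rightarrow> complex) \<Rightarrow> bool" where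
  "has_weak_laplacian u g \<longleftrightarrow>
     locally_integrable u \<and> locally_integrable g \<and>
     (\<forall>\<eta>. test_function \<eta> \<longrightarrow>
        (LINT x|lebesgue. u x * laplacian \<eta> x) = (LINT x|lebesgue. g x * \<eta> x))"

fun sobolev_H :: "nat \<Rightarrow> ('a::euclidean_space \<Rightarrow> complex) \<Rightarrow> bool" where
  "sobolev_H 0 f \<longleftrightarrow> L2_fun f"
| "sobolev_H (Suc k) f \<longleftrightarrow> L2_fun f \<and> (\<forall>b\<in>Basis. \<exists>g. has_weak_partial b f g \<and> sobolev_H k g)"

text \<open>A representative of the weak derivative, which is unique up to null sets when it exists.\<close>

definition weak_partial :: "'a::euclidean_space \<Rightarrow> ('a \<Rightarrow> complex) \<Rightarrow> 'a \<Rightarrow> complex" where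
  "weak_partial b f = (SOME g. has_weak_partial b f g)"

definition H1h_norm :: "real \<Rightarrow> ('a::euclidean_space \<Rightarrow> complex) \<Rightarrow> real" where
  "H1h_norm h f =
     sqrt ((L2_norm f)\<^sup>2 + h\<^sup>2 * (\<Sum>b\<in>Basis. (L2_norm (weak_partial b f))\<^sup>2))"

section \<open>The weights and the conjugated operator\<close>

definition japanese :: "'a::euclidean_space \<Rightarrow> real" where
  "japanese x = sqrt ((norm x)\<^sup>2 + 1)"

definition K_const :: "real \<Rightarrow> real \<Rightarrow> real \<Rightarrow> real \<Rightarrow> real" where
  "K_const s l \<kappa> A = (A + 1) powr (2 * s - l) * (2 - (A + 1) powr (- \<kappa>))"

definition phase_deriv :: "real \<Rightarrow> real \<Rightarrow> real \<Rightarrow> real \<Rightarrow> real \<Rightarrow> real" where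
  "phase_deriv s l \<kappa> A r =
     (if r \<le> A then (r + 1) powr (- l) * (2 - (r + 1) powr (- \<kappa>))
      else K_const s l \<kappa> A * (r + 1) powr (- 2 * s))"

text \<open>The solution of \<open>\<phi> 0 = 0\<close>, \<open>\<phi>' = phase_deriv s l \<kappa> A\<close> on \<open>[0, \<infinity>)\<close>; see
  \<open>phase_has_derivative\<close> and \<open>phase_unique\<close> below.\<close>

definition phase :: "real \<Rightarrow> real \<Rightarrow> real \<Rightarrow> real \<Rightarrow> real \<Rightarrow> real" where
  "phase s l \<kappa> A r = integral {0..r} (phase_deriv s l \<kappa> A)"

text \<open>\<open>has_conj_laplacian \<tau> \<phi> f p\<close> says that the distribution
  $P_{0,\varphi}(\tau) f = - e^{\tau\varphi} \Delta (e^{-\tau\varphi} f)$ is the function \<open>p\<close>.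
  The phase is not smooth at the origin, so \<open>\<Delta>\<close> has to be the weak Laplacian.\<close>

definition has_conj_laplacian ::
  "real \<Rightarrow> ('a::euclidean_space \<Rightarrow> real) \<Rightarrow> ('a \<Rightarrow> complex) \<Rightarrow> ('a \<Rightarrow> complex) \<Rightarrow> bool" where
  "has_conj_laplacian \<tau> \<phi> f p \<longleftrightarrow>
     (\<exists>g. has_weak_laplacian (\<lambda>x. complex_of_real (exp (- \<tau> * \<phi> x)) * f x) g \<and>
          (\<forall>x. p x = - complex_of_real (exp (\<tau> * \<phi> x)) * g x))"

lemma phase_deriv_continuous:
  assumes "A \<ge> 0"
  shows "continuous_on {0..} (phase_deriv s l \<kappa> A)"
proof -
  have eq: "(A + 1) powr (- l) * (2 - (A + 1) powr (- \<kappa>)) = K_const s l \<kappa> A * (A + 1) powr (- 2 * s)"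
  proof -
    have "(A + 1) powr (2 * s - l) * (A + 1) powr (- 2 * s) = (A + 1) powr (- l)"
      by (simp flip: powr_add)
    then show ?thesis by (simp add: K_const_def algebra_simps)
  qed
  have "continuous_on ({0..A} \<union> {A..}) (\<lambda>r. if r \<le> A then (r + 1) powr (- l) * (2 - (r + 1) powr (- \<kappa>))
      else K_const s l \<kappa> A * (r + 1) powr (- 2 * s))"
    using assms eq by (intro continuous_on_If) (auto intro!: continuous_intros dest: antisym)
  moreover have "{0..A} \<union> {A..} = {0..}" using assms by auto
  ultimately show ?thesis unfolding phase_deriv_def[abs_def] by simp
qed

lemma phase_zero: "phase s l \<kappa> A 0 = 0"
  by (simp add: phase_def)

lemma phase_has_derivative:
  assumes "A \<ge> 0" "r \<ge> 0"
  shows "(phase s l \<kappa> A has_real_derivative phase_deriv s l \<kappa> A r) (at r within {0..})"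
proof -
  have "continuous_on {0..r + 1} (phase_deriv s l \<kappa> A)"
    using phase_deriv_continuous[OF assms(1)] by (rule continuous_on_subset) auto
  then have "(phase s l \<kappa> A has_real_derivative phase_deriv s l \<kappa> A r) (at r within {0..r + 1})"
    unfolding phase_def[abs_def] using assms by (intro integral_has_real_derivative) auto
  moreover have "at r within {0..r + 1} = at r within {0..}"
    using assms by (intro at_within_nhd[where S = "{..<r + 1}"]) auto
  ultimately show ?thesis by simp
qed

lemma phase_unique:
  assumes "\<phi> 0 = 0" "r \<ge> 0"
    and deriv: "\<And>t. t \<ge> 0 \<Longrightarrow> (\<phi> has_real_derivative phase_deriv s l \<kappa> A t) (at t within {0..})"
  shows "\<phi> r = phase s l \<kappa> A r"
proof -
  have "(\<phi> has_vector_derivative phase_deriv s l \<kappa> A t) (at t within {0..r})" if "t \<in> {0..r}" for t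
    using DERIV_subset[OF deriv[of t], of "{0..r}"] that
    by (auto simp flip: has_real_derivative_iff_has_vector_derivative)
  then have "(phase_deriv s l \<kappa> A has_integral \<phi> r - \<phi> 0) {0..r}"
    using assms(2) by (intro fundamental_theorem_of_calculus) auto
  then show ?thesis using assms(1) by (simp add: phase_def integral_unique)
qed

end

theory Submission
  imports Defs
begin

text \<open>
  Write \<open>P\<close> for the conjugated operator and \<open>u\<close> for \<open>f\<close> or \<open>(1 - \<psi>) f\<close>, put \<open>N = (d - 1)/2\<close> and \<open>h = 1/(lam + \<tau>)\<close>, and let \<open>F\<close>
  be the weighted source, so that \<open>P u - lam\<^sup>2 u \<plusminus> i \<epsilon> u = \<langle>x\<rangle>\<^sup>-\<^sup>s F\<close>.  The estimate is a Morawetz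
  estimate: the equation is tested against a radial first-order multiplier
  \<open>M u = m(r) (r \<partial>\<^sub>r u + N u)\<close>, and the real part of the result is bounded from below.

  Integrating by parts in the direction of \<open>x\<close> turns the real part of the pairing of \<open>(P - lam\<^sup>2) u\<close>
  with \<open>M u\<close> into a quadratic form in \<open>u\<close> and \<open>\<nabla>u\<close> (\<open>morawetz_identity\<close>, \<open>morawetz_inequality\<close>): with
  \<open>\<mu> = r m\<close> and \<open>\<Phi> = \<phi>'\<close>, it contains \<open>lam\<^sup>2 \<mu>'/2\<close> and \<open>\<tau>\<^sup>2 (\<mu> \<Phi>\<^sup>2)'/2\<close> times \<open>|u|\<^sup>2\<close>, a nonnegative
  angular part, and the friction term \<open>2 \<tau> \<Phi> m |r \<partial>\<^sub>r u + N u|\<^sup>2 / r\<close>, which is produced by the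
  skew-adjoint part of \<open>P\<close>.  Half of the friction absorbs the cross term with \<open>\<phi>''\<close>;
  the other half absorbs the pairing of the source with \<open>M u\<close> at the cost of
  \<open>\<parallel>F\<parallel>\<^sup>2 / \<tau>\<close>, and this is the origin of the factor \<open>\<tau>\<^sup>-\<^sup>1\<^sup>/\<^sup>2\<close>.

  The multiplier has to make the coefficient of \<open>|u|\<^sup>2\<close> at least a constant times
  \<open>(lam\<^sup>2 + \<tau>\<^sup>2) (r + 1)\<^sup>-\<^sup>2\<^sup>s\<close> (lemma \<open>coercive\<close>).  For \<open>r \<le> A\<close> take \<open>m = (r + 1)\<^sup>2\<^sup>l\<^sup>-\<^sup>1\<close>: then
  \<open>(r + 1) m \<Phi>\<^sup>2 = (2 - (r + 1)\<^sup>-\<^sup>\<kappa>)\<^sup>2\<close> is increasing, which gives the \<open>\<tau>\<^sup>2\<close>-part, and \<open>\<mu>\<close> is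
  increasing, which gives the \<open>lam\<^sup>2\<close>-part.  For \<open>r > A\<close> the phase decays and \<open>(\<mu> \<Phi>\<^sup>2)'\<close> is negative of
  size \<open>a\<^sup>2\<^sup>s\<^sup>-\<^sup>1 (r + 1)\<^sup>-\<^sup>2\<^sup>s\<close>, where \<open>a = A + 1\<close>; but \<open>m\<close> is continued so that \<open>\<mu>'\<close> is larger than this by a
  factor of order \<open>a\<^sup>2\<^sup>l\<close>.  Since \<open>lam \<ge> \<delta>\<close>, the \<open>lam\<^sup>2\<close>-part wins as soon as \<open>a\<^sup>2\<^sup>l\<close> exceeds a large
  multiple of \<open>\<tau>\<^sup>2\<close>, and this is what \<open>A = A0 \<tau> powr (2 / (1 + 2 l - 2 s))\<close> guarantees.

  The term \<open>\<plusminus> i \<epsilon> u\<close> costs \<open>\<epsilon> \<parallel>u\<parallel> \<parallel>M u\<parallel>\<close>, where \<open>\<parallel>M u\<parallel>\<close> is at most a multiple of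
  \<open>A\<^sup>2\<^sup>l (\<parallel>\<nabla>u\<parallel> + \<parallel>u\<parallel>)\<close>.  Gradients, with and without the weight \<open>\<langle>x\<rangle>\<^sup>-\<^sup>s\<close>, are controlled by testing the
  equation against a real weight times \<open>cnj u\<close> (\<open>conjugated_energy_estimate\<close>), and
  \<open>combine_weighted_estimates\<close> puts the three inequalities together.

  The dimension enters through the zeroth-order term \<open>N (N - 1) |u|\<^sup>2 / r\<^sup>2\<close>.  It is nonnegative for
  \<open>d \<ge> 3\<close>; for \<open>d = 2\<close> it equals \<open>- |u|\<^sup>2 / (4 r\<^sup>2)\<close>, which is harmless only away from the origin.  This is why
  the general statement concerns \<open>(1 - \<psi>) f\<close>.

  Neither \<open>\<phi>\<close> nor the multiplier is smooth at the origin and at \<open>r = A\<close>, but both have bounded Lipschitz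
  coefficients, so everything is done with weak derivatives and the first-order form of the equation
  (\<open>weak_conjugated_equation\<close>).  The identities are proved for test functions and extended by density
  (\<open>weak_grad2_approx\<close>).
\<close>

section \<open>Square-integrable functions\<close>

lemma L2_fun_measurable: "L2_fun f \<Longrightarrow> f \<in> borel_measurable lebesgue"
  by (simp add: L2_fun_def)

lemma L2_fun_integrable: "L2_fun f \<Longrightarrow> integrable lebesgue (\<lambda>x. (cmod (f x))\<^sup>2)"
  by (simp add: L2_fun_def)

lemma L2_fun_bound:
  assumes "L2_fun g" "f \<in> borel_measurable lebesgue" "AE x in lebesgue. cmod (f x) \<le> C * cmod (g x)"
  shows "L2_fun f"
proof -
  have "integrable lebesgue (\<lambda>x. (cmod (f x))\<^sup>2)"
  proof (rule Bochner_Integration.integrable_bound)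
    show "integrable lebesgue (\<lambda>x. C\<^sup>2 * (cmod (g x))\<^sup>2)"
      using L2_fun_integrable[OF assms(1)] by simp
    show "(\<lambda>x. (cmod (f x))\<^sup>2) \<in> borel_measurable lebesgue"
      using assms(2) by measurable
    show "AE x in lebesgue. norm ((cmod (f x))\<^sup>2) \<le> norm (C\<^sup>2 * (cmod (g x))\<^sup>2)"
      using assms(3)
    proof eventually_elim
      case (elim x)
      then have "(cmod (f x))\<^sup>2 \<le> (C * cmod (g x))\<^sup>2" by (intro power_mono) auto
      then show ?case by (simp add: power_mult_distrib)
    qed
  qed
  then show ?thesis using assms(2) by (simp add: L2_fun_def)
qed

lemma L2_fun_bounded_mult:
  fixes w f :: "'a::euclidean_space \<Rightarrow> complex"
  assumes "L2_fun f" "w \<in> borel_measurable lebesgue" "\<And>x. cmod (w x) \<le> C"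
  shows "L2_fun (\<lambda>x. w x * f x)"
proof (rule L2_fun_bound[OF assms(1)])
  show "(\<lambda>x. w x * f x) \<in> borel_measurable lebesgue"
    using assms(2) L2_fun_measurable[OF assms(1)] by measurable
  show "AE x in lebesgue. cmod (w x * f x) \<le> C * cmod (f x)"
    using assms(3) by (simp add: norm_mult mult_right_mono)
qed

lemma L2_fun_zero [simp, intro]: "L2_fun (\<lambda>x. 0)"
  by (simp add: L2_fun_def)

lemma L2_fun_cmult: "L2_fun f \<Longrightarrow> L2_fun (\<lambda>x. c * f x)"
  by (rule L2_fun_bounded_mult[where C = "cmod c"]) auto

lemma L2_fun_minus: "L2_fun f \<Longrightarrow> L2_fun (\<lambda>x. - f x)"
  using L2_fun_cmult[of f "-1"] by simp

lemma L2_fun_cnj: "L2_fun f \<Longrightarrow> L2_fun (\<lambda>x. cnj (f x))"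
  unfolding L2_fun_def
  using measurable_comp[of f lebesgue borel cnj borel] borel_measurable_continuous_onI[of cnj]
  by (auto simp: o_def continuous_intros)

lemma L2_fun_add:
  assumes "L2_fun f" "L2_fun g"
  shows "L2_fun (\<lambda>x. f x + g x)"
proof -
  note [measurable] = L2_fun_measurable[OF assms(1)] L2_fun_measurable[OF assms(2)]
  have "integrable lebesgue (\<lambda>x. (cmod (f x + g x))\<^sup>2)"
  proof (rule Bochner_Integration.integrable_bound)
    show "integrable lebesgue (\<lambda>x. 2 * (cmod (f x))\<^sup>2 + 2 * (cmod (g x))\<^sup>2)"
      using assms by (auto simp: L2_fun_def)
    have "(cmod (f x + g x))\<^sup>2 \<le> 2 * (cmod (f x))\<^sup>2 + 2 * (cmod (g x))\<^sup>2" for x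
    proof -
      have "(cmod (f x + g x))\<^sup>2 \<le> (cmod (f x) + cmod (g x))\<^sup>2"
        by (intro power_mono norm_triangle_ineq) auto
      also have "\<dots> \<le> 2 * (cmod (f x))\<^sup>2 + 2 * (cmod (g x))\<^sup>2"
        using sum_squares_bound[of "cmod (f x)" "cmod (g x)"] by (simp add: power2_sum)
      finally show ?thesis .
    qed
    then show "AE x in lebesgue. norm ((cmod (f x + g x))\<^sup>2) \<le> norm (2 * (cmod (f x))\<^sup>2 + 2 * (cmod (g x))\<^sup>2)"
      by auto
  qed measurable
  then show ?thesis by (simp add: L2_fun_def)
qed

lemma L2_fun_diff: "L2_fun f \<Longrightarrow> L2_fun g \<Longrightarrow> L2_fun (\<lambda>x. f x - g x)"
  using L2_fun_add[of f "\<lambda>x. - g x"] L2_fun_minus[of g] by simp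

lemma L2_fun_sum: "(\<And>i. i \<in> I \<Longrightarrow> L2_fun (f i)) \<Longrightarrow> L2_fun (\<lambda>x. \<Sum>i\<in>I. f i x)"
  by (induction I rule: infinite_finite_induct) (auto intro: L2_fun_add)

lemma integrable_L2_mult_norm:
  assumes "L2_fun f" "L2_fun g"
  shows "integrable lebesgue (\<lambda>x. cmod (f x) * cmod (g x))"
proof (rule Bochner_Integration.integrable_bound)
  note [measurable] = L2_fun_measurable[OF assms(1)] L2_fun_measurable[OF assms(2)]
  show "integrable lebesgue (\<lambda>x. (cmod (f x))\<^sup>2 + (cmod (g x))\<^sup>2)"
    using assms by (auto simp: L2_fun_def)
  show "(\<lambda>x. cmod (f x) * cmod (g x)) \<in> borel_measurable lebesgue" by measurable
  have "cmod (f x) * cmod (g x) \<le> (cmod (f x))\<^sup>2 + (cmod (g x))\<^sup>2" for x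
    using sum_squares_bound[of "cmod (f x)" "cmod (g x)"]
      mult_nonneg_nonneg[of "cmod (f x)" "cmod (g x)"] norm_ge_zero[of "f x"] norm_ge_zero[of "g x"] unfolding mult.assoc by linarith
  then show "AE x in lebesgue. norm (cmod (f x) * cmod (g x)) \<le> norm ((cmod (f x))\<^sup>2 + (cmod (g x))\<^sup>2)"
    by auto
qed

lemma integrable_L2_mult:
  assumes "L2_fun f" "L2_fun g"
  shows "integrable lebesgue (\<lambda>x. f x * g x)"
proof (rule Bochner_Integration.integrable_bound)
  note [measurable] = L2_fun_measurable[OF assms(1)] L2_fun_measurable[OF assms(2)]
  show "integrable lebesgue (\<lambda>x. cmod (f x) * cmod (g x))" by (rule integrable_L2_mult_norm[OF assms])
  show "(\<lambda>x. f x * g x) \<in> borel_measurable lebesgue" by measurable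
qed (simp add: norm_mult)

lemma L2_norm_nonneg [simp]: "0 \<le> L2_norm f"
  unfolding L2_norm_def by (intro real_sqrt_ge_zero Bochner_Integration.integral_nonneg) auto

lemma L2_norm_sq: "(L2_norm f)\<^sup>2 = (LINT x|lebesgue. (cmod (f x))\<^sup>2)"
  unfolding L2_norm_def by (intro real_sqrt_pow2 Bochner_Integration.integral_nonneg) auto

lemma L2_norm_cong_AE:
  assumes "AE x in lebesgue. f x = g x" "f \<in> borel_measurable lebesgue" "g \<in> borel_measurable lebesgue"
  shows "L2_norm f = L2_norm g"
proof -
  note [measurable] = assms(2,3)
  have "(LINT x|lebesgue. (cmod (f x))\<^sup>2) = (LINT x|lebesgue. (cmod (g x))\<^sup>2)"
    by (rule integral_cong_AE) (measurable, use assms(1) in auto)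
  then show ?thesis by (simp add: L2_norm_def)
qed

lemma L2_norm_mono:
  assumes "L2_fun g" "f \<in> borel_measurable lebesgue" "AE x in lebesgue. cmod (f x) \<le> C * cmod (g x)" "C \<ge> 0"
  shows "L2_norm f \<le> C * L2_norm g"
proof -
  have "L2_fun f" by (rule L2_fun_bound[OF assms(1-3)])
  moreover have "AE x in lebesgue. (cmod (f x))\<^sup>2 \<le> C\<^sup>2 * (cmod (g x))\<^sup>2"
    using assms(3)
  proof eventually_elim
    case (elim x)
    then have "(cmod (f x))\<^sup>2 \<le> (C * cmod (g x))\<^sup>2" by (intro power_mono) auto
    then show ?case by (simp add: power_mult_distrib)
  qed
  ultimately have "(LINT x|lebesgue. (cmod (f x))\<^sup>2) \<le> (LINT x|lebesgue. C\<^sup>2 * (cmod (g x))\<^sup>2)"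
    using assms(1) by (intro integral_mono_AE) (auto simp: L2_fun_def)
  then have "(L2_norm f)\<^sup>2 \<le> (C * L2_norm g)\<^sup>2"
    by (simp add: L2_norm_sq power_mult_distrib)
  then show ?thesis using assms(4) by (simp add: power2_le_iff_abs_le)
qed

lemma L2_Cauchy_Schwarz:
  assumes "L2_fun f" "L2_fun g"
  shows "(LINT x|lebesgue. cmod (f x) * cmod (g x)) \<le> L2_norm f * L2_norm g"
proof -
  let ?I = "LINT x|lebesgue. cmod (f x) * cmod (g x)"
  have I0: "0 \<le> ?I" by (intro Bochner_Integration.integral_nonneg) auto
  have "2 * ?I * t \<le> (L2_norm f)\<^sup>2 * t\<^sup>2 + (L2_norm g)\<^sup>2" for t
  proof -
    have "(LINT x|lebesgue. 2 * t * (cmod (f x) * cmod (g x)))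
        \<le> (LINT x|lebesgue. t\<^sup>2 * (cmod (f x))\<^sup>2 + (cmod (g x))\<^sup>2)"
    proof (rule integral_mono)
      show "2 * t * (cmod (f x) * cmod (g x)) \<le> t\<^sup>2 * (cmod (f x))\<^sup>2 + (cmod (g x))\<^sup>2" for x
        using sum_squares_bound[of "t * cmod (f x)" "cmod (g x)"] by (simp add: power_mult_distrib mult_ac)
    qed (use assms integrable_L2_mult_norm[OF assms] in \<open>auto simp: L2_fun_def\<close>)
    also have "\<dots> = t\<^sup>2 * (L2_norm f)\<^sup>2 + (L2_norm g)\<^sup>2"
      using assms by (subst Bochner_Integration.integral_add) (auto simp: L2_fun_def L2_norm_sq)
    finally show ?thesis by (simp add: mult_ac)
  qed
  then have *: "0 \<le> (L2_norm f)\<^sup>2 * t\<^sup>2 - 2 * ?I * t + (L2_norm g)\<^sup>2" for t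
    by (simp add: algebra_simps)
  have "?I\<^sup>2 \<le> (L2_norm f)\<^sup>2 * (L2_norm g)\<^sup>2"
  proof (cases "L2_norm f = 0")
    case True
    have "?I = 0"
    proof (rule ccontr)
      assume "?I \<noteq> 0"
      then have "2 * ?I * (((L2_norm g)\<^sup>2 + 1) / (2 * ?I)) = (L2_norm g)\<^sup>2 + 1"
        by (simp add: field_simps)
      then show False using *[of "((L2_norm g)\<^sup>2 + 1) / (2 * ?I)"] True by simp
    qed
    then show ?thesis by simp
  next
    case False
    then show ?thesis using *[of "?I / (L2_norm f)\<^sup>2"]
      L2_norm_nonneg[of f] by (auto simp: field_simps power2_eq_square zero_le_divide_iff mult_le_0_iff)
  qed
  then have "?I\<^sup>2 \<le> (L2_norm f * L2_norm g)\<^sup>2" by (simp add: power_mult_distrib)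
  then show ?thesis by (rule power2_le_imp_le) simp
qed

lemma L2_Cauchy_Schwarz_integral:
  assumes "L2_fun f" "L2_fun g"
  shows "cmod (LINT x|lebesgue. f x * g x) \<le> L2_norm f * L2_norm g"
proof -
  have "cmod (LINT x|lebesgue. f x * g x) \<le> (LINT x|lebesgue. cmod (f x * g x))"
    by (rule integral_norm_bound)
  also have "\<dots> \<le> L2_norm f * L2_norm g"
    using L2_Cauchy_Schwarz[OF assms] by (simp add: norm_mult)
  finally show ?thesis .
qed

lemma L2_norm_triangle:
  assumes "L2_fun f" "L2_fun g"
  shows "L2_norm (\<lambda>x. f x + g x) \<le> L2_norm f + L2_norm g"
proof -
  have "(L2_norm (\<lambda>x. f x + g x))\<^sup>2 \<le>
     (LINT x|lebesgue. (cmod (f x))\<^sup>2 + (cmod (g x))\<^sup>2 + 2 * (cmod (f x) * cmod (g x)))"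
    unfolding L2_norm_sq
  proof (rule integral_mono)
    show "(cmod (f x + g x))\<^sup>2 \<le> (cmod (f x))\<^sup>2 + (cmod (g x))\<^sup>2 + 2 * (cmod (f x) * cmod (g x))" for x
      using power_mono[OF norm_triangle_ineq[of "f x" "g x"], of 2] by (simp add: power2_sum)
  qed (use L2_fun_add[OF assms] assms integrable_L2_mult_norm[OF assms] in \<open>auto simp: L2_fun_def\<close>)
  also have "\<dots> = (L2_norm f)\<^sup>2 + (L2_norm g)\<^sup>2 + 2 * (LINT x|lebesgue. cmod (f x) * cmod (g x))"
    using assms integrable_L2_mult_norm[OF assms]
    by (subst Bochner_Integration.integral_add) (auto simp: L2_fun_def L2_norm_sq)
  also have "\<dots> \<le> (L2_norm f + L2_norm g)\<^sup>2"
    using L2_Cauchy_Schwarz[OF assms] by (simp add: power2_sum)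
  finally show ?thesis by (rule power2_le_imp_le) simp
qed

lemma L2_norm_cnj: "L2_norm (\<lambda>x. cnj (f x)) = L2_norm f"
  by (simp add: L2_norm_def)

lemma L2_norm_commute: "L2_norm (\<lambda>x. f x - g x) = L2_norm (\<lambda>x. g x - f x)"
  by (simp add: L2_norm_def norm_minus_commute)

definition L2_lim :: "(nat \<Rightarrow> 'a::euclidean_space \<Rightarrow> complex) \<Rightarrow> ('a \<Rightarrow> complex) \<Rightarrow> bool" where
  "L2_lim F f \<longleftrightarrow> (\<forall>n. L2_fun (F n)) \<and> L2_fun f \<and> (\<lambda>n. L2_norm (\<lambda>x. F n x - f x)) \<longlonglongrightarrow> 0"

lemma L2_limD: "L2_lim F f \<Longrightarrow> L2_fun f" "L2_lim F f \<Longrightarrow> L2_fun (F n)"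
  by (auto simp: L2_lim_def)

lemma L2_lim_const: "L2_fun f \<Longrightarrow> L2_lim (\<lambda>n. f) f"
  by (simp add: L2_lim_def L2_norm_def)

lemma L2_lim_add:
  assumes "L2_lim F f" "L2_lim G g"
  shows "L2_lim (\<lambda>n x. F n x + G n x) (\<lambda>x. f x + g x)"
proof -
  have "(\<lambda>n. L2_norm (\<lambda>x. F n x + G n x - (f x + g x))) \<longlonglongrightarrow> 0"
  proof (rule tendsto_sandwich)
    show "eventually (\<lambda>n. 0 \<le> L2_norm (\<lambda>x. F n x + G n x - (f x + g x))) sequentially" by simp
    have "L2_norm (\<lambda>x. F n x + G n x - (f x + g x)) \<le> L2_norm (\<lambda>x. F n x - f x) + L2_norm (\<lambda>x. G n x - g x)" for n
      using L2_norm_triangle[of "\<lambda>x. F n x - f x" "\<lambda>x. G n x - g x"] assms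
      by (auto simp: L2_lim_def L2_fun_diff algebra_simps)
    then show "eventually (\<lambda>n. L2_norm (\<lambda>x. F n x + G n x - (f x + g x)) \<le> L2_norm (\<lambda>x. F n x - f x) + L2_norm (\<lambda>x. G n x - g x)) sequentially"
      by simp
    show "(\<lambda>n. L2_norm (\<lambda>x. F n x - f x) + L2_norm (\<lambda>x. G n x - g x)) \<longlonglongrightarrow> 0"
      using tendsto_add[of _ 0 _ _ 0] assms by (force simp: L2_lim_def)
  qed simp
  then show ?thesis using assms by (auto simp: L2_lim_def L2_fun_add)
qed

lemma L2_lim_bounded_mult:
  assumes "L2_lim F f" "w \<in> borel_measurable lebesgue" "\<And>x. cmod (w x) \<le> C"
  shows "L2_lim (\<lambda>n x. w x * F n x) (\<lambda>x. w x * f x)"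
proof -
  have C: "0 \<le> C" using norm_ge_zero[of "w undefined"] assms(3)[of undefined] by linarith
  have "(\<lambda>n. L2_norm (\<lambda>x. w x * F n x - w x * f x)) \<longlonglongrightarrow> 0"
  proof (rule tendsto_sandwich)
    show "eventually (\<lambda>n. 0 \<le> L2_norm (\<lambda>x. w x * F n x - w x * f x)) sequentially" by simp
    have "L2_norm (\<lambda>x. w x * F n x - w x * f x) \<le> C * L2_norm (\<lambda>x. F n x - f x)" for n
    proof (rule L2_norm_mono)
      show d: "L2_fun (\<lambda>x. F n x - f x)" using assms by (auto simp: L2_lim_def L2_fun_diff)
      show "(\<lambda>x. w x * F n x - w x * f x) \<in> borel_measurable lebesgue"
        using L2_fun_measurable[OF L2_fun_bounded_mult[OF d assms(2,3)]] by (simp add: algebra_simps)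
      show "AE x in lebesgue. cmod (w x * F n x - w x * f x) \<le> C * cmod (F n x - f x)"
        using assms(3) by (auto simp: norm_mult mult_right_mono right_diff_distrib[symmetric])
    qed (use C in auto)
    then show "eventually (\<lambda>n. L2_norm (\<lambda>x. w x * F n x - w x * f x) \<le> C * L2_norm (\<lambda>x. F n x - f x)) sequentially"
      by simp
    show "(\<lambda>n. C * L2_norm (\<lambda>x. F n x - f x)) \<longlonglongrightarrow> 0"
      using tendsto_mult_right_zero[of _ _ C] assms(1) by (auto simp: L2_lim_def)
  qed simp
  then show ?thesis using assms by (auto simp: L2_lim_def intro: L2_fun_bounded_mult[OF _ assms(2,3)])
qed

lemma L2_lim_cmult: "L2_lim F f \<Longrightarrow> L2_lim (\<lambda>n x. c * F n x) (\<lambda>x. c * f x)"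
  by (rule L2_lim_bounded_mult[where C = "cmod c"]) auto

lemma L2_lim_diff: "L2_lim F f \<Longrightarrow> L2_lim G g \<Longrightarrow> L2_lim (\<lambda>n x. F n x - G n x) (\<lambda>x. f x - g x)"
  using L2_lim_add[of F f "\<lambda>n x. -1 * G n x" "\<lambda>x. -1 * g x"] L2_lim_cmult[of G g "-1"] by simp

lemma L2_lim_sum: "(\<And>i. i \<in> I \<Longrightarrow> L2_lim (F i) (f i)) \<Longrightarrow> L2_lim (\<lambda>n x. \<Sum>i\<in>I. F i n x) (\<lambda>x. \<Sum>i\<in>I. f i x)"
  by (induction I rule: infinite_finite_induct) (auto intro: L2_lim_add L2_lim_const)

lemma L2_lim_cnj: "L2_lim F f \<Longrightarrow> L2_lim (\<lambda>n x. cnj (F n x)) (\<lambda>x. cnj (f x))"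
  unfolding L2_lim_def by (simp add: L2_fun_cnj L2_norm_cnj flip: complex_cnj_diff)

lemma L2_lim_norm_bounded:
  assumes "L2_lim F f"
  shows "(\<lambda>n. L2_norm (F n)) \<longlonglongrightarrow> L2_norm f"
proof -
  have a: "\<bar>L2_norm (F n) - L2_norm f\<bar> \<le> L2_norm (\<lambda>x. F n x - f x)" for n
  proof -
    have 1: "L2_fun (F n)" "L2_fun f" using assms by (auto simp: L2_lim_def)
    have "L2_norm (F n) \<le> L2_norm (\<lambda>x. F n x - f x) + L2_norm f"
      using L2_norm_triangle[OF L2_fun_diff[OF 1] 1(2)] by simp
    moreover have "L2_norm f \<le> L2_norm (\<lambda>x. f x - F n x) + L2_norm (F n)"
      using L2_norm_triangle[OF L2_fun_diff[OF 1(2,1)] 1(1)] by simp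
    ultimately show ?thesis using L2_norm_commute[of f "F n"] by linarith
  qed
  have "(\<lambda>n. L2_norm (F n) - L2_norm f) \<longlonglongrightarrow> 0"
    by (rule Lim_null_comparison[where g = "\<lambda>n. L2_norm (\<lambda>x. F n x - f x)"])
       (use a assms in \<open>auto simp: L2_lim_def\<close>)
  then show ?thesis by (simp add: LIM_zero_iff)
qed

lemma L2_lim_integral_mult:
  assumes "L2_lim F f" "L2_lim G g"
  shows "(\<lambda>n. LINT x|lebesgue. F n x * G n x) \<longlonglongrightarrow> (LINT x|lebesgue. f x * g x)"
proof -
  note F = L2_limD[OF assms(1)] and G = L2_limD[OF assms(2)]
  have A: "cmod ((LINT x|lebesgue. F n x * G n x) - (LINT x|lebesgue. f x * g x))
     \<le> L2_norm (\<lambda>x. F n x - f x) * L2_norm (G n) + L2_norm f * L2_norm (\<lambda>x. G n x - g x)" for n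
  proof -
    have "(LINT x|lebesgue. F n x * G n x) - (LINT x|lebesgue. f x * g x)
       = (LINT x|lebesgue. (F n x - f x) * G n x) + (LINT x|lebesgue. f x * (G n x - g x))"
    proof -
      have i: "integrable lebesgue (\<lambda>x. F n x * G n x)" "integrable lebesgue (\<lambda>x. f x * G n x)"
        "integrable lebesgue (\<lambda>x. f x * g x)"
        by (intro integrable_L2_mult F G)+
      then show ?thesis by (simp add: left_diff_distrib right_diff_distrib)
    qed
    also have "cmod \<dots> \<le> cmod (LINT x|lebesgue. (F n x - f x) * G n x) + cmod (LINT x|lebesgue. f x * (G n x - g x))"
      by (rule norm_triangle_ineq)
    also have "\<dots> \<le> L2_norm (\<lambda>x. F n x - f x) * L2_norm (G n) + L2_norm f * L2_norm (\<lambda>x. G n x - g x)"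
      by (intro add_mono L2_Cauchy_Schwarz_integral L2_fun_diff F G)
    finally show ?thesis .
  qed
  have B: "(\<lambda>n. L2_norm (\<lambda>x. F n x - f x) * L2_norm (G n) + L2_norm f * L2_norm (\<lambda>x. G n x - g x)) \<longlonglongrightarrow> 0 * L2_norm g + L2_norm f * 0"
    by (rule tendsto_add[OF tendsto_mult[OF _ L2_lim_norm_bounded[OF assms(2)]] tendsto_mult[OF tendsto_const]])
       (use assms in \<open>simp_all add: L2_lim_def\<close>)
  have "(\<lambda>n. (LINT x|lebesgue. F n x * G n x) - (LINT x|lebesgue. f x * g x)) \<longlonglongrightarrow> 0"
    by (rule Lim_null_comparison[OF always_eventually[OF allI[OF A]]]) (use B in simp)
  then show ?thesis by (simp add: LIM_zero_iff)
qed

lemma L2_lim_dominated: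
  fixes f :: "'a::euclidean_space \<Rightarrow> complex"
  assumes [measurable]: "\<And>n. F n \<in> borel_measurable lebesgue" "f \<in> borel_measurable lebesgue"
    and g: "L2_fun g" and b: "\<And>n. AE x in lebesgue. cmod (F n x) \<le> cmod (g x)"
    and lim: "AE x in lebesgue. (\<lambda>n. F n x) \<longlonglongrightarrow> f x"
  shows "L2_lim F f"
proof -
  have F: "L2_fun (F n)" for n by (rule L2_fun_bound[OF g, where C = 1]) (use b in auto)
  have "AE x in lebesgue. \<forall>n. cmod (F n x) \<le> cmod (g x)" using b by (simp add: AE_all_countable)
  then have bf: "AE x in lebesgue. cmod (f x) \<le> cmod (g x)"
    using lim by eventually_elim (rule LIMSEQ_le_const2[OF tendsto_norm], auto)
  have f: "L2_fun f" by (rule L2_fun_bound[OF g, where C = 1]) (use bf in auto)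
  have "(\<lambda>n. LINT x|lebesgue. (cmod (F n x - f x))\<^sup>2) \<longlonglongrightarrow> integral\<^sup>L (lebesgue :: 'a measure) (\<lambda>x. 0)"
  proof (rule integral_dominated_convergence[where w = "\<lambda>x. 4 * (cmod (g x))\<^sup>2"])
    show "integrable lebesgue (\<lambda>x. 4 * (cmod (g x))\<^sup>2)" using g by (simp add: L2_fun_def)
    show "AE x in lebesgue. (\<lambda>n. (cmod (F n x - f x))\<^sup>2) \<longlonglongrightarrow> 0"
      using lim
    proof eventually_elim
      case (elim x)
      then have "(\<lambda>n. (cmod (F n x - f x))\<^sup>2) \<longlonglongrightarrow> (cmod (f x - f x))\<^sup>2" by (intro tendsto_intros)
      then show ?case by simp
    qed
    show "AE x in lebesgue. norm ((cmod (F n x - f x))\<^sup>2) \<le> 4 * (cmod (g x))\<^sup>2" for n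
      using b[of n] bf
    proof eventually_elim
      case (elim x)
      then have "cmod (F n x - f x) \<le> 2 * cmod (g x)" using norm_triangle_ineq4[of "F n x" "f x"] by linarith
      then have "(cmod (F n x - f x))\<^sup>2 \<le> (2 * cmod (g x))\<^sup>2" by (intro power_mono) auto
      then show ?case by (simp add: power_mult_distrib)
    qed
  qed measurable
  then have "(\<lambda>n. sqrt (LINT x|lebesgue. (cmod (F n x - f x))\<^sup>2)) \<longlonglongrightarrow> sqrt 0"
    by (intro tendsto_real_sqrt) simp
  then show ?thesis using F f by (simp add: L2_lim_def L2_norm_def)
qed

lemma L2_fun_locally_integrable:
  assumes "L2_fun f"
  shows "locally_integrable f"
  unfolding locally_integrable_def set_integrable_def
proof (intro allI impI)
  fix K :: "'a set" assume K: "compact K"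
  then have Km: "K \<in> sets lebesgue" "emeasure lebesgue K < \<infinity>"
    using emeasure_compact_finite[OF K] by (auto simp: compact_imp_closed)
  show "integrable lebesgue (\<lambda>x. indicat_real K x *\<^sub>R f x)"
  proof (rule Bochner_Integration.integrable_bound)
    show "integrable lebesgue (\<lambda>x. indicat_real K x + (cmod (f x))\<^sup>2)"
      using assms Km by (auto simp: L2_fun_def)
    show "(\<lambda>x. indicat_real K x *\<^sub>R f x) \<in> borel_measurable lebesgue"
      using L2_fun_measurable[OF assms] Km(1) by measurable
    have "cmod (f x) \<le> 1 + (cmod (f x))\<^sup>2" for x
      using sum_squares_bound[of 1 "cmod (f x)"] norm_ge_zero[of "f x"] unfolding power_one mult_1_right by linarith
    then show "AE x in lebesgue. norm (indicat_real K x *\<^sub>R f x) \<le> norm (indicat_real K x + (cmod (f x))\<^sup>2)"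
      by (auto simp: indicator_def)
  qed
qed

section \<open>Smooth functions and test functions\<close>

lemma pderiv_dir_eqI: "(f has_derivative f') (at x) \<Longrightarrow> pderiv_dir b f x = f' b"
  unfolding pderiv_dir_def by (metis frechet_derivative_at)

lemma Ck_Suc_differentiable: "Ck (Suc k) f \<Longrightarrow> f differentiable (at x)"
  by simp

lemma Ck_Suc_pderiv: "Ck (Suc k) f \<Longrightarrow> b \<in> Basis \<Longrightarrow> Ck k (pderiv_dir b f)"
  by simp

lemma Ck_Suc_imp_Ck: "Ck (Suc k) f \<Longrightarrow> Ck k f"
proof (induction k arbitrary: f)
  case 0
  then show ?case
    by (auto intro!: continuous_at_imp_continuous_on differentiable_imp_continuous_within)
next
  case (Suc k)
  then have 1: "Ck (Suc k) (pderiv_dir b f)" if "b \<in> Basis" for b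
    using Ck_Suc_pderiv that by blast
  show ?case
    unfolding Ck.simps(2)[of k f] using Suc.IH[OF 1] Ck_Suc_differentiable[OF Suc.prems] by blast
qed

lemma Ck_const: "Ck k (\<lambda>x. c)"
proof (induction k arbitrary: c)
  case (Suc k)
  have "pderiv_dir b (\<lambda>x. c) = (\<lambda>x. 0)" for b :: 'a
    by (intro ext pderiv_dir_eqI[where f' = "\<lambda>h. 0"]) auto
  then show ?case using Suc[of 0] by simp
qed simp

lemma Ck_add: "Ck k f \<Longrightarrow> Ck k g \<Longrightarrow> Ck k (\<lambda>x. f x + g x)"
proof (induction k arbitrary: f g)
  case (Suc k)
  have "pderiv_dir b (\<lambda>x. f x + g x) = (\<lambda>x. pderiv_dir b f x + pderiv_dir b g x)" for b
  proof
    fix x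
    have "(f has_derivative frechet_derivative f (at x)) (at x)" "(g has_derivative frechet_derivative g (at x)) (at x)"
      using Suc.prems by (simp_all flip: frechet_derivative_works)
    from pderiv_dir_eqI[OF has_derivative_add[OF this]]
    show "pderiv_dir b (\<lambda>x. f x + g x) x = pderiv_dir b f x + pderiv_dir b g x"
      by (simp add: pderiv_dir_def)
  qed
  then show ?case using Suc by (auto intro: differentiable_add)
qed (auto intro: continuous_intros)

lemma Ck_mult: "Ck k f \<Longrightarrow> Ck k g \<Longrightarrow> Ck k (\<lambda>x. f x * g x)"
proof (induction k arbitrary: f g)
  case (Suc k)
  have eq: "pderiv_dir b (\<lambda>x. f x * g x) = (\<lambda>x. f x * pderiv_dir b g x + pderiv_dir b f x * g x)" for b
  proof
    fix x
    have "(f has_derivative frechet_derivative f (at x)) (at x)" "(g has_derivative frechet_derivative g (at x)) (at x)"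
      using Suc.prems by (simp_all flip: frechet_derivative_works)
    from pderiv_dir_eqI[OF has_derivative_mult[OF this]]
    show "pderiv_dir b (\<lambda>x. f x * g x) x = f x * pderiv_dir b g x + pderiv_dir b f x * g x"
      by (simp add: pderiv_dir_def)
  qed
  have "Ck k (\<lambda>x. f x * pderiv_dir b g x + pderiv_dir b f x * g x)" if "b \<in> Basis" for b
    using Suc.prems Ck_Suc_imp_Ck that Ck_Suc_pderiv by (intro Ck_add Suc.IH) blast+
  then show ?case using Suc.prems by (auto simp: eq intro: differentiable_mult)
qed (auto intro: continuous_intros)

lemma Ck_cnj: "Ck k f \<Longrightarrow> Ck k (\<lambda>x. cnj (f x))"
proof (induction k arbitrary: f)
  case (Suc k)
  have d: "((\<lambda>x. cnj (f x)) has_derivative (\<lambda>h. cnj (frechet_derivative f (at x) h))) (at x)" for x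
    using Suc.prems by (intro has_derivative_cnj) (simp flip: frechet_derivative_works)
  have "pderiv_dir b (\<lambda>x. cnj (f x)) = (\<lambda>x. cnj (pderiv_dir b f x))" for b
    by (rule ext) (simp add: pderiv_dir_eqI[OF d] pderiv_dir_def)
  then show ?case using Suc d by (auto simp: differentiable_def)
qed (auto intro: continuous_intros)

lemma Ck_affine: "Ck k f \<Longrightarrow> Ck k (\<lambda>x. f (a + c *\<^sub>R x))"
proof (induction k arbitrary: f)
  case 0
  then have "continuous_on UNIV f" by simp
  then have "continuous_on UNIV (\<lambda>x. f (a + c *\<^sub>R x))"
    by (rule continuous_on_compose2) (auto intro!: continuous_intros)
  then show ?case by simp
next
  case (Suc k)
  have d: "((\<lambda>x. f (a + c *\<^sub>R x)) has_derivative (\<lambda>h. frechet_derivative f (at (a + c *\<^sub>R x)) (c *\<^sub>R h))) (at x)" for x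
  proof (rule has_derivative_compose[where f = "\<lambda>x. a + c *\<^sub>R x"])
    show "((\<lambda>x. a + c *\<^sub>R x) has_derivative (\<lambda>h. c *\<^sub>R h)) (at x)"
      by (auto intro!: derivative_eq_intros)
    show "(f has_derivative frechet_derivative f (at (a + c *\<^sub>R x))) (at (a + c *\<^sub>R x))"
      using Suc.prems by (simp flip: frechet_derivative_works)
  qed
  have lin: "linear (frechet_derivative f (at y))" for y
    using Suc.prems by (intro linear_frechet_derivative) simp
  have eq: "pderiv_dir b (\<lambda>x. f (a + c *\<^sub>R x)) = (\<lambda>x. of_real c * pderiv_dir b f (a + c *\<^sub>R x))" for b
    by (rule ext) (simp add: pderiv_dir_eqI[OF d] pderiv_dir_def linear_cmul[OF lin] scaleR_conv_of_real)
  have "Ck k (\<lambda>x. of_real c * pderiv_dir b f (a + c *\<^sub>R x))" if "b \<in> Basis" for b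
    by (intro Ck_mult Ck_const Suc.IH) (use Suc.prems that in simp)
  then show ?case using Suc d by (auto simp: differentiable_def eq)
qed

definition smooth_fun :: "('a::euclidean_space \<Rightarrow> complex) \<Rightarrow> bool" where
  "smooth_fun f \<longleftrightarrow> (\<forall>k. Ck k f)"

lemma smooth_fun_pderiv: "smooth_fun f \<Longrightarrow> b \<in> Basis \<Longrightarrow> smooth_fun (pderiv_dir b f)"
  unfolding smooth_fun_def using Ck_Suc_pderiv by blast

lemma smooth_fun_differentiable: "smooth_fun f \<Longrightarrow> f differentiable (at x)"
  unfolding smooth_fun_def using Ck_Suc_differentiable by blast

lemma smooth_fun_continuous: "smooth_fun f \<Longrightarrow> continuous_on UNIV f"
  unfolding smooth_fun_def using Ck.simps(1) by blast

lemma smooth_fun_has_derivative: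
  assumes "smooth_fun f"
  shows "(f has_derivative (\<lambda>h. \<Sum>b\<in>Basis. (h \<bullet> b) *\<^sub>R pderiv_dir b f x)) (at x)"
proof -
  have d: "f differentiable (at x)" by (rule smooth_fun_differentiable[OF assms])
  have lin: "linear (frechet_derivative f (at x))" by (rule linear_frechet_derivative[OF d])
  have "frechet_derivative f (at x) h = (\<Sum>b\<in>Basis. (h \<bullet> b) *\<^sub>R pderiv_dir b f x)" for h
  proof -
    have "frechet_derivative f (at x) h = frechet_derivative f (at x) (\<Sum>b\<in>Basis. (h \<bullet> b) *\<^sub>R b)"
      by (simp add: euclidean_representation)
    also have "\<dots> = (\<Sum>b\<in>Basis. (h \<bullet> b) *\<^sub>R pderiv_dir b f x)"
      by (simp add: linear_sum[OF lin] linear_cmul[OF lin] pderiv_dir_def)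
    finally show ?thesis .
  qed
  then have "frechet_derivative f (at x) = (\<lambda>h. \<Sum>b\<in>Basis. (h \<bullet> b) *\<^sub>R pderiv_dir b f x)" by auto
  then show ?thesis using d by (simp add: frechet_derivative_works)
qed

text \<open>A support condition in terms of the norm is easier to propagate through derivatives, products and
  convolutions than compactness of the closure.\<close>

lemma test_function_iff:
  "test_function f \<longleftrightarrow> smooth_fun f \<and> (\<exists>R. \<forall>x. norm x > R \<longrightarrow> f x = 0)"
proof -
  have "compact (closure {x. f x \<noteq> 0}) \<longleftrightarrow> bounded {x. f x \<noteq> 0}" by simp
  also have "\<dots> \<longleftrightarrow> (\<exists>R. \<forall>x. norm x > R \<longrightarrow> f x = 0)"
    unfolding bounded_iff mem_Collect_eq not_le[symmetric] by blast
  finally show ?thesis by (simp add: test_function_def smooth_fun_def)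
qed

lemma test_functionI: "smooth_fun f \<Longrightarrow> (\<And>x. norm x > R \<Longrightarrow> f x = 0) \<Longrightarrow> test_function f"
  unfolding test_function_iff by blast

lemma test_functionE:
  assumes "test_function f"
  obtains R where "R > 0" "\<And>x. norm x > R \<Longrightarrow> f x = 0"
proof -
  obtain R where "\<And>x. norm x > R \<Longrightarrow> f x = 0" using assms by (auto simp: test_function_iff)
  then show ?thesis using that[of "max R 1"] by auto
qed

lemma test_function_smooth: "test_function f \<Longrightarrow> smooth_fun f"
  by (simp add: test_function_iff)

text \<open>The set where \<open>norm x > R\<close> is open, so there the derivative is that of the zero function.\<close>

lemma pderiv_dir_zero_outside:
  assumes "\<And>x. norm x > R \<Longrightarrow> f x = 0" "norm x > R"
  shows "pderiv_dir b f x = 0"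
proof (rule pderiv_dir_eqI[where f' = "\<lambda>h. 0"])
  show "(f has_derivative (\<lambda>h. 0)) (at x)"
  proof (rule has_derivative_transform_within_open[of "\<lambda>x. 0" _ _ _ "- cball 0 R"])
    show "x \<in> - cball 0 R" using assms(2) by auto
  qed (use assms(1) in auto)
qed

lemma test_function_pderiv:
  assumes "test_function f" "b \<in> Basis"
  shows "test_function (pderiv_dir b f)"
proof -
  obtain R where "\<And>x. norm x > R \<Longrightarrow> f x = 0" using test_functionE[OF assms(1)] by blast
  then have "\<And>x. norm x > R \<Longrightarrow> pderiv_dir b f x = 0" using pderiv_dir_zero_outside by blast
  then show ?thesis using assms smooth_fun_pderiv test_function_smooth by (blast intro: test_functionI)
qed

lemma smooth_fun_mult: "smooth_fun f \<Longrightarrow> smooth_fun g \<Longrightarrow> smooth_fun (\<lambda>x. f x * g x)"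
  by (simp add: smooth_fun_def Ck_mult)

lemma smooth_fun_const: "smooth_fun (\<lambda>x. c)"
  by (simp add: smooth_fun_def Ck_const)

lemma smooth_fun_affine: "smooth_fun f \<Longrightarrow> smooth_fun (\<lambda>x. f (a + c *\<^sub>R x))"
  by (simp add: smooth_fun_def Ck_affine)

lemma test_function_mult:
  assumes "smooth_fun f" "test_function g"
  shows "test_function (\<lambda>x. f x * g x)"
proof -
  obtain R where "\<And>x. norm x > R \<Longrightarrow> g x = 0" using test_functionE[OF assms(2)] by blast
  then show ?thesis using assms test_function_smooth
    by (intro test_functionI[where R = R] smooth_fun_mult) auto
qed

lemma pderiv_dir_mult:
  assumes "smooth_fun f" "smooth_fun g"
  shows "pderiv_dir b (\<lambda>x. f x * g x) x = f x * pderiv_dir b g x + pderiv_dir b f x * g x"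
proof -
  have "(f has_derivative frechet_derivative f (at x)) (at x)" "(g has_derivative frechet_derivative g (at x)) (at x)"
    using assms smooth_fun_differentiable by (simp_all flip: frechet_derivative_works)
  from pderiv_dir_eqI[OF has_derivative_mult[OF this]]
  show ?thesis by (simp add: pderiv_dir_def)
qed

lemma pderiv_dir_affine:
  assumes "smooth_fun f"
  shows "pderiv_dir b (\<lambda>x. f (a + c *\<^sub>R x)) x = of_real c * pderiv_dir b f (a + c *\<^sub>R x)"
proof -
  have lin: "linear (frechet_derivative f (at y))" for y
    using assms by (intro linear_frechet_derivative smooth_fun_differentiable)
  have d: "((\<lambda>x. f (a + c *\<^sub>R x)) has_derivative (\<lambda>h. frechet_derivative f (at (a + c *\<^sub>R x)) (c *\<^sub>R h))) (at x)"
  proof (rule has_derivative_compose[where f = "\<lambda>x. a + c *\<^sub>R x"])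
    show "((\<lambda>x. a + c *\<^sub>R x) has_derivative (\<lambda>h. c *\<^sub>R h)) (at x)"
      by (auto intro!: derivative_eq_intros)
    show "(f has_derivative frechet_derivative f (at (a + c *\<^sub>R x))) (at (a + c *\<^sub>R x))"
      using assms smooth_fun_differentiable by (simp flip: frechet_derivative_works)
  qed
  show ?thesis
    unfolding pderiv_dir_eqI[OF d]
    by (simp add: pderiv_dir_def linear_cmul[OF lin] scaleR_conv_of_real)
qed

lemma continuous_compact_support_bounded:
  fixes f :: "'a::euclidean_space \<Rightarrow> 'b::real_normed_vector"
  assumes "continuous_on UNIV f" "\<And>x. norm x > R \<Longrightarrow> f x = 0"
  shows "bounded (range f)"
proof -
  have "compact (f ` cball 0 R)"
    by (intro compact_continuous_image continuous_on_subset[OF assms(1)]) auto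
  then have "bounded (insert 0 (f ` cball 0 R))" using compact_imp_bounded by auto
  moreover have "range f \<subseteq> insert 0 (f ` cball 0 R)"
    using assms(2) by (force simp: image_iff not_le[symmetric])
  ultimately show ?thesis by (rule bounded_subset)
qed

lemma test_function_bounded: "test_function f \<Longrightarrow> bounded (range f)"
  by (metis continuous_compact_support_bounded smooth_fun_continuous test_functionE test_function_smooth)

lemma continuous_lebesgue_measurable:
  "continuous_on UNIV (f :: 'a::euclidean_space \<Rightarrow> 'b::{topological_space}) \<Longrightarrow> f \<in> borel_measurable lebesgue"
  by (intro measurable_completion) (simp add: borel_measurable_continuous_onI)

lemma continuous_compact_support_integrable:
  fixes f :: "'a::euclidean_space \<Rightarrow> 'b::euclidean_space"
  assumes "continuous_on UNIV f" "\<And>x. norm x > R \<Longrightarrow> f x = 0"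
  shows "integrable lebesgue f"
proof -
  obtain B where B: "\<And>x. norm (f x) \<le> B"
    using continuous_compact_support_bounded[OF assms] by (auto simp: bounded_iff)
  show ?thesis
  proof (rule Bochner_Integration.integrable_bound)
    show "integrable lebesgue (\<lambda>x. B * indicat_real (cball 0 R) x)"
      using emeasure_lborel_cball_finite[of 0 R]
      by (intro integrable_mult_right integrable_real_indicator) auto
    show "f \<in> borel_measurable lebesgue" by (rule continuous_lebesgue_measurable[OF assms(1)])
    show "AE x in lebesgue. norm (f x) \<le> norm (B * indicat_real (cball 0 R) x)"
      using assms(2) by (intro AE_I2) (auto simp: indicator_def intro: order_trans[OF B abs_ge_self])
  qed
qed

lemma continuous_compact_support_L2:
  fixes f :: "'a::euclidean_space \<Rightarrow> complex"
  assumes "continuous_on UNIV f" "\<And>x. norm x > R \<Longrightarrow> f x = 0"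
  shows "L2_fun f"
proof -
  have "integrable lebesgue (\<lambda>x. (cmod (f x))\<^sup>2)"
    by (rule continuous_compact_support_integrable[where R = R])
       (use assms in \<open>auto intro!: continuous_intros\<close>)
  then show ?thesis using continuous_lebesgue_measurable[OF assms(1)] by (simp add: L2_fun_def)
qed

lemma test_function_L2: "test_function f \<Longrightarrow> L2_fun f"
  by (metis continuous_compact_support_L2 smooth_fun_continuous test_functionE test_function_smooth)

section \<open>Bounded Lipschitz functions\<close>

text \<open>The multipliers of the proof (phase, weights, radial coefficients) are only piecewise smooth.  Bounded
  Lipschitz functions form an algebra that contains all of them, and they multiply weak gradients.\<close>

definition lip_bdd :: "('a::real_normed_vector \<Rightarrow> 'b::real_normed_vector) \<Rightarrow> bool" where
  "lip_bdd f \<longleftrightarrow> (\<exists>B. \<forall>x. norm (f x) \<le> B) \<and> (\<exists>L. \<forall>x y. norm (f x - f y) \<le> L * norm (x - y))"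

lemma lip_bddE:
  assumes "lip_bdd f"
  obtains B L where "B \<ge> 0" "L \<ge> 0" "\<And>x. norm (f x) \<le> B" "\<And>x y. norm (f x - f y) \<le> L * norm (x - y)"
proof -
  obtain B L where B: "\<And>x. norm (f x) \<le> B" and L: "\<And>x y. norm (f x - f y) \<le> L * norm (x - y)"
    using assms by (auto simp: lip_bdd_def)
  have "B \<ge> 0" using B norm_ge_zero order_trans by blast
  moreover have "norm (f x - f y) \<le> max L 0 * norm (x - y)" for x y
    by (rule order_trans[OF L]) (auto intro: mult_right_mono)
  ultimately show ?thesis using B that[of B "max L 0"] by auto
qed

lemma lip_bddI: "(\<And>x. norm (f x) \<le> B) \<Longrightarrow> (\<And>x y. norm (f x - f y) \<le> L * norm (x - y)) \<Longrightarrow> lip_bdd f"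
  unfolding lip_bdd_def by blast

lemma lip_bdd_continuous:
  assumes "lip_bdd f"
  shows "continuous_on UNIV f"
proof -
  obtain L where "L \<ge> 0" "\<And>x y. norm (f x - f y) \<le> L * norm (x - y)"
    using lip_bddE[OF assms] by metis
  then have "L-lipschitz_on UNIV f" by (intro lipschitz_onI) (auto simp: dist_norm)
  then show ?thesis by (rule lipschitz_on_continuous_on)
qed

lemma lip_bdd_const: "lip_bdd (\<lambda>x. c)"
  by (rule lip_bddI[where B = "norm c" and L = 0]) auto

lemma lip_bdd_add:
  assumes "lip_bdd f" "lip_bdd g"
  shows "lip_bdd (\<lambda>x. f x + g x)"
proof -
  obtain B L where f: "\<And>x. norm (f x) \<le> B" "\<And>x y. norm (f x - f y) \<le> L * norm (x - y)"
    using lip_bddE[OF assms(1)] by metis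
  obtain B' L' where g: "\<And>x. norm (g x) \<le> B'" "\<And>x y. norm (g x - g y) \<le> L' * norm (x - y)"
    using lip_bddE[OF assms(2)] by metis
  show ?thesis
  proof (rule lip_bddI)
    show "norm (f x + g x) \<le> B + B'" for x using f(1) g(1) norm_triangle_mono by blast
    show "norm (f x + g x - (f y + g y)) \<le> (L + L') * norm (x - y)" for x y
      using norm_triangle_mono[OF f(2)[of x y] g(2)[of x y]] by (simp add: algebra_simps)
  qed
qed

lemma lip_bdd_mult:
  fixes f g :: "'a::real_normed_vector \<Rightarrow> 'b::real_normed_algebra"
  assumes "lip_bdd f" "lip_bdd g"
  shows "lip_bdd (\<lambda>x. f x * g x)"
proof -
  obtain B L where f: "B \<ge> 0" "L \<ge> 0" "\<And>x. norm (f x) \<le> B" "\<And>x y. norm (f x - f y) \<le> L * norm (x - y)"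
    using lip_bddE[OF assms(1)] by metis
  obtain B' L' where g: "B' \<ge> 0" "L' \<ge> 0" "\<And>x. norm (g x) \<le> B'" "\<And>x y. norm (g x - g y) \<le> L' * norm (x - y)"
    using lip_bddE[OF assms(2)] by metis
  show ?thesis
  proof (rule lip_bddI)
    show "norm (f x * g x) \<le> B * B'" for x
      by (rule order_trans[OF norm_mult_ineq]) (intro mult_mono f g norm_ge_zero)
    show "norm (f x * g x - f y * g y) \<le> (B * L' + L * B') * norm (x - y)" for x y
    proof -
      have "f x * g x - f y * g y = f x * (g x - g y) + (f x - f y) * g y" by (simp add: algebra_simps)
      also have "norm \<dots> \<le> norm (f x) * norm (g x - g y) + norm (f x - f y) * norm (g y)"
        by (intro norm_triangle_mono norm_mult_ineq)
      also have "\<dots> \<le> B * (L' * norm (x - y)) + (L * norm (x - y)) * B'"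
        by (intro add_mono mult_mono f g norm_ge_zero mult_nonneg_nonneg)
      finally show ?thesis by (simp add: algebra_simps)
    qed
  qed
qed

lemma lip_bdd_bounded_linear:
  assumes "bounded_linear T" "lip_bdd f"
  shows "lip_bdd (\<lambda>x. T (f x))"
proof -
  interpret T: bounded_linear T by fact
  obtain B L where f: "B \<ge> 0" "L \<ge> 0" "\<And>x. norm (f x) \<le> B" "\<And>x y. norm (f x - f y) \<le> L * norm (x - y)"
    using lip_bddE[OF assms(2)] by metis
  obtain K where K: "K \<ge> 0" "\<And>x. norm (T x) \<le> norm x * K" using T.nonneg_bounded by blast
  show ?thesis
  proof (rule lip_bddI)
    show "norm (T (f x)) \<le> B * K" for x
      by (rule order_trans[OF K(2)]) (intro mult_right_mono f K)
    show "norm (T (f x) - T (f y)) \<le> (L * K) * norm (x - y)" for x y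
    proof -
      have "norm (T (f x) - T (f y)) \<le> norm (f x - f y) * K" using K(2)[of "f x - f y"] by (simp add: T.diff)
      also have "\<dots> \<le> (L * norm (x - y)) * K" by (intro mult_right_mono f K)
      finally show ?thesis by (simp add: algebra_simps)
    qed
  qed
qed

lemma lip_bdd_cnj: "lip_bdd f \<Longrightarrow> lip_bdd (\<lambda>x. cnj (f x))"
  by (rule lip_bdd_bounded_linear[OF bounded_linear_cnj])

lemma lip_bdd_Re: "lip_bdd f \<Longrightarrow> lip_bdd (\<lambda>x. Re (f x))"
  by (rule lip_bdd_bounded_linear[OF bounded_linear_Re])

lemma lip_bdd_of_real: "lip_bdd f \<Longrightarrow> lip_bdd (\<lambda>x. complex_of_real (f x))"
  by (rule lip_bdd_bounded_linear[OF bounded_linear_of_real])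

lemma lip_bdd_minus: "lip_bdd f \<Longrightarrow> lip_bdd (\<lambda>x. - f x)"
  by (rule lip_bdd_bounded_linear[OF bounded_linear_minus[OF bounded_linear_ident]])

lemma lip_bdd_diff: "lip_bdd f \<Longrightarrow> lip_bdd g \<Longrightarrow> lip_bdd (\<lambda>x. f x - g x)"
  using lip_bdd_add[of f "\<lambda>x. - g x"] lip_bdd_minus[of g] by simp

lemma lip_bdd_sum: "(\<And>i. i \<in> I \<Longrightarrow> lip_bdd (f i)) \<Longrightarrow> lip_bdd (\<lambda>x. \<Sum>i\<in>I. f i x)"
  by (induction I rule: infinite_finite_induct) (auto intro: lip_bdd_add lip_bdd_const)

text \<open>The partial derivatives are bounded, so the mean value inequality applies.\<close>

lemma test_function_lip_bdd:
  fixes f :: "'a::euclidean_space \<Rightarrow> complex"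
  assumes "test_function f"
  shows "lip_bdd f"
proof -
  obtain B where B: "\<And>x. norm (f x) \<le> B"
    using test_function_bounded[OF assms] by (auto simp: bounded_iff)
  have "\<forall>b\<in>Basis. \<exists>C. \<forall>x. norm (pderiv_dir b f x) \<le> C"
    using test_function_bounded[OF test_function_pderiv[OF assms]] by (force simp: bounded_iff)
  then obtain C where C: "\<And>b x. b \<in> Basis \<Longrightarrow> norm (pderiv_dir b f x) \<le> C b" by metis
  have "norm (f x - f y) \<le> (\<Sum>b\<in>Basis. C b) * norm (x - y)" for x y
  proof (rule differentiable_bound[of UNIV])
    show "(f has_derivative (\<lambda>h. \<Sum>b\<in>Basis. (h \<bullet> b) *\<^sub>R pderiv_dir b f z)) (at z within UNIV)" for z
      using smooth_fun_has_derivative[OF test_function_smooth[OF assms]] by simp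
    show "onorm (\<lambda>h. \<Sum>b\<in>Basis. (h \<bullet> b) *\<^sub>R pderiv_dir b f z) \<le> (\<Sum>b\<in>Basis. C b)" for z
    proof (rule onorm_le)
      fix h :: 'a
      have "norm (\<Sum>b\<in>Basis. (h \<bullet> b) *\<^sub>R pderiv_dir b f z) \<le> (\<Sum>b\<in>Basis. norm ((h \<bullet> b) *\<^sub>R pderiv_dir b f z))"
        by (rule norm_sum)
      also have "\<dots> \<le> (\<Sum>b\<in>Basis. C b * norm h)"
      proof (rule sum_mono)
        fix b :: 'a assume b: "b \<in> Basis"
        have "norm ((h \<bullet> b) *\<^sub>R pderiv_dir b f z) \<le> norm h * C b"
          unfolding norm_scaleR using Basis_le_norm[OF b, of h] C[OF b]
          by (intro mult_mono) (auto simp: real_norm_def)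
        then show "norm ((h \<bullet> b) *\<^sub>R pderiv_dir b f z) \<le> C b * norm h" by (simp add: mult.commute)
      qed
      finally show "norm (\<Sum>b\<in>Basis. (h \<bullet> b) *\<^sub>R pderiv_dir b f z) \<le> (\<Sum>b\<in>Basis. C b) * norm h"
        by (simp add: sum_distrib_right)
    qed
  qed auto
  with B show ?thesis by (rule lip_bddI)
qed

section \<open>Integration by parts for Lipschitz functions\<close>

lemma integral_lebesgue_translation:
  fixes f :: "'a::euclidean_space \<Rightarrow> 'b::{banach, second_countable_topology}"
  assumes "continuous_on UNIV f"
  shows "(LINT x|lebesgue. f (x + a)) = (LINT x|lebesgue. f x)"
proof -
  have [measurable]: "f \<in> borel_measurable borel" by (rule borel_measurable_continuous_onI[OF assms])
  have "(LINT x|lebesgue. f (x + a)) = (LINT x|lborel. f (a + x))"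
    by (subst integral_completion) (auto simp: add.commute)
  also have "\<dots> = (LINT x|distr lborel borel ((+) a). f x)" by (subst integral_distr) auto
  also have "\<dots> = (LINT x|lborel. f x)" by (simp add: lborel_distr_plus)
  finally show ?thesis by (simp add: integral_completion)
qed

lemma has_derivative_difference_quotient:
  fixes G :: "'a::real_normed_vector \<Rightarrow> 'b::real_normed_vector"
  assumes "(G has_derivative G') (at x)"
  shows "(\<lambda>n. real (Suc n) *\<^sub>R (G (x + (1 / real (Suc n)) *\<^sub>R b) - G x)) \<longlonglongrightarrow> G' b"
proof (cases "b = 0")
  case True
  then show ?thesis
    using has_derivative_bounded_linear[OF assms] by (simp add: linear_0 bounded_linear.linear)
next
  case False
  interpret bounded_linear G' using assms by (rule has_derivative_bounded_linear)
  let ?h = "\<lambda>n. (1 / real (Suc n)) *\<^sub>R b"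
  have lim0: "?h \<longlonglongrightarrow> 0 *\<^sub>R b"
    by (intro tendsto_scaleR tendsto_const LIMSEQ_Suc[OF lim_1_over_n])
  have "filterlim ?h (at 0) sequentially"
    unfolding filterlim_at using lim0 False by simp
  moreover have "((\<lambda>h. norm (G (x + h) - G x - G' h) / norm h) \<longlongrightarrow> 0) (at 0)"
    using assms by (simp add: has_derivative_at)
  ultimately have "(\<lambda>n. norm (G (x + ?h n) - G x - G' (?h n)) / norm (?h n)) \<longlonglongrightarrow> 0"
    by (rule filterlim_compose[rotated])
  then have "(\<lambda>n. norm b * (norm (G (x + ?h n) - G x - G' (?h n)) / norm (?h n))) \<longlonglongrightarrow> norm b * 0"
    by (rule tendsto_mult_left)
  moreover have "norm b * (norm (G (x + ?h n) - G x - G' (?h n)) / norm (?h n))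
      = norm (real (Suc n) *\<^sub>R (G (x + ?h n) - G x) - G' b)" for n
  proof -
    have "real (Suc n) *\<^sub>R (G (x + ?h n) - G x) - G' b = real (Suc n) *\<^sub>R (G (x + ?h n) - G x - G' (?h n))"
      by (simp add: scaleR scaleR_diff_right del: of_nat_Suc)
    then show ?thesis using False by (simp del: of_nat_Suc)
  qed
  ultimately have "(\<lambda>n. norm (real (Suc n) *\<^sub>R (G (x + ?h n) - G x) - G' b)) \<longlonglongrightarrow> 0" by simp
  then show ?thesis by (simp add: tendsto_norm_zero_iff LIM_zero_iff)
qed

text \<open>The Lebesgue measure is complete, so changing the limit on a null set is harmless.\<close>

lemma borel_measurable_AE_limit:
  fixes f :: "'a::euclidean_space \<Rightarrow> 'b::euclidean_space"
  assumes "\<And>n. F n \<in> borel_measurable lebesgue" "AE x in lebesgue. (\<lambda>n. F n x) \<longlonglongrightarrow> f x"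
  shows "f \<in> borel_measurable lebesgue"
proof -
  obtain N where N: "N \<in> null_sets lebesgue" "{x. \<not> (\<lambda>n. F n x) \<longlonglongrightarrow> f x} \<subseteq> N"
    using assms(2) by (auto simp: eventually_ae_filter)
  then have [measurable]: "N \<in> sets lebesgue" by auto
  define g where "g x = (if x \<in> N then 0 else f x)" for x
  have "g \<in> borel_measurable lebesgue"
  proof (rule borel_measurable_LIMSEQ_metric)
    show "(\<lambda>x. if x \<in> N then 0 else F n x) \<in> borel_measurable lebesgue" for n
      using assms(1) by measurable
    show "(\<lambda>n. if x \<in> N then 0 else F n x) \<longlonglongrightarrow> g x" for x
      using N(2) by (auto simp: g_def)
  qed
  moreover have "AE x in lebesgue. g x = f x"
    using AE_not_in[OF N(1)] by eventually_elim (auto simp: g_def)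
  ultimately show ?thesis by (rule borel_measurable_AE)
qed

text \<open>The integral of a difference quotient of \<open>G\<close> vanishes by translation invariance, and the
  Lipschitz bound dominates the quotients.  Differentiability is needed only almost everywhere, which
  is what the piecewise smooth weights provide.\<close>

lemma integral_derivative_compact_support:
  fixes G :: "'a::euclidean_space \<Rightarrow> 'b::euclidean_space"
  assumes "lip_bdd G" "\<And>x. norm x > R \<Longrightarrow> G x = 0"
    and deriv: "AE x in lebesgue. (G has_derivative G' x) (at x)"
  shows "(\<lambda>x. G' x b) \<in> borel_measurable lebesgue" "integrable lebesgue (\<lambda>x. G' x b)"
    and "(LINT x|lebesgue. G' x b) = 0"
proof -
  have G: "continuous_on UNIV G" by (rule lip_bdd_continuous[OF assms(1)])
  obtain L where L: "L \<ge> 0" "\<And>x y. norm (G x - G y) \<le> L * norm (x - y)"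
    using lip_bddE[OF assms(1)] by metis
  define D where "D n x = real (Suc n) *\<^sub>R (G (x + (1 / real (Suc n)) *\<^sub>R b) - G x)" for n x
  have Gt: "continuous_on UNIV (\<lambda>x. G (x + c))" for c
    by (rule continuous_on_compose2[OF G]) (auto intro!: continuous_intros)
  have D0: "(LINT x|lebesgue. D n x) = 0" for n
  proof -
    have i1: "integrable lebesgue G" by (rule continuous_compact_support_integrable[OF G assms(2)])
    have i2: "integrable lebesgue (\<lambda>x. G (x + (1 / real (Suc n)) *\<^sub>R b))"
    proof (rule continuous_compact_support_integrable[OF Gt, where R = "R + norm ((1 / real (Suc n)) *\<^sub>R b)"])
      fix x :: 'a assume "norm x > R + norm ((1 / real (Suc n)) *\<^sub>R b)"
      then have "norm (x + (1 / real (Suc n)) *\<^sub>R b) > R"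
        using norm_triangle_ineq4[of "x + (1 / real (Suc n)) *\<^sub>R b" "(1 / real (Suc n)) *\<^sub>R b"] by simp
      then show "G (x + (1 / real (Suc n)) *\<^sub>R b) = 0" by (rule assms(2))
    qed
    show ?thesis
      unfolding D_def using i1 i2 integral_lebesgue_translation[OF G]
      by (simp add: Bochner_Integration.integral_diff)
  qed
  have m: "D n \<in> borel_measurable lebesgue" for n
    unfolding D_def by (intro continuous_lebesgue_measurable continuous_intros G Gt)
  have lim: "AE x in lebesgue. (\<lambda>n. D n x) \<longlonglongrightarrow> G' x b"
    using deriv unfolding D_def by eventually_elim (rule has_derivative_difference_quotient)
  have mG: "(\<lambda>x. G' x b) \<in> borel_measurable lebesgue"
    by (rule borel_measurable_AE_limit[OF m lim])
  have w: "integrable lebesgue (\<lambda>x. L * norm b * indicat_real (cball (0::'a) (R + norm b)) x)"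
    using emeasure_lborel_cball_finite[of "0::'a" "R + norm b"]
    by (intro integrable_mult_right integrable_real_indicator) auto
  have bd: "AE x in lebesgue. norm (D n x) \<le> L * norm b * indicat_real (cball 0 (R + norm b)) x" for n
  proof (rule AE_I2)
    fix x
    let ?c = "(1 / real (Suc n)) *\<^sub>R b"
    have c: "norm ?c \<le> norm b"
      using mult_left_mono[of 1 "1 + real n" "norm b"] by (simp add: divide_simps)
    show "norm (D n x) \<le> L * norm b * indicat_real (cball 0 (R + norm b)) x"
    proof (cases "norm x > R + norm b")
      case True
      then have "norm x > R" "norm (x + ?c) > R"
        using norm_triangle_ineq4[of "x + ?c" ?c] c norm_ge_zero[of b] by (simp_all del: norm_ge_zero)
      then show ?thesis using assms(2) True by (simp add: D_def)
    next
      case False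
      have "norm (D n x) \<le> real (Suc n) * (L * norm ?c)"
        unfolding D_def norm_scaleR using L(2)[of "x + ?c" x] by (intro mult_mono) auto
      also have "\<dots> = L * norm b" by simp
      finally show ?thesis using False by (simp add: not_less)
    qed
  qed
  note dct = mG m w lim bd
  show "(\<lambda>x. G' x b) \<in> borel_measurable lebesgue" "integrable lebesgue (\<lambda>x. G' x b)"
    using mG integrable_dominated_convergence[OF dct] by auto
  have "(\<lambda>n. LINT x|lebesgue. D n x) \<longlonglongrightarrow> (LINT x|lebesgue. G' x b)"
    by (rule integral_dominated_convergence[OF dct])
  then show "(LINT x|lebesgue. G' x b) = 0" using D0 by (simp add: LIMSEQ_const_iff)
qed

section \<open>Mollification\<close>

text \<open>Truncate \<open>f\<close> in height and in space, take a sequence of continuous functions converging almost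
  everywhere to the truncation, and truncate this sequence continuously so that dominated convergence
  applies.\<close>

lemma L2_dense_continuous:
  fixes f :: "'a::euclidean_space \<Rightarrow> complex"
  assumes f: "L2_fun f" and e: "e > 0"
  obtains g R where "continuous_on UNIV g" "\<And>x. norm x > R \<Longrightarrow> g x = 0" "L2_norm (\<lambda>x. g x - f x) < e"
proof -
  note [measurable] = L2_fun_measurable[OF f]
  define F where "F n x = (if cmod (f x) \<le> real n \<and> norm x \<le> real n then f x else 0)" for n x
  have mF: "F n \<in> borel_measurable lebesgue" for n unfolding F_def
    by (rule measurable_If) (measurable, auto intro!: continuous_lebesgue_measurable continuous_intros)
  have "L2_lim F f"
  proof (rule L2_lim_dominated[OF mF _ f])
    show "AE x in lebesgue. (\<lambda>n. F n x) \<longlonglongrightarrow> f x"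
    proof (rule AE_I2)
      fix x
      obtain N :: nat where N: "cmod (f x) \<le> N" "norm x \<le> N"
        using real_arch_simple[of "max (cmod (f x)) (norm x)"] by auto
      have "\<forall>\<^sub>F n in sequentially. F n x = f x"
        using eventually_ge_at_top[of N] by eventually_elim (use N in \<open>auto simp: F_def\<close>)
      then show "(\<lambda>n. F n x) \<longlonglongrightarrow> f x" by (rule tendsto_eventually)
    qed
  qed (auto simp: F_def)
  then have "\<forall>\<^sub>F n in sequentially. L2_norm (\<lambda>x. F n x - f x) < e / 2"
    using e by (auto simp: L2_lim_def dest!: order_tendstoD(2)[of _ 0 _ "e/2"])
  then obtain n where n: "L2_norm (\<lambda>x. F n x - f x) < e / 2" by (auto simp: eventually_sequentially)
  have LF: "L2_fun (F n)" using \<open>L2_lim F f\<close> by (rule L2_limD)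
  have "F n measurable_on UNIV" using mF by (intro lebesgue_measurable_imp_measurable_on) auto
  then obtain Z h where Z: "negligible Z" and h: "\<And>m. continuous_on UNIV (h m)"
      "\<And>x. x \<notin> Z \<Longrightarrow> (\<lambda>m. h m x) \<longlonglongrightarrow> F n x"
    by (auto simp: measurable_on_def)
  let ?N = "real n + 1"
  define cl where "cl z = of_real (?N / max ?N (cmod z)) * z" for z :: complex
  define cut where "cut x = max 0 (min 1 (?N + 1 - norm x))" for x :: 'a
  define H where "H m x = of_real (cut x) * cl (h m x)" for m x
  have ccl: "continuous_on UNIV cl" unfolding cl_def by (intro continuous_intros) (auto simp: max_def)
  have cH: "continuous_on UNIV (H m)" for m unfolding H_def cut_def
    by (intro continuous_intros continuous_on_compose2[OF ccl h(1)]) auto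
  have H0: "H m x = 0" if "norm x > ?N + 1" for m x using that by (simp add: H_def cut_def)
  have bcl: "cmod (cl z) \<le> ?N" for z
  proof -
    have "cmod (cl z) = ?N / max ?N (cmod z) * cmod z"
      by (simp add: cl_def norm_mult norm_divide del: of_real_divide)
    also have "\<dots> \<le> ?N / max ?N (cmod z) * max ?N (cmod z)"
      by (intro mult_left_mono divide_nonneg_nonneg) auto
    also have "\<dots> = ?N" by (auto simp: max_def)
    finally show ?thesis .
  qed
  have clid: "cl z = z" if "cmod z \<le> ?N" for z
  proof -
    have "max ?N (cmod z) = ?N" using that by (rule max_absorb1)
    then have "?N / max ?N (cmod z) = 1" by simp
    then show ?thesis by (simp only: cl_def) simp
  qed
  have "L2_lim H (F n)"
  proof (rule L2_lim_dominated[where g = "\<lambda>x. of_real (?N * indicat_real (cball 0 (?N + 1)) x)"])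
    show "H m \<in> borel_measurable lebesgue" for m by (rule continuous_lebesgue_measurable[OF cH])
    show "F n \<in> borel_measurable lebesgue" by (rule mF)
    have "integrable lebesgue (\<lambda>x. ?N\<^sup>2 * indicat_real (cball (0::'a) (?N + 1)) x)"
      using emeasure_lborel_cball_finite[of "0::'a" "?N + 1"]
      by (intro integrable_mult_right integrable_real_indicator) auto
    moreover have "(cmod (of_real (?N * indicat_real (cball (0::'a) (?N + 1)) x)))\<^sup>2 = ?N\<^sup>2 * indicat_real (cball (0::'a) (?N + 1)) x" for x
      by (auto simp: indicator_def norm_of_real simp del: of_real_add of_real_mult)
    moreover have "(\<lambda>x. complex_of_real (?N * indicat_real (cball (0::'a) (?N + 1)) x)) \<in> borel_measurable lebesgue"
    proof -
      have [measurable]: "cball (0::'a) (?N + 1) \<in> sets borel" by simp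
      show ?thesis by (rule measurable_completion) measurable
    qed
    ultimately show "L2_fun (\<lambda>x. complex_of_real (?N * indicat_real (cball (0::'a) (?N + 1)) x))"
      unfolding L2_fun_def by simp
    show "AE x in lebesgue. cmod (H m x) \<le> cmod (of_real (?N * indicat_real (cball 0 (?N + 1)) x))" for m
    proof (rule AE_I2)
      fix x :: 'a
      have "cmod (H m x) = \<bar>cut x\<bar> * cmod (cl (h m x))" by (simp add: H_def norm_mult)
      also have "\<dots> \<le> 1 * ?N" using bcl by (intro mult_mono) (auto simp: cut_def)
      finally have "cmod (H m x) \<le> ?N" by simp
      then show "cmod (H m x) \<le> cmod (of_real (?N * indicat_real (cball 0 (?N + 1)) x))"
        using H0[of x m] by (auto simp: indicator_def norm_of_real not_le simp del: of_real_add of_real_mult)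
    qed
    have "Z \<in> null_sets lebesgue" using Z by (simp add: negligible_iff_null_sets)
    from AE_not_in[OF this] show "AE x in lebesgue. (\<lambda>m. H m x) \<longlonglongrightarrow> F n x"
    proof eventually_elim
      case (elim x)
      have "isCont cl (F n x)" using ccl by (simp add: continuous_on_eq_continuous_at)
      then have "(\<lambda>m. cl (h m x)) \<longlonglongrightarrow> cl (F n x)" by (rule isCont_tendsto_compose) (rule h(2)[OF elim])
      then have "(\<lambda>m. H m x) \<longlonglongrightarrow> of_real (cut x) * cl (F n x)" unfolding H_def by (intro tendsto_intros)
      moreover have "cmod (F n x) \<le> ?N" by (auto simp: F_def)
      moreover have "of_real (cut x) * F n x = F n x" by (auto simp: F_def cut_def)
      ultimately show ?case by (simp add: clid)
    qed
  qed
  then have "\<forall>\<^sub>F m in sequentially. L2_norm (\<lambda>x. H m x - F n x) < e / 2"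
    using e by (auto simp: L2_lim_def dest!: order_tendstoD(2)[of _ 0 _ "e/2"])
  then obtain m where m: "L2_norm (\<lambda>x. H m x - F n x) < e / 2" by (auto simp: eventually_sequentially)
  have LH: "L2_fun (H m)" using \<open>L2_lim H (F n)\<close> by (rule L2_limD)
  have "L2_norm (\<lambda>x. H m x - f x) \<le> L2_norm (\<lambda>x. H m x - F n x) + L2_norm (\<lambda>x. F n x - f x)"
    using L2_norm_triangle[OF L2_fun_diff[OF LH LF] L2_fun_diff[OF LF f]] by simp
  then have "L2_norm (\<lambda>x. H m x - f x) < e" using n m by linarith
  with cH H0 show ?thesis using that by blast
qed

definition mollify :: "('a::euclidean_space \<Rightarrow> complex) \<Rightarrow> ('a \<Rightarrow> complex) \<Rightarrow> 'a \<Rightarrow> complex" where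
  "mollify \<eta> f x = (LINT y|lebesgue. f y * \<eta> (x - y))"

lemma test_function_reflect:
  assumes "test_function \<eta>"
  shows "test_function (\<lambda>y. \<eta> (x - y))"
proof -
  obtain R where R: "\<And>x. norm x > R \<Longrightarrow> \<eta> x = 0" using test_functionE[OF assms] by blast
  show ?thesis
  proof (rule test_functionI)
    show "smooth_fun (\<lambda>y. \<eta> (x - y))"
      using smooth_fun_affine[OF test_function_smooth[OF assms], of x "-1"] by simp
    show "\<eta> (x - y) = 0" if "norm y > R + norm x" for y
      using that norm_triangle_ineq4[of x "x - y"] by (intro R) simp
  qed
qed

lemma pderiv_dir_reflect:
  assumes "test_function \<eta>"
  shows "pderiv_dir b (\<lambda>y. \<eta> (x - y)) y = - pderiv_dir b \<eta> (x - y)"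
  using pderiv_dir_affine[OF test_function_smooth[OF assms], of b x "-1" y] by simp

lemma integrable_mult_test:
  assumes "integrable lebesgue f" "test_function \<eta>"
  shows "integrable lebesgue (\<lambda>y. f y * \<eta> y)"
proof -
  obtain B where B: "\<And>x. norm (\<eta> x) \<le> B"
    using test_function_bounded[OF assms(2)] by (auto simp: bounded_iff)
  have [measurable]: "\<eta> \<in> borel_measurable lebesgue" "f \<in> borel_measurable lebesgue"
    using L2_fun_measurable test_function_L2[OF assms(2)] assms(1) by auto
  show ?thesis
  proof (rule Bochner_Integration.integrable_bound)
    show "integrable lebesgue (\<lambda>y. B *\<^sub>R f y)" using assms(1) by simp
    show "AE x in lebesgue. norm (f x * \<eta> x) \<le> norm (B *\<^sub>R f x)"
      by (intro AE_I2) (auto simp: norm_mult mult.commute intro!: mult_right_mono order_trans[OF B abs_ge_self])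
  qed measurable
qed

text \<open>The first derivatives are Lipschitz, so the error of linearization is quadratic, uniformly in the
  base point.  The uniformity makes differentiation under a convolution integral elementary.\<close>

lemma test_function_taylor:
  fixes \<eta> :: "'a::euclidean_space \<Rightarrow> complex"
  assumes "test_function \<eta>"
  obtains C where "C \<ge> 0"
    "\<And>z h. cmod (\<eta> (z + h) - \<eta> z - (\<Sum>b\<in>Basis. (h \<bullet> b) *\<^sub>R pderiv_dir b \<eta> z)) \<le> C * (norm h)\<^sup>2"
proof -
  have "\<forall>b\<in>Basis. \<exists>L. L \<ge> 0 \<and> (\<forall>x y. norm (pderiv_dir b \<eta> x - pderiv_dir b \<eta> y) \<le> L * norm (x - y))"
    using test_function_lip_bdd[OF test_function_pderiv[OF assms]] lip_bddE by metis
  then obtain L where L: "\<And>b. b \<in> Basis \<Longrightarrow> L b \<ge> 0"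
    "\<And>b x y. b \<in> Basis \<Longrightarrow> norm (pderiv_dir b \<eta> x - pderiv_dir b \<eta> y) \<le> L b * norm (x - y)"
    by metis
  define C where "C = (\<Sum>b\<in>(Basis::'a set). L b)"
  have C: "C \<ge> 0" unfolding C_def by (intro sum_nonneg L)
  have "cmod (\<eta> (z + h) - \<eta> z - (\<Sum>b\<in>Basis. (h \<bullet> b) *\<^sub>R pderiv_dir b \<eta> z)) \<le> C * (norm h)\<^sup>2" for z h
  proof -
    let ?D = "\<lambda>x h. \<Sum>b\<in>Basis. (h \<bullet> b) *\<^sub>R pderiv_dir b \<eta> x"
    have "norm (\<eta> (z + h) - \<eta> z - ?D z (z + h - z)) \<le> norm (z + h - z) * (C * norm h)"
    proof (rule differentiable_bound_linearization[where S = "cball z (norm h)"])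
      show "z + t *\<^sub>R (z + h - z) \<in> cball z (norm h)" if "t \<in> {0..1}" for t
        using that by (auto simp: dist_norm mult_left_le_one_le)
      show "(\<eta> has_derivative ?D x) (at x within cball z (norm h))" for x
        using smooth_fun_has_derivative[OF test_function_smooth[OF assms]] by (rule has_derivative_at_withinI)
      show "onorm (?D x - ?D z) \<le> C * norm h" if x: "x \<in> cball z (norm h)" for x
      proof (rule onorm_le)
        fix v :: 'a
        have "norm (?D x v - ?D z v) = norm (\<Sum>b\<in>Basis. (v \<bullet> b) *\<^sub>R (pderiv_dir b \<eta> x - pderiv_dir b \<eta> z))"
          by (simp add: sum_subtractf scaleR_diff_right)
        also have "\<dots> \<le> (\<Sum>b\<in>Basis. L b * norm h * norm v)"
        proof (rule order_trans[OF norm_sum sum_mono])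
          fix b :: 'a assume b: "b \<in> Basis"
          have "norm (pderiv_dir b \<eta> x - pderiv_dir b \<eta> z) \<le> L b * norm h"
            using x by (intro order_trans[OF L(2)[OF b]] mult_left_mono L(1)[OF b]) (simp add: dist_norm norm_minus_commute)
          then have "\<bar>v \<bullet> b\<bar> * norm (pderiv_dir b \<eta> x - pderiv_dir b \<eta> z) \<le> norm v * (L b * norm h)"
            using Basis_le_norm[OF b, of v] by (intro mult_mono) auto
          then show "norm ((v \<bullet> b) *\<^sub>R (pderiv_dir b \<eta> x - pderiv_dir b \<eta> z)) \<le> L b * norm h * norm v"
            by (simp add: mult_ac)
        qed
        finally show "norm ((?D x - ?D z) v) \<le> C * norm h * norm v"
          by (simp add: C_def sum_distrib_right)
      qed
    qed auto
    then show ?thesis by (simp add: power2_eq_square mult_ac)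
  qed
  with C show ?thesis using that by blast
qed

lemma mollify_has_derivative:
  assumes f: "integrable lebesgue f" and \<eta>: "test_function \<eta>"
  shows "(mollify \<eta> f has_derivative (\<lambda>h. \<Sum>b\<in>Basis. (h \<bullet> b) *\<^sub>R mollify (pderiv_dir b \<eta>) f x)) (at x)"
proof -
  let ?D = "\<lambda>h. \<Sum>b\<in>Basis. (h \<bullet> b) *\<^sub>R mollify (pderiv_dir b \<eta>) f x"
  obtain C where C: "C \<ge> 0"
    "\<And>z h. cmod (\<eta> (z + h) - \<eta> z - (\<Sum>b\<in>Basis. (h \<bullet> b) *\<^sub>R pderiv_dir b \<eta> z)) \<le> C * (norm h)\<^sup>2"
    using test_function_taylor[OF \<eta>] by blast
  let ?M = "LINT y|lebesgue. cmod (f y)"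
  have i: "integrable lebesgue (\<lambda>y. f y * \<eta> (z - y))" for z
    by (rule integrable_mult_test[OF f test_function_reflect[OF \<eta>]])
  have ib: "integrable lebesgue (\<lambda>y. f y * pderiv_dir b \<eta> (z - y))" if "b \<in> Basis" for b z
    by (rule integrable_mult_test[OF f test_function_reflect[OF test_function_pderiv[OF \<eta> that]]])
  have bd: "norm (mollify \<eta> f (x + h) - mollify \<eta> f x - ?D h) \<le> ?M * (C * (norm h)\<^sup>2)" for h
  proof -
    have "mollify \<eta> f (x + h) - mollify \<eta> f x - ?D h
       = (LINT y|lebesgue. f y * \<eta> (x + h - y) - f y * \<eta> (x - y) - (\<Sum>b\<in>Basis. (h \<bullet> b) *\<^sub>R (f y * pderiv_dir b \<eta> (x - y))))"
      unfolding mollify_def using i ib by (simp add: Bochner_Integration.integral_diff Bochner_Integration.integral_sum)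
    also have "norm \<dots> \<le> (LINT y|lebesgue. norm (f y) * (C * (norm h)\<^sup>2))"
    proof (rule Bochner_Integration.integral_norm_bound_integral)
      show "integrable lebesgue (\<lambda>y. f y * \<eta> (x + h - y) - f y * \<eta> (x - y) - (\<Sum>b\<in>Basis. (h \<bullet> b) *\<^sub>R (f y * pderiv_dir b \<eta> (x - y))))"
        using i ib by auto
      show "integrable lebesgue (\<lambda>y. norm (f y) * (C * (norm h)\<^sup>2))" using f by simp
      fix y
      have "f y * \<eta> (x + h - y) - f y * \<eta> (x - y) - (\<Sum>b\<in>Basis. (h \<bullet> b) *\<^sub>R (f y * pderiv_dir b \<eta> (x - y)))
         = f y * (\<eta> (x - y + h) - \<eta> (x - y) - (\<Sum>b\<in>Basis. (h \<bullet> b) *\<^sub>R pderiv_dir b \<eta> (x - y)))"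
        by (simp add: algebra_simps sum_distrib_left)
      then show "norm (f y * \<eta> (x + h - y) - f y * \<eta> (x - y) - (\<Sum>b\<in>Basis. (h \<bullet> b) *\<^sub>R (f y * pderiv_dir b \<eta> (x - y))))
           \<le> norm (f y) * (C * (norm h)\<^sup>2)"
        using C(2)[of "x - y" h] by (simp add: norm_mult mult_left_mono)
    qed
    finally show ?thesis by simp
  qed
  have "(\<lambda>h. norm (mollify \<eta> f (x + h) - mollify \<eta> f x - ?D h) / norm h) \<midarrow>0\<rightarrow> 0"
  proof (rule Lim_null_comparison)
    show "(\<lambda>h. ?M * C * norm h) \<midarrow>0\<rightarrow> 0" by (auto intro!: tendsto_eq_intros)
    show "\<forall>\<^sub>F h in at 0. norm (norm (mollify \<eta> f (x + h) - mollify \<eta> f x - ?D h) / norm h) \<le> ?M * C * norm h"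
    proof (rule always_eventually, rule allI)
      fix h show "norm (norm (mollify \<eta> f (x + h) - mollify \<eta> f x - ?D h) / norm h) \<le> ?M * C * norm h"
        using bd[of h] by (cases "h = 0") (simp_all add: field_simps power2_eq_square)
    qed
  qed
  moreover have "bounded_linear ?D"
    by (intro bounded_linear_sum bounded_linear_scaleR_const bounded_linear_inner_left)
  ultimately show ?thesis by (simp add: has_derivative_at)
qed

lemma pderiv_mollify:
  assumes "integrable lebesgue f" "test_function \<eta>" "b \<in> Basis"
  shows "pderiv_dir b (mollify \<eta> f) = mollify (pderiv_dir b \<eta>) f"
proof
  fix x
  have "pderiv_dir b (mollify \<eta> f) x = (\<Sum>c\<in>Basis. (b \<bullet> c) *\<^sub>R mollify (pderiv_dir c \<eta>) f x)"
    by (rule pderiv_dir_eqI[OF mollify_has_derivative[OF assms(1,2)]])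
  also have "\<dots> = (\<Sum>c\<in>Basis. if c = b then mollify (pderiv_dir c \<eta>) f x else 0)"
    using assms(3) by (intro sum.cong) (auto simp: inner_Basis)
  finally show "pderiv_dir b (mollify \<eta> f) x = mollify (pderiv_dir b \<eta>) f x"
    using assms(3) by simp
qed

lemma Ck_mollify:
  assumes "integrable lebesgue f"
  shows "test_function \<eta> \<Longrightarrow> Ck k (mollify \<eta> f)"
proof (induction k arbitrary: \<eta>)
  case 0
  have "continuous_on UNIV (mollify \<eta> f)"
    using has_derivative_continuous[OF mollify_has_derivative[OF assms 0]]
    by (simp add: continuous_on_eq_continuous_at)
  then show ?case by simp
next
  case (Suc k)
  have "mollify \<eta> f differentiable (at x)" for x
    using mollify_has_derivative[OF assms Suc.prems] by (auto simp: differentiable_def)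
  moreover have "Ck k (pderiv_dir b (mollify \<eta> f))" if "b \<in> Basis" for b
    unfolding pderiv_mollify[OF assms Suc.prems that]
    by (rule Suc.IH[OF test_function_pderiv[OF Suc.prems that]])
  ultimately show ?case by simp
qed

lemma mollify_zero_outside:
  assumes "\<And>x. norm x > R \<Longrightarrow> f x = 0" "\<And>x. norm x > r \<Longrightarrow> \<eta> x = 0" "norm x > R + r"
  shows "mollify \<eta> f x = 0"
proof -
  have "f y * \<eta> (x - y) = 0" for y
    using assms norm_triangle_ineq[of "x - y" y] by (cases "norm y > R") auto
  then have "(\<lambda>y. f y * \<eta> (x - y)) = (\<lambda>y. 0)" by (intro ext)
  then show ?thesis by (simp add: mollify_def)
qed

lemma test_function_mollify:
  assumes "integrable lebesgue f" "\<And>x. norm x > R \<Longrightarrow> f x = 0" "test_function \<eta>"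
  shows "test_function (mollify \<eta> f)"
proof -
  obtain r where "\<And>x. norm x > r \<Longrightarrow> \<eta> x = 0" using test_functionE[OF assms(3)] by blast
  then show ?thesis
    using mollify_zero_outside[of R f r \<eta>, OF assms(2)] Ck_mollify[OF assms(1,3)]
    by (intro test_functionI[where R = "R + r"]) (auto simp: smooth_fun_def)
qed

text \<open>For fixed \<open>x\<close> the reflected kernel \<open>y \<mapsto> \<eta> (x - y)\<close> is a test function, so the
  definition of the weak derivative applies to it.\<close>

lemma mollify_weak_partial:
  assumes "has_weak_partial b f g" "integrable lebesgue f" "b \<in> Basis" "test_function \<eta>"
  shows "pderiv_dir b (mollify \<eta> f) = mollify \<eta> g"
proof
  fix x
  have "(LINT y|lebesgue. f y * pderiv_dir b (\<lambda>y. \<eta> (x - y)) y) = - (LINT y|lebesgue. g y * \<eta> (x - y))"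
    using assms(1) test_function_reflect[OF assms(4)] by (simp add: has_weak_partial_def)
  then have "(LINT y|lebesgue. f y * pderiv_dir b \<eta> (x - y)) = (LINT y|lebesgue. g y * \<eta> (x - y))"
    by (simp add: pderiv_dir_reflect[OF assms(4)])
  then show "pderiv_dir b (mollify \<eta> f) x = mollify \<eta> g x"
    unfolding pderiv_mollify[OF assms(2,4,3)] by (simp add: mollify_def)
qed

definition mollifier :: "real \<Rightarrow> ('a::euclidean_space \<Rightarrow> real) \<Rightarrow> bool" where
  "mollifier r k \<longleftrightarrow> test_function (\<lambda>x. complex_of_real (k x)) \<and> (\<forall>x. 0 \<le> k x) \<and>
     (LINT x|lebesgue. k x) = 1 \<and> (\<forall>x. norm x > r \<longrightarrow> k x = 0)"

text \<open>Rescale and normalize \<open>|\<psi>|\<^sup>2\<close>.  The values of \<open>\<psi>\<close> may be complex; the squared modulus is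
  smooth and nonnegative.\<close>

lemma mollifier_exists:
  fixes \<psi> :: "'a::euclidean_space \<Rightarrow> complex"
  assumes \<psi>: "test_function \<psi>" and one: "\<And>x. norm x \<le> 1 \<Longrightarrow> \<psi> x = 1" and r: "r > 0"
  shows "\<exists>k. mollifier r (k :: 'a \<Rightarrow> real)"
proof -
  obtain R where R: "R > 0" "\<And>x. norm x > R \<Longrightarrow> \<psi> x = 0" using test_functionE[OF \<psi>] by blast
  define c where "c = R / r"
  have c: "c > 0" using R r by (simp add: c_def)
  define q where "q x = (cmod (\<psi> (c *\<^sub>R x)))\<^sup>2" for x
  have q0: "q x = 0" if "norm x > r" for x
  proof -
    have "norm (c *\<^sub>R x) > R" using that r R(1) by (simp add: c_def field_simps)
    then show ?thesis using R(2) by (simp add: q_def)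
  qed
  have qc: "complex_of_real (q x) = \<psi> (c *\<^sub>R x) * cnj (\<psi> (c *\<^sub>R x))" for x
    unfolding q_def by (rule complex_norm_square)
  have sm: "smooth_fun (\<lambda>x. \<psi> (c *\<^sub>R x))"
    using smooth_fun_affine[OF test_function_smooth[OF \<psi>], of 0 c] by simp
  then have "smooth_fun (\<lambda>x. cnj (\<psi> (c *\<^sub>R x)))" by (simp add: smooth_fun_def Ck_cnj)
  with sm have "smooth_fun (\<lambda>x. complex_of_real (q x))"
    unfolding qc by (rule smooth_fun_mult)
  then have tq: "test_function (\<lambda>x. complex_of_real (q x))"
    by (rule test_functionI[where R = r]) (simp add: q0)
  have cq: "continuous_on UNIV q"
    using continuous_on_Re[OF smooth_fun_continuous[OF test_function_smooth[OF tq]]] by simp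
  have iq: "integrable lebesgue q" by (rule continuous_compact_support_integrable[OF cq q0])
  define I where "I = (LINT x|lebesgue. q x)"
  have "I > 0"
  proof -
    have "(LINT x|lebesgue. indicat_real (cball (0::'a) (1/c)) x) \<le> I"
      unfolding I_def
    proof (rule integral_mono)
      show "integrable lebesgue (indicat_real (cball (0::'a) (1/c)))"
        using emeasure_lborel_cball_finite[of "0::'a" "1/c"] by (intro integrable_real_indicator) auto
      show "indicat_real (cball 0 (1/c)) x \<le> q x" for x :: 'a
        using one[of "c *\<^sub>R x"] c by (auto simp: indicator_def q_def field_simps)
    qed (rule iq)
    moreover have "(LINT x|lebesgue. indicat_real (cball (0::'a) (1/c)) x) = measure lebesgue (cball (0::'a) (1/c))"
      by simp
    moreover have "measure lebesgue (cball (0::'a) (1/c)) > 0"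
      using c content_cball_pos[of "1/c" "0::'a"] by simp
    ultimately show ?thesis by linarith
  qed
  have "mollifier r (\<lambda>x. q x / I)"
    unfolding mollifier_def
  proof (intro conjI allI impI)
    have "test_function (\<lambda>x. complex_of_real (1 / I) * complex_of_real (q x))"
      by (rule test_function_mult[OF smooth_fun_const tq])
    then show "test_function (\<lambda>x. complex_of_real (q x / I))" by (simp add: field_simps)
    show "0 \<le> q x / I" for x using \<open>I > 0\<close> by (simp add: q_def)
    show "(LINT x|lebesgue. q x / I) = 1" using \<open>I > 0\<close> by (simp add: I_def)
    show "q x / I = 0" if "norm x > r" for x using q0[OF that] by simp
  qed
  then show ?thesis by blast
qed

lemma lborel_reflect: "lborel = distr lborel borel (\<lambda>y::'a::euclidean_space. x - y)"
  using lborel_affine[of "-1" x] by (simp add: density_1)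

lemma integral_lebesgue_reflect:
  fixes k :: "'a::euclidean_space \<Rightarrow> real"
  assumes "continuous_on UNIV k"
  shows "(LINT y|lebesgue. k (x - y)) = (LINT y|lebesgue. k y)"
proof -
  have [measurable]: "k \<in> borel_measurable borel" by (rule borel_measurable_continuous_onI[OF assms])
  have "(LINT y|lebesgue. k (x - y)) = (LINT y|lborel. k (x - y))"
    by (subst integral_completion) auto
  also have "\<dots> = (LINT y|distr lborel borel (\<lambda>y. x - y). k y)" by (subst integral_distr) auto
  also have "\<dots> = (LINT y|lborel. k y)" by (simp flip: lborel_reflect)
  finally show ?thesis by (simp add: integral_completion)
qed

lemma mollifierD:
  assumes "mollifier r (k :: 'a::euclidean_space \<Rightarrow> real)"
  shows "test_function (\<lambda>x. complex_of_real (k x))" "0 \<le> k x" "(LINT x|lebesgue. k x) = 1"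
    "norm x > r \<Longrightarrow> k x = 0" "continuous_on UNIV k"
proof -
  show 1: "test_function (\<lambda>x. complex_of_real (k x))" "0 \<le> k x" "(LINT x|lebesgue. k x) = 1"
    "norm x > r \<Longrightarrow> k x = 0" using assms by (auto simp: mollifier_def)
  show "continuous_on UNIV k"
    using continuous_on_Re[OF smooth_fun_continuous[OF test_function_smooth[OF 1(1)]]] by simp
qed

lemma mollifier_total:
  assumes "mollifier r (k :: 'a::euclidean_space \<Rightarrow> real)"
  shows "(LINT y|lebesgue. k (x - y)) = 1" "integrable lebesgue (\<lambda>y. k (x - y))"
proof -
  show "(LINT y|lebesgue. k (x - y)) = 1"
    using integral_lebesgue_reflect[OF mollifierD(5)[OF assms]] mollifierD(3)[OF assms] by simp
  then show "integrable lebesgue (\<lambda>y. k (x - y))"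
    using not_integrable_integral_eq by fastforce
qed

text \<open>Cauchy-Schwarz after splitting the kernel into two factors \<open>sqrt (k (x - y))\<close>.\<close>

lemma mollify_pointwise_square_bound:
  fixes f :: "'a::euclidean_space \<Rightarrow> complex"
  assumes f: "L2_fun f" and k: "mollifier r k"
  shows "integrable lebesgue (\<lambda>y. (cmod (f y))\<^sup>2 * k (x - y))"
    "(cmod (mollify (\<lambda>x. complex_of_real (k x)) f x))\<^sup>2 \<le> (LINT y|lebesgue. (cmod (f y))\<^sup>2 * k (x - y))"
proof -
  note kk = mollifierD[OF k]
  obtain B where B: "\<And>x. k x \<le> B"
    using test_function_bounded[OF kk(1)] kk(2) by (auto simp: bounded_iff)
  have ck: "continuous_on UNIV (\<lambda>y. k (x - y))"
    by (rule continuous_on_compose2[OF kk(5)]) (auto intro!: continuous_intros)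
  have [measurable]: "(\<lambda>y. k (x - y)) \<in> borel_measurable lebesgue"
    by (rule continuous_lebesgue_measurable[OF ck])
  have [measurable]: "(\<lambda>y. complex_of_real (sqrt (k (x - y)))) \<in> borel_measurable lebesgue"
    by (intro continuous_lebesgue_measurable continuous_intros ck)
  have F: "L2_fun (\<lambda>y. complex_of_real (sqrt (k (x - y))) * f y)"
    by (rule L2_fun_bounded_mult[OF f, where C = "sqrt B"]) (use B kk(2) in auto)
  have G: "L2_fun (\<lambda>y. complex_of_real (sqrt (k (x - y))))"
    using mollifier_total(2)[OF k] kk(2) by (simp add: L2_fun_def)
  have sqF: "(cmod (complex_of_real (sqrt (k (x - y))) * f y))\<^sup>2 = (cmod (f y))\<^sup>2 * k (x - y)" for y
    using kk(2) by (simp add: norm_mult power_mult_distrib)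
  show "integrable lebesgue (\<lambda>y. (cmod (f y))\<^sup>2 * k (x - y))"
    using L2_fun_integrable[OF F] by (simp add: sqF)
  have "mollify (\<lambda>x. complex_of_real (k x)) f x
     = (LINT y|lebesgue. (complex_of_real (sqrt (k (x - y))) * f y) * complex_of_real (sqrt (k (x - y))))"
    unfolding mollify_def
  proof (rule Bochner_Integration.integral_cong[OF refl])
    fix y
    have "complex_of_real (k (x - y)) = complex_of_real (sqrt (k (x - y))) * complex_of_real (sqrt (k (x - y)))"
      using kk(2) by (simp flip: of_real_mult)
    then show "f y * complex_of_real (k (x - y)) =
         complex_of_real (sqrt (k (x - y))) * f y * complex_of_real (sqrt (k (x - y)))"
      by (simp add: mult_ac)
  qed
  then have "cmod (mollify (\<lambda>x. complex_of_real (k x)) f x)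
     \<le> L2_norm (\<lambda>y. complex_of_real (sqrt (k (x - y))) * f y) * L2_norm (\<lambda>y. complex_of_real (sqrt (k (x - y))))"
    using L2_Cauchy_Schwarz_integral[OF F G] by simp
  then have "(cmod (mollify (\<lambda>x. complex_of_real (k x)) f x))\<^sup>2
     \<le> (L2_norm (\<lambda>y. complex_of_real (sqrt (k (x - y))) * f y) * L2_norm (\<lambda>y. complex_of_real (sqrt (k (x - y)))))\<^sup>2"
    by (rule power_mono) auto
  also have "\<dots> = (LINT y|lebesgue. (cmod (f y))\<^sup>2 * k (x - y)) * (LINT y|lebesgue. k (x - y))"
    unfolding power_mult_distrib L2_norm_sq sqF using kk(2) by simp
  finally show "(cmod (mollify (\<lambda>x. complex_of_real (k x)) f x))\<^sup>2 \<le> (LINT y|lebesgue. (cmod (f y))\<^sup>2 * k (x - y))"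
    by (simp add: mollifier_total(1)[OF k])
qed

text \<open>Integrate the pointwise bound in \<open>x\<close> and exchange the integrals; every translate of \<open>k\<close> has
  integral one.\<close>

lemma mollify_L2:
  fixes f :: "'a::euclidean_space \<Rightarrow> complex"
  assumes f: "L2_fun f" and i: "integrable lebesgue f" and k: "mollifier r k"
  shows "L2_fun (mollify (\<lambda>x. complex_of_real (k x)) f)"
    "L2_norm (mollify (\<lambda>x. complex_of_real (k x)) f) \<le> L2_norm f"
proof -
  let ?m = "mollify (\<lambda>x. complex_of_real (k x)) f"
  note kk = mollifierD[OF k]
  have [measurable]: "k \<in> borel_measurable borel" by (rule borel_measurable_continuous_onI[OF kk(5)])
  have cm: "continuous_on UNIV ?m" using Ck_mollify[OF i kk(1), of 0] by simp
  have mm: "?m \<in> borel_measurable lebesgue" by (rule continuous_lebesgue_measurable[OF cm])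
  have "(\<lambda>y. (cmod (f y))\<^sup>2) \<in> borel_measurable lebesgue"
    using L2_fun_measurable[OF f] by measurable
  from completion_ex_borel_measurable_real[OF this]
  obtain q where [measurable]: "q \<in> borel_measurable lborel" and q: "AE y in lborel. (cmod (f y))\<^sup>2 = q y"
    by auto
  have one: "(\<integral>\<^sup>+x. ennreal (k (x - y)) \<partial>lborel) = 1" for y
  proof -
    have ik: "integrable lborel k"
      using kk(3) not_integrable_integral_eq[of lebesgue k] integrable_completion[of k lborel] by fastforce
    have "(\<integral>\<^sup>+x. ennreal (k (x - y)) \<partial>lborel) = (\<integral>\<^sup>+x. ennreal (k x) \<partial>distr lborel borel ((+) (- y)))"
      by (subst nn_integral_distr) auto
    also have "\<dots> = (\<integral>\<^sup>+x. ennreal (k x) \<partial>lborel)" by (simp only: lborel_distr_plus)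
    also have "\<dots> = ennreal (LINT x|lborel. k x)"
      by (rule nn_integral_eq_integral[OF ik]) (use kk(2) in auto)
    also have "(LINT x|lborel. k x) = 1" using kk(3) integral_completion[of k lborel] by simp
    finally show ?thesis by simp
  qed
  have "(\<integral>\<^sup>+x. ennreal ((cmod (?m x))\<^sup>2) \<partial>lborel)
      \<le> (\<integral>\<^sup>+x. (\<integral>\<^sup>+y. ennreal (q y) * ennreal (k (x - y)) \<partial>lborel) \<partial>lborel)"
  proof (rule nn_integral_mono)
    fix x
    have "ennreal ((cmod (?m x))\<^sup>2) \<le> ennreal (LINT y|lebesgue. (cmod (f y))\<^sup>2 * k (x - y))"
      by (intro ennreal_leI mollify_pointwise_square_bound[OF f k])
    also have "\<dots> = (\<integral>\<^sup>+y. ennreal ((cmod (f y))\<^sup>2 * k (x - y)) \<partial>lebesgue)"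
      by (rule nn_integral_eq_integral[symmetric])
         (use mollify_pointwise_square_bound[OF f k] kk(2) in auto)
    also have "\<dots> = (\<integral>\<^sup>+y. ennreal ((cmod (f y))\<^sup>2 * k (x - y)) \<partial>lborel)"
      by (rule nn_integral_completion)
    also have "\<dots> = (\<integral>\<^sup>+y. ennreal (q y) * ennreal (k (x - y)) \<partial>lborel)"
      by (rule nn_integral_cong_AE) (use q kk(2) in \<open>auto elim!: eventually_mono simp: ennreal_mult'' \<close>)
    finally show "ennreal ((cmod (?m x))\<^sup>2) \<le> (\<integral>\<^sup>+y. ennreal (q y) * ennreal (k (x - y)) \<partial>lborel)" .
  qed
  also have "\<dots> = (\<integral>\<^sup>+y. (\<integral>\<^sup>+x. ennreal (q y) * ennreal (k (x - y)) \<partial>lborel) \<partial>lborel)"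
    by (rule lborel_pair.Fubini'[symmetric]) measurable
  also have "\<dots> = (\<integral>\<^sup>+y. ennreal (q y) \<partial>lborel)"
    by (subst nn_integral_cmult) (auto simp: one)
  also have "\<dots> = (\<integral>\<^sup>+y. ennreal ((cmod (f y))\<^sup>2) \<partial>lborel)"
    by (rule nn_integral_cong_AE) (use q in \<open>auto elim!: eventually_mono\<close>)
  finally have le: "(\<integral>\<^sup>+x. ennreal ((cmod (?m x))\<^sup>2) \<partial>lebesgue) \<le> (\<integral>\<^sup>+x. ennreal ((cmod (f x))\<^sup>2) \<partial>lebesgue)"
    by (simp only: nn_integral_completion)
  also have "(\<integral>\<^sup>+x. ennreal ((cmod (f x))\<^sup>2) \<partial>lebesgue) = ennreal (LINT x|lebesgue. (cmod (f x))\<^sup>2)"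
    by (rule nn_integral_eq_integral) (use f in \<open>auto simp: L2_fun_def\<close>)
  finally have le: "(\<integral>\<^sup>+x. ennreal ((cmod (?m x))\<^sup>2) \<partial>lebesgue) \<le> ennreal (LINT x|lebesgue. (cmod (f x))\<^sup>2)" .
  have "integrable lebesgue (\<lambda>x. (cmod (?m x))\<^sup>2)"
  proof (rule integrableI_bounded)
    show "(\<lambda>x. (cmod (?m x))\<^sup>2) \<in> borel_measurable lebesgue" using mm by measurable
    show "(\<integral>\<^sup>+x. ennreal (norm ((cmod (?m x))\<^sup>2)) \<partial>lebesgue) < \<infinity>"
      using le by (simp add: le_less_trans[OF le])
  qed
  then show L: "L2_fun ?m" using mm by (simp add: L2_fun_def)
  have "ennreal (LINT x|lebesgue. (cmod (?m x))\<^sup>2) \<le> ennreal (LINT x|lebesgue. (cmod (f x))\<^sup>2)"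
    using le nn_integral_eq_integral[OF L2_fun_integrable[OF L]] by simp
  then have "(LINT x|lebesgue. (cmod (?m x))\<^sup>2) \<le> (LINT x|lebesgue. (cmod (f x))\<^sup>2)"
    by (subst (asm) ennreal_le_iff) (auto intro!: Bochner_Integration.integral_nonneg)
  then show "L2_norm ?m \<le> L2_norm f" by (simp add: L2_norm_def)
qed

lemma mollify_diff:
  assumes "integrable lebesgue f" "integrable lebesgue g" "test_function \<eta>"
  shows "mollify \<eta> (\<lambda>x. f x - g x) x = mollify \<eta> f x - mollify \<eta> g x"
  unfolding mollify_def
  using integrable_mult_test[OF assms(1) test_function_reflect[OF assms(3), of x]]
    integrable_mult_test[OF assms(2) test_function_reflect[OF assms(3), of x]]
  by (simp add: left_diff_distrib)

lemma continuous_compact_support_uniform: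
  fixes g :: "'a::euclidean_space \<Rightarrow> complex"
  assumes "continuous_on UNIV g" "\<And>x. norm x > R \<Longrightarrow> g x = 0" "e > 0"
  obtains d where "d > 0" "\<And>x y. norm (x - y) < d \<Longrightarrow> cmod (g x - g y) < e"
proof -
  have "uniformly_continuous_on (cball 0 (R + 1)) g"
    by (rule compact_uniformly_continuous) (auto intro: continuous_on_subset[OF assms(1)])
  then obtain d where d: "d > 0"
    "\<And>x y. x \<in> cball 0 (R + 1) \<Longrightarrow> y \<in> cball 0 (R + 1) \<Longrightarrow> dist y x < d \<Longrightarrow> dist (g y) (g x) < e"
    unfolding uniformly_continuous_on_def using assms(3) by metis
  have "cmod (g x - g y) < e" if xy: "norm (x - y) < min d 1" for x y
  proof (cases "norm x \<le> R + 1 \<and> norm y \<le> R + 1")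
    case True
    then show ?thesis using d(2)[of y x] xy by (auto simp: dist_norm)
  next
    case False
    then have "norm x > R" "norm y > R"
      using xy norm_triangle_ineq2[of x y] norm_triangle_ineq2[of y x] by (auto simp: norm_minus_commute)
    then show ?thesis using assms(2,3) by simp
  qed
  then show ?thesis using that[of "min d 1"] d(1) by auto
qed

lemma mollify_uniform:
  fixes g :: "'a::euclidean_space \<Rightarrow> complex"
  assumes g: "continuous_on UNIV g" "\<And>x. norm x > R \<Longrightarrow> g x = 0"
    and d: "\<And>x y. norm (x - y) < d \<Longrightarrow> cmod (g x - g y) < e" and k: "mollifier r k" "r < d"
  shows "cmod (mollify (\<lambda>x. complex_of_real (k x)) g x - g x) \<le> e"
proof -
  have ig: "integrable lebesgue g" by (rule continuous_compact_support_integrable[OF g])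
  note kk = mollifierD[OF k(1)]
  have i: "integrable lebesgue (\<lambda>y. g y * complex_of_real (k (x - y)))"
    by (rule integrable_mult_test[OF ig test_function_reflect[OF kk(1)]])
  have ik: "integrable lebesgue (\<lambda>y. complex_of_real (k (x - y)))"
    using mollifier_total(2)[OF k(1)] by (rule integrable_of_real)
  have "mollify (\<lambda>x. complex_of_real (k x)) g x - g x
      = (LINT y|lebesgue. (g y - g x) * complex_of_real (k (x - y)))"
    using i ik mollifier_total(1)[OF k(1), of x] by (simp add: mollify_def left_diff_distrib)
  also have "cmod \<dots> \<le> (LINT y|lebesgue. e * k (x - y))"
  proof (rule Bochner_Integration.integral_norm_bound_integral)
    show "integrable lebesgue (\<lambda>y. (g y - g x) * complex_of_real (k (x - y)))"
      using i ik by (simp add: left_diff_distrib)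
    show "integrable lebesgue (\<lambda>y. e * k (x - y))" using mollifier_total(2)[OF k(1)] by simp
    show "cmod ((g y - g x) * complex_of_real (k (x - y))) \<le> e * k (x - y)" for y
    proof (cases "norm (x - y) > r")
      case True
      then show ?thesis using kk(4) by simp
    next
      case False
      then have "cmod (g y - g x) < e" using d[of y x] k(2) by (simp add: norm_minus_commute)
      then show ?thesis using kk(2)[of "x - y"] by (simp add: norm_mult mult_right_mono)
    qed
  qed
  finally show ?thesis using mollifier_total(1)[OF k(1)] by simp
qed

text \<open>Convergence is uniform for continuous functions of compact support; these are dense, and
  mollification does not increase the norm.\<close>

lemma mollify_L2_close:
  fixes f :: "'a::euclidean_space \<Rightarrow> complex"
  assumes f: "L2_fun f" "integrable lebesgue f" and e: "e > 0"
  shows "\<exists>\<rho>>0. \<forall>r k. r \<le> \<rho> \<longrightarrow> mollifier r k \<longrightarrow>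
     L2_norm (\<lambda>x. mollify (\<lambda>x. complex_of_real (k x)) f x - f x) < e"
proof -
  obtain g R where g: "continuous_on UNIV g" "\<And>x. norm x > R \<Longrightarrow> g x = 0" "L2_norm (\<lambda>x. g x - f x) < e / 3"
    using L2_dense_continuous[OF f(1), of "e / 3"] e by auto
  have ig: "integrable lebesgue g" by (rule continuous_compact_support_integrable[OF g(1,2)])
  have Lg: "L2_fun g" by (rule continuous_compact_support_L2[OF g(1,2)])
  define V where "V = measure lborel (cball (0::'a) (R + 1)) + 1"
  have V: "V > 0" by (simp add: V_def add_nonneg_pos)
  define e' where "e' = e / (3 * sqrt V)"
  have e': "e' > 0" using e V by (simp add: e'_def)
  obtain d where d: "d > 0" "\<And>x y. norm (x - y) < d \<Longrightarrow> cmod (g x - g y) < e'"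
    using continuous_compact_support_uniform[OF g(1,2) e'] by metis
  have "L2_norm (\<lambda>x. mollify (\<lambda>x. complex_of_real (k x)) f x - f x) < e"
    if r: "r \<le> min (d / 2) 1" and k: "mollifier r k" for r k
  proof -
    let ?J = "mollify (\<lambda>x. complex_of_real (k x))"
    note kk = mollifierD[OF k]
    have u: "cmod (?J g x - g x) \<le> e'" for x
      by (rule mollify_uniform[OF g(1,2) d(2) k]) (use r d(1) in auto)
    have z: "?J g x - g x = 0" if "norm x > R + 1" for x
      using mollify_zero_outside[of R g 1 "\<lambda>x. complex_of_real (k x)" x] g(2) kk(4) r that by auto
    have L1: "L2_fun (\<lambda>x. ?J g x - g x)" by (rule L2_fun_diff[OF mollify_L2(1)[OF Lg ig k] Lg])
    have "(L2_norm (\<lambda>x. ?J g x - g x))\<^sup>2 \<le> (LINT x|lebesgue. e'\<^sup>2 * indicat_real (cball (0::'a) (R + 1)) x)"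
      unfolding L2_norm_sq
    proof (rule integral_mono)
      show "integrable lebesgue (\<lambda>x. e'\<^sup>2 * indicat_real (cball (0::'a) (R + 1)) x)"
        using emeasure_lborel_cball_finite[of "0::'a" "R + 1"]
        by (intro integrable_mult_right integrable_real_indicator) auto
      show "(cmod (?J g x - g x))\<^sup>2 \<le> e'\<^sup>2 * indicat_real (cball (0::'a) (R + 1)) x" for x
        using u[of x] z[of x] by (auto simp: indicator_def not_le intro!: power_mono)
    qed (rule L2_fun_integrable[OF L1])
    also have "\<dots> = e'\<^sup>2 * measure lborel (cball (0::'a) (R + 1))" by simp
    also have "\<dots> \<le> e'\<^sup>2 * V" by (intro mult_left_mono) (auto simp: V_def)
    also have "\<dots> = (e / 3)\<^sup>2" using V by (simp add: e'_def power_divide power_mult_distrib)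
    finally have A: "L2_norm (\<lambda>x. ?J g x - g x) \<le> e / 3" by (rule power2_le_imp_le) (use e in simp)
    have Lfg: "L2_fun (\<lambda>x. f x - g x)" by (rule L2_fun_diff[OF f(1) Lg])
    have ifg: "integrable lebesgue (\<lambda>x. f x - g x)" using f(2) ig by simp
    have B: "L2_norm (?J (\<lambda>x. f x - g x)) < e / 3"
      using mollify_L2(2)[OF Lfg ifg k] g(3) L2_norm_commute[of f g] by simp
    have LB: "L2_fun (?J (\<lambda>x. f x - g x))" by (rule mollify_L2(1)[OF Lfg ifg k])
    have "(\<lambda>x. ?J f x - f x) = (\<lambda>x. (?J (\<lambda>x. f x - g x) x + (?J g x - g x)) + (g x - f x))"
      by (intro ext) (simp add: mollify_diff[OF f(2) ig kk(1)])
    then have "L2_norm (\<lambda>x. ?J f x - f x) = L2_norm (\<lambda>x. (?J (\<lambda>x. f x - g x) x + (?J g x - g x)) + (g x - f x))"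
      by simp
    also have "\<dots> \<le> L2_norm (\<lambda>x. ?J (\<lambda>x. f x - g x) x + (?J g x - g x)) + L2_norm (\<lambda>x. g x - f x)"
      by (intro L2_norm_triangle L2_fun_add LB L1 L2_fun_diff Lg f(1))
    also have "\<dots> \<le> L2_norm (?J (\<lambda>x. f x - g x)) + L2_norm (\<lambda>x. ?J g x - g x) + L2_norm (\<lambda>x. g x - f x)"
      using L2_norm_triangle[OF LB L1] by simp
    also have "\<dots> < e" using A B g(3) by linarith
    finally show ?thesis .
  qed
  then show ?thesis using d(1) by (intro exI[of _ "min (d / 2) 1"]) auto
qed

lemma L2_compact_support_integrable:
  assumes "L2_fun f" "\<And>x. norm x > R \<Longrightarrow> f x = 0"
  shows "integrable lebesgue f"
proof -
  have "set_integrable lebesgue (cball 0 R) f"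
    using L2_fun_locally_integrable[OF assms(1)] by (simp add: locally_integrable_def)
  moreover have "(\<lambda>x. indicat_real (cball 0 R) x *\<^sub>R f x) = f"
    using assms(2) by (auto simp: indicator_def fun_eq_iff)
  ultimately show ?thesis by (simp add: set_integrable_def)
qed

text \<open>One mollifier has to serve a function and all its first and second weak derivatives at the
  same time, because mollification commutes with differentiation only for a fixed kernel.\<close>

lemma mollify_L2_close_finite:
  fixes F :: "'i \<Rightarrow> 'a::euclidean_space \<Rightarrow> complex"
  assumes "finite I" "\<And>i. i \<in> I \<Longrightarrow> L2_fun (F i)" "\<And>i x. i \<in> I \<Longrightarrow> norm x > R \<Longrightarrow> F i x = 0" and e: "e > 0"
  shows "\<exists>\<rho>>0. \<forall>r k. r \<le> \<rho> \<longrightarrow> mollifier r k \<longrightarrow>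
     (\<forall>i\<in>I. L2_norm (\<lambda>x. mollify (\<lambda>x. complex_of_real (k x)) (F i) x - F i x) < e)"
  using assms(1-3)
proof (induction I rule: finite_induct)
  case empty
  then show ?case by (auto intro: exI[of _ 1])
next
  case (insert j I)
  obtain \<rho> where \<rho>: "\<rho> > 0" "\<And>r k. r \<le> \<rho> \<Longrightarrow> mollifier r k \<Longrightarrow>
     \<forall>i\<in>I. L2_norm (\<lambda>x. mollify (\<lambda>x. complex_of_real (k x)) (F i) x - F i x) < e"
    using insert.IH insert.prems by auto
  have "integrable lebesgue (F j)"
    by (rule L2_compact_support_integrable[where R = R]) (use insert.prems in auto)
  then obtain \<rho>' where \<rho>': "\<rho>' > 0" "\<And>r k. r \<le> \<rho>' \<Longrightarrow> mollifier r k \<Longrightarrow>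
     L2_norm (\<lambda>x. mollify (\<lambda>x. complex_of_real (k x)) (F j) x - F j x) < e"
    using mollify_L2_close[OF _ _ e, of "F j"] insert.prems by auto
  show ?case using \<rho> \<rho>' by (intro exI[of _ "min \<rho> \<rho>'"]) auto
qed

section \<open>Weak gradients\<close>

text \<open>A function is in $H^2$ precisely if it has a weak gradient whose components have weak gradients.  Naming
  the derivatives makes it possible to pass to the limit in them.\<close>

definition weak_grad :: "('a::euclidean_space \<Rightarrow> complex) \<Rightarrow> ('a \<Rightarrow> 'a \<Rightarrow> complex) \<Rightarrow> bool" where
  "weak_grad f g \<longleftrightarrow> L2_fun f \<and> (\<forall>b\<in>Basis. L2_fun (g b) \<and> has_weak_partial b f (g b))"

lemma weak_gradD:
  assumes "weak_grad f g"
  shows "L2_fun f" "b \<in> Basis \<Longrightarrow> L2_fun (g b)" "b \<in> Basis \<Longrightarrow> has_weak_partial b f (g b)"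
  using assms by (auto simp: weak_grad_def)

lemma has_weak_partial_L2I:
  assumes "L2_fun f" "L2_fun g"
    "\<And>\<eta>. test_function \<eta> \<Longrightarrow> (LINT x|lebesgue. f x * pderiv_dir b \<eta> x) = - (LINT x|lebesgue. g x * \<eta> x)"
  shows "has_weak_partial b f g"
  using assms by (simp add: has_weak_partial_def L2_fun_locally_integrable)

lemma L2_fun_test_mult: "L2_fun f \<Longrightarrow> test_function \<theta> \<Longrightarrow> L2_fun (\<lambda>x. \<theta> x * f x)"
  using test_function_bounded[of \<theta>] L2_fun_measurable[OF test_function_L2[of \<theta>]]
  by (auto simp: bounded_iff intro: L2_fun_bounded_mult)

lemma has_weak_partial_test_mult:
  assumes "has_weak_partial b f g" "L2_fun f" "L2_fun g" "test_function \<theta>" "b \<in> Basis"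
  shows "has_weak_partial b (\<lambda>x. \<theta> x * f x) (\<lambda>x. \<theta> x * g x + pderiv_dir b \<theta> x * f x)"
proof (rule has_weak_partial_L2I)
  note d\<theta> = test_function_pderiv[OF assms(4,5)]
  show "L2_fun (\<lambda>x. \<theta> x * f x)" by (rule L2_fun_test_mult[OF assms(2,4)])
  show "L2_fun (\<lambda>x. \<theta> x * g x + pderiv_dir b \<theta> x * f x)"
    by (intro L2_fun_add L2_fun_test_mult assms d\<theta>)
  fix \<eta> :: "'a \<Rightarrow> complex" assume \<eta>: "test_function \<eta>"
  note d\<eta> = test_function_pderiv[OF \<eta> assms(5)]
  have t: "test_function (\<lambda>x. \<theta> x * \<eta> x)" by (rule test_function_mult[OF test_function_smooth[OF assms(4)] \<eta>])
  have i1: "integrable lebesgue (\<lambda>x. \<theta> x * f x * pderiv_dir b \<eta> x)"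
    by (intro integrable_L2_mult L2_fun_test_mult assms test_function_L2 d\<eta>)
  have i2: "integrable lebesgue (\<lambda>x. pderiv_dir b \<theta> x * f x * \<eta> x)"
    by (intro integrable_L2_mult L2_fun_test_mult assms test_function_L2 d\<theta> \<eta>)
  have i3: "integrable lebesgue (\<lambda>x. \<theta> x * g x * \<eta> x)"
    by (intro integrable_L2_mult L2_fun_test_mult assms test_function_L2 \<eta>)
  have "(LINT x|lebesgue. f x * pderiv_dir b (\<lambda>x. \<theta> x * \<eta> x) x) = - (LINT x|lebesgue. g x * (\<theta> x * \<eta> x))"
    using assms(1) t by (simp add: has_weak_partial_def)
  also have "(LINT x|lebesgue. f x * pderiv_dir b (\<lambda>x. \<theta> x * \<eta> x) x)
    = (LINT x|lebesgue. \<theta> x * f x * pderiv_dir b \<eta> x + pderiv_dir b \<theta> x * f x * \<eta> x)"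
    by (rule Bochner_Integration.integral_cong[OF refl],
        subst pderiv_dir_mult[OF test_function_smooth[OF assms(4)] test_function_smooth[OF \<eta>]])
       (simp add: algebra_simps)
  also have "\<dots> = (LINT x|lebesgue. \<theta> x * f x * pderiv_dir b \<eta> x) + (LINT x|lebesgue. pderiv_dir b \<theta> x * f x * \<eta> x)"
    by (rule Bochner_Integration.integral_add[OF i1 i2])
  finally have "(LINT x|lebesgue. \<theta> x * f x * pderiv_dir b \<eta> x)
     = - ((LINT x|lebesgue. \<theta> x * g x * \<eta> x) + (LINT x|lebesgue. pderiv_dir b \<theta> x * f x * \<eta> x))"
    by (simp add: algebra_simps)
  also have "(LINT x|lebesgue. \<theta> x * g x * \<eta> x) + (LINT x|lebesgue. pderiv_dir b \<theta> x * f x * \<eta> x)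
     = (LINT x|lebesgue. (\<theta> x * g x + pderiv_dir b \<theta> x * f x) * \<eta> x)"
    by (simp add: Bochner_Integration.integral_add[OF i3 i2, symmetric] distrib_right)
  finally show "(LINT x|lebesgue. \<theta> x * f x * pderiv_dir b \<eta> x)
     = - (LINT x|lebesgue. (\<theta> x * g x + pderiv_dir b \<theta> x * f x) * \<eta> x)" .
qed

text \<open>The function \<open>\<psi>\<close> that occurs in the estimate also serves as the source of mollifiers and of the
  cutoffs at infinity.\<close>

locale bump =
  fixes \<psi> :: "'a::euclidean_space \<Rightarrow> complex"
  assumes test_psi: "test_function \<psi>" and psi_one: "\<And>x. norm x \<le> 1 \<Longrightarrow> \<psi> x = 1"
begin

lemma mollifier_ex: "r > 0 \<Longrightarrow> \<exists>k :: 'a \<Rightarrow> real. mollifier r k"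
  by (rule mollifier_exists[OF test_psi psi_one])

subsection \<open>The fundamental lemma of the calculus of variations\<close>

text \<open>On a ball, integrate \<open>k\<close> against the conjugate of its sign.  The sign is approximated by
  mollifications, which stay bounded by one; as \<open>k\<close> is only integrable, it is split into a bounded part,
  for which convergence of the mollifications in the $L^2$ sense suffices, and a remainder of small integral.\<close>

lemma fundamental_lemma_calculus_of_variations:
  fixes k :: "'a \<Rightarrow> complex"
  assumes li: "locally_integrable k" and z: "\<And>\<eta>. test_function \<eta> \<Longrightarrow> (LINT x|lebesgue. k x * \<eta> x) = 0"
  shows "AE x in lebesgue. k x = 0"
proof -
  have "AE x in lebesgue. norm x \<le> real N \<longrightarrow> k x = 0" for N :: nat
  proof -
    define K where "K = cball (0::'a) (real N + 1)"
    define \<kappa> where "\<kappa> x = indicat_real K x *\<^sub>R k x" for x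
    have i\<kappa>: "integrable lebesgue \<kappa>"
      using li unfolding locally_integrable_def set_integrable_def \<kappa>_def[abs_def] K_def by auto
    then have m\<kappa>[measurable]: "\<kappa> \<in> borel_measurable lebesgue" by simp
    define s where "s x = indicat_real (cball 0 (real N)) x *\<^sub>R cnj (sgn (\<kappa> x))" for x
    have mc: "cball (0::'a) (real N) \<in> sets lebesgue" by simp
    have ms[measurable]: "s \<in> borel_measurable lebesgue"
    proof -
      have [measurable]: "cnj \<in> borel_measurable borel"
        by (intro borel_measurable_continuous_onI continuous_intros)
      have "(\<lambda>z. cnj (sgn z)) \<in> borel_measurable (borel :: complex measure)"
        unfolding sgn_div_norm by measurable
      from measurable_compose[OF m\<kappa> this] have [measurable]: "(\<lambda>x. cnj (sgn (\<kappa> x))) \<in> borel_measurable lebesgue" .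
      show ?thesis unfolding s_def using mc by measurable
    qed
    have s1: "cmod (s x) \<le> 1" for x by (auto simp: s_def indicator_def norm_sgn)
    have s0: "s x = 0" if "norm x > real N" for x using that by (simp add: s_def)
    have Ls: "L2_fun s"
    proof -
      have "integrable lebesgue (\<lambda>x. (cmod (s x))\<^sup>2)"
      proof (rule Bochner_Integration.integrable_bound)
        show "integrable lebesgue (indicat_real (cball (0::'a) (real N)))"
          using emeasure_lborel_cball_finite[of "0::'a" "real N"] by (intro integrable_real_indicator) auto
        show "AE x in lebesgue. norm ((cmod (s x))\<^sup>2) \<le> norm (indicat_real (cball 0 (real N)) x)"
          using s1 by (intro AE_I2) (auto simp: s_def indicator_def norm_sgn)
      qed measurable
      then show ?thesis by (simp add: L2_fun_def)
    qed
    have i_s: "integrable lebesgue s" by (rule L2_compact_support_integrable[OF Ls s0])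
    have \<kappa>s: "\<kappa> x * s x = complex_of_real (indicat_real (cball 0 (real N)) x * cmod (\<kappa> x))" for x
    proof -
      have "\<kappa> x * cnj (sgn (\<kappa> x)) = complex_of_real (cmod (\<kappa> x))"
      proof -
        have "\<kappa> x * cnj (sgn (\<kappa> x)) = (\<kappa> x * cnj (\<kappa> x)) / of_real (cmod (\<kappa> x))"
          by (simp add: sgn_div_norm scaleR_conv_of_real divide_inverse mult_ac)
        also have "\<dots> = of_real ((cmod (\<kappa> x))\<^sup>2) / of_real (cmod (\<kappa> x))"
          by (simp only: complex_norm_square)
        finally show ?thesis by (simp add: power2_eq_square)
      qed
      then show ?thesis by (simp add: s_def scaleR_conv_of_real mult_ac)
    qed
    have i\<kappa>s: "integrable lebesgue (\<lambda>x. indicat_real (cball 0 (real N)) x * cmod (\<kappa> x))"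
      by (rule integrable_mult_indicator[of _ _ "\<lambda>x. cmod (\<kappa> x)", simplified]) (use i\<kappa> mc in auto)
    have small: "cmod (LINT x|lebesgue. \<kappa> x * s x) < e" if e: "e > 0" for e
    proof -
      define \<kappa>1 where "\<kappa>1 M x = (if cmod (\<kappa> x) \<le> real M then \<kappa> x else 0)" for M :: nat and x
      have m1[measurable]: "\<kappa>1 M \<in> borel_measurable lebesgue" for M unfolding \<kappa>1_def by measurable
      have "(\<lambda>M. LINT x|lebesgue. cmod (\<kappa> x - \<kappa>1 M x)) \<longlonglongrightarrow> integral\<^sup>L (lebesgue :: 'a measure) (\<lambda>x. 0)"
      proof (rule integral_dominated_convergence[where w = "\<lambda>x. cmod (\<kappa> x)"])
        show "AE x in lebesgue. (\<lambda>M. cmod (\<kappa> x - \<kappa>1 M x)) \<longlonglongrightarrow> 0"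
        proof (rule AE_I2)
          fix x
          obtain M0 :: nat where M0: "cmod (\<kappa> x) \<le> M0" using real_arch_simple by blast
          have "\<forall>\<^sub>F M in sequentially. cmod (\<kappa> x - \<kappa>1 M x) = 0"
            using eventually_ge_at_top[of M0] by eventually_elim (use M0 in \<open>auto simp: \<kappa>1_def\<close>)
          then show "(\<lambda>M. cmod (\<kappa> x - \<kappa>1 M x)) \<longlonglongrightarrow> 0" by (rule tendsto_eventually)
        qed
      qed (use i\<kappa> in \<open>auto simp: \<kappa>1_def\<close>)
      then have "\<forall>\<^sub>F M in sequentially. (LINT x|lebesgue. cmod (\<kappa> x - \<kappa>1 M x)) < e / 4"
        using e by (auto dest!: order_tendstoD(2)[of _ 0 _ "e/4"])
      then obtain M where M: "(LINT x|lebesgue. cmod (\<kappa> x - \<kappa>1 M x)) < e / 4"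
        by (auto simp: eventually_sequentially)
      have L1: "L2_fun (\<kappa>1 M)"
      proof -
        have "integrable lebesgue (\<lambda>x. (cmod (\<kappa>1 M x))\<^sup>2)"
        proof (rule Bochner_Integration.integrable_bound)
          show "integrable lebesgue (\<lambda>x. real M * cmod (\<kappa> x))" using i\<kappa> by simp
          show "AE x in lebesgue. norm ((cmod (\<kappa>1 M x))\<^sup>2) \<le> norm (real M * cmod (\<kappa> x))"
            by (intro AE_I2) (auto simp: \<kappa>1_def power2_eq_square intro!: mult_right_mono)
        qed measurable
        then show ?thesis by (simp add: L2_fun_def)
      qed
      define e' where "e' = e / (2 * (L2_norm (\<kappa>1 M) + 1))"
      have n1: "L2_norm (\<kappa>1 M) + 1 > 0" by (simp add: add_nonneg_pos)
      have e': "e' > 0" using e n1 by (simp add: e'_def)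
      obtain \<rho> where \<rho>: "\<rho> > 0" "\<And>r k. r \<le> \<rho> \<Longrightarrow> mollifier r k \<Longrightarrow>
          L2_norm (\<lambda>x. mollify (\<lambda>x. complex_of_real (k x)) s x - s x) < e'"
        using mollify_L2_close[OF Ls i_s e'] by blast
      obtain q :: "'a \<Rightarrow> real" where q: "mollifier (min \<rho> 1) q" using mollifier_ex[of "min \<rho> 1"] \<rho>(1) by auto
      let ?J = "mollify (\<lambda>x. complex_of_real (q x)) s"
      note qq = mollifierD[OF q]
      have tJ: "test_function ?J" by (rule test_function_mollify[OF i_s s0 qq(1)])
      have J0: "?J x = 0" if "norm x > real N + 1" for x
        using mollify_zero_outside[of "real N" s 1 "\<lambda>x. complex_of_real (q x)" x] s0 qq(4) that by auto
      have J1: "cmod (?J x) \<le> 1" for x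
      proof -
        have "cmod (?J x) \<le> (LINT y|lebesgue. q (x - y))"
          unfolding mollify_def
        proof (rule Bochner_Integration.integral_norm_bound_integral)
          show "integrable lebesgue (\<lambda>y. s y * complex_of_real (q (x - y)))"
            by (rule integrable_mult_test[OF i_s test_function_reflect[OF qq(1)]])
          show "cmod (s y * complex_of_real (q (x - y))) \<le> q (x - y)" for y
            using s1[of y] qq(2)[of "x - y"] by (simp add: norm_mult mult_left_le_one_le)
        qed (rule mollifier_total(2)[OF q])
        then show ?thesis by (simp add: mollifier_total(1)[OF q])
      qed
      have "(LINT x|lebesgue. \<kappa> x * ?J x) = (LINT x|lebesgue. k x * ?J x)"
        by (rule Bochner_Integration.integral_cong) (use J0 in \<open>auto simp: \<kappa>_def K_def indicator_def not_le\<close>)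
      then have zJ: "(LINT x|lebesgue. \<kappa> x * ?J x) = 0" using z[OF tJ] by simp
      have iJ: "integrable lebesgue (\<lambda>x. \<kappa> x * ?J x)" by (rule integrable_mult_test[OF i\<kappa> tJ])
      have is\<kappa>: "integrable lebesgue (\<lambda>x. \<kappa> x * s x)" unfolding \<kappa>s using i\<kappa>s by (rule integrable_of_real)
      have LJ: "L2_fun ?J" by (rule test_function_L2[OF tJ])
      have mJ[measurable]: "?J \<in> borel_measurable lebesgue" by (rule L2_fun_measurable[OF LJ])
      have i3: "integrable lebesgue (\<lambda>x. cmod (\<kappa>1 M x) * cmod (?J x - s x))"
        by (rule integrable_L2_mult_norm[OF L1 L2_fun_diff[OF LJ Ls]])
      have i4: "integrable lebesgue (\<lambda>x. cmod (\<kappa> x - \<kappa>1 M x))"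
        by (rule Bochner_Integration.integrable_bound[OF i\<kappa>]) (measurable, auto simp: \<kappa>1_def)
      have "(LINT x|lebesgue. \<kappa> x * s x) = - (LINT x|lebesgue. \<kappa> x * (?J x - s x))"
        using zJ iJ is\<kappa> by (simp add: right_diff_distrib)
      then have "cmod (LINT x|lebesgue. \<kappa> x * s x) = cmod (LINT x|lebesgue. \<kappa> x * (?J x - s x))" by simp
      also have "\<dots> \<le> (LINT x|lebesgue. cmod (\<kappa>1 M x) * cmod (?J x - s x) + 2 * cmod (\<kappa> x - \<kappa>1 M x))"
      proof (rule Bochner_Integration.integral_norm_bound_integral)
        show "integrable lebesgue (\<lambda>x. \<kappa> x * (?J x - s x))" using iJ is\<kappa> by (simp add: right_diff_distrib)
        show "integrable lebesgue (\<lambda>x. cmod (\<kappa>1 M x) * cmod (?J x - s x) + 2 * cmod (\<kappa> x - \<kappa>1 M x))"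
          using i3 i4 by simp
        fix x
        have "cmod (?J x - s x) \<le> 2" using norm_triangle_ineq4[of "?J x" "s x"] J1[of x] s1[of x] by linarith
        then have "cmod (\<kappa> x - \<kappa>1 M x) * cmod (?J x - s x) \<le> cmod (\<kappa> x - \<kappa>1 M x) * 2" by (intro mult_left_mono) auto
        moreover have "cmod (\<kappa> x * (?J x - s x)) \<le> cmod (\<kappa>1 M x) * cmod (?J x - s x) + cmod (\<kappa> x - \<kappa>1 M x) * cmod (?J x - s x)"
          using norm_triangle_ineq[of "\<kappa>1 M x * (?J x - s x)" "(\<kappa> x - \<kappa>1 M x) * (?J x - s x)"]
          by (simp add: norm_mult[symmetric] distrib_right[symmetric])
        ultimately show "cmod (\<kappa> x * (?J x - s x)) \<le> cmod (\<kappa>1 M x) * cmod (?J x - s x) + 2 * cmod (\<kappa> x - \<kappa>1 M x)"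
          by linarith
      qed
      also have "\<dots> = (LINT x|lebesgue. cmod (\<kappa>1 M x) * cmod (?J x - s x)) + 2 * (LINT x|lebesgue. cmod (\<kappa> x - \<kappa>1 M x))"
        using i3 i4 by simp
      also have "\<dots> < e"
      proof -
        have "(LINT x|lebesgue. cmod (\<kappa>1 M x) * cmod (?J x - s x)) \<le> L2_norm (\<kappa>1 M) * L2_norm (\<lambda>x. ?J x - s x)"
          by (rule L2_Cauchy_Schwarz[OF L1 L2_fun_diff[OF LJ Ls]])
        also have "\<dots> \<le> (L2_norm (\<kappa>1 M) + 1) * e'"
          using \<rho>(2)[OF _ q] by (intro mult_mono) auto
        also have "\<dots> = e / 2"
        proof -
          have "c * (e / (2 * c)) = e / 2" if "c > 0" for c :: real using that by simp
          from this[OF n1] show ?thesis by (simp only: e'_def)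
        qed
        finally show ?thesis using M by linarith
      qed
      finally show ?thesis .
    qed
    have "(LINT x|lebesgue. \<kappa> x * s x) = 0"
      using small[of "cmod (LINT x|lebesgue. \<kappa> x * s x)"] by fastforce
    then have "(LINT x|lebesgue. indicat_real (cball 0 (real N)) x * cmod (\<kappa> x)) = 0"
      unfolding \<kappa>s integral_complex_of_real by (simp only: of_real_eq_0_iff)
    then have "AE x in lebesgue. indicat_real (cball 0 (real N)) x * cmod (\<kappa> x) = 0"
      by (subst (asm) integral_nonneg_eq_0_iff_AE[OF i\<kappa>s]) auto
    then show ?thesis
      by eventually_elim (auto simp: indicator_def \<kappa>_def K_def split: if_splits)
  qed
  then have "AE x in lebesgue. \<forall>N. norm x \<le> real N \<longrightarrow> k x = 0" unfolding AE_all_countable by blast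
  then show ?thesis
  proof eventually_elim
    case (elim x)
    obtain N :: nat where "norm x \<le> N" using real_arch_simple by blast
    then show ?case using elim by blast
  qed
qed

lemma weak_partial_unique:
  fixes u g g' :: "'a \<Rightarrow> complex"
  assumes "has_weak_partial b u g" "has_weak_partial b u g'"
  shows "AE x in lebesgue. g x = g' x"
proof -
  have li: "locally_integrable g" "locally_integrable g'" using assms by (auto simp: has_weak_partial_def)
  have "AE x in lebesgue. g x - g' x = 0"
  proof (rule fundamental_lemma_calculus_of_variations)
    show "locally_integrable (\<lambda>x. g x - g' x)"
      using li unfolding locally_integrable_def by (auto intro: set_integral_diff)
    fix \<eta> :: "'a \<Rightarrow> complex" assume \<eta>: "test_function \<eta>"
    obtain R where R: "\<And>x. norm x > R \<Longrightarrow> \<eta> x = 0" using test_functionE[OF \<eta>] by blast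
    have i: "integrable lebesgue (\<lambda>x. w x * \<eta> x)" if "locally_integrable w" for w
    proof -
      have "integrable lebesgue (\<lambda>x. indicat_real (cball 0 R) x *\<^sub>R w x)"
        using that by (auto simp: locally_integrable_def set_integrable_def)
      from integrable_mult_test[OF this \<eta>]
      show ?thesis
        by (rule back_subst[where P = "integrable lebesgue"]) (use R in \<open>auto simp: fun_eq_iff indicator_def not_le\<close>)
    qed
    show "(LINT x|lebesgue. (g x - g' x) * \<eta> x) = 0"
      using assms \<eta> i[OF li(1)] i[OF li(2)] by (simp add: has_weak_partial_def left_diff_distrib)
  qed
  then show ?thesis by simp
qed

text \<open>The chosen representative of the weak derivative agrees with every other one almost everywhere, so
  the norm may be computed with any of them.\<close>

lemma L2_norm_weak_partial:
  fixes u g :: "'a \<Rightarrow> complex"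
  assumes "has_weak_partial b u g" "L2_fun g"
  shows "L2_norm (weak_partial b u) = L2_norm g"
proof -
  have "has_weak_partial b u (weak_partial b u)"
    unfolding weak_partial_def using someI_ex[of "has_weak_partial b u"] assms(1) by blast
  from weak_partial_unique[OF assms(1) this]
  have ae: "AE x in lebesgue. g x = weak_partial b u x" .
  have "weak_partial b u \<in> borel_measurable lebesgue"
    by (rule borel_measurable_AE[OF L2_fun_measurable[OF assms(2)] ae])
  then show ?thesis
    using L2_norm_cong_AE[OF ae L2_fun_measurable[OF assms(2)]] by simp
qed

subsection \<open>Density of test functions\<close>

definition cutoff :: "nat \<Rightarrow> 'a \<Rightarrow> complex" where
  "cutoff n x = \<psi> ((1 / real (Suc n)) *\<^sub>R x)"

lemma cutoff_smooth: "smooth_fun (cutoff n)"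
  using smooth_fun_affine[OF test_function_smooth[OF test_psi], of 0 "1 / real (Suc n)"]
  unfolding cutoff_def[abs_def] by simp

lemma cutoff_support: "\<exists>R. \<forall>x. norm x > R \<longrightarrow> cutoff n x = 0"
proof -
  obtain R where R: "\<And>x. norm x > R \<Longrightarrow> \<psi> x = 0" using test_functionE[OF test_psi] by blast
  have "cutoff n x = 0" if "norm x > R * real (Suc n)" for x
    unfolding cutoff_def by (rule R) (use that in \<open>simp add: field_simps\<close>)
  then show ?thesis by blast
qed

lemma test_cutoff: "test_function (cutoff n)"
  using cutoff_smooth cutoff_support by (auto simp: test_function_iff)

lemma pderiv_cutoff: "pderiv_dir b (cutoff n) x = of_real (1 / real (Suc n)) * pderiv_dir b \<psi> ((1 / real (Suc n)) *\<^sub>R x)"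
  using pderiv_dir_affine[OF test_function_smooth[OF test_psi], of b 0 "1 / real (Suc n)" x]
  unfolding cutoff_def[abs_def] by simp

lemma pderiv2_cutoff:
  assumes "b \<in> Basis"
  shows "pderiv_dir c (pderiv_dir b (cutoff n)) x
     = of_real ((1 / real (Suc n))\<^sup>2) * pderiv_dir c (pderiv_dir b \<psi>) ((1 / real (Suc n)) *\<^sub>R x)"
proof -
  have t: "smooth_fun (pderiv_dir b \<psi>)" using test_function_smooth test_function_pderiv[OF test_psi assms] by blast
  have eq: "pderiv_dir b (cutoff n) = (\<lambda>x. of_real (1 / real (Suc n)) * pderiv_dir b \<psi> (0 + (1 / real (Suc n)) *\<^sub>R x))"
    by (rule ext) (simp only: pderiv_cutoff add_0)
  have z: "pderiv_dir c (\<lambda>x. of_real (1 / real (Suc n)) :: complex) x = 0"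
    by (rule pderiv_dir_eqI[where f' = "\<lambda>h. 0"]) auto
  show ?thesis
    unfolding eq pderiv_dir_mult[OF smooth_fun_const smooth_fun_affine[OF t]] pderiv_dir_affine[OF t] z
    by (simp only: add_0 mult_zero_left add_0_right power2_eq_square of_real_mult mult.assoc)
qed

text \<open>The cutoffs are uniformly bounded and equal to one on balls that exhaust the space.\<close>

lemma L2_lim_cutoff:
  assumes "L2_fun f"
  shows "L2_lim (\<lambda>n x. cutoff n x * f x) f"
proof -
  obtain B where B: "\<And>x. cmod (\<psi> x) \<le> B" using test_function_bounded[OF test_psi] by (auto simp: bounded_iff)
  have B0: "B \<ge> 0" using B[of 0] norm_ge_zero order_trans by blast
  show ?thesis
  proof (rule L2_lim_dominated[where g = "\<lambda>x. of_real B * f x"])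
    show "(\<lambda>x. cutoff n x * f x) \<in> borel_measurable lebesgue" for n
      by (rule L2_fun_measurable[OF L2_fun_test_mult[OF assms test_cutoff]])
    show "f \<in> borel_measurable lebesgue" by (rule L2_fun_measurable[OF assms])
    show "L2_fun (\<lambda>x. of_real B * f x)" by (rule L2_fun_cmult[OF assms])
    show "AE x in lebesgue. cmod (cutoff n x * f x) \<le> cmod (of_real B * f x)" for n
      using B B0 by (intro AE_I2) (simp add: cutoff_def norm_mult mult_right_mono)
    show "AE x in lebesgue. (\<lambda>n. cutoff n x * f x) \<longlonglongrightarrow> f x"
    proof (rule AE_I2)
      fix x :: 'a
      obtain N :: nat where N: "norm x \<le> N" using real_arch_simple by blast
      have "cutoff n x * f x = f x" if "n \<ge> N" for n
      proof -
        have "norm ((1 / real (Suc n)) *\<^sub>R x) \<le> 1" using N that by (simp add: field_simps)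
        then show ?thesis by (simp add: cutoff_def psi_one)
      qed
      then have "\<forall>\<^sub>F n in sequentially. cutoff n x * f x = f x"
        unfolding eventually_sequentially by blast
      then show "(\<lambda>n. cutoff n x * f x) \<longlonglongrightarrow> f x" by (rule tendsto_eventually)
    qed
  qed
qed

lemma L2_lim_zeroI:
  fixes f :: "'a \<Rightarrow> complex"
  assumes "L2_fun f" "\<And>n. w n \<in> borel_measurable lebesgue" "\<And>n x. cmod (w n x) \<le> B * (1 / real (Suc n))"
  shows "L2_lim (\<lambda>n x. w n x * f x) (\<lambda>x. 0)"
proof -
  have B: "B \<ge> 0" using order_trans[OF norm_ge_zero assms(3)[of 0 undefined]] by simp
  have L: "L2_fun (\<lambda>x. w n x * f x)" for n by (rule L2_fun_bounded_mult[OF assms])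
  have le: "L2_norm (\<lambda>x. w n x * f x) \<le> B * (1 / real (Suc n)) * L2_norm f" for n
    using B unfolding norm_mult
    by (intro L2_norm_mono[OF assms(1) L2_fun_measurable[OF L]] AE_I2)
       (auto simp only: norm_mult intro!: mult_right_mono assms(3), simp_all)
  have "(\<lambda>n. B * (1 / real (Suc n)) * L2_norm f) \<longlonglongrightarrow> B * 0 * L2_norm f"
    by (intro tendsto_mult tendsto_const LIMSEQ_Suc[OF lim_1_over_n])
  then have lim: "(\<lambda>n. B * (1 / real (Suc n)) * L2_norm f) \<longlonglongrightarrow> 0" by simp
  have "(\<lambda>n. L2_norm (\<lambda>x. w n x * f x)) \<longlonglongrightarrow> 0"
    by (rule Lim_null_comparison[OF always_eventually lim]) (use le in simp)
  then show ?thesis using L by (simp add: L2_lim_def)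
qed

lemma L2_lim_pderiv_cutoff:
  assumes "L2_fun f" "b \<in> Basis"
  shows "L2_lim (\<lambda>n x. pderiv_dir b (cutoff n) x * f x) (\<lambda>x. 0)"
proof -
  obtain B where B: "\<And>x. cmod (pderiv_dir b \<psi> x) \<le> B"
    using test_function_bounded[OF test_function_pderiv[OF test_psi assms(2)]] by (auto simp: bounded_iff)
  show ?thesis
  proof (rule L2_lim_zeroI[OF assms(1)])
    show "pderiv_dir b (cutoff n) \<in> borel_measurable lebesgue" for n
      by (rule L2_fun_measurable[OF test_function_L2[OF test_function_pderiv[OF test_cutoff assms(2)]]])
    show "cmod (pderiv_dir b (cutoff n) x) \<le> B * (1 / real (Suc n))" for n x
      unfolding pderiv_cutoff norm_mult norm_of_real using B[of "(1 / real (Suc n)) *\<^sub>R x"]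
      by (simp add: divide_right_mono)
  qed
qed

lemma L2_lim_pderiv2_cutoff:
  assumes "L2_fun f" "b \<in> Basis" "c \<in> Basis"
  shows "L2_lim (\<lambda>n x. pderiv_dir c (pderiv_dir b (cutoff n)) x * f x) (\<lambda>x. 0)"
proof -
  obtain B where B: "\<And>x. cmod (pderiv_dir c (pderiv_dir b \<psi>) x) \<le> B"
    using test_function_bounded[OF test_function_pderiv[OF test_function_pderiv[OF test_psi assms(2)] assms(3)]]
    by (auto simp: bounded_iff)
  have B0: "B \<ge> 0" using B[of 0] norm_ge_zero order_trans by blast
  show ?thesis
  proof (rule L2_lim_zeroI[OF assms(1)])
    show "pderiv_dir c (pderiv_dir b (cutoff n)) \<in> borel_measurable lebesgue" for n
      by (rule L2_fun_measurable[OF test_function_L2[OF test_function_pderiv[OF test_function_pderiv[OF test_cutoff assms(2)] assms(3)]]])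
    show "cmod (pderiv_dir c (pderiv_dir b (cutoff n)) x) \<le> B * (1 / real (Suc n))" for n x
    proof -
      have "(1 / real (Suc n))\<^sup>2 \<le> 1 / real (Suc n)"
        unfolding power2_eq_square by (rule mult_left_le) auto
      then have "(1 / real (Suc n))\<^sup>2 * cmod (pderiv_dir c (pderiv_dir b \<psi>) ((1 / real (Suc n)) *\<^sub>R x)) \<le> (1 / real (Suc n)) * B"
        using B by (intro mult_mono) auto
      then show ?thesis unfolding pderiv2_cutoff[OF assms(2)] norm_mult norm_of_real by (simp add: mult_ac)
    qed
  qed
qed

lemma L2_lim_perturb:
  fixes f :: "'a \<Rightarrow> complex"
  assumes "L2_lim F f" "\<And>n. L2_fun (G n)" "\<And>n. L2_norm (\<lambda>x. G n x - F n x) \<le> 1 / real (Suc n)"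
  shows "L2_lim G f"
proof -
  note F = L2_limD[OF assms(1)]
  have A: "norm (L2_norm (\<lambda>x. G n x - f x)) \<le> 1 / real (Suc n) + L2_norm (\<lambda>x. F n x - f x)" for n
    using L2_norm_triangle[OF L2_fun_diff[OF assms(2)[of n] F(2)] L2_fun_diff[OF F(2) F(1)], of n n] assms(3)[of n]
    by simp
  have "(\<lambda>n. 1 / real (Suc n) + L2_norm (\<lambda>x. F n x - f x)) \<longlonglongrightarrow> 0 + 0"
    by (rule tendsto_add[OF LIMSEQ_Suc[OF lim_1_over_n]]) (use assms(1) in \<open>simp add: L2_lim_def\<close>)
  then have B: "(\<lambda>n. 1 / real (Suc n) + L2_norm (\<lambda>x. F n x - f x)) \<longlonglongrightarrow> 0" by simp
  have "(\<lambda>n. L2_norm (\<lambda>x. G n x - f x)) \<longlonglongrightarrow> 0"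
    by (rule Lim_null_comparison[OF always_eventually[OF allI[OF A]] B])
  then show ?thesis using assms(2) F by (simp add: L2_lim_def)
qed

end

text \<open>A kernel supported in the ball of radius \<open>1/4\<close> does not see the exterior of the unit ball from a point
  of the ball of radius \<open>1/2\<close>.\<close>

lemma mollify_vanish_inside:
  assumes "\<And>x. norm x < 1 \<Longrightarrow> f x = 0" "\<And>x. norm x > r \<Longrightarrow> \<eta> x = 0" "r \<le> 1/4" "norm x < 1/2"
  shows "mollify \<eta> f x = 0"
proof -
  have "f y * \<eta> (x - y) = 0" for y
    using assms norm_triangle_ineq4[of x "x - y"] by (cases "norm y < 1") auto
  then have "(\<lambda>y. f y * \<eta> (x - y)) = (\<lambda>y. 0)" by (intro ext)
  then show ?thesis by (simp add: mollify_def)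
qed

context bump
begin

text \<open>Cut off at infinity, then mollify.  The derivatives of the cutoff at scale \<open>n\<close> are of size \<open>1/n\<close>,
  so the terms they produce vanish in the limit.\<close>

lemma weak_grad_approx:
  fixes f :: "'a \<Rightarrow> complex"
  assumes fg: "weak_grad f g"
  obtains u where "\<And>n. test_function (u n)" "L2_lim u f"
    "\<And>b. b \<in> Basis \<Longrightarrow> L2_lim (\<lambda>n. pderiv_dir b (u n)) (g b)"
proof -
  note f = weak_gradD(1)[OF fg] and g = weak_gradD(2)[OF fg] and wk = weak_gradD(3)[OF fg]
  define fn where "fn n x = cutoff n x * f x" for n x
  define gn where "gn b n x = cutoff n x * g b x + pderiv_dir b (cutoff n) x * f x" for b n x
  have Lfn: "L2_fun (fn n)" for n unfolding fn_def[abs_def] by (rule L2_fun_test_mult[OF f test_cutoff])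
  have Lgn: "L2_fun (gn b n)" if "b \<in> Basis" for b n unfolding gn_def[abs_def]
    by (intro L2_fun_add L2_fun_test_mult f g that test_cutoff test_function_pderiv)
  have wkn: "has_weak_partial b (fn n) (gn b n)" if "b \<in> Basis" for b n
    unfolding fn_def[abs_def] gn_def[abs_def]
    by (rule has_weak_partial_test_mult[OF wk[OF that] f g[OF that] test_cutoff that])
  have limf: "L2_lim fn f" unfolding fn_def[abs_def] by (rule L2_lim_cutoff[OF f])
  have limg: "L2_lim (gn b) (g b)" if "b \<in> Basis" for b
    using L2_lim_add[OF L2_lim_cutoff[OF g[OF that]] L2_lim_pderiv_cutoff[OF f that]]
    unfolding gn_def[abs_def] by simp
  define F where "F n i = (case i of None \<Rightarrow> fn n | Some b \<Rightarrow> gn b n)" for n i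
  define I where "I = insert None (Some ` (Basis :: 'a set))"
  have "\<exists>k :: 'a \<Rightarrow> real. test_function (\<lambda>x. complex_of_real (k x)) \<and>
     (\<exists>r. mollifier r k) \<and>
     (\<forall>i\<in>I. L2_norm (\<lambda>x. mollify (\<lambda>x. complex_of_real (k x)) (F n i) x - F n i x) < 1 / real (Suc n))" for n
  proof -
    obtain R where R: "\<And>x. norm x > R \<Longrightarrow> cutoff n x = 0" using cutoff_support by blast
    have LF: "L2_fun (F n i)" if "i \<in> I" for i
      using that Lfn Lgn by (auto simp: F_def I_def)
    have F0: "F n i x = 0" if "i \<in> I" "norm x > R" for i x
      using that R pderiv_dir_zero_outside[OF R] by (auto simp: F_def I_def fn_def gn_def)
    obtain \<rho> where \<rho>: "\<rho> > 0" "\<And>r k. r \<le> \<rho> \<Longrightarrow> mollifier r k \<Longrightarrow>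
       (\<forall>i\<in>I. L2_norm (\<lambda>x. mollify (\<lambda>x. complex_of_real (k x)) (F n i) x - F n i x) < 1 / real (Suc n))"
      using mollify_L2_close_finite[of I "F n" R "1 / real (Suc n)", OF _ LF F0] by (auto simp: I_def)
    obtain k :: "'a \<Rightarrow> real" where "mollifier \<rho> k" using mollifier_ex[OF \<rho>(1)] by blast
    then show ?thesis using \<rho>(2) mollifierD(1) by blast
  qed
  then obtain k where k: "\<And>n. test_function (\<lambda>x. complex_of_real (k n x :: real))"
     "\<And>n. \<exists>r. mollifier r (k n)"
     "\<And>n i. i \<in> I \<Longrightarrow> L2_norm (\<lambda>x. mollify (\<lambda>x. complex_of_real (k n x)) (F n i) x - F n i x) < 1 / real (Suc n)"
    by metis
  define u where "u n = mollify (\<lambda>x. complex_of_real (k n x)) (fn n)" for n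
  have int: "integrable lebesgue (fn n)" for n
    using cutoff_support[of n] L2_compact_support_integrable[OF Lfn[of n]] by (auto simp: fn_def)
  have intg: "integrable lebesgue (gn b n)" if "b \<in> Basis" for b n
  proof -
    obtain R where R: "\<And>x. norm x > R \<Longrightarrow> cutoff n x = 0" using cutoff_support by blast
    show ?thesis
      by (rule L2_compact_support_integrable[OF Lgn[OF that], where R = R])
         (use R pderiv_dir_zero_outside[OF R] in \<open>auto simp: gn_def\<close>)
  qed
  have tu: "test_function (u n)" for n
  proof -
    obtain R where R: "\<And>x. norm x > R \<Longrightarrow> cutoff n x = 0" using cutoff_support by blast
    show ?thesis unfolding u_def
      by (rule test_function_mollify[OF int _ k(1), where R = R]) (simp add: fn_def R)
  qed
  have du: "pderiv_dir b (u n) = mollify (\<lambda>x. complex_of_real (k n x)) (gn b n)" if "b \<in> Basis" for b n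
    unfolding u_def by (rule mollify_weak_partial[OF wkn[OF that] int that k(1)])
  have "L2_lim u f"
  proof (rule L2_lim_perturb[OF limf])
    show "L2_fun (u n)" for n by (rule test_function_L2[OF tu])
    show "L2_norm (\<lambda>x. u n x - fn n x) \<le> 1 / real (Suc n)" for n
      using k(3)[of None n] by (simp add: I_def F_def u_def)
  qed
  moreover have "L2_lim (\<lambda>n. pderiv_dir b (u n)) (g b)" if b: "b \<in> Basis" for b
  proof (rule L2_lim_perturb[OF limg[OF b]])
    show "L2_fun (pderiv_dir b (u n))" for n by (rule test_function_L2[OF test_function_pderiv[OF tu b]])
    show "L2_norm (\<lambda>x. pderiv_dir b (u n) x - gn b n x) \<le> 1 / real (Suc n)" for n
      using k(3)[of "Some b" n] b by (simp add: I_def F_def du)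
  qed
  ultimately show ?thesis using tu that by blast
qed

text \<open>The argument of \<open>weak_grad_approx\<close> with second derivatives.  The last part keeps a neighbourhood of
  the origin free of the support of the approximations, as the Morawetz inequality in dimension two requires.\<close>

lemma weak_grad2_approx:
  fixes f :: "'a \<Rightarrow> complex"
  assumes fg: "weak_grad f g" and gh: "\<And>b. b \<in> Basis \<Longrightarrow> weak_grad (g b) (h b)"
  obtains u where "\<And>n. test_function (u n)" "L2_lim u f"
    "\<And>b. b \<in> Basis \<Longrightarrow> L2_lim (\<lambda>n. pderiv_dir b (u n)) (g b)"
    "\<And>b c. b \<in> Basis \<Longrightarrow> c \<in> Basis \<Longrightarrow> L2_lim (\<lambda>n. pderiv_dir c (pderiv_dir b (u n))) (h b c)"
    "(\<And>x. norm x < 1 \<Longrightarrow> f x = 0) \<Longrightarrow> \<forall>n x. norm x < 1/2 \<longrightarrow> u n x = 0"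
proof -
  note f = weak_gradD(1)[OF fg] and g = weak_gradD(2)[OF fg] and wk = weak_gradD(3)[OF fg]
  note h = weak_gradD(2)[OF gh] and wkh = weak_gradD(3)[OF gh]
  define fn where "fn n x = cutoff n x * f x" for n x
  define gn where "gn b n x = cutoff n x * g b x + pderiv_dir b (cutoff n) x * f x" for b n x
  define hn where "hn b c n x = (cutoff n x * h b c x + pderiv_dir c (cutoff n) x * g b x)
     + (pderiv_dir b (cutoff n) x * g c x + pderiv_dir c (pderiv_dir b (cutoff n)) x * f x)" for b c n x
  note td = test_function_pderiv[OF test_cutoff]
  have Lfn: "L2_fun (fn n)" for n unfolding fn_def[abs_def] by (rule L2_fun_test_mult[OF f test_cutoff])
  have Lgn: "L2_fun (gn b n)" if "b \<in> Basis" for b n unfolding gn_def[abs_def]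
    by (intro L2_fun_add L2_fun_test_mult f g that test_cutoff td)
  have Lhn: "L2_fun (hn b c n)" if "b \<in> Basis" "c \<in> Basis" for b c n unfolding hn_def[abs_def]
    by (intro L2_fun_add L2_fun_test_mult f g h that test_cutoff td test_function_pderiv)
  have wkn: "has_weak_partial b (fn n) (gn b n)" if "b \<in> Basis" for b n
    unfolding fn_def[abs_def] gn_def[abs_def]
    by (rule has_weak_partial_test_mult[OF wk[OF that] f g[OF that] test_cutoff that])
  have wkhn: "has_weak_partial c (gn b n) (hn b c n)" if b: "b \<in> Basis" and c: "c \<in> Basis" for b c n
  proof (rule has_weak_partial_L2I[OF Lgn[OF b] Lhn[OF b c]])
    fix \<eta> :: "'a \<Rightarrow> complex" assume \<eta>: "test_function \<eta>"
    note d\<eta> = test_function_pderiv[OF \<eta> c]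
    have 1: "(LINT x|lebesgue. (cutoff n x * g b x) * pderiv_dir c \<eta> x)
       = - (LINT x|lebesgue. (cutoff n x * h b c x + pderiv_dir c (cutoff n) x * g b x) * \<eta> x)"
      using has_weak_partial_test_mult[OF wkh[OF b c] g[OF b] h[OF b c] test_cutoff c, of n] \<eta>
      by (simp add: has_weak_partial_def)
    have 2: "(LINT x|lebesgue. (pderiv_dir b (cutoff n) x * f x) * pderiv_dir c \<eta> x)
       = - (LINT x|lebesgue. (pderiv_dir b (cutoff n) x * g c x + pderiv_dir c (pderiv_dir b (cutoff n)) x * f x) * \<eta> x)"
      using has_weak_partial_test_mult[OF wk[OF c] f g[OF c] td[OF b] c, of n] \<eta>
      by (simp add: has_weak_partial_def)
    have i1: "integrable lebesgue (\<lambda>x. (cutoff n x * g b x) * pderiv_dir c \<eta> x)"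
      "integrable lebesgue (\<lambda>x. (pderiv_dir b (cutoff n) x * f x) * pderiv_dir c \<eta> x)"
      by (intro integrable_L2_mult L2_fun_test_mult test_function_L2 f g b c test_cutoff td d\<eta>)+
    have i2: "integrable lebesgue (\<lambda>x. (cutoff n x * h b c x + pderiv_dir c (cutoff n) x * g b x) * \<eta> x)"
      by (intro integrable_L2_mult L2_fun_add L2_fun_test_mult test_function_L2 f g h b c test_cutoff td \<eta>)
    have i3: "integrable lebesgue (\<lambda>x. (pderiv_dir b (cutoff n) x * g c x + pderiv_dir c (pderiv_dir b (cutoff n)) x * f x) * \<eta> x)"
      by (intro integrable_L2_mult L2_fun_add L2_fun_test_mult test_function_L2 f g h b c test_cutoff td \<eta> test_function_pderiv)
    have "(LINT x|lebesgue. gn b n x * pderiv_dir c \<eta> x)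
       = (LINT x|lebesgue. (cutoff n x * g b x) * pderiv_dir c \<eta> x) + (LINT x|lebesgue. (pderiv_dir b (cutoff n) x * f x) * pderiv_dir c \<eta> x)"
      unfolding gn_def distrib_right[of _ _ "pderiv_dir c \<eta> _"] by (rule Bochner_Integration.integral_add[OF i1])
    also have "\<dots> = - ((LINT x|lebesgue. (cutoff n x * h b c x + pderiv_dir c (cutoff n) x * g b x) * \<eta> x)
       + (LINT x|lebesgue. (pderiv_dir b (cutoff n) x * g c x + pderiv_dir c (pderiv_dir b (cutoff n)) x * f x) * \<eta> x))"
      unfolding 1 2 by simp
    also have "\<dots> = - (LINT x|lebesgue. hn b c n x * \<eta> x)"
      unfolding hn_def
      by (subst Bochner_Integration.integral_add[OF i2 i3, symmetric]) (simp only: distrib_right[of _ _ "\<eta> _"])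
    finally show "(LINT x|lebesgue. gn b n x * pderiv_dir c \<eta> x) = - (LINT x|lebesgue. hn b c n x * \<eta> x)" .
  qed
  have limf: "L2_lim fn f" unfolding fn_def[abs_def] by (rule L2_lim_cutoff[OF f])
  have limg: "L2_lim (gn b) (g b)" if "b \<in> Basis" for b
    using L2_lim_add[OF L2_lim_cutoff[OF g[OF that]] L2_lim_pderiv_cutoff[OF f that]]
    unfolding gn_def[abs_def] by simp
  have limh: "L2_lim (hn b c) (h b c)" if b: "b \<in> Basis" and c: "c \<in> Basis" for b c
    using L2_lim_add[OF L2_lim_add[OF L2_lim_cutoff[OF h[OF b c]] L2_lim_pderiv_cutoff[OF g[OF b] c]]
       L2_lim_add[OF L2_lim_pderiv_cutoff[OF g[OF c] b] L2_lim_pderiv2_cutoff[OF f b c]]]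
    unfolding hn_def[abs_def] by simp
  define F where "F n i = (case i of (None, _) \<Rightarrow> fn n | (Some b, None) \<Rightarrow> gn b n | (Some b, Some c) \<Rightarrow> hn b c n)" for n i
  define I0 where "I0 = insert None (Some ` (Basis :: 'a set))"
  define I where "I = I0 \<times> I0"
  have supp: "\<exists>R. \<forall>i\<in>I. \<forall>x. norm x > R \<longrightarrow> F n i x = 0" for n
  proof -
    obtain R where R: "\<And>x. norm x > R \<Longrightarrow> cutoff n x = 0" using cutoff_support by blast
    note R1 = pderiv_dir_zero_outside[OF R]
    note R2 = pderiv_dir_zero_outside[OF R1]
    show ?thesis
      by (rule exI[of _ R]) (auto simp: F_def I_def I0_def fn_def gn_def hn_def R R1 R2 split: option.splits)
  qed
  have LF: "L2_fun (F n i)" if "i \<in> I" for i n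
    using that Lfn Lgn Lhn by (auto simp: F_def I_def I0_def)
  have int: "integrable lebesgue (F n i)" if "i \<in> I" for i n
    using supp[of n] L2_compact_support_integrable[OF LF[OF that, of n]] that by blast
  have "\<exists>k :: 'a \<Rightarrow> real. mollifier (1/4) k \<and>
     (\<forall>i\<in>I. L2_norm (\<lambda>x. mollify (\<lambda>x. complex_of_real (k x)) (F n i) x - F n i x) < 1 / real (Suc n))" for n
  proof -
    obtain R where R: "\<And>i x. i \<in> I \<Longrightarrow> norm x > R \<Longrightarrow> F n i x = 0" using supp by blast
    obtain \<rho> where \<rho>: "\<rho> > 0" "\<And>r k. r \<le> \<rho> \<Longrightarrow> mollifier r k \<Longrightarrow>
       (\<forall>i\<in>I. L2_norm (\<lambda>x. mollify (\<lambda>x. complex_of_real (k x)) (F n i) x - F n i x) < 1 / real (Suc n))"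
      using mollify_L2_close_finite[of I "F n" R "1 / real (Suc n)", OF _ LF R] by (auto simp: I_def I0_def)
    obtain k :: "'a \<Rightarrow> real" where k: "mollifier (min \<rho> (1/4)) k" using mollifier_ex[of "min \<rho> (1/4)"] \<rho>(1) by auto
    then have "mollifier (1/4) k" by (auto simp: mollifier_def)
    with k show ?thesis using \<rho>(2)[OF _ k] by auto
  qed
  then obtain k where k: "\<And>n. mollifier (1/4) (k n :: 'a \<Rightarrow> real)"
     "\<And>n i. i \<in> I \<Longrightarrow> L2_norm (\<lambda>x. mollify (\<lambda>x. complex_of_real (k n x)) (F n i) x - F n i x) < 1 / real (Suc n)"
    by metis
  note tk = mollifierD(1)[OF k(1)]
  define u where "u n = mollify (\<lambda>x. complex_of_real (k n x)) (fn n)" for n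
  have iI: "(None, None) \<in> I" "b \<in> Basis \<Longrightarrow> (Some b, None) \<in> I"
    "b \<in> Basis \<Longrightarrow> c \<in> Basis \<Longrightarrow> (Some b, Some c) \<in> I" for b c
    by (auto simp: I_def I0_def)
  have intf: "integrable lebesgue (fn n)" for n using int[OF iI(1), of n] by (simp add: F_def)
  have intg: "integrable lebesgue (gn b n)" if "b \<in> Basis" for b n using int[OF iI(2)[OF that], of n] by (simp add: F_def)
  have tu: "test_function (u n)" for n
  proof -
    obtain R where R: "\<And>x. norm x > R \<Longrightarrow> cutoff n x = 0" using cutoff_support by blast
    show ?thesis unfolding u_def
      by (rule test_function_mollify[OF intf _ tk, where R = R]) (simp add: fn_def R)
  qed
  have du: "pderiv_dir b (u n) = mollify (\<lambda>x. complex_of_real (k n x)) (gn b n)" if "b \<in> Basis" for b n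
    unfolding u_def by (rule mollify_weak_partial[OF wkn[OF that] intf that tk])
  have ddu: "pderiv_dir c (pderiv_dir b (u n)) = mollify (\<lambda>x. complex_of_real (k n x)) (hn b c n)"
    if "b \<in> Basis" "c \<in> Basis" for b c n
    unfolding du[OF that(1)] by (rule mollify_weak_partial[OF wkhn[OF that] intg[OF that(1)] that(2) tk])
  have "L2_lim u f"
  proof (rule L2_lim_perturb[OF limf])
    show "L2_fun (u n)" for n by (rule test_function_L2[OF tu])
    show "L2_norm (\<lambda>x. u n x - fn n x) \<le> 1 / real (Suc n)" for n
      using k(2)[OF iI(1), of n] by (simp add: F_def u_def)
  qed
  moreover have "L2_lim (\<lambda>n. pderiv_dir b (u n)) (g b)" if b: "b \<in> Basis" for b
  proof (rule L2_lim_perturb[OF limg[OF b]])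
    show "L2_fun (pderiv_dir b (u n))" for n by (rule test_function_L2[OF test_function_pderiv[OF tu b]])
    show "L2_norm (\<lambda>x. pderiv_dir b (u n) x - gn b n x) \<le> 1 / real (Suc n)" for n
      using k(2)[OF iI(2)[OF b], of n] by (simp add: F_def du[OF b])
  qed
  moreover have "L2_lim (\<lambda>n. pderiv_dir c (pderiv_dir b (u n))) (h b c)" if b: "b \<in> Basis" and c: "c \<in> Basis" for b c
  proof (rule L2_lim_perturb[OF limh[OF b c]])
    show "L2_fun (pderiv_dir c (pderiv_dir b (u n)))" for n
      by (rule test_function_L2[OF test_function_pderiv[OF test_function_pderiv[OF tu b] c]])
    show "L2_norm (\<lambda>x. pderiv_dir c (pderiv_dir b (u n)) x - hn b c n x) \<le> 1 / real (Suc n)" for n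
      using k(2)[OF iI(3)[OF b c], of n] by (simp add: F_def ddu[OF b c])
  qed
  moreover have "\<forall>n x. norm x < 1/2 \<longrightarrow> u n x = 0" if "\<And>x. norm x < 1 \<Longrightarrow> f x = 0"
  proof (intro allI impI)
    fix n and x :: 'a assume "norm x < 1/2"
    then show "u n x = 0" unfolding u_def
      by (intro mollify_vanish_inside[where r = "1/4"])
         (use that mollifierD(4)[OF k(1)[of n]] in \<open>auto simp: fn_def\<close>)
  qed
  ultimately show ?thesis using tu that by blast
qed

end

section \<open>Multiplication by bounded Lipschitz functions\<close>

text \<open>The derivative is an almost everywhere limit of difference quotients, which are measurable and
  bounded by the Lipschitz constant.\<close>

lemma lip_bdd_derivative:
  fixes G :: "'a::euclidean_space \<Rightarrow> 'b::euclidean_space"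
  assumes "lip_bdd G" and deriv: "AE x in lebesgue. (G has_derivative G' x) (at x)"
  shows "(\<lambda>x. G' x b) \<in> borel_measurable lebesgue"
    and "\<exists>C. AE x in lebesgue. norm (G' x b) \<le> C"
proof -
  have G: "continuous_on UNIV G" by (rule lip_bdd_continuous[OF assms(1)])
  obtain L where L: "L \<ge> 0" "\<And>x y. norm (G x - G y) \<le> L * norm (x - y)"
    using lip_bddE[OF assms(1)] by metis
  define D where "D n x = real (Suc n) *\<^sub>R (G (x + (1 / real (Suc n)) *\<^sub>R b) - G x)" for n x
  have Gt: "continuous_on UNIV (\<lambda>x. G (x + c))" for c
    by (rule continuous_on_compose2[OF G]) (auto intro!: continuous_intros)
  have m: "D n \<in> borel_measurable lebesgue" for n
    unfolding D_def by (intro continuous_lebesgue_measurable continuous_intros G Gt)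
  have lim: "AE x in lebesgue. (\<lambda>n. D n x) \<longlonglongrightarrow> G' x b"
    using deriv unfolding D_def by eventually_elim (rule has_derivative_difference_quotient)
  show "(\<lambda>x. G' x b) \<in> borel_measurable lebesgue"
    by (rule borel_measurable_AE_limit[OF m lim])
  have bd: "norm (D n x) \<le> L * norm b" for n x
  proof -
    have "norm (D n x) \<le> real (Suc n) * (L * norm ((1 / real (Suc n)) *\<^sub>R b))"
      unfolding D_def norm_scaleR using L(2)[of "x + (1 / real (Suc n)) *\<^sub>R b" x] by (intro mult_mono) auto
    then show ?thesis by simp
  qed
  have "AE x in lebesgue. norm (G' x b) \<le> L * norm b"
    using lim by eventually_elim (rule LIMSEQ_le_const2[OF tendsto_norm], use bd in auto)
  then show "\<exists>C. AE x in lebesgue. norm (G' x b) \<le> C" by blast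
qed

lemma L2_fun_AE_bounded_mult:
  assumes "L2_fun f" "w \<in> borel_measurable lebesgue" "AE x in lebesgue. cmod (w x) \<le> C"
  shows "L2_fun (\<lambda>x. w x * f x)"
proof (rule L2_fun_bound[OF assms(1)])
  show "(\<lambda>x. w x * f x) \<in> borel_measurable lebesgue"
    using assms(2) L2_fun_measurable[OF assms(1)] by measurable
  show "AE x in lebesgue. cmod (w x * f x) \<le> C * cmod (f x)"
    using assms(3) by eventually_elim (simp add: norm_mult mult_right_mono)
qed

lemma L2_fun_lip_mult:
  assumes "L2_fun f" "lip_bdd w"
  shows "L2_fun (\<lambda>x. w x * f x)"
  using lip_bddE[OF assms(2)] L2_fun_bounded_mult[OF assms(1) continuous_lebesgue_measurable[OF lip_bdd_continuous[OF assms(2)]]]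
  by metis

lemma L2_fun_lip_deriv_mult:
  assumes "L2_fun f" "lip_bdd w" "AE x in lebesgue. (w has_derivative w' x) (at x)"
  shows "L2_fun (\<lambda>x. w' x b * f x)"
  using lip_bdd_derivative[OF assms(2,3)] L2_fun_AE_bounded_mult[OF assms(1)] by blast

context bump
begin

text \<open>For a test function \<open>u n\<close> in place of \<open>f\<close> this is integration by parts for the compactly
  supported Lipschitz function \<open>w u \<eta>\<close>; the general case follows by density.\<close>

lemma weak_grad_lip_mult:
  fixes f w :: "'a \<Rightarrow> complex"
  assumes fg: "weak_grad f g" and w: "lip_bdd w" "AE x in lebesgue. (w has_derivative w' x) (at x)"
  shows "weak_grad (\<lambda>x. w x * f x) (\<lambda>b x. w x * g b x + w' x b * f x)"
proof -
  note f = weak_gradD(1)[OF fg] and g = weak_gradD(2)[OF fg]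
  have L1: "L2_fun (\<lambda>x. w x * f x)" by (rule L2_fun_lip_mult[OF f w(1)])
  have L2: "L2_fun (\<lambda>x. w x * g b x + w' x b * f x)" if "b \<in> Basis" for b
    by (rule L2_fun_add[OF L2_fun_lip_mult[OF g[OF that] w(1)] L2_fun_lip_deriv_mult[OF f w]])
  obtain u where u: "\<And>n. test_function (u n)" "L2_lim u f"
    "\<And>b. b \<in> Basis \<Longrightarrow> L2_lim (\<lambda>n. pderiv_dir b (u n)) (g b)"
    using weak_grad_approx[OF fg] by metis
  have "has_weak_partial b (\<lambda>x. w x * f x) (\<lambda>x. w x * g b x + w' x b * f x)" if b: "b \<in> Basis" for b
  proof (rule has_weak_partial_L2I[OF L1 L2[OF b]])
    fix \<eta> :: "'a \<Rightarrow> complex" assume \<eta>: "test_function \<eta>"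
    note d\<eta> = test_function_pderiv[OF \<eta> b]
    have Lw: "L2_fun (\<lambda>x. w x * pderiv_dir b \<eta> x)" "L2_fun (\<lambda>x. w x * \<eta> x)" "L2_fun (\<lambda>x. w' x b * \<eta> x)"
      using L2_fun_lip_mult[OF test_function_L2[OF d\<eta>] w(1)] L2_fun_lip_mult[OF test_function_L2[OF \<eta>] w(1)]
        L2_fun_lip_deriv_mult[OF test_function_L2[OF \<eta>] w] by blast+
    have step: "(LINT x|lebesgue. u n x * (w x * pderiv_dir b \<eta> x))
       = - ((LINT x|lebesgue. pderiv_dir b (u n) x * (w x * \<eta> x)) + (LINT x|lebesgue. u n x * (w' x b * \<eta> x)))" for n
    proof -
      note Lu = test_function_L2[OF u(1)[of n]] and Ldu = test_function_L2[OF test_function_pderiv[OF u(1)[of n] b]]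
      have sm: "smooth_fun (u n)" "smooth_fun \<eta>" using u(1) \<eta> test_function_smooth by blast+
      let ?du = "\<lambda>x h. \<Sum>c\<in>Basis. (h \<bullet> c) *\<^sub>R pderiv_dir c (u n) x"
      let ?d\<eta> = "\<lambda>x h. \<Sum>c\<in>Basis. (h \<bullet> c) *\<^sub>R pderiv_dir c \<eta> x"
      have sb: "(\<Sum>c\<in>Basis. (b \<bullet> c) *\<^sub>R q c) = q b" for q :: "'a \<Rightarrow> complex"
      proof -
        have "(\<Sum>c\<in>Basis. (b \<bullet> c) *\<^sub>R q c) = (\<Sum>c\<in>Basis. if c = b then q c else 0)"
          using b by (intro sum.cong) (auto simp: inner_Basis)
        then show ?thesis using b by simp
      qed
      obtain R where R: "\<And>x. norm x > R \<Longrightarrow> \<eta> x = 0" using test_functionE[OF \<eta>] by blast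
      have "AE x in lebesgue. ((\<lambda>x. w x * (u n x * \<eta> x)) has_derivative
          (\<lambda>h. w x * (u n x * ?d\<eta> x h + ?du x h * \<eta> x) + w' x h * (u n x * \<eta> x))) (at x)"
        using w(2) by eventually_elim (intro has_derivative_mult smooth_fun_has_derivative sm)
      from integral_derivative_compact_support(3)[OF _ _ this, of R b]
      have "(LINT x|lebesgue. w x * (u n x * pderiv_dir b \<eta> x + pderiv_dir b (u n) x * \<eta> x) + w' x b * (u n x * \<eta> x)) = 0"
        using R w(1) u(1) \<eta> by (simp add: sb lip_bdd_mult test_function_lip_bdd)
      also have "(\<lambda>x. w x * (u n x * pderiv_dir b \<eta> x + pderiv_dir b (u n) x * \<eta> x) + w' x b * (u n x * \<eta> x))
         = (\<lambda>x. (u n x * (w x * pderiv_dir b \<eta> x) + pderiv_dir b (u n) x * (w x * \<eta> x)) + u n x * (w' x b * \<eta> x))"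
        by (simp add: fun_eq_iff algebra_simps)
      finally have "(LINT x|lebesgue. (u n x * (w x * pderiv_dir b \<eta> x) + pderiv_dir b (u n) x * (w x * \<eta> x)) + u n x * (w' x b * \<eta> x)) = 0" .
      then have "(LINT x|lebesgue. u n x * (w x * pderiv_dir b \<eta> x)) + (LINT x|lebesgue. pderiv_dir b (u n) x * (w x * \<eta> x))
         + (LINT x|lebesgue. u n x * (w' x b * \<eta> x)) = 0"
        using integrable_L2_mult[OF Lu Lw(1)] integrable_L2_mult[OF Ldu Lw(2)] integrable_L2_mult[OF Lu Lw(3)]
        by simp
      then show ?thesis by (simp add: add_eq_0_iff add.assoc)
    qed
    have l1: "(\<lambda>n. LINT x|lebesgue. u n x * (w x * pderiv_dir b \<eta> x)) \<longlonglongrightarrow> (LINT x|lebesgue. f x * (w x * pderiv_dir b \<eta> x))"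
      by (rule L2_lim_integral_mult[OF u(2) L2_lim_const[OF Lw(1)]])
    have l2: "(\<lambda>n. - ((LINT x|lebesgue. pderiv_dir b (u n) x * (w x * \<eta> x)) + (LINT x|lebesgue. u n x * (w' x b * \<eta> x))))
       \<longlonglongrightarrow> - ((LINT x|lebesgue. g b x * (w x * \<eta> x)) + (LINT x|lebesgue. f x * (w' x b * \<eta> x)))"
      by (intro tendsto_minus tendsto_add L2_lim_integral_mult[OF u(3)[OF b] L2_lim_const[OF Lw(2)]]
          L2_lim_integral_mult[OF u(2) L2_lim_const[OF Lw(3)]])
    have "(LINT x|lebesgue. f x * (w x * pderiv_dir b \<eta> x))
      = - ((LINT x|lebesgue. g b x * (w x * \<eta> x)) + (LINT x|lebesgue. f x * (w' x b * \<eta> x)))"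
      by (rule LIMSEQ_unique[OF l1]) (use l2 step in simp)
    also have "(LINT x|lebesgue. g b x * (w x * \<eta> x)) + (LINT x|lebesgue. f x * (w' x b * \<eta> x))
       = (LINT x|lebesgue. g b x * (w x * \<eta> x) + f x * (w' x b * \<eta> x))"
      by (rule Bochner_Integration.integral_add[symmetric, OF integrable_L2_mult[OF g[OF b] Lw(2)] integrable_L2_mult[OF f Lw(3)]])
    finally show "(LINT x|lebesgue. w x * f x * pderiv_dir b \<eta> x)
       = - (LINT x|lebesgue. (w x * g b x + w' x b * f x) * \<eta> x)"
      by (simp add: algebra_simps)
  qed
  then show ?thesis using L1 L2 by (simp add: weak_grad_def)
qed

end

section \<open>The conjugated equation in weak form\<close>

lemma pderiv_dir_cnj:
  assumes "smooth_fun f"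
  shows "pderiv_dir b (\<lambda>x. cnj (f x)) x = cnj (pderiv_dir b f x)"
proof -
  have "((\<lambda>x. cnj (f x)) has_derivative (\<lambda>h. cnj (frechet_derivative f (at x) h))) (at x)"
    by (intro has_derivative_cnj) (use smooth_fun_differentiable[OF assms] in \<open>simp flip: frechet_derivative_works\<close>)
  from pderiv_dir_eqI[OF this] show ?thesis by (simp add: pderiv_dir_def)
qed

lemma test_function_cnj:
  assumes "test_function f"
  shows "test_function (\<lambda>x. cnj (f x))"
proof -
  obtain R where "\<And>x. norm x > R \<Longrightarrow> f x = 0" using test_functionE[OF assms] by blast
  then show ?thesis using test_function_smooth[OF assms]
    by (intro test_functionI[where R = R]) (auto simp: smooth_fun_def Ck_cnj)
qed

lemma weak_grad_cnj:
  assumes "weak_grad f g"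
  shows "weak_grad (\<lambda>x. cnj (f x)) (\<lambda>b x. cnj (g b x))"
proof -
  note fg = weak_gradD[OF assms]
  have "has_weak_partial b (\<lambda>x. cnj (f x)) (\<lambda>x. cnj (g b x))" if b: "b \<in> Basis" for b
  proof (rule has_weak_partial_L2I[OF L2_fun_cnj[OF fg(1)] L2_fun_cnj[OF fg(2)[OF b]]])
    fix \<eta> :: "'a \<Rightarrow> complex" assume \<eta>: "test_function \<eta>"
    have "(LINT x|lebesgue. f x * pderiv_dir b (\<lambda>x. cnj (\<eta> x)) x) = - (LINT x|lebesgue. g b x * cnj (\<eta> x))"
      using fg(3)[OF b] test_function_cnj[OF \<eta>] by (simp add: has_weak_partial_def)
    then have "cnj (LINT x|lebesgue. f x * cnj (pderiv_dir b \<eta> x)) = cnj (- (LINT x|lebesgue. g b x * cnj (\<eta> x)))"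
      by (simp add: pderiv_dir_cnj[OF test_function_smooth[OF \<eta>]])
    then show "(LINT x|lebesgue. cnj (f x) * pderiv_dir b \<eta> x) = - (LINT x|lebesgue. cnj (g b x) * \<eta> x)"
      by (simp only: Bochner_Integration.integral_cnj[symmetric] complex_cnj_mult complex_cnj_cnj complex_cnj_minus)
  qed
  then show ?thesis using fg by (simp add: weak_grad_def L2_fun_cnj)
qed

lemma weak_grad_add:
  assumes "weak_grad f g" "weak_grad f' g'"
  shows "weak_grad (\<lambda>x. f x + f' x) (\<lambda>b x. g b x + g' b x)"
proof -
  note fg = weak_gradD[OF assms(1)] and fg' = weak_gradD[OF assms(2)]
  have "has_weak_partial b (\<lambda>x. f x + f' x) (\<lambda>x. g b x + g' b x)" if b: "b \<in> Basis" for b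
  proof (rule has_weak_partial_L2I[OF L2_fun_add[OF fg(1) fg'(1)] L2_fun_add[OF fg(2)[OF b] fg'(2)[OF b]]])
    fix \<eta> :: "'a \<Rightarrow> complex" assume \<eta>: "test_function \<eta>"
    note L = test_function_L2[OF \<eta>] test_function_L2[OF test_function_pderiv[OF \<eta> b]]
    show "(LINT x|lebesgue. (f x + f' x) * pderiv_dir b \<eta> x) = - (LINT x|lebesgue. (g b x + g' b x) * \<eta> x)"
      using fg(3)[OF b] fg'(3)[OF b] \<eta> integrable_L2_mult[OF fg(1) L(2)] integrable_L2_mult[OF fg'(1) L(2)]
        integrable_L2_mult[OF fg(2)[OF b] L(1)] integrable_L2_mult[OF fg'(2)[OF b] L(1)]
      by (simp add: has_weak_partial_def distrib_right)
  qed
  then show ?thesis using fg fg' by (simp add: weak_grad_def L2_fun_add)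
qed

lemma weak_grad_zero: "weak_grad (\<lambda>x. 0) (\<lambda>b x. 0)"
  by (simp add: weak_grad_def has_weak_partial_L2I)

lemma weak_grad_sum:
  "(\<And>i. i \<in> I \<Longrightarrow> weak_grad (f i) (g i)) \<Longrightarrow> weak_grad (\<lambda>x. \<Sum>i\<in>I. f i x) (\<lambda>b x. \<Sum>i\<in>I. g i b x)"
  by (induction I rule: infinite_finite_induct) (auto intro: weak_grad_add weak_grad_zero)

lemma weak_grad_cong: "weak_grad f g \<Longrightarrow> f = f' \<Longrightarrow> (\<And>b. g b = g' b) \<Longrightarrow> weak_grad f' g'"
  by (simp add: weak_grad_def)

lemma lip_bdd_exp:
  fixes f :: "'a::real_normed_vector \<Rightarrow> real"
  assumes "lip_bdd f"
  shows "lip_bdd (\<lambda>x. exp (f x))"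
proof -
  obtain B L where f: "B \<ge> 0" "L \<ge> 0" "\<And>x. norm (f x) \<le> B" "\<And>x y. norm (f x - f y) \<le> L * norm (x - y)"
    using lip_bddE[OF assms] by metis
  show ?thesis
  proof (rule lip_bddI)
    show "norm (exp (f x)) \<le> exp B" for x using f(3)[of x] by simp
    show "norm (exp (f x) - exp (f y)) \<le> (exp B * L) * norm (x - y)" for x y
    proof -
      have "norm (exp (f x) - exp (f y)) \<le> exp B * norm (f x - f y)"
      proof (rule field_differentiable_bound[where S = "{-B..B}" and f' = exp])
        show "(exp has_field_derivative exp z) (at z within {-B..B})" for z :: real
          by (auto intro!: derivative_eq_intros)
        show "f x \<in> {-B..B}" "f y \<in> {-B..B}" using f(3)[of x] f(3)[of y] by auto
      qed auto
      also have "\<dots> \<le> exp B * (L * norm (x - y))" by (intro mult_left_mono f) auto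
      finally show ?thesis by simp
    qed
  qed
qed

context bump
begin

text \<open>With \<open>w = exp (\<tau> \<phi>)\<close>, the function \<open>f / w\<close> has the weak Laplacian \<open>- p / w\<close>; testing
  this against \<open>w \<theta>\<close> moves the exponentials onto the derivatives.  Only first derivatives of \<open>\<phi>\<close> remain, so
  that the singularity of the phase at the origin does no harm.\<close>

lemma weak_conjugated_equation:
  fixes f :: "'a \<Rightarrow> complex" and \<phi> :: "'a \<Rightarrow> real"
  assumes \<phi>: "lip_bdd \<phi>" "AE x in lebesgue. (\<phi> has_derivative \<phi>' x) (at x)"
    and fg: "weak_grad f g" and eq: "has_conj_laplacian \<tau> \<phi> f p" and p: "L2_fun p"
    and \<theta>: "weak_grad \<theta> \<theta>'"
  shows "(\<Sum>b\<in>Basis. LINT x|lebesgue. (g b x - of_real (\<tau> * \<phi>' x b) * f x) * (\<theta>' b x + of_real (\<tau> * \<phi>' x b) * \<theta> x))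
       = (LINT x|lebesgue. p x * \<theta> x)"
proof -
  define w where "w c x = complex_of_real (exp (c * \<phi> x))" for c :: real and x
  define w' where "w' c x h = complex_of_real (exp (c * \<phi> x) * (c * \<phi>' x h))" for c :: real and x h
  have lw: "lip_bdd (w c)" for c unfolding w_def[abs_def]
    by (intro lip_bdd_of_real lip_bdd_exp lip_bdd_mult lip_bdd_const \<phi>)
  have dw: "AE x in lebesgue. (w c has_derivative w' c x) (at x)" for c
    using \<phi>(2) unfolding w_def[abs_def] w'_def[abs_def]
    by eventually_elim (auto intro!: derivative_eq_intros simp: mult_ac)
  obtain G where G: "has_weak_laplacian (\<lambda>x. w (- \<tau>) x * f x) G" "\<And>x. p x = - w \<tau> x * G x"
    using eq by (auto simp: has_conj_laplacian_def w_def)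
  have inv: "w (- \<tau>) x * w \<tau> x = 1" for x
    by (simp add: w_def flip: of_real_mult exp_add)
  have Gp: "G x = - (w (- \<tau>) x * p x)" for x
  proof -
    have "w (- \<tau>) x * p x = - ((w (- \<tau>) x * w \<tau> x) * G x)" using G(2)[of x] by simp
    then show ?thesis by (simp add: inv)
  qed
  have LG: "L2_fun G" unfolding Gp[abs_def] by (intro L2_fun_minus L2_fun_lip_mult p lw)
  define v where "v b x = w (- \<tau>) x * g b x + w' (- \<tau>) x b * f x" for b x
  have vg: "weak_grad (\<lambda>x. w (- \<tau>) x * f x) v"
    unfolding v_def[abs_def] by (rule weak_grad_lip_mult[OF fg lw dw])
  note vD = weak_gradD[OF vg]
  have test: "(\<Sum>b\<in>Basis. LINT x|lebesgue. v b x * pderiv_dir b \<eta> x) = - (LINT x|lebesgue. G x * \<eta> x)"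
    if \<eta>: "test_function \<eta>" for \<eta>
  proof -
    have "(LINT x|lebesgue. G x * \<eta> x) = (LINT x|lebesgue. w (- \<tau>) x * f x * laplacian \<eta> x)"
      using G(1) \<eta> by (simp add: has_weak_laplacian_def)
    also have "\<dots> = (\<Sum>b\<in>Basis. LINT x|lebesgue. w (- \<tau>) x * f x * pderiv_dir b (pderiv_dir b \<eta>) x)"
      unfolding laplacian_def sum_distrib_left
      by (rule Bochner_Integration.integral_sum)
         (intro integrable_L2_mult vD test_function_L2 test_function_pderiv \<eta>)
    also have "\<dots> = (\<Sum>b\<in>Basis. - (LINT x|lebesgue. v b x * pderiv_dir b \<eta> x))"
      by (rule sum.cong[OF refl]) (use vD(3) test_function_pderiv[OF \<eta>] in \<open>simp add: has_weak_partial_def\<close>)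
    finally show ?thesis by (simp add: sum_negf)
  qed
  have ext: "(\<Sum>b\<in>Basis. LINT x|lebesgue. v b x * z b x) = - (LINT x|lebesgue. G x * \<zeta> x)"
    if \<zeta>: "weak_grad \<zeta> z" for \<zeta> z
  proof -
    obtain u where u: "\<And>n. test_function (u n)" "L2_lim u \<zeta>"
      "\<And>b. b \<in> Basis \<Longrightarrow> L2_lim (\<lambda>n. pderiv_dir b (u n)) (z b)"
      using weak_grad_approx[OF \<zeta>] by metis
    have l1: "(\<lambda>n. \<Sum>b\<in>Basis. LINT x|lebesgue. v b x * pderiv_dir b (u n) x)
       \<longlonglongrightarrow> (\<Sum>b\<in>Basis. LINT x|lebesgue. v b x * z b x)"
      by (intro tendsto_sum L2_lim_integral_mult L2_lim_const vD u(3))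
    have l2: "(\<lambda>n. - (LINT x|lebesgue. G x * u n x)) \<longlonglongrightarrow> - (LINT x|lebesgue. G x * \<zeta> x)"
      by (intro tendsto_minus L2_lim_integral_mult L2_lim_const LG u(2))
    show ?thesis by (rule LIMSEQ_unique[OF l1]) (use l2 test[OF u(1)] in simp)
  qed
  have "weak_grad (\<lambda>x. w \<tau> x * \<theta> x) (\<lambda>b x. w \<tau> x * \<theta>' b x + w' \<tau> x b * \<theta> x)"
    by (rule weak_grad_lip_mult[OF \<theta> lw dw])
  from ext[OF this]
  have "(\<Sum>b\<in>Basis. LINT x|lebesgue. v b x * (w \<tau> x * \<theta>' b x + w' \<tau> x b * \<theta> x)) = - (LINT x|lebesgue. G x * (w \<tau> x * \<theta> x))" .
  moreover have "v b x * (w \<tau> x * \<theta>' b x + w' \<tau> x b * \<theta> x)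
     = (g b x - of_real (\<tau> * \<phi>' x b) * f x) * (\<theta>' b x + of_real (\<tau> * \<phi>' x b) * \<theta> x)" for b x
  proof -
    have "v b x = w (- \<tau>) x * (g b x - of_real (\<tau> * \<phi>' x b) * f x)"
      by (simp add: v_def w_def w'_def algebra_simps)
    moreover have "w \<tau> x * \<theta>' b x + w' \<tau> x b * \<theta> x = w \<tau> x * (\<theta>' b x + of_real (\<tau> * \<phi>' x b) * \<theta> x)"
      by (simp add: w_def w'_def algebra_simps)
    ultimately have "v b x * (w \<tau> x * \<theta>' b x + w' \<tau> x b * \<theta> x)
      = (w (- \<tau>) x * w \<tau> x) * ((g b x - of_real (\<tau> * \<phi>' x b) * f x) * (\<theta>' b x + of_real (\<tau> * \<phi>' x b) * \<theta> x))"
      by (simp only: mult_ac)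
    then show ?thesis by (simp add: inv)
  qed
  moreover have "- (G x * (w \<tau> x * \<theta> x)) = p x * \<theta> x" for x
    using G(2)[of x] by simp
  ultimately show ?thesis by (simp flip: Bochner_Integration.integral_minus)
qed

text \<open>Test the equation against \<open>\<omega>\<^sup>2 cnj f\<close>.  The cross terms between \<open>f\<close> and its gradient complete the square
  of \<open>\<nabla>(\<omega> f)\<close>, and what is left is \<open>- |\<nabla>\<omega> + \<tau> \<omega> \<nabla>\<phi>|\<^sup>2 |f|\<^sup>2\<close>.\<close>

lemma conjugated_energy_estimate:
  fixes f :: "'a \<Rightarrow> complex" and \<phi> \<omega> :: "'a \<Rightarrow> real" and K :: real
  assumes \<phi>: "lip_bdd \<phi>" "AE x in lebesgue. (\<phi> has_derivative \<phi>' x) (at x)"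
    and \<omega>: "lip_bdd \<omega>" "AE x in lebesgue. (\<omega> has_derivative \<omega>' x) (at x)"
    and fg: "weak_grad f g" and eq: "has_conj_laplacian \<tau> \<phi> f p" and p: "L2_fun p"
    and K: "\<And>b. b \<in> Basis \<Longrightarrow> AE x in lebesgue. \<bar>\<omega>' x b + \<tau> * \<phi>' x b * \<omega> x\<bar> \<le> K * \<bar>\<omega> x\<bar>"
  shows "(\<Sum>b\<in>Basis. (L2_norm (\<lambda>x. of_real (\<omega> x) * g b x + of_real (\<omega>' x b) * f x))\<^sup>2)
    \<le> DIM('a) * K\<^sup>2 * (L2_norm (\<lambda>x. of_real (\<omega> x) * f x))\<^sup>2
      + Re (LINT x|lebesgue. p x * of_real ((\<omega> x)\<^sup>2) * cnj (f x))"
proof -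
  note D = weak_gradD[OF fg]
  define \<omega>c where "\<omega>c x = complex_of_real (\<omega> x)" for x
  have l\<omega>: "lip_bdd \<omega>c" unfolding \<omega>c_def[abs_def] by (rule lip_bdd_of_real[OF \<omega>(1)])
  have d\<omega>: "AE x in lebesgue. (\<omega>c has_derivative (\<lambda>h. of_real (\<omega>' x h))) (at x)"
    using \<omega>(2) unfolding \<omega>c_def[abs_def] by eventually_elim (rule has_derivative_of_real)
  have l2: "lip_bdd (\<lambda>x. \<omega>c x * \<omega>c x)" by (rule lip_bdd_mult[OF l\<omega> l\<omega>])
  have d2: "AE x in lebesgue. ((\<lambda>x. \<omega>c x * \<omega>c x) has_derivative
      (\<lambda>h. \<omega>c x * of_real (\<omega>' x h) + of_real (\<omega>' x h) * \<omega>c x)) (at x)"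
    using d\<omega> by eventually_elim (rule has_derivative_mult)
  let ?\<theta> = "\<lambda>x. \<omega>c x * \<omega>c x * cnj (f x)"
  let ?\<theta>' = "\<lambda>b x. \<omega>c x * \<omega>c x * cnj (g b x) + (\<omega>c x * of_real (\<omega>' x b) + of_real (\<omega>' x b) * \<omega>c x) * cnj (f x)"
  have \<theta>: "weak_grad ?\<theta> ?\<theta>'" by (rule weak_grad_lip_mult[OF weak_grad_cnj[OF fg] l2 d2])
  note \<theta>D = weak_gradD[OF \<theta>]
  have lt: "lip_bdd (\<lambda>x. complex_of_real (\<tau> * \<phi> x))"
    by (intro lip_bdd_of_real lip_bdd_mult lip_bdd_const \<phi>)
  have dt: "AE x in lebesgue. ((\<lambda>x. complex_of_real (\<tau> * \<phi> x)) has_derivative (\<lambda>h. of_real (\<tau> * \<phi>' x h))) (at x)"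
    using \<phi>(2) by eventually_elim (intro has_derivative_of_real has_derivative_mult_right)
  note L\<phi> = L2_fun_lip_deriv_mult[OF _ lt dt]
  have I: "integrable lebesgue (\<lambda>x. (g b x - of_real (\<tau> * \<phi>' x b) * f x) * (?\<theta>' b x + of_real (\<tau> * \<phi>' x b) * ?\<theta> x))"
    if "b \<in> Basis" for b
    by (rule integrable_L2_mult[OF L2_fun_diff[OF D(2)[OF that] L\<phi>[OF D(1)]] L2_fun_add[OF \<theta>D(2)[OF that] L\<phi>[OF \<theta>D(1)]]])
  have L\<omega>f: "L2_fun (\<lambda>x. \<omega>c x * f x)" by (rule L2_fun_lip_mult[OF D(1) l\<omega>])
  have L\<omega>g: "L2_fun (\<lambda>x. \<omega>c x * g b x + of_real (\<omega>' x b) * f x)" if "b \<in> Basis" for b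
    by (rule L2_fun_add[OF L2_fun_lip_mult[OF D(2)[OF that] l\<omega>] L2_fun_lip_deriv_mult[OF D(1) l\<omega> d\<omega>]])
  have pt: "Re ((g b x - of_real (\<tau> * \<phi>' x b) * f x) * (?\<theta>' b x + of_real (\<tau> * \<phi>' x b) * ?\<theta> x))
     = (cmod (\<omega>c x * g b x + of_real (\<omega>' x b) * f x))\<^sup>2 - (\<omega>' x b + \<tau> * \<phi>' x b * \<omega> x)\<^sup>2 * (cmod (f x))\<^sup>2" for b x
    unfolding cmod_power2 \<omega>c_def by (simp add: power2_eq_square algebra_simps)
  have one: "(L2_norm (\<lambda>x. \<omega>c x * g b x + of_real (\<omega>' x b) * f x))\<^sup>2 - K\<^sup>2 * (L2_norm (\<lambda>x. \<omega>c x * f x))\<^sup>2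
     \<le> Re (LINT x|lebesgue. (g b x - of_real (\<tau> * \<phi>' x b) * f x) * (?\<theta>' b x + of_real (\<tau> * \<phi>' x b) * ?\<theta> x))"
    if b: "b \<in> Basis" for b
  proof -
    have "(L2_norm (\<lambda>x. \<omega>c x * g b x + of_real (\<omega>' x b) * f x))\<^sup>2 - K\<^sup>2 * (L2_norm (\<lambda>x. \<omega>c x * f x))\<^sup>2
      = (LINT x|lebesgue. (cmod (\<omega>c x * g b x + of_real (\<omega>' x b) * f x))\<^sup>2 - K\<^sup>2 * (cmod (\<omega>c x * f x))\<^sup>2)"
      unfolding L2_norm_sq using L2_fun_integrable[OF L\<omega>g[OF b]] L2_fun_integrable[OF L\<omega>f] by simp
    also have "\<dots> \<le> (LINT x|lebesgue. Re ((g b x - of_real (\<tau> * \<phi>' x b) * f x) * (?\<theta>' b x + of_real (\<tau> * \<phi>' x b) * ?\<theta> x)))"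
    proof (rule integral_mono_AE)
      show "integrable lebesgue (\<lambda>x. (cmod (\<omega>c x * g b x + of_real (\<omega>' x b) * f x))\<^sup>2 - K\<^sup>2 * (cmod (\<omega>c x * f x))\<^sup>2)"
        using L2_fun_integrable[OF L\<omega>g[OF b]] L2_fun_integrable[OF L\<omega>f] by simp
      show "integrable lebesgue (\<lambda>x. Re ((g b x - of_real (\<tau> * \<phi>' x b) * f x) * (?\<theta>' b x + of_real (\<tau> * \<phi>' x b) * ?\<theta> x)))"
        by (rule integrable_Re[OF I[OF b]])
      show "AE x in lebesgue. (cmod (\<omega>c x * g b x + of_real (\<omega>' x b) * f x))\<^sup>2 - K\<^sup>2 * (cmod (\<omega>c x * f x))\<^sup>2
         \<le> Re ((g b x - of_real (\<tau> * \<phi>' x b) * f x) * (?\<theta>' b x + of_real (\<tau> * \<phi>' x b) * ?\<theta> x))"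
        using K[OF b]
      proof eventually_elim
        case (elim x)
        have "(\<omega>' x b + \<tau> * \<phi>' x b * \<omega> x)\<^sup>2 \<le> (K * \<bar>\<omega> x\<bar>)\<^sup>2"
          using power_mono[OF elim abs_ge_zero, of 2] by simp
        then have "(\<omega>' x b + \<tau> * \<phi>' x b * \<omega> x)\<^sup>2 * (cmod (f x))\<^sup>2 \<le> (K * \<bar>\<omega> x\<bar>)\<^sup>2 * (cmod (f x))\<^sup>2"
          by (rule mult_right_mono) simp
        also have "\<dots> = K\<^sup>2 * (cmod (\<omega>c x * f x))\<^sup>2"
          by (simp add: \<omega>c_def norm_mult power_mult_distrib)
        finally show ?case unfolding pt by linarith
      qed
    qed
    also have "\<dots> = Re (LINT x|lebesgue. (g b x - of_real (\<tau> * \<phi>' x b) * f x) * (?\<theta>' b x + of_real (\<tau> * \<phi>' x b) * ?\<theta> x))"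
      by (rule integral_Re[OF I[OF b]])
    finally show ?thesis .
  qed
  have "(\<Sum>b\<in>Basis. (L2_norm (\<lambda>x. \<omega>c x * g b x + of_real (\<omega>' x b) * f x))\<^sup>2 - K\<^sup>2 * (L2_norm (\<lambda>x. \<omega>c x * f x))\<^sup>2)
     \<le> Re (\<Sum>b\<in>Basis. LINT x|lebesgue. (g b x - of_real (\<tau> * \<phi>' x b) * f x) * (?\<theta>' b x + of_real (\<tau> * \<phi>' x b) * ?\<theta> x))"
    unfolding Re_sum by (intro sum_mono one)
  also have "\<dots> = Re (LINT x|lebesgue. p x * ?\<theta> x)"
    by (simp only: weak_conjugated_equation[OF \<phi> fg eq p \<theta>])
  also have "(\<lambda>x. p x * ?\<theta> x) = (\<lambda>x. p x * of_real ((\<omega> x)\<^sup>2) * cnj (f x))"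
    by (simp add: \<omega>c_def power2_eq_square mult_ac fun_eq_iff)
  finally show ?thesis unfolding \<omega>c_def by (simp add: sum_subtractf algebra_simps)
qed

end

section \<open>Symmetry of second derivatives\<close>

lemma test_function_taylor_dir:
  fixes \<eta> :: "'a::euclidean_space \<Rightarrow> complex"
  assumes "test_function \<eta>" "b \<in> Basis"
  obtains C where "C \<ge> 0" "\<And>z h. cmod (\<eta> (z + h *\<^sub>R b) - \<eta> z - h *\<^sub>R pderiv_dir b \<eta> z) \<le> C * h\<^sup>2"
proof -
  obtain C where C: "C \<ge> 0"
    "\<And>z h. cmod (\<eta> (z + h) - \<eta> z - (\<Sum>c\<in>Basis. (h \<bullet> c) *\<^sub>R pderiv_dir c \<eta> z)) \<le> C * (norm h)\<^sup>2"
    using test_function_taylor[OF assms(1)] by blast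
  have "(\<Sum>c\<in>Basis. ((h *\<^sub>R b) \<bullet> c) *\<^sub>R pderiv_dir c \<eta> z) = h *\<^sub>R pderiv_dir b \<eta> z" for h z
  proof -
    have "(\<Sum>c\<in>Basis. ((h *\<^sub>R b) \<bullet> c) *\<^sub>R pderiv_dir c \<eta> z) = (\<Sum>c\<in>Basis. if c = b then h *\<^sub>R pderiv_dir c \<eta> z else 0)"
      using assms(2) by (intro sum.cong) (auto simp: inner_Basis)
    then show ?thesis using assms(2) by simp
  qed
  then have "cmod (\<eta> (z + h *\<^sub>R b) - \<eta> z - h *\<^sub>R pderiv_dir b \<eta> z) \<le> C * h\<^sup>2" for z h
    using C(2)[of z "h *\<^sub>R b"] assms(2) by (simp add: power_mult_distrib)
  with C(1) show ?thesis using that by blast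
qed

text \<open>The mean value inequality in the direction \<open>b\<close>, applied to the difference in the direction \<open>c\<close>, with
  an error that is uniform in the base point.\<close>

lemma second_difference_bound:
  fixes u :: "'a::euclidean_space \<Rightarrow> complex"
  assumes u: "test_function u" and b: "b \<in> Basis" and c: "c \<in> Basis"
  shows "\<exists>C. \<forall>z h. h > 0 \<longrightarrow> cmod (u (z + h *\<^sub>R b + h *\<^sub>R c) - u (z + h *\<^sub>R b) - u (z + h *\<^sub>R c) + u z
      - h\<^sup>2 *\<^sub>R pderiv_dir c (pderiv_dir b u) z) \<le> C * h ^ 3"
proof -
  note db = test_function_pderiv[OF u b] and dcb = test_function_pderiv[OF test_function_pderiv[OF u b] c]
  obtain C where C: "C \<ge> 0" "\<And>z h. cmod (pderiv_dir b u (z + h *\<^sub>R c) - pderiv_dir b u z - h *\<^sub>R pderiv_dir c (pderiv_dir b u) z) \<le> C * h\<^sup>2"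
    using test_function_taylor_dir[OF db c] by blast
  obtain L where L: "L \<ge> 0" "\<And>x y. norm (pderiv_dir c (pderiv_dir b u) x - pderiv_dir c (pderiv_dir b u) y) \<le> L * norm (x - y)"
    using lip_bddE[OF test_function_lip_bdd[OF dcb]] by metis
  have "cmod (u (z + h *\<^sub>R b + h *\<^sub>R c) - u (z + h *\<^sub>R b) - u (z + h *\<^sub>R c) + u z
      - h\<^sup>2 *\<^sub>R pderiv_dir c (pderiv_dir b u) z) \<le> (C + L) * h ^ 3" if h: "h > 0" for z h
  proof -
    let ?w = "pderiv_dir c (pderiv_dir b u) z"
    define F where "F s = u (z + h *\<^sub>R c + s *\<^sub>R b) - u (z + s *\<^sub>R b) - s *\<^sub>R (h *\<^sub>R ?w)" for s
    define F' where "F' s = pderiv_dir b u (z + h *\<^sub>R c + s *\<^sub>R b) - pderiv_dir b u (z + s *\<^sub>R b) - h *\<^sub>R ?w" for s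
    have lineb: "((\<lambda>s. u (y + s *\<^sub>R b)) has_derivative (\<lambda>t. t *\<^sub>R pderiv_dir b u (y + s *\<^sub>R b))) (at s)" for y s
    proof -
      have "((\<lambda>s. u (y + s *\<^sub>R b)) has_derivative (\<lambda>t. frechet_derivative u (at (y + s *\<^sub>R b)) (t *\<^sub>R b))) (at s)"
        by (rule has_derivative_compose[of "\<lambda>s. y + s *\<^sub>R b"])
           (use smooth_fun_differentiable[OF test_function_smooth[OF u]] in
             \<open>auto intro!: derivative_eq_intros simp flip: frechet_derivative_works\<close>)
      moreover have "linear (frechet_derivative u (at (y + s *\<^sub>R b)))"
        by (intro linear_frechet_derivative smooth_fun_differentiable test_function_smooth u)
      ultimately show ?thesis by (simp add: linear_cmul pderiv_dir_def)
    qed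
    have dF: "(F has_derivative (\<lambda>t. t *\<^sub>R F' s)) (at s within {0..h})" for s
      unfolding F_def[abs_def] F'_def
      by (rule has_derivative_at_withinI)
         (auto intro!: derivative_eq_intros lineb simp: scaleR_diff_right)
    have "norm (F h - F 0) \<le> (C * h\<^sup>2 + h * (L * h)) * norm (h - 0)"
    proof (rule differentiable_bound[OF _ dF])
      fix s assume s: "s \<in> {0..h}"
      have "norm (F' s) \<le> C * h\<^sup>2 + h * (L * h)"
      proof -
        have "F' s = (pderiv_dir b u (z + s *\<^sub>R b + h *\<^sub>R c) - pderiv_dir b u (z + s *\<^sub>R b)
            - h *\<^sub>R pderiv_dir c (pderiv_dir b u) (z + s *\<^sub>R b))
            + h *\<^sub>R (pderiv_dir c (pderiv_dir b u) (z + s *\<^sub>R b) - ?w)"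
          by (simp add: F'_def algebra_simps)
        also have "norm \<dots> \<le> C * h\<^sup>2 + h * (L * h)"
        proof (rule norm_triangle_mono)
          show "norm (pderiv_dir b u (z + s *\<^sub>R b + h *\<^sub>R c) - pderiv_dir b u (z + s *\<^sub>R b)
            - h *\<^sub>R pderiv_dir c (pderiv_dir b u) (z + s *\<^sub>R b)) \<le> C * h\<^sup>2" by (rule C(2))
          have "norm (pderiv_dir c (pderiv_dir b u) (z + s *\<^sub>R b) - ?w) \<le> L * h"
            by (rule order_trans[OF L(2)]) (use s b L(1) in \<open>auto intro!: mult_left_mono\<close>)
          then show "norm (h *\<^sub>R (pderiv_dir c (pderiv_dir b u) (z + s *\<^sub>R b) - ?w)) \<le> h * (L * h)"
            using h by (simp add: mult_left_mono)
        qed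
        finally show ?thesis .
      qed
      then show "onorm (\<lambda>t. t *\<^sub>R F' s) \<le> C * h\<^sup>2 + h * (L * h)"
        by (intro onorm_le) (simp add: mult.commute mult_left_mono)
    qed (use h in auto)
    moreover have "F h - F 0 = u (z + h *\<^sub>R b + h *\<^sub>R c) - u (z + h *\<^sub>R b) - u (z + h *\<^sub>R c) + u z - h\<^sup>2 *\<^sub>R ?w"
      by (simp add: F_def algebra_simps power2_eq_square)
    moreover have "(C * h\<^sup>2 + h * (L * h)) * norm (h - 0) = (C + L) * h ^ 3"
      using h by (simp add: power2_eq_square power3_eq_cube algebra_simps)
    ultimately show ?thesis by simp
  qed
  then show ?thesis by blast
qed

text \<open>The second difference quotient is symmetric in the two directions.\<close>

lemma pderiv_dir_symmetric:
  fixes u :: "'a::euclidean_space \<Rightarrow> complex"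
  assumes u: "test_function u" and b: "b \<in> Basis" and c: "c \<in> Basis"
  shows "pderiv_dir c (pderiv_dir b u) z = pderiv_dir b (pderiv_dir c u) z"
proof -
  let ?p = "pderiv_dir c (pderiv_dir b u) z" and ?q = "pderiv_dir b (pderiv_dir c u) z"
  obtain C1 where C1: "\<And>z h. h > 0 \<Longrightarrow> cmod (u (z + h *\<^sub>R b + h *\<^sub>R c) - u (z + h *\<^sub>R b) - u (z + h *\<^sub>R c) + u z
      - h\<^sup>2 *\<^sub>R pderiv_dir c (pderiv_dir b u) z) \<le> C1 * h ^ 3"
    using second_difference_bound[OF u b c] by blast
  obtain C2 where C2: "\<And>z h. h > 0 \<Longrightarrow> cmod (u (z + h *\<^sub>R c + h *\<^sub>R b) - u (z + h *\<^sub>R c) - u (z + h *\<^sub>R b) + u z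
      - h\<^sup>2 *\<^sub>R pderiv_dir b (pderiv_dir c u) z) \<le> C2 * h ^ 3"
    using second_difference_bound[OF u c b] by blast
  have le: "cmod (?p - ?q) \<le> (C1 + C2) * h" if h: "h > 0" for h
  proof -
    let ?D = "u (z + h *\<^sub>R b + h *\<^sub>R c) - u (z + h *\<^sub>R b) - u (z + h *\<^sub>R c) + u z"
    have "h\<^sup>2 *\<^sub>R (?p - ?q) = (?D - h\<^sup>2 *\<^sub>R ?q) - (?D - h\<^sup>2 *\<^sub>R ?p)" by (simp add: algebra_simps)
    also have "cmod \<dots> \<le> C2 * h ^ 3 + C1 * h ^ 3"
      by (rule order_trans[OF norm_triangle_ineq4 add_mono])
         (use C1[OF h, of z] C2[OF h, of z] in \<open>simp_all add: algebra_simps\<close>)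
    also have "C2 * h ^ 3 + C1 * h ^ 3 = h\<^sup>2 * ((C1 + C2) * h)"
      by (simp add: power3_eq_cube power2_eq_square algebra_simps)
    finally have "h\<^sup>2 * cmod (?p - ?q) \<le> h\<^sup>2 * ((C1 + C2) * h)"
      unfolding norm_scaleR by simp
    then show ?thesis using h by simp
  qed
  have "cmod (?p - ?q) \<le> 0"
  proof (rule field_le_epsilon)
    fix e :: real assume e: "e > 0"
    have "(C1 + C2) * (e / (\<bar>C1 + C2\<bar> + 1)) \<le> e"
    proof -
      have "(C1 + C2) * (e / (\<bar>C1 + C2\<bar> + 1)) \<le> (\<bar>C1 + C2\<bar> + 1) * (e / (\<bar>C1 + C2\<bar> + 1))"
        using e by (intro mult_right_mono) auto
      also have "\<dots> = e" by (simp add: add_nonneg_eq_0_iff)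
      finally show ?thesis .
    qed
    then show "cmod (?p - ?q) \<le> 0 + e"
      using le[of "e / (\<bar>C1 + C2\<bar> + 1)"] e by (simp add: add_nonneg_pos)
  qed
  then show ?thesis by simp
qed

section \<open>Radial functions\<close>

lemma radial_has_derivative:
  fixes x :: "'a::euclidean_space" and k :: "real \<Rightarrow> real"
  assumes "(k has_real_derivative k') (at (norm x))" "x \<noteq> 0"
  shows "((\<lambda>x. k (norm x)) has_derivative (\<lambda>h. k' * (x \<bullet> h) / norm x)) (at x)"
proof -
  have "((\<lambda>x. norm x) has_derivative (\<lambda>h. (x \<bullet> h) / norm x)) (at x)"
    using has_derivative_norm[OF assms(2)] by (simp add: sgn_div_norm divide_inverse mult.commute inner_commute)
  from has_derivative_compose[OF this assms(1)[unfolded has_field_derivative_def]]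
  show ?thesis by simp
qed

text \<open>Spheres are null sets, so finitely many radii and the origin may be left out.\<close>

lemma AE_radial:
  assumes "finite S" "\<And>x. norm x \<notin> S \<Longrightarrow> x \<noteq> 0 \<Longrightarrow> P (x::'a::euclidean_space)"
  shows "AE x in lebesgue. P x"
proof -
  have "negligible (\<Union>r\<in>S. sphere (0::'a) r)"
    by (intro negligible_Union) (use assms(1) in \<open>auto simp: negligible_sphere\<close>)
  moreover have "negligible {0::'a}" by simp
  ultimately have "negligible ((\<Union>r\<in>S. sphere (0::'a) r) \<union> {0})" by (rule negligible_Un)
  then have "(\<Union>r\<in>S. sphere (0::'a) r) \<union> {0} \<in> null_sets lebesgue" by (simp add: negligible_iff_null_sets)
  from AE_not_in[OF this] show ?thesis
    by eventually_elim (use assms(2) in auto)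
qed

lemma lip_bdd_radial:
  fixes k :: "real \<Rightarrow> real"
  assumes "\<And>r. r \<ge> 0 \<Longrightarrow> \<bar>k r\<bar> \<le> B" "\<And>r t. r \<ge> 0 \<Longrightarrow> t \<ge> 0 \<Longrightarrow> \<bar>k r - k t\<bar> \<le> L * \<bar>r - t\<bar>" "L \<ge> 0"
  shows "lip_bdd (\<lambda>x::'a::real_normed_vector. k (norm x))"
proof (rule lip_bddI)
  show "norm (k (norm x)) \<le> B" for x :: 'a using assms(1) by simp
  show "norm (k (norm x) - k (norm y)) \<le> L * norm (x - y)" for x y :: 'a
    using assms(2)[of "norm x" "norm y"] mult_left_mono[OF norm_triangle_ineq3[of x y] assms(3)] by simp
qed

lemma lip_bdd_mult_coord:
  fixes f :: "'a::euclidean_space \<Rightarrow> 'b::real_normed_vector"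
  assumes f: "lip_bdd f" and R: "\<And>x. norm x > R \<Longrightarrow> f x = 0" and b: "b \<in> Basis"
  shows "lip_bdd (\<lambda>x. (x \<bullet> b) *\<^sub>R f x)"
proof -
  obtain B L where f: "B \<ge> 0" "L \<ge> 0" "\<And>x. norm (f x) \<le> B" "\<And>x y. norm (f x - f y) \<le> L * norm (x - y)"
    using lip_bddE[OF f] by metis
  have bb: "\<bar>x \<bullet> b\<bar> \<le> norm x" for x using Basis_le_norm[OF b] by blast
  have main: "norm ((x \<bullet> b) *\<^sub>R f x - (y \<bullet> b) *\<^sub>R f y) \<le> (\<bar>R\<bar> * L + B) * norm (x - y)" if "norm x \<le> R" for x y
  proof -
    have "(x \<bullet> b) *\<^sub>R f x - (y \<bullet> b) *\<^sub>R f y = (x \<bullet> b) *\<^sub>R (f x - f y) + ((x - y) \<bullet> b) *\<^sub>R f y"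
      by (simp add: algebra_simps inner_diff_left)
    also have "norm \<dots> \<le> \<bar>x \<bullet> b\<bar> * norm (f x - f y) + \<bar>(x - y) \<bullet> b\<bar> * norm (f y)"
      by (rule order_trans[OF norm_triangle_ineq]) simp
    also have "\<dots> \<le> \<bar>R\<bar> * (L * norm (x - y)) + norm (x - y) * B"
      using bb[of x] bb[of "x - y"] that f by (intro add_mono mult_mono) auto
    finally show ?thesis by (simp add: algebra_simps)
  qed
  show ?thesis
  proof (rule lip_bddI)
    show "norm ((x \<bullet> b) *\<^sub>R f x) \<le> \<bar>R\<bar> * B" for x
    proof (cases "norm x > R")
      case False
      then show ?thesis using bb[of x] f by (auto intro!: mult_mono)
    qed (use R f in auto)
    show "norm ((x \<bullet> b) *\<^sub>R f x - (y \<bullet> b) *\<^sub>R f y) \<le> (\<bar>R\<bar> * L + B) * norm (x - y)" for x y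
    proof (cases "norm x \<le> R")
      case True
      then show ?thesis by (rule main)
    next
      case False
      show ?thesis
      proof (cases "norm y \<le> R")
        case True
        from main[OF this, of x] show ?thesis by (simp add: norm_minus_commute)
      next
        case False
        with \<open>\<not> norm x \<le> R\<close> show ?thesis using R f by simp
      qed
    qed
  qed
qed

text \<open>The integrand is the divergence of the vector field \<open>x \<mapsto> T x \<cdot> x\<close>.  Working with this field has the
  advantage that only the derivative \<open>T' x x\<close> in the radial direction has to be known.\<close>

lemma integral_radial_divergence:
  fixes T :: "'a::euclidean_space \<Rightarrow> real"
  assumes T: "lip_bdd T" "\<And>x. norm x > R \<Longrightarrow> T x = 0" "AE x in lebesgue. (T has_derivative T' x) (at x)"
  shows "integrable lebesgue (\<lambda>x. DIM('a) * T x + T' x x)" "(LINT x|lebesgue. DIM('a) * T x + T' x x) = 0"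
proof -
  have l: "lip_bdd (\<lambda>x. (x \<bullet> b) *\<^sub>R T x)" if "b \<in> Basis" for b
    by (rule lip_bdd_mult_coord[OF T(1,2) that])
  have z: "(x \<bullet> b) *\<^sub>R T x = 0" if "norm x > R" for x b using T(2)[OF that] by simp
  have d: "AE x in lebesgue. ((\<lambda>x. (x \<bullet> b) *\<^sub>R T x) has_derivative (\<lambda>h. (x \<bullet> b) *\<^sub>R T' x h + (h \<bullet> b) *\<^sub>R T x)) (at x)" for b
    using T(3) by eventually_elim (auto intro!: derivative_eq_intros)
  note P = integral_derivative_compact_support[OF l z d]
  have I1: "integrable lebesgue (\<lambda>x. \<Sum>b\<in>Basis. (x \<bullet> b) *\<^sub>R T' x b + (b \<bullet> b) *\<^sub>R T x)"
    by (intro Bochner_Integration.integrable_sum P(2)) auto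
  have I2: "(LINT x|lebesgue. (\<Sum>b\<in>Basis. (x \<bullet> b) *\<^sub>R T' x b + (b \<bullet> b) *\<^sub>R T x)) = 0"
  proof -
    have "(LINT x|lebesgue. (\<Sum>b\<in>Basis. (x \<bullet> b) *\<^sub>R T' x b + (b \<bullet> b) *\<^sub>R T x))
      = (\<Sum>b\<in>Basis. LINT x|lebesgue. (x \<bullet> b) *\<^sub>R T' x b + (b \<bullet> b) *\<^sub>R T x)"
      by (rule Bochner_Integration.integral_sum) (rule P(2))
    also have "\<dots> = 0" by (intro sum.neutral ballI P(3))
    finally show ?thesis .
  qed
  have ae: "AE x in lebesgue. (\<Sum>b\<in>Basis. (x \<bullet> b) *\<^sub>R T' x b + (b \<bullet> b) *\<^sub>R T x) = DIM('a) * T x + T' x x"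
    using T(3)
  proof eventually_elim
    case (elim x)
    interpret bounded_linear "T' x" using elim by (rule has_derivative_bounded_linear)
    have "T' x x = T' x (\<Sum>b\<in>Basis. (x \<bullet> b) *\<^sub>R b)" by (simp add: euclidean_representation)
    also have "\<dots> = (\<Sum>b\<in>Basis. (x \<bullet> b) *\<^sub>R T' x b)" by (simp add: sum scaleR)
    finally show ?case by (simp add: sum.distrib)
  qed
  have m1: "(\<lambda>x. \<Sum>b\<in>Basis. (x \<bullet> b) *\<^sub>R T' x b + (b \<bullet> b) *\<^sub>R T x) \<in> borel_measurable lebesgue"
    using I1 by simp
  have m2: "(\<lambda>x. DIM('a) * T x + T' x x) \<in> borel_measurable lebesgue"
    by (rule borel_measurable_AE[OF m1 ae])
  show "integrable lebesgue (\<lambda>x. DIM('a) * T x + T' x x)"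
    by (rule integrable_cong_AE_imp[OF I1 m2 ae])
  show "(LINT x|lebesgue. DIM('a) * T x + T' x x) = 0"
    unfolding integral_cong_AE[OF m1 m2 ae, symmetric] by (rule I2)
qed

section \<open>The multiplier identity\<close>

text \<open>The algebra of the Morawetz identity at one point.  Here \<open>U\<close> is the value of the function,
  \<open>E = r \<partial>\<^sub>r u\<close>, \<open>g = |\<nabla>u|\<^sup>2\<close>, and \<open>Q\<close> and \<open>G2\<close> are the second-order quantities \<open>x \<cdot> D\<^sup>2u x\<close> and
  \<open>Re (\<nabla>u \<cdot> cnj (D\<^sup>2u x))\<close>.  The left-hand side is the integrand of the quadratic form.  On the right, the
  first bracket is the quadratic form that is bounded from below; the second and the third one are, with \<open>2 N + 1 = d\<close>, the divergence
  of \<open>x \<mapsto> T x \<cdot> x\<close> for \<open>T = m g / 2 - N m |u|\<^sup>2 / (2 r\<^sup>2) - \<tau> \<Phi> m Re (u cnj Z) / r - (lam\<^sup>2 + \<tau>\<^sup>2 \<Phi>\<^sup>2) m |u|\<^sup>2 / 2\<close>.\<close>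

lemma morawetz_identity:
  fixes r m m' \<Phi> \<Phi>' \<tau> lam N g G2 :: real and U E Q :: complex
  assumes r: "r > 0"
  defines "Z \<equiv> E + of_real N * U"
  defines "\<mu>' \<equiv> m + r * m'"
  shows "m' / r * Re (E * cnj Z) + m * ((1 + N) * g + G2)
     + \<tau> * \<Phi> / r * (m * Re (E * cnj Z) - Re (U * cnj (of_real (r * m') * Z + of_real m * (E + Q + of_real N * E))))
     - (\<tau>\<^sup>2 * \<Phi>\<^sup>2 + lam\<^sup>2) * m * Re (U * cnj Z)
   = (1/2 * \<mu>' * (cmod Z)\<^sup>2 / r\<^sup>2 + (m - 1/2 * \<mu>') * (g - (cmod E)\<^sup>2 / r\<^sup>2 + N * (N - 1) * (cmod U)\<^sup>2 / r\<^sup>2)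
      + 2 * \<tau> * \<Phi> * m * (cmod Z)\<^sup>2 / r + \<tau> * \<Phi>' * m * Re (U * cnj Z)
      + 1/2 * lam\<^sup>2 * \<mu>' * (cmod U)\<^sup>2 + 1/2 * \<tau>\<^sup>2 * (\<mu>' * \<Phi>\<^sup>2 + 2 * r * m * \<Phi> * \<Phi>') * (cmod U)\<^sup>2)
     + (1/2 * m' * r * g + m * G2 - N/2 * (m' * r * (cmod U)\<^sup>2 / r\<^sup>2 - 2 * m * (cmod U)\<^sup>2 / r\<^sup>2 + 2 * m * Re (E * cnj U) / r\<^sup>2)
      - \<tau> * ((\<Phi>' - \<Phi> / r) * m + \<Phi> / r * m' * r) * Re (U * cnj Z)
      - \<tau> * \<Phi> / r * m * Re (E * cnj Z + U * cnj (E + Q + of_real N * E))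
      - \<tau>\<^sup>2 * \<Phi> * \<Phi>' * r * m * (cmod U)\<^sup>2
      - 1/2 * (lam\<^sup>2 + \<tau>\<^sup>2 * \<Phi>\<^sup>2) * (m' * r * (cmod U)\<^sup>2 + 2 * m * Re (E * cnj U)))
     + (2 * N + 1) * (1/2 * m * g - N/2 * m * (cmod U)\<^sup>2 / r\<^sup>2 - \<tau> * \<Phi> / r * m * Re (U * cnj Z)
      - 1/2 * (lam\<^sup>2 + \<tau>\<^sup>2 * \<Phi>\<^sup>2) * m * (cmod U)\<^sup>2)"
proof -
  obtain u1 u2 where U: "U = Complex u1 u2" by (cases U)
  obtain e1 e2 where E: "E = Complex e1 e2" by (cases E)
  obtain q1 q2 where Q: "Q = Complex q1 q2" by (cases Q)
  define i where "i = 1 / r"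
  have i: "r * i = 1" using r by (simp add: i_def)
  have ri: "x / r = x * i" "x / r\<^sup>2 = x * i * i" for x using r by (simp_all add: i_def power2_eq_square)
  have s1: "r * (i * x) = x" "i * (r * x) = x" for x
    using i by (simp_all add: mult.assoc[symmetric] mult.commute[of i r])
  have s2: "i * (m' * (r * x)) = m' * x" for x using s1(2)[of "m' * x"] by (simp add: mult_ac)
  show ?thesis
    unfolding U E Q Z_def \<mu>'_def cmod_power2 ri
    by (simp add: power2_eq_square) (simp add: field_simps s1 s2)
qed

section \<open>The Morawetz inequality\<close>

text \<open>\<open>m\<close> is the multiplier, \<open>\<Phi>\<close> the radial derivative of the phase, \<open>W\<close> the weight that is gained and \<open>A\<close> the
  radius where derivatives may jump.  In \<open>coercive\<close> the right-hand side is the coefficient of \<open>|u|\<^sup>2\<close> in the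
  Morawetz identity after the cross term with \<open>\<Phi>'\<close> has been absorbed by half of the friction.  The term with
  \<open>min 0 (N * (N - 1))\<close> is present only in dimension two, where functions vanishing near the origin are
  considered; hence the alternative \<open>r \<ge> 1/2\<close>.  Condition \<open>mu_mono\<close> says that \<open>r m\<close> is nondecreasing and that the
  angular derivatives have a nonnegative coefficient.\<close>

locale radial_weights =
  fixes m m' \<Phi> \<Phi>' W :: "real \<Rightarrow> real" and A lam \<tau> Bm Lm B\<Phi> L\<Phi> BW N :: real
  assumes m_nonneg: "\<And>r. r \<ge> 0 \<Longrightarrow> 0 \<le> m r" and m_le: "\<And>r. r \<ge> 0 \<Longrightarrow> m r \<le> Bm"
    and rm_le: "\<And>r. r \<ge> 0 \<Longrightarrow> r * m r \<le> Bm"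
    and m_lip: "\<And>r t. r \<ge> 0 \<Longrightarrow> t \<ge> 0 \<Longrightarrow> \<bar>m r - m t\<bar> \<le> Lm * \<bar>r - t\<bar>"
    and rm_lip: "\<And>r t. t \<ge> 0 \<Longrightarrow> t \<le> r \<Longrightarrow> t * \<bar>m r - m t\<bar> \<le> Lm * \<bar>r - t\<bar>"
    and m_deriv: "\<And>r. r > 0 \<Longrightarrow> r \<noteq> A \<Longrightarrow> (m has_real_derivative m' r) (at r)"
    and Phi_pos: "\<And>r. r \<ge> 0 \<Longrightarrow> 0 < \<Phi> r" and Phi_le: "\<And>r. r \<ge> 0 \<Longrightarrow> \<Phi> r \<le> B\<Phi>"
    and Phi_lip: "\<And>r t. r \<ge> 0 \<Longrightarrow> t \<ge> 0 \<Longrightarrow> \<bar>\<Phi> r - \<Phi> t\<bar> \<le> L\<Phi> * \<bar>r - t\<bar>"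
    and Phi_deriv: "\<And>r. r > 0 \<Longrightarrow> r \<noteq> A \<Longrightarrow> (\<Phi> has_real_derivative \<Phi>' r) (at r)"
    and mu_mono: "\<And>r. r > 0 \<Longrightarrow> r \<noteq> A \<Longrightarrow> 0 \<le> m r + r * m' r \<and> m r + r * m' r \<le> 2 * m r"
    and W_bound: "\<And>r. r \<ge> 0 \<Longrightarrow> \<bar>W r\<bar> \<le> BW"
    and W_cont: "continuous_on {0..} W"
    and tau_pos: "\<tau> > 0" and N_nonneg: "N \<ge> 1/2"
    and coercive: "\<And>r. r > 0 \<Longrightarrow> r \<noteq> A \<Longrightarrow> N \<ge> 1 \<or> r \<ge> 1/2 \<Longrightarrow>
      W r \<le> 1/2 * lam\<^sup>2 * (m r + r * m' r) + 1/2 * \<tau>\<^sup>2 * ((m r + r * m' r) * (\<Phi> r)\<^sup>2 + 2 * r * m r * \<Phi> r * \<Phi>' r)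
        - \<tau> * (\<Phi>' r)\<^sup>2 * (r * m r) / (4 * \<Phi> r) + min 0 (N * (N - 1)) * (m r - 1/2 * (m r + r * m' r)) / r\<^sup>2"
begin

lemma Bm_nonneg: "Bm \<ge> 0" using m_nonneg[of 0] m_le[of 0] by simp
lemma B\<Phi>_pos: "B\<Phi> > 0" using Phi_pos[of 0] Phi_le[of 0] by simp
lemma Lm_nonneg: "Lm \<ge> 0" using m_lip[of 0 1] by auto
lemma L\<Phi>_nonneg: "L\<Phi> \<ge> 0" using Phi_lip[of 0 1] by auto

lemma quadratic_lower_bound:
  fixes a b c X :: real
  assumes "a > 0"
  shows "a * X\<^sup>2 - b * X \<ge> - b\<^sup>2 / (4 * a)"
proof -
  have "0 \<le> (2 * a * X - b)\<^sup>2 / (4 * a)" using assms by simp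
  also have "\<dots> = a * X\<^sup>2 - b * X + b\<^sup>2 / (4 * a)"
    using assms by (simp add: power2_eq_square field_simps)
  finally show ?thesis by simp
qed

text \<open>The friction \<open>2 \<tau> \<Phi> m |Z|\<^sup>2 / r\<close> is used twice, once to complete the square with the cross term
  \<open>\<tau> \<Phi>' m Re (U cnj Z)\<close> and once with \<open>v m |Z|\<close>.  The number \<open>v\<close> will be the modulus of the source, so that the
  second use yields a free term \<open>v |M u|\<close> on the good side.\<close>

lemma pointwise_lower_bound:
  fixes U E :: complex and g v :: real
  assumes r: "r > 0" "r \<noteq> A" and g: "(cmod E)\<^sup>2 / r\<^sup>2 \<le> g" and U: "N \<ge> 1 \<or> r \<ge> 1/2 \<or> U = 0" and v: "v \<ge> 0"
  defines "Z \<equiv> E + of_real N * U"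
  defines "\<mu>' \<equiv> m r + r * m' r"
  shows "W r * (cmod U)\<^sup>2 + v * cmod (of_real (m r) * Z) - r * m r / (4 * \<tau> * \<Phi> r) * v\<^sup>2
   \<le> 1/2 * \<mu>' * (cmod Z)\<^sup>2 / r\<^sup>2 + (m r - 1/2 * \<mu>') * (g - (cmod E)\<^sup>2 / r\<^sup>2 + N * (N - 1) * (cmod U)\<^sup>2 / r\<^sup>2)
      + 2 * \<tau> * \<Phi> r * m r * (cmod Z)\<^sup>2 / r + \<tau> * \<Phi>' r * m r * Re (U * cnj Z)
      + 1/2 * lam\<^sup>2 * \<mu>' * (cmod U)\<^sup>2 + 1/2 * \<tau>\<^sup>2 * (\<mu>' * (\<Phi> r)\<^sup>2 + 2 * r * m r * \<Phi> r * \<Phi>' r) * (cmod U)\<^sup>2"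
proof -
  have mr: "m r \<ge> 0" and Pr: "\<Phi> r > 0" using r m_nonneg Phi_pos by auto
  have mu: "0 \<le> \<mu>'" "0 \<le> m r - 1/2 * \<mu>'" using mu_mono[OF r] by (auto simp: \<mu>'_def)
  let ?X = "cmod Z"
  define a where "a = \<tau> * \<Phi> r / r"
  have a: "a > 0" using r Pr tau_pos by (simp add: a_def)
  have t1: "0 \<le> 1/2 * \<mu>' * ?X\<^sup>2 / r\<^sup>2" using mu by simp
  have t2: "(m r - 1/2 * \<mu>') * (min 0 (N * (N - 1)) * (cmod U)\<^sup>2 / r\<^sup>2)
     \<le> (m r - 1/2 * \<mu>') * (g - (cmod E)\<^sup>2 / r\<^sup>2 + N * (N - 1) * (cmod U)\<^sup>2 / r\<^sup>2)"
  proof (rule mult_left_mono[OF _ mu(2)])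
    have "min 0 (N * (N - 1)) * (cmod U)\<^sup>2 / r\<^sup>2 \<le> N * (N - 1) * (cmod U)\<^sup>2 / r\<^sup>2"
      by (intro divide_right_mono mult_right_mono) auto
    then show "min 0 (N * (N - 1)) * (cmod U)\<^sup>2 / r\<^sup>2 \<le> g - (cmod E)\<^sup>2 / r\<^sup>2 + N * (N - 1) * (cmod U)\<^sup>2 / r\<^sup>2"
      using g by linarith
  qed
  have t3: "v * ?X - r / (4 * \<tau> * \<Phi> r) * v\<^sup>2 \<le> a * ?X\<^sup>2"
  proof -
    have "v\<^sup>2 / (4 * a) = r / (4 * \<tau> * \<Phi> r) * v\<^sup>2" using r by (simp add: a_def mult_ac)
    then show ?thesis using quadratic_lower_bound[OF a, of v ?X] by simp
  qed
  have t4: "- (\<tau> * (\<Phi>' r)\<^sup>2 * r / (4 * \<Phi> r) * (cmod U)\<^sup>2) \<le> a * ?X\<^sup>2 + \<tau> * \<Phi>' r * Re (U * cnj Z)"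
  proof -
    have "(\<tau> * \<bar>\<Phi>' r\<bar> * cmod U)\<^sup>2 / (4 * a) = \<tau> * (\<Phi>' r)\<^sup>2 * r / (4 * \<Phi> r) * (cmod U)\<^sup>2"
      using r tau_pos Pr by (simp add: a_def power_mult_distrib power2_eq_square)
    then have "- (\<tau> * (\<Phi>' r)\<^sup>2 * r / (4 * \<Phi> r) * (cmod U)\<^sup>2) \<le> a * ?X\<^sup>2 - \<tau> * \<bar>\<Phi>' r\<bar> * cmod U * ?X"
      using quadratic_lower_bound[OF a, of "\<tau> * \<bar>\<Phi>' r\<bar> * cmod U" ?X] by simp
    moreover have "- (\<tau> * \<bar>\<Phi>' r\<bar> * cmod U * ?X) \<le> \<tau> * \<Phi>' r * Re (U * cnj Z)"
    proof -
      have "\<bar>Re (U * cnj Z)\<bar> \<le> cmod U * ?X" using abs_Re_le_cmod[of "U * cnj Z"] by (simp add: norm_mult)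
      then have "\<bar>\<tau> * \<Phi>' r * Re (U * cnj Z)\<bar> \<le> \<tau> * \<bar>\<Phi>' r\<bar> * (cmod U * ?X)"
        using tau_pos by (simp add: abs_mult mult_left_mono)
      then show ?thesis by (simp add: mult.assoc abs_le_iff)
    qed
    ultimately show ?thesis by linarith
  qed
  have t34: "m r * (v * ?X - r / (4 * \<tau> * \<Phi> r) * v\<^sup>2) + m r * (- (\<tau> * (\<Phi>' r)\<^sup>2 * r / (4 * \<Phi> r) * (cmod U)\<^sup>2))
      \<le> m r * (a * ?X\<^sup>2) + m r * (a * ?X\<^sup>2 + \<tau> * \<Phi>' r * Re (U * cnj Z))"
    by (intro add_mono mult_left_mono t3 t4 mr)
  have t5: "W r * (cmod U)\<^sup>2 \<le> (1/2 * lam\<^sup>2 * \<mu>' + 1/2 * \<tau>\<^sup>2 * (\<mu>' * (\<Phi> r)\<^sup>2 + 2 * r * m r * \<Phi> r * \<Phi>' r)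
        - \<tau> * (\<Phi>' r)\<^sup>2 * (r * m r) / (4 * \<Phi> r) + min 0 (N * (N - 1)) * (m r - 1/2 * \<mu>') / r\<^sup>2) * (cmod U)\<^sup>2"
  proof (cases "U = 0")
    case False
    then show ?thesis using coercive[OF r] U unfolding \<mu>'_def by (intro mult_right_mono) auto
  qed simp
  have e1: "2 * \<tau> * \<Phi> r * m r * ?X\<^sup>2 / r + \<tau> * \<Phi>' r * m r * Re (U * cnj Z)
     = m r * (a * ?X\<^sup>2) + m r * (a * ?X\<^sup>2 + \<tau> * \<Phi>' r * Re (U * cnj Z))"
    by (simp add: a_def algebra_simps)
  have e2: "v * cmod (of_real (m r) * Z) - r * m r / (4 * \<tau> * \<Phi> r) * v\<^sup>2 = m r * (v * ?X - r / (4 * \<tau> * \<Phi> r) * v\<^sup>2)"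
    using mr by (simp add: norm_mult algebra_simps)
  have e3: "(1/2 * lam\<^sup>2 * \<mu>' + 1/2 * \<tau>\<^sup>2 * (\<mu>' * (\<Phi> r)\<^sup>2 + 2 * r * m r * \<Phi> r * \<Phi>' r)
        - \<tau> * (\<Phi>' r)\<^sup>2 * (r * m r) / (4 * \<Phi> r) + min 0 (N * (N - 1)) * (m r - 1/2 * \<mu>') / r\<^sup>2) * (cmod U)\<^sup>2
     = 1/2 * lam\<^sup>2 * \<mu>' * (cmod U)\<^sup>2 + 1/2 * \<tau>\<^sup>2 * (\<mu>' * (\<Phi> r)\<^sup>2 + 2 * r * m r * \<Phi> r * \<Phi>' r) * (cmod U)\<^sup>2
       + m r * (- (\<tau> * (\<Phi>' r)\<^sup>2 * r / (4 * \<Phi> r) * (cmod U)\<^sup>2))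
       + (m r - 1/2 * \<mu>') * (min 0 (N * (N - 1)) * (cmod U)\<^sup>2 / r\<^sup>2)"
    by (simp add: algebra_simps)
  show ?thesis using t1 t2 t34 t5 unfolding e3 using e1 e2 by linarith
qed

text \<open>In \<open>Mul\<close>, \<open>dMul\<close> and \<open>Form\<close> the arguments \<open>g\<close> and \<open>h\<close> are the first and second weak derivatives of \<open>f\<close>:
  $Mf = m(|x|)(x\cdot\nabla f + N f)$, its gradient, and the integrand of the pairing of \<open>(P - lam\<^sup>2) f\<close> with \<open>M f\<close>.\<close>

definition Mul :: "('a::euclidean_space \<Rightarrow> complex) \<Rightarrow> ('a \<Rightarrow> 'a \<Rightarrow> complex) \<Rightarrow> 'a \<Rightarrow> complex" where
  "Mul f g x = (\<Sum>c\<in>Basis. of_real (m (norm x) * (x \<bullet> c)) * g c x) + of_real (N * m (norm x)) * f x"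

definition dMul :: "('a::euclidean_space \<Rightarrow> complex) \<Rightarrow> ('a \<Rightarrow> 'a \<Rightarrow> complex) \<Rightarrow> ('a \<Rightarrow> 'a \<Rightarrow> 'a \<Rightarrow> complex) \<Rightarrow> 'a \<Rightarrow> 'a \<Rightarrow> complex" where
  "dMul f g h b x =
     (\<Sum>c\<in>Basis. of_real (m (norm x) * (x \<bullet> c)) * h c b x
         + of_real (m (norm x) * (b \<bullet> c) + m' (norm x) * (x \<bullet> b) / norm x * (x \<bullet> c)) * g c x)
     + (of_real (N * m (norm x)) * g b x + of_real (N * (m' (norm x) * (x \<bullet> b) / norm x)) * f x)"

definition dphase :: "'a::euclidean_space \<Rightarrow> 'a \<Rightarrow> real" where
  "dphase x b = \<Phi> (norm x) * (x \<bullet> b) / norm x"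

definition Form :: "('a::euclidean_space \<Rightarrow> complex) \<Rightarrow> ('a \<Rightarrow> 'a \<Rightarrow> complex) \<Rightarrow> ('a \<Rightarrow> 'a \<Rightarrow> 'a \<Rightarrow> complex) \<Rightarrow> 'a \<Rightarrow> complex" where
  "Form f g h x = (\<Sum>b\<in>Basis. (g b x - of_real (\<tau> * dphase x b) * f x) *
       (cnj (dMul f g h b x) + of_real (\<tau> * dphase x b) * cnj (Mul f g x))) - of_real (lam\<^sup>2) * (f x * cnj (Mul f g x))"

text \<open>Rewrites the integrand in terms of the radial quantities of \<open>morawetz_identity\<close>.\<close>

lemma Form_expand:
  fixes x :: "'a::euclidean_space" and f :: "'a \<Rightarrow> complex" and g :: "'a \<Rightarrow> 'a \<Rightarrow> complex"
    and h :: "'a \<Rightarrow> 'a \<Rightarrow> 'a \<Rightarrow> complex"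
  assumes x: "x \<noteq> 0"
  defines "r \<equiv> norm x" and "E \<equiv> \<Sum>c\<in>Basis. (x \<bullet> c) *\<^sub>R g c x"
    and "H \<equiv> \<lambda>b. \<Sum>c\<in>Basis. (x \<bullet> c) *\<^sub>R h c b x"
  defines "Q \<equiv> \<Sum>b\<in>Basis. (x \<bullet> b) *\<^sub>R H b" and "Z \<equiv> E + of_real N * f x"
  shows "Mul f g x = of_real (m r) * Z"
    and "Re (Form f g h x) = m' r / r * Re (E * cnj Z) + m r * ((1 + N) * (\<Sum>b\<in>Basis. (cmod (g b x))\<^sup>2) + (\<Sum>b\<in>Basis. Re (g b x * cnj (H b))))
     + \<tau> * \<Phi> r / r * (m r * Re (E * cnj Z) - Re (f x * cnj (of_real (r * m' r) * Z + of_real (m r) * (E + Q + of_real N * E))))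
     - (\<tau>\<^sup>2 * (\<Phi> r)\<^sup>2 + lam\<^sup>2) * m r * Re (f x * cnj Z)"
proof -
  have r: "r > 0" using x by (simp add: r_def)
  show M: "Mul f g x = of_real (m r) * Z"
    unfolding Mul_def Z_def E_def r_def
    by (simp add: scaleR_conv_of_real sum_distrib_left algebra_simps)
  let ?y = "\<lambda>b. complex_of_real (x \<bullet> b)"
  have dM: "dMul f g h b x = of_real (m' r / r) * ?y b * Z + of_real (m r) * (of_real (1 + N) * g b x + H b)"
    if b: "b \<in> Basis" for b
  proof -
    have "(\<Sum>c\<in>Basis. of_real (m r * (b \<bullet> c)) * g c x) = (\<Sum>c\<in>Basis. if c = b then of_real (m r) * g c x else 0)"
      using b by (intro sum.cong) (auto simp: inner_Basis)
    also have "\<dots> = of_real (m r) * g b x" using b by simp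
    finally have s: "(\<Sum>c\<in>Basis. of_real (m r * (b \<bullet> c)) * g c x) = of_real (m r) * g b x" .
    have k1: "(\<Sum>c\<in>Basis. of_real (m r * (b \<bullet> c) + m' r * (x \<bullet> b) / r * (x \<bullet> c)) * g c x)
       = (\<Sum>c\<in>Basis. of_real (m r * (b \<bullet> c)) * g c x) + of_real (m' r / r) * ?y b * E"
      unfolding E_def sum_distrib_left sum.distrib[symmetric]
      by (rule sum.cong[OF refl]) (simp add: scaleR_conv_of_real algebra_simps)
    have k2: "(\<Sum>c\<in>Basis. of_real (m r * (x \<bullet> c)) * h c b x) = of_real (m r) * H b"
      unfolding H_def sum_distrib_left by (rule sum.cong[OF refl]) (simp add: scaleR_conv_of_real)
    have "dMul f g h b x = of_real (m r) * H b + ((\<Sum>c\<in>Basis. of_real (m r * (b \<bullet> c)) * g c x)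
         + of_real (m' r / r) * ?y b * E) + (of_real (N * m r) * g b x + of_real (N * (m' r / r)) * ?y b * f x)"
      unfolding dMul_def r_def[symmetric] sum.distrib k1 k2 by simp
    then show ?thesis unfolding s Z_def by (simp add: algebra_simps add_divide_distrib)
  qed
  have yy: "(\<Sum>b\<in>Basis. ?y b * ?y b) = of_real (r\<^sup>2)"
  proof -
    have "r\<^sup>2 = (\<Sum>b\<in>Basis. (x \<bullet> b) * (x \<bullet> b))"
      unfolding r_def by (subst power2_norm_eq_inner, subst euclidean_inner) (rule refl)
    then show ?thesis by simp
  qed
  have Ey: "E = (\<Sum>b\<in>Basis. ?y b * g b x)" by (simp add: E_def scaleR_conv_of_real)
  have Qy: "Q = (\<Sum>b\<in>Basis. ?y b * H b)" by (simp add: Q_def scaleR_conv_of_real)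
  define G where "G = (\<Sum>b\<in>Basis. g b x * cnj (g b x))"
  define K where "K = (\<Sum>b\<in>Basis. g b x * cnj (H b))"
  define t where "t = complex_of_real (\<tau> * \<Phi> r / r)"
  define c1 where "c1 = complex_of_real (m' r / r)"
  define c2 where "c2 = complex_of_real (m r)"
  define c3 where "c3 = complex_of_real (1 + N)"
  have cc: "cnj t = t" "cnj c1 = c1" "cnj c2 = c2" "cnj c3 = c3" by (simp_all add: t_def c1_def c2_def c3_def)
  have "Form f g h x = (\<Sum>b\<in>Basis. (g b x - t * ?y b * f x) *
       (c1 * ?y b * cnj Z + c2 * (c3 * cnj (g b x) + cnj (H b)) + t * ?y b * c2 * cnj Z)) - of_real (lam\<^sup>2) * (f x * (c2 * cnj Z))"
    unfolding Form_def M
    by (intro arg_cong2[where f = minus] sum.cong refl)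
       (simp_all add: dM dphase_def r_def[symmetric] t_def c1_def c2_def c3_def mult.assoc)
  also have "(\<Sum>b\<in>Basis. (g b x - t * ?y b * f x) *
       (c1 * ?y b * cnj Z + c2 * (c3 * cnj (g b x) + cnj (H b)) + t * ?y b * c2 * cnj Z))
     = (\<Sum>b\<in>Basis. c1 * cnj Z * (?y b * g b x) + c2 * c3 * (g b x * cnj (g b x)) + c2 * (g b x * cnj (H b))
         + t * c2 * cnj Z * (?y b * g b x)
         - t * f x * c1 * cnj Z * (?y b * ?y b) - t * f x * c2 * c3 * (?y b * cnj (g b x)) - t * f x * c2 * (?y b * cnj (H b))
         - t * t * f x * c2 * cnj Z * (?y b * ?y b))"
    by (rule sum.cong[OF refl]) (simp add: algebra_simps)
  also have "\<dots> = c1 * cnj Z * E + c2 * c3 * G + c2 * K + t * c2 * cnj Z * E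
      - t * f x * c1 * cnj Z * of_real (r\<^sup>2) - t * f x * c2 * c3 * cnj E - t * f x * c2 * cnj Q - t * t * f x * c2 * cnj Z * of_real (r\<^sup>2)"
    by (simp add: sum.distrib sum_subtractf sum_distrib_left[symmetric] yy Ey Qy G_def K_def)
  finally have F: "Form f g h x = c1 * cnj Z * E + c2 * c3 * G + c2 * K + t * c2 * cnj Z * E
      - t * f x * c1 * cnj Z * of_real (r\<^sup>2) - t * f x * c2 * c3 * cnj E - t * f x * c2 * cnj Q - t * t * f x * c2 * cnj Z * of_real (r\<^sup>2)
      - of_real (lam\<^sup>2) * (f x * (c2 * cnj Z))" .
  have ReG: "Re G = (\<Sum>b\<in>Basis. (cmod (g b x))\<^sup>2)" unfolding G_def Re_sum cmod_power2
    by (rule sum.cong[OF refl]) (simp add: power2_eq_square)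
  have ImG: "Im G = 0" unfolding G_def Im_sum by (rule sum.neutral) simp
  have ReK: "Re K = (\<Sum>b\<in>Basis. Re (g b x * cnj (H b)))" unfolding K_def Re_sum ..
  have e1: "t * c1 * of_real (r\<^sup>2) = of_real (\<tau> * \<Phi> r / r * (r * m' r))"
    using r by (simp add: t_def c1_def power2_eq_square)
  have e2: "t * t * of_real (r\<^sup>2) = of_real (\<tau>\<^sup>2 * (\<Phi> r)\<^sup>2)"
    using r by (simp add: t_def power2_eq_square)
  have F2: "Form f g h x = c1 * (E * cnj Z) + c2 * (c3 * G + K) + t * (c2 * (E * cnj Z))
      - of_real (\<tau> * \<Phi> r / r * (r * m' r)) * (f x * cnj Z) - t * (c2 * (f x * (c3 * cnj E + cnj Q))) - of_real (\<tau>\<^sup>2 * (\<Phi> r)\<^sup>2) * (c2 * (f x * cnj Z))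
      - of_real (lam\<^sup>2) * (c2 * (f x * cnj Z))"
    unfolding F e1[symmetric] e2[symmetric] by (simp add: algebra_simps)
  show "Re (Form f g h x) = m' r / r * Re (E * cnj Z) + m r * ((1 + N) * (\<Sum>b\<in>Basis. (cmod (g b x))\<^sup>2) + (\<Sum>b\<in>Basis. Re (g b x * cnj (H b))))
     + \<tau> * \<Phi> r / r * (m r * Re (E * cnj Z) - Re (f x * cnj (of_real (r * m' r) * Z + of_real (m r) * (E + Q + of_real N * E))))
     - (\<tau>\<^sup>2 * (\<Phi> r)\<^sup>2 + lam\<^sup>2) * m r * Re (f x * cnj Z)"
    unfolding F2 ReG[symmetric] ReK[symmetric] t_def c1_def c2_def c3_def
    by (simp add: ImG algebra_simps add_divide_distrib)
qed

end

lemma clamp_lip: "\<bar>max 0 (min 1 a) - max 0 (min 1 (b::real))\<bar> \<le> \<bar>a - b\<bar>"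
  by (auto simp: max_def min_def)

text \<open>Cuts out a neighbourhood of the origin, where \<open>1/r\<close> and the coefficients are singular; it
  rises linearly from \<open>0\<close> at \<open>\<delta>\<close> to \<open>1\<close> at \<open>2 \<delta>\<close>.\<close>

definition ramp :: "real \<Rightarrow> real \<Rightarrow> real" where
  "ramp \<delta> r = max 0 (min 1 (r / \<delta> - 1))"

definition ramp' :: "real \<Rightarrow> real \<Rightarrow> real" where
  "ramp' \<delta> r = (if \<delta> < r \<and> r < 2 * \<delta> then 1 / \<delta> else 0)"

lemma ramp_bounds: "0 \<le> ramp \<delta> r" "ramp \<delta> r \<le> 1"
  by (auto simp: ramp_def)

lemma ramp_lip: "\<delta> > 0 \<Longrightarrow> \<bar>ramp \<delta> r - ramp \<delta> t\<bar> \<le> (1 / \<delta>) * \<bar>r - t\<bar>"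
  using clamp_lip[of "r / \<delta> - 1" "t / \<delta> - 1"] by (simp add: ramp_def diff_divide_distrib[symmetric] abs_divide)

lemma ramp_zero: "\<delta> > 0 \<Longrightarrow> r \<le> \<delta> \<Longrightarrow> ramp \<delta> r = 0"
  by (simp add: ramp_def field_simps)

lemma ramp_one: "\<delta> > 0 \<Longrightarrow> r \<ge> 2 * \<delta> \<Longrightarrow> ramp \<delta> r = 1"
  by (simp add: ramp_def field_simps)

lemma ramp_deriv:
  assumes \<delta>: "\<delta> > 0" and r: "r \<noteq> \<delta>" "r \<noteq> 2 * \<delta>"
  shows "(ramp \<delta> has_real_derivative ramp' \<delta> r) (at r)"
proof -
  consider "r < \<delta>" | "\<delta> < r" "r < 2 * \<delta>" | "r > 2 * \<delta>" using r by linarith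
  then show ?thesis
  proof cases
    case 1
    show ?thesis
    proof (rule has_field_derivative_transform_within_open[where S = "{..<\<delta>}" and f = "\<lambda>x. 0"])
      show "((\<lambda>x. 0) has_real_derivative ramp' \<delta> r) (at r)" using 1 by (simp add: ramp'_def)
    qed (use 1 \<delta> in \<open>auto simp: ramp_zero\<close>)
  next
    case 2
    show ?thesis
    proof (rule has_field_derivative_transform_within_open[where S = "{\<delta><..<2*\<delta>}" and f = "\<lambda>x. x / \<delta> - 1"])
      show "((\<lambda>x. x / \<delta> - 1) has_real_derivative ramp' \<delta> r) (at r)"
        using 2 \<delta> by (auto simp: ramp'_def intro!: derivative_eq_intros)
    qed (use 2 \<delta> in \<open>auto simp: ramp_def field_simps\<close>)
  next
    case 3
    show ?thesis
    proof (rule has_field_derivative_transform_within_open[where S = "{2*\<delta><..}" and f = "\<lambda>x. 1"])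
      show "((\<lambda>x. 1) has_real_derivative ramp' \<delta> r) (at r)" using 3 by (simp add: ramp'_def)
    qed (use 3 \<delta> in \<open>auto simp: ramp_one\<close>)
  qed
qed

lemma lip_bdd_ramp: "\<delta> > 0 \<Longrightarrow> lip_bdd (\<lambda>x::'a::euclidean_space. ramp \<delta> (norm x))"
  by (rule lip_bdd_radial[where B = 1 and L = "1 / \<delta>"]) (use ramp_lip ramp_bounds in auto)

text \<open>Agrees with \<open>1/r\<close> on the support of \<open>ramp \<delta>\<close> and is Lipschitz everywhere.\<close>

lemma lip_bdd_inverse_max:
  assumes "\<delta> > 0"
  shows "lip_bdd (\<lambda>x::'a::euclidean_space. 1 / max (norm x) \<delta>)"
proof (rule lip_bdd_radial[where B = "1 / \<delta>" and L = "1 / \<delta>\<^sup>2"])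
  show "\<bar>1 / max r \<delta>\<bar> \<le> 1 / \<delta>" for r using assms by (simp add: frac_le)
  show "\<bar>1 / max r \<delta> - 1 / max t \<delta>\<bar> \<le> 1 / \<delta>\<^sup>2 * \<bar>r - t\<bar>" for r t
  proof -
    have p: "max r \<delta> > 0" "max t \<delta> > 0" using assms by auto
    have "\<bar>1 / max r \<delta> - 1 / max t \<delta>\<bar> = \<bar>max t \<delta> - max r \<delta>\<bar> / (max r \<delta> * max t \<delta>)"
      using p by (simp add: diff_frac_eq abs_divide abs_mult)
    also have "\<dots> \<le> \<bar>r - t\<bar> / (\<delta> * \<delta>)"
      using assms p by (intro frac_le mult_mono) auto
    finally show ?thesis by (simp add: power2_eq_square)
  qed
qed simp

text \<open>The product rule for the function \<open>T\<close> of \<open>morawetz_identity\<close>, multiplied by a cutoff \<open>\<theta>\<close>; \<open>q\<close> stands for \<open>1/r\<close>,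
  \<open>S\<close> for \<open>|u|\<^sup>2\<close>, \<open>Y\<close> for \<open>Re (u cnj Z)\<close>.\<close>

lemma bracket_has_derivative:
  fixes \<theta> m q \<Phi> g S Y :: "'a::real_normed_vector \<Rightarrow> real"
  assumes "(\<theta> has_derivative d\<theta>) (at x)" "(m has_derivative dm) (at x)" "(q has_derivative dq) (at x)"
    "(\<Phi> has_derivative d\<Phi>) (at x)" "(g has_derivative dg) (at x)" "(S has_derivative dS) (at x)" "(Y has_derivative dY) (at x)"
  shows "((\<lambda>x. \<theta> x * (m x * (1/2 * g x) - N/2 * (q x * q x * (m x * S x)) - \<tau> * (q x * \<Phi> x * (m x * Y x))
            - 1/2 * ((l + t * (\<Phi> x * \<Phi> x)) * (m x * S x)))) has_derivative
     (\<lambda>h. d\<theta> h * (m x * (1/2 * g x) - N/2 * (q x * q x * (m x * S x)) - \<tau> * (q x * \<Phi> x * (m x * Y x))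
            - 1/2 * ((l + t * (\<Phi> x * \<Phi> x)) * (m x * S x)))
        + \<theta> x * (1/2 * (dm h * g x + m x * dg h) - N/2 * (2 * q x * dq h * m x * S x + q x * q x * (dm h * S x + m x * dS h))
            - \<tau> * ((dq h * \<Phi> x + q x * d\<Phi> h) * m x * Y x + q x * \<Phi> x * (dm h * Y x + m x * dY h))
            - (t * \<Phi> x * d\<Phi> h * m x * S x + 1/2 * (l + t * (\<Phi> x * \<Phi> x)) * (dm h * S x + m x * dS h))))) (at x)"
  by (rule has_derivative_eq_rhs, (rule derivative_intros assms)+) (simp add: fun_eq_iff algebra_simps)

lemma weak_grad_test:
  fixes u :: "'a::euclidean_space \<Rightarrow> complex"
  assumes u: "test_function u"
  shows "weak_grad u (\<lambda>b. pderiv_dir b u)"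
proof -
  have "has_weak_partial b u (pderiv_dir b u)" if b: "b \<in> Basis" for b
  proof (rule has_weak_partial_L2I[OF test_function_L2[OF u] test_function_L2[OF test_function_pderiv[OF u b]]])
    fix \<eta> :: "'a \<Rightarrow> complex" assume \<eta>: "test_function \<eta>"
    note sm = test_function_smooth[OF u] test_function_smooth[OF \<eta>]
    have t: "test_function (\<lambda>x. u x * \<eta> x)" by (rule test_function_mult[OF sm(1) \<eta>])
    obtain R where R: "\<And>x. norm x > R \<Longrightarrow> u x * \<eta> x = 0" using test_functionE[OF t] by blast
    have d: "AE x in lebesgue. ((\<lambda>x. u x * \<eta> x) has_derivative frechet_derivative (\<lambda>x. u x * \<eta> x) (at x)) (at x)"
      using smooth_fun_differentiable[OF test_function_smooth[OF t]] by (simp flip: frechet_derivative_works)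
    have "(LINT x|lebesgue. pderiv_dir b (\<lambda>x. u x * \<eta> x) x) = 0"
      using integral_derivative_compact_support(3)[OF test_function_lip_bdd[OF t] R d, where b = b]
      by (simp add: pderiv_dir_def)
    then have z: "(LINT x|lebesgue. u x * pderiv_dir b \<eta> x + pderiv_dir b u x * \<eta> x) = 0"
      by (simp add: pderiv_dir_mult[OF sm])
    have i: "integrable lebesgue (\<lambda>x. u x * pderiv_dir b \<eta> x)" "integrable lebesgue (\<lambda>x. pderiv_dir b u x * \<eta> x)"
      by (intro integrable_L2_mult test_function_L2 test_function_pderiv u \<eta> b)+
    show "(LINT x|lebesgue. u x * pderiv_dir b \<eta> x) = - (LINT x|lebesgue. pderiv_dir b u x * \<eta> x)"
      using z unfolding Bochner_Integration.integral_add[OF i] by (simp add: add_eq_0_iff)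
  qed
  then show ?thesis using u by (simp add: weak_grad_def test_function_L2 test_function_pderiv)
qed

lemma Re_mult_cnj_self: "Re (z * cnj z) = (cmod z)\<^sup>2"
  unfolding cmod_power2 by (simp add: power2_eq_square)

locale radial_bump = bump \<psi> + radial_weights m m' \<Phi> \<Phi>' W A lam \<tau> Bm Lm B\<Phi> L\<Phi> BW N
  for \<psi> :: "'a::euclidean_space \<Rightarrow> complex" and m m' \<Phi> \<Phi>' W A lam \<tau> Bm Lm B\<Phi> L\<Phi> BW N +
  assumes N_def: "N = (real DIM('a) - 1) / 2"
begin

lemma lip_m: "lip_bdd (\<lambda>x::'a. m (norm x))"
  by (rule lip_bdd_radial[where B = Bm and L = Lm]) (use m_nonneg m_le m_lip Lm_nonneg in auto)

lemma lip_Phi: "lip_bdd (\<lambda>x::'a. \<Phi> (norm x))"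
  by (rule lip_bdd_radial[where B = B\<Phi> and L = L\<Phi>]) (use Phi_pos Phi_le Phi_lip L\<Phi>_nonneg in \<open>auto simp: abs_of_pos\<close>)

lemma deriv_m:
  fixes x :: 'a assumes "x \<noteq> 0" "norm x \<noteq> A"
  shows "((\<lambda>x. m (norm x)) has_derivative (\<lambda>h. m' (norm x) * (x \<bullet> h) / norm x)) (at x)"
  by (rule radial_has_derivative[OF m_deriv]) (use assms in auto)

lemma deriv_Phi:
  fixes x :: 'a assumes "x \<noteq> 0" "norm x \<noteq> A"
  shows "((\<lambda>x. \<Phi> (norm x)) has_derivative (\<lambda>h. \<Phi>' (norm x) * (x \<bullet> h) / norm x)) (at x)"
  by (rule radial_has_derivative[OF Phi_deriv]) (use assms in auto)

text \<open>The coordinate is unbounded and \<open>m\<close> is only known to decay like \<open>1/r\<close>; splitting the increment at the point closer to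
  the origin leaves the quantity controlled by \<open>rm_lip\<close>.\<close>

lemma lip_m_coord:
  assumes c: "c \<in> Basis"
  shows "lip_bdd (\<lambda>x::'a. m (norm x) * (x \<bullet> c))"
proof -
  have bc: "\<bar>x \<bullet> c\<bar> \<le> norm x" for x :: 'a using Basis_le_norm[OF c] by blast
  have main: "\<bar>m (norm x) * (x \<bullet> c) - m (norm y) * (y \<bullet> c)\<bar> \<le> (Bm + Lm) * norm (x - y)" if "norm y \<le> norm x" for x y :: 'a
  proof -
    have "m (norm x) * (x \<bullet> c) - m (norm y) * (y \<bullet> c) = m (norm x) * ((x - y) \<bullet> c) + (m (norm x) - m (norm y)) * (y \<bullet> c)"
      by (simp add: algebra_simps inner_diff_left)
    also have "\<bar>\<dots>\<bar> \<le> \<bar>m (norm x)\<bar> * \<bar>(x - y) \<bullet> c\<bar> + \<bar>m (norm x) - m (norm y)\<bar> * \<bar>y \<bullet> c\<bar>"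
      by (rule order_trans[OF abs_triangle_ineq]) (simp add: abs_mult)
    also have "\<dots> \<le> Bm * norm (x - y) + norm y * \<bar>m (norm x) - m (norm y)\<bar>"
    proof (rule add_mono)
      show "\<bar>m (norm x)\<bar> * \<bar>(x - y) \<bullet> c\<bar> \<le> Bm * norm (x - y)"
        using m_nonneg[of "norm x"] m_le[of "norm x"] bc Bm_nonneg by (intro mult_mono) auto
      show "\<bar>m (norm x) - m (norm y)\<bar> * \<bar>y \<bullet> c\<bar> \<le> norm y * \<bar>m (norm x) - m (norm y)\<bar>"
        using bc[of y] by (subst mult.commute) (rule mult_right_mono, auto)
    qed
    also have "\<dots> \<le> Bm * norm (x - y) + Lm * norm (x - y)"
    proof -
      have "norm y * \<bar>m (norm x) - m (norm y)\<bar> \<le> Lm * \<bar>norm x - norm y\<bar>"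
        using rm_lip[of "norm y" "norm x"] that by simp
      also have "\<dots> \<le> Lm * norm (x - y)" by (intro mult_left_mono norm_triangle_ineq3 Lm_nonneg)
      finally show ?thesis by simp
    qed
    finally show ?thesis by (simp add: algebra_simps)
  qed
  show ?thesis
  proof (rule lip_bddI)
    show "norm (m (norm x) * (x \<bullet> c)) \<le> Bm" for x :: 'a
    proof -
      have "\<bar>m (norm x) * (x \<bullet> c)\<bar> \<le> m (norm x) * norm x"
        using bc[of x] m_nonneg[of "norm x"] by (simp add: abs_mult mult_left_mono)
      also have "\<dots> \<le> Bm" using rm_le[of "norm x"] by (simp add: mult.commute)
      finally show ?thesis by simp
    qed
    show "norm (m (norm x) * (x \<bullet> c) - m (norm y) * (y \<bullet> c)) \<le> (Bm + Lm) * norm (x - y)" for x y :: 'a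
      using main[of x y] main[of y x] by (cases "norm y \<le> norm x") (auto simp: norm_minus_commute abs_minus_commute)
  qed
qed

lemma weak_grad_Mul:
  fixes f :: "'a \<Rightarrow> complex"
  assumes fg: "weak_grad f g" and gh: "\<And>b. b \<in> Basis \<Longrightarrow> weak_grad (g b) (h b)"
  shows "weak_grad (Mul f g) (dMul f g h)"
proof -
  let ?w = "\<lambda>c x::'a. complex_of_real (m (norm x) * (x \<bullet> c))"
  let ?w' = "\<lambda>c (x::'a) h. complex_of_real (m (norm x) * (h \<bullet> c) + m' (norm x) * (x \<bullet> h) / norm x * (x \<bullet> c))"
  have lw: "lip_bdd (?w c)" if "c \<in> Basis" for c by (rule lip_bdd_of_real[OF lip_m_coord[OF that]])
  have dw: "AE x in lebesgue. (?w c has_derivative ?w' c x) (at x)" for c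
    by (rule AE_radial[of "{A}"]) (auto intro!: derivative_eq_intros deriv_m)
  let ?k = "\<lambda>x::'a. complex_of_real (N * m (norm x))"
  let ?k' = "\<lambda>(x::'a) h. complex_of_real (N * (m' (norm x) * (x \<bullet> h) / norm x))"
  have lk: "lip_bdd ?k" by (intro lip_bdd_of_real lip_bdd_mult lip_bdd_const lip_m)
  have dk: "AE x in lebesgue. (?k has_derivative ?k' x) (at x)"
    by (rule AE_radial[of "{A}"]) (auto intro!: derivative_eq_intros deriv_m)
  have "weak_grad (\<lambda>x. (\<Sum>c\<in>Basis. ?w c x * g c x) + ?k x * f x)
     (\<lambda>b x. (\<Sum>c\<in>Basis. ?w c x * h c b x + ?w' c x b * g c x) + (?k x * g b x + ?k' x b * f x))"
    by (rule weak_grad_add[OF weak_grad_sum[OF weak_grad_lip_mult[OF gh lw dw]] weak_grad_lip_mult[OF fg lk dk]])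
  then show ?thesis
    by (rule weak_grad_cong) (auto simp: Mul_def dMul_def fun_eq_iff)
qed

lemma dphase_measurable: "(\<lambda>x::'a. complex_of_real (\<tau> * dphase x b)) \<in> borel_measurable lebesgue"
proof -
  have [measurable]: "(\<lambda>x::'a. \<Phi> (norm x)) \<in> borel_measurable borel"
    by (rule borel_measurable_continuous_onI[OF lip_bdd_continuous[OF lip_Phi]])
  have "(\<lambda>x::'a. complex_of_real (\<tau> * dphase x b)) \<in> borel_measurable borel"
    unfolding dphase_def by measurable
  then show ?thesis by (intro measurable_completion) simp
qed

lemma dphase_bound:
  assumes "b \<in> Basis"
  shows "\<bar>dphase (x::'a) b\<bar> \<le> B\<Phi>"
proof -
  have "\<bar>dphase x b\<bar> = \<Phi> (norm x) * (\<bar>x \<bullet> b\<bar> / norm x)"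
    using Phi_pos[of "norm x"] by (simp add: dphase_def abs_mult)
  also have "\<dots> \<le> B\<Phi> * 1"
    using Phi_pos[of "norm x"] Phi_le[of "norm x"] Basis_le_norm[OF assms, of x] B\<Phi>_pos
    by (intro mult_mono) (auto simp: divide_le_eq)
  finally show ?thesis by simp
qed

lemma L2_dphase_mult:
  assumes "L2_fun f" "b \<in> Basis"
  shows "L2_fun (\<lambda>x::'a. of_real (\<tau> * dphase x b) * f x)"
proof (rule L2_fun_bounded_mult[OF assms(1) dphase_measurable])
  show "cmod (complex_of_real (\<tau> * dphase x b)) \<le> \<tau> * B\<Phi>" for x
    using dphase_bound[OF assms(2), of x] tau_pos by (simp add: abs_mult mult_left_mono del: of_real_mult)
qed

lemma L2_lim_dphase_mult:
  assumes "L2_lim F f" "b \<in> Basis"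
  shows "L2_lim (\<lambda>n x::'a. of_real (\<tau> * dphase x b) * F n x) (\<lambda>x. of_real (\<tau> * dphase x b) * f x)"
proof (rule L2_lim_bounded_mult[OF assms(1) dphase_measurable])
  show "cmod (complex_of_real (\<tau> * dphase x b)) \<le> \<tau> * B\<Phi>" for x
    using dphase_bound[OF assms(2), of x] tau_pos by (simp add: abs_mult mult_left_mono del: of_real_mult)
qed

lemma integrable_Form:
  assumes fg: "weak_grad f g" and gh: "\<And>b. b \<in> Basis \<Longrightarrow> weak_grad (g b) (h b)"
  shows "integrable lebesgue (Form f g h :: 'a \<Rightarrow> complex)"
proof -
  note M = weak_gradD[OF weak_grad_Mul[OF fg gh]] and F = weak_gradD[OF fg]
  show ?thesis unfolding Form_def[abs_def]
    by (intro Bochner_Integration.integrable_diff Bochner_Integration.integrable_sum integrable_mult_right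
         integrable_L2_mult L2_fun_diff L2_fun_add L2_dphase_mult L2_fun_cnj M F)
qed

lemma W_measurable: "(\<lambda>x::'a. W (norm x)) \<in> borel_measurable lebesgue"
  by (intro continuous_lebesgue_measurable continuous_on_compose2[OF W_cont] continuous_intros) auto

lemma integrable_W:
  assumes "L2_fun (f :: 'a \<Rightarrow> complex)"
  shows "integrable lebesgue (\<lambda>x. W (norm x) * (cmod (f x))\<^sup>2)"
proof (rule Bochner_Integration.integrable_bound)
  show "integrable lebesgue (\<lambda>x. BW * (cmod (f x))\<^sup>2)" using L2_fun_integrable[OF assms] by simp
  show "(\<lambda>x. W (norm x) * (cmod (f x))\<^sup>2) \<in> borel_measurable lebesgue"
    using W_measurable L2_fun_measurable[OF assms] by measurable
  show "AE x in lebesgue. norm (W (norm x) * (cmod (f x))\<^sup>2) \<le> norm (BW * (cmod (f x))\<^sup>2)"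
    using W_bound by (intro AE_I2) (auto simp: abs_mult intro!: mult_right_mono order_trans[OF W_bound abs_ge_self])
qed

end

context radial_bump
begin

text \<open>Multiply the pointwise inequality by \<open>ramp \<delta>\<close> and integrate; the divergence integrates to zero except
  for the term with the derivative of the cutoff.  That term lives on the shell \<open>\<delta> < r < 2 \<delta>\<close>.  If \<open>d \<ge> 3\<close>, it is of size
  \<open>1 / \<delta>\<^sup>2\<close> on a set of volume at most a multiple of \<open>\<delta>\<^sup>3\<close>; otherwise \<open>u\<close> vanishes on the shell.\<close>

lemma morawetz_cutoff:
  fixes u :: "'a \<Rightarrow> complex" and v :: "'a \<Rightarrow> real"
  assumes u: "test_function u" and origin: "N \<ge> 1 \<or> (\<forall>x. norm x < 1/2 \<longrightarrow> u x = 0)"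
    and v: "\<And>x. v x \<ge> 0" "L2_fun (\<lambda>x. complex_of_real (v x))"
    and vi: "integrable lebesgue (\<lambda>x. norm x * m (norm x) / \<Phi> (norm x) * (v x)\<^sup>2)"
  defines "P \<equiv> \<lambda>b. pderiv_dir b u" and "H \<equiv> \<lambda>c b. pderiv_dir b (pderiv_dir c u)"
  defines "L \<equiv> \<lambda>x. W (norm x) * (cmod (u x))\<^sup>2 + v x * cmod (Mul u P x) - norm x * m (norm x) / (4 * \<tau> * \<Phi> (norm x)) * (v x)\<^sup>2"
  shows "integrable lebesgue L"
    and "\<exists>C. \<forall>\<delta>. 0 < \<delta> \<longrightarrow> \<delta> \<le> 1/4 \<longrightarrow>
      (LINT x|lebesgue. ramp \<delta> (norm x) * L x) \<le> (LINT x|lebesgue. ramp \<delta> (norm x) * Re (Form u P H x)) + C * \<delta>"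
proof -
  obtain R where R: "R > 0" "\<And>x. norm x > R \<Longrightarrow> u x = 0" using test_functionE[OF u] by blast
  have tP: "test_function (P b)" if "b \<in> Basis" for b unfolding P_def by (rule test_function_pderiv[OF u that])
  have tH: "test_function (H c b)" if "c \<in> Basis" "b \<in> Basis" for b c
    unfolding H_def by (intro test_function_pderiv u that)
  have RP: "P b x = 0" if "norm x > R" for b x unfolding P_def by (rule pderiv_dir_zero_outside[OF R(2) that])
  have wu: "weak_grad u P" unfolding P_def by (rule weak_grad_test[OF u])
  have wP: "weak_grad (P b) (H b)" if "b \<in> Basis" for b
    using weak_grad_test[OF tP[OF that]] unfolding H_def P_def by simp
  have LM: "L2_fun (Mul u P)" using weak_gradD(1)[OF weak_grad_Mul[OF wu wP]] .
  have iF: "integrable lebesgue (Form u P H)" by (rule integrable_Form[OF wu wP])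
  have vi': "integrable lebesgue (\<lambda>x. norm x * m (norm x) / (4 * \<tau> * \<Phi> (norm x)) * (v x)\<^sup>2)"
  proof -
    have "integrable lebesgue (\<lambda>x. (1 / (4 * \<tau>)) * (norm x * m (norm x) / \<Phi> (norm x) * (v x)\<^sup>2))"
      using vi by (rule integrable_mult_right)
    then show ?thesis by (simp add: mult_ac)
  qed
  have ivM: "integrable lebesgue (\<lambda>x. v x * cmod (Mul u P x))"
    using integrable_L2_mult_norm[OF v(2) LM] v(1) by simp
  show iL: "integrable lebesgue L" unfolding L_def
    by (intro Bochner_Integration.integrable_diff Bochner_Integration.integrable_add integrable_W test_function_L2 u ivM vi')
  define Ef where "Ef x = (\<Sum>c\<in>Basis. (x \<bullet> c) *\<^sub>R P c x)" for x
  define Zf where "Zf x = Ef x + of_real N * u x" for x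
  define Sf where "Sf x = Re (u x * cnj (u x))" for x
  define gf where "gf x = (\<Sum>b\<in>Basis. Re (P b x * cnj (P b x)))" for x
  define Yf where "Yf x = Re (u x * cnj (Zf x))" for x
  define Hf where "Hf x b = (\<Sum>c\<in>Basis. (x \<bullet> c) *\<^sub>R H c b x)" for x b
  note lu = test_function_lip_bdd[OF u] and lP = test_function_lip_bdd[OF tP]
  have lE: "lip_bdd Ef" unfolding Ef_def by (intro lip_bdd_sum lip_bdd_mult_coord[OF lP RP])
  have lZ: "lip_bdd Zf" unfolding Zf_def by (intro lip_bdd_add lip_bdd_mult lip_bdd_const lE lu)
  have lS: "lip_bdd Sf" unfolding Sf_def by (intro lip_bdd_Re lip_bdd_mult lip_bdd_cnj lu)
  have lg: "lip_bdd gf" unfolding gf_def by (intro lip_bdd_sum lip_bdd_Re lip_bdd_mult lip_bdd_cnj lP)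
  have lY: "lip_bdd Yf" unfolding Yf_def by (intro lip_bdd_Re lip_bdd_mult lip_bdd_cnj lu lZ)
  obtain BS where BS: "BS \<ge> 0" "\<And>x. \<bar>Sf x\<bar> \<le> BS" using lip_bddE[OF lS] by (metis real_norm_def)
  obtain Bg where Bg: "Bg \<ge> 0" "\<And>x. \<bar>gf x\<bar> \<le> Bg" using lip_bddE[OF lg] by (metis real_norm_def)
  obtain BY where BY: "BY \<ge> 0" "\<And>x. \<bar>Yf x\<bar> \<le> BY" using lip_bddE[OF lY] by (metis real_norm_def)
  define CT where "CT = Bm * Bg + N * (Bm * BS) + \<tau> * (B\<Phi> * (Bm * BY)) + (lam\<^sup>2 + \<tau>\<^sup>2 * (B\<Phi> * B\<Phi>)) * (Bm * BS)"
  have CT: "CT \<ge> 0" unfolding CT_def using Bm_nonneg BS(1) Bg(1) BY(1) B\<Phi>_pos N_nonneg tau_pos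
    by (intro add_nonneg_nonneg mult_nonneg_nonneg) auto
  \<comment> \<open>\<open>Tr\<close> is the radial flux \<open>T\<close> of \<open>morawetz_identity\<close>, with a singularity \<open>1/r\<^sup>2\<close> at the origin;
    \<open>T\<close> below is its cutoff\<close>
  define Tr where "Tr x = m (norm x) * (1/2 * gf x) - N/2 * (1 / norm x * (1 / norm x) * (m (norm x) * Sf x))
      - \<tau> * (1 / norm x * \<Phi> (norm x) * (m (norm x) * Yf x))
      - 1/2 * ((lam\<^sup>2 + \<tau>\<^sup>2 * (\<Phi> (norm x) * \<Phi> (norm x))) * (m (norm x) * Sf x))" for x
  have Tr_bound: "\<bar>Tr x\<bar> * (norm x)\<^sup>2 \<le> CT" if x: "x \<noteq> 0" "norm x \<le> 1" for x
  proof -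
    let ?r = "norm x"
    have r: "0 < ?r" "?r \<le> 1" using x by auto
    have r2: "?r * ?r \<le> 1" using r by (simp add: mult_le_one)
    have mr: "0 \<le> m ?r" "m ?r \<le> Bm" using m_nonneg m_le by auto
    have Pr: "0 \<le> \<Phi> ?r" "\<Phi> ?r \<le> B\<Phi>" using Phi_pos[of ?r] Phi_le[of ?r] by auto
    have mS: "m ?r * \<bar>Sf x\<bar> \<le> Bm * BS" using mr BS Bm_nonneg by (intro mult_mono) auto
    have mS0: "0 \<le> m ?r * \<bar>Sf x\<bar>" using mr by simp
    have PP: "\<Phi> ?r * \<Phi> ?r \<le> B\<Phi> * B\<Phi>" using Pr by (intro mult_mono) auto
    have e: "Tr x * ?r\<^sup>2 = m ?r * (1/2 * gf x) * (?r * ?r) - N/2 * (m ?r * Sf x)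
      - \<tau> * (?r * \<Phi> ?r * (m ?r * Yf x)) - 1/2 * ((lam\<^sup>2 + \<tau>\<^sup>2 * (\<Phi> ?r * \<Phi> ?r)) * (m ?r * Sf x)) * (?r * ?r)"
      using r by (simp add: Tr_def field_simps power2_eq_square)
    have "\<bar>Tr x\<bar> * ?r\<^sup>2 = \<bar>Tr x * ?r\<^sup>2\<bar>" by (simp add: abs_mult)
    also have "\<dots> \<le> \<bar>m ?r * (1/2 * gf x) * (?r * ?r)\<bar> + \<bar>N/2 * (m ?r * Sf x)\<bar>
      + \<bar>\<tau> * (?r * \<Phi> ?r * (m ?r * Yf x))\<bar> + \<bar>1/2 * ((lam\<^sup>2 + \<tau>\<^sup>2 * (\<Phi> ?r * \<Phi> ?r)) * (m ?r * Sf x)) * (?r * ?r)\<bar>"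
      unfolding e by linarith
    also have "\<dots> \<le> Bm * Bg + N * (Bm * BS) + \<tau> * (B\<Phi> * (Bm * BY)) + (lam\<^sup>2 + \<tau>\<^sup>2 * (B\<Phi> * B\<Phi>)) * (Bm * BS)"
    proof (intro add_mono)
      have "\<bar>m ?r * (1/2 * gf x) * (?r * ?r)\<bar> = m ?r * (1/2 * \<bar>gf x\<bar>) * (?r * ?r)"
        using mr r by (simp add: abs_mult)
      also have "\<dots> \<le> Bm * Bg * 1"
        using mr Bg(2)[of x] Bg(1) r r2 Bm_nonneg by (intro mult_mono) auto
      finally show "\<bar>m ?r * (1/2 * gf x) * (?r * ?r)\<bar> \<le> Bm * Bg" by simp
      have "\<bar>N/2 * (m ?r * Sf x)\<bar> = N/2 * (m ?r * \<bar>Sf x\<bar>)" using mr N_nonneg by (simp add: abs_mult)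
      also have "\<dots> \<le> N * (Bm * BS)" using N_nonneg by (intro mult_mono[OF _ mS] mS0) auto
      finally show "\<bar>N/2 * (m ?r * Sf x)\<bar> \<le> N * (Bm * BS)" .
      have "\<bar>\<tau> * (?r * \<Phi> ?r * (m ?r * Yf x))\<bar> = \<tau> * (?r * \<Phi> ?r * (m ?r * \<bar>Yf x\<bar>))"
        using mr Pr tau_pos r by (simp add: abs_mult)
      also have "\<dots> \<le> \<tau> * (1 * B\<Phi> * (Bm * BY))"
        using mr Pr BY(1) BY(2)[of x] r Bm_nonneg B\<Phi>_pos tau_pos by (intro mult_mono mult_left_mono) auto
      finally show "\<bar>\<tau> * (?r * \<Phi> ?r * (m ?r * Yf x))\<bar> \<le> \<tau> * (B\<Phi> * (Bm * BY))" by simp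
      have "\<bar>1/2 * ((lam\<^sup>2 + \<tau>\<^sup>2 * (\<Phi> ?r * \<Phi> ?r)) * (m ?r * Sf x)) * (?r * ?r)\<bar>
         = 1/2 * ((lam\<^sup>2 + \<tau>\<^sup>2 * (\<Phi> ?r * \<Phi> ?r)) * (m ?r * \<bar>Sf x\<bar>)) * (?r * ?r)"
        using mr Pr r by (simp add: abs_mult)
      also have "\<dots> \<le> 1 * ((lam\<^sup>2 + \<tau>\<^sup>2 * (B\<Phi> * B\<Phi>)) * (Bm * BS)) * 1"
        using mr BS(2)[of x] PP Pr r r2 BS(1) Bm_nonneg B\<Phi>_pos
        by (intro mult_mono add_mono mult_left_mono) (auto intro!: mult_nonneg_nonneg add_nonneg_nonneg)
      finally show "\<bar>1/2 * ((lam\<^sup>2 + \<tau>\<^sup>2 * (\<Phi> ?r * \<Phi> ?r)) * (m ?r * Sf x)) * (?r * ?r)\<bar>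
        \<le> (lam\<^sup>2 + \<tau>\<^sup>2 * (B\<Phi> * B\<Phi>)) * (Bm * BS)" by simp
    qed
    finally show ?thesis by (simp add: CT_def)
  qed
  define d where "d = DIM('a)"
  have dN: "real d = 2 * N + 1" using N_def by (simp add: d_def)
  define C where "C = (if N \<ge> 1 then CT * (unit_ball_vol (real d) * 2 ^ d) else 0)"
  have main: "(LINT x|lebesgue. ramp \<delta> (norm x) * L x) \<le> (LINT x|lebesgue. ramp \<delta> (norm x) * Re (Form u P H x)) + C * \<delta>"
    if \<delta>: "0 < \<delta>" "\<delta> \<le> 1/4" for \<delta>
  proof -
    define T where "T x = ramp \<delta> (norm x) * (m (norm x) * (1/2 * gf x)
        - N/2 * (1 / max (norm x) \<delta> * (1 / max (norm x) \<delta>) * (m (norm x) * Sf x))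
        - \<tau> * (1 / max (norm x) \<delta> * \<Phi> (norm x) * (m (norm x) * Yf x))
        - 1/2 * ((lam\<^sup>2 + \<tau>\<^sup>2 * (\<Phi> (norm x) * \<Phi> (norm x))) * (m (norm x) * Sf x)))" for x
    note lr = lip_bdd_ramp[OF \<delta>(1), where 'a = 'a] and lq = lip_bdd_inverse_max[OF \<delta>(1), where 'a = 'a]
    have lT: "lip_bdd T" unfolding T_def
      by (intro lip_bdd_mult lip_bdd_diff lip_bdd_add lip_bdd_const lr lq lip_m lip_Phi lg lS lY)
    have T0: "T x = 0" if "norm x > R" for x
      using R(2)[OF that] RP[OF that] by (simp add: T_def gf_def Sf_def Yf_def)
    \<comment> \<open>the radii where \<open>m\<close>, \<open>\<Phi>\<close> or the cutoff may fail to be differentiable\<close>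
    define exc where "exc = {A, \<delta>, 2 * \<delta>}"
    have good: "\<exists>D. (T has_derivative D) (at x) \<and>
        ramp \<delta> (norm x) * L x \<le> ramp \<delta> (norm x) * Re (Form u P H x) - (real d * T x + D x) + ramp' \<delta> (norm x) * norm x * Tr x"
      if x: "norm x \<notin> exc" "x \<noteq> 0" for x
    proof (cases "norm x < \<delta>")
      case True
      have "(T has_derivative (\<lambda>h. 0)) (at x)"
      proof (rule has_derivative_transform_within_open[of "\<lambda>x. 0" _ _ _ "ball 0 \<delta>"])
        show "\<And>y. y \<in> ball 0 \<delta> \<Longrightarrow> 0 = T y" using \<delta>(1) by (simp add: T_def ramp_zero)
      qed (use True in auto)
      moreover have "T x = 0" "ramp \<delta> (norm x) = 0" "ramp' \<delta> (norm x) = 0"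
        using True \<delta>(1) by (simp_all add: T_def ramp_zero ramp'_def)
      ultimately show ?thesis by (intro exI[of _ "\<lambda>h. 0"]) simp
    next
      case False
      define r where "r = norm x"
      have r: "r > \<delta>" "r > 0" "r \<noteq> A" "r \<noteq> 2 * \<delta>" using False x \<delta>(1) by (auto simp: exc_def r_def)
      define U E Q where "U = u x" and "E = Ef x" and "Q = (\<Sum>b\<in>Basis. (x \<bullet> b) *\<^sub>R Hf x b)"
      define Z where "Z = E + of_real N * U"
      have xx: "x \<bullet> x / r = r" using r(2) by (simp add: r_def power2_norm_eq_inner[symmetric] power2_eq_square)
      \<comment> \<open>derivatives at \<open>x\<close>; only their value in the radial direction matters\<close>
      note Dm = deriv_m[OF x(2) r(3)[unfolded r_def]] and DPhi = deriv_Phi[OF x(2) r(3)[unfolded r_def]]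
      have Dr: "((\<lambda>x. ramp \<delta> (norm x)) has_derivative (\<lambda>h. ramp' \<delta> r * (x \<bullet> h) / norm x)) (at x)"
        unfolding r_def by (rule radial_has_derivative[OF ramp_deriv]) (use \<delta> r x in \<open>auto simp: r_def\<close>)
      have Dq: "((\<lambda>x. 1 / max (norm x) \<delta>) has_derivative (\<lambda>h. - (1 / r\<^sup>2) * (x \<bullet> h) / norm x)) (at x)"
      proof (rule radial_has_derivative[OF _ x(2)])
        show "((\<lambda>t. 1 / max t \<delta>) has_real_derivative - (1 / r\<^sup>2)) (at (norm x))"
        proof (rule has_field_derivative_transform_within_open[where S = "{\<delta><..}" and f = "\<lambda>t. 1 / t"])
          show "((\<lambda>t. 1 / t) has_real_derivative - (1 / r\<^sup>2)) (at (norm x))"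
            using r by (auto intro!: derivative_eq_intros simp: r_def power2_eq_square)
        qed (use r in \<open>auto simp: r_def max_def\<close>)
      qed
      define du where "du h = (\<Sum>b\<in>Basis. (h \<bullet> b) *\<^sub>R P b x)" for h
      define dP where "dP c h = (\<Sum>b\<in>Basis. (h \<bullet> b) *\<^sub>R H c b x)" for c h
      have Du: "(u has_derivative du) (at x)"
        unfolding du_def[abs_def] P_def by (rule smooth_fun_has_derivative[OF test_function_smooth[OF u]])
      have DP: "(P c has_derivative dP c) (at x)" if "c \<in> Basis" for c
        using smooth_fun_has_derivative[OF test_function_smooth[OF tP[OF that]], of x]
        unfolding dP_def[abs_def] H_def P_def .
      have dux: "du x = E" by (simp add: du_def E_def Ef_def)
      have sym: "H c b x = H b c x" if "b \<in> Basis" "c \<in> Basis" for b c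
        unfolding H_def by (rule pderiv_dir_symmetric[OF u that(2,1)])
      have dPx: "dP b x = Hf x b" if "b \<in> Basis" for b
        unfolding dP_def Hf_def by (rule sum.cong[OF refl]) (simp add: sym[OF that])
      define dE where "dE h = (\<Sum>c\<in>Basis. (x \<bullet> c) *\<^sub>R dP c h + (h \<bullet> c) *\<^sub>R P c x)" for h
      have DE: "(Ef has_derivative dE) (at x)"
        unfolding Ef_def[abs_def] dE_def[abs_def]
        by (intro has_derivative_sum has_derivative_scaleR DP has_derivative_inner_left has_derivative_ident)
      have dEx: "dE x = Q + E" by (simp add: dE_def sum.distrib dPx Q_def E_def Ef_def)
      define dZ where "dZ h = dE h + of_real N * du h" for h
      have DZ: "(Zf has_derivative dZ) (at x)"
        unfolding Zf_def[abs_def] dZ_def[abs_def] by (intro has_derivative_add has_derivative_mult_right DE Du)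
      define dS where "dS h = Re (u x * cnj (du h) + du h * cnj (u x))" for h
      have DS: "(Sf has_derivative dS) (at x)" unfolding Sf_def[abs_def] dS_def[abs_def]
        by (intro has_derivative_Re has_derivative_mult has_derivative_cnj Du)
      define dg where "dg h = (\<Sum>b\<in>Basis. Re (P b x * cnj (dP b h) + dP b h * cnj (P b x)))" for h
      have Dg: "(gf has_derivative dg) (at x)" unfolding gf_def[abs_def] dg_def[abs_def]
        by (intro has_derivative_sum has_derivative_Re has_derivative_mult has_derivative_cnj DP)
      define dY where "dY h = Re (u x * cnj (dZ h) + du h * cnj (Zf x))" for h
      have DY: "(Yf has_derivative dY) (at x)" unfolding Yf_def[abs_def] dY_def[abs_def]
        by (intro has_derivative_Re has_derivative_mult has_derivative_cnj Du DZ)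
      define G2 where "G2 = (\<Sum>b\<in>Basis. Re (P b x * cnj (Hf x b)))"
      have dgx: "dg x = 2 * G2" unfolding dg_def G2_def sum_distrib_left
        by (rule sum.cong[OF refl]) (simp add: dPx algebra_simps)
      have dSx: "dS x = 2 * Re (E * cnj U)" by (simp add: dS_def dux U_def algebra_simps)
      have Zx: "Zf x = Z" by (simp add: Zf_def Z_def E_def U_def)
      have dYx: "dY x = Re (E * cnj Z + U * cnj (E + Q + of_real N * E))"
        by (simp add: dY_def dZ_def dEx dux Zx U_def algebra_simps)
      have gx: "gf x = (\<Sum>b\<in>Basis. (cmod (P b x))\<^sup>2)" unfolding gf_def Re_mult_cnj_self ..
      have Sx: "Sf x = (cmod U)\<^sup>2" unfolding Sf_def Re_mult_cnj_self U_def ..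
      have Yx: "Yf x = Re (U * cnj Z)" by (simp add: Yf_def Zx U_def)
      have qx: "1 / max (norm x) \<delta> = 1 / r" using r by (simp add: r_def max_def)
      let ?M = "m r" and ?M' = "m' r" and ?P = "\<Phi> r" and ?P' = "\<Phi>' r" and ?th = "ramp \<delta> r" and ?g = "gf x"
      define ET where "ET = 1/2 * ?M' * r * ?g + ?M * G2 - N/2 * (?M' * r * (cmod U)\<^sup>2 / r\<^sup>2 - 2 * ?M * (cmod U)\<^sup>2 / r\<^sup>2 + 2 * ?M * Re (E * cnj U) / r\<^sup>2)
        - \<tau> * ((?P' - ?P / r) * ?M + ?P / r * ?M' * r) * Re (U * cnj Z)
        - \<tau> * ?P / r * ?M * Re (E * cnj Z + U * cnj (E + Q + of_real N * E))
        - \<tau>\<^sup>2 * ?P * ?P' * r * ?M * (cmod U)\<^sup>2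
        - 1/2 * (lam\<^sup>2 + \<tau>\<^sup>2 * ?P\<^sup>2) * (?M' * r * (cmod U)\<^sup>2 + 2 * ?M * Re (E * cnj U))"
      have Trx: "Tr x = 1/2 * ?M * ?g - N/2 * ?M * (cmod U)\<^sup>2 / r\<^sup>2 - \<tau> * ?P / r * ?M * Re (U * cnj Z)
          - 1/2 * (lam\<^sup>2 + \<tau>\<^sup>2 * ?P\<^sup>2) * ?M * (cmod U)\<^sup>2"
        unfolding Tr_def r_def[symmetric] Sx Yx by (simp add: power2_eq_square)
      have Tx: "T x = ?th * Tr x" unfolding T_def Tr_def qx by (simp add: r_def)
      define DT where "DT h = (ramp' \<delta> r * (x \<bullet> h) / norm x) * (m (norm x) * (1/2 * gf x) - N/2 * (1 / max (norm x) \<delta> * (1 / max (norm x) \<delta>) * (m (norm x) * Sf x))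
             - \<tau> * (1 / max (norm x) \<delta> * \<Phi> (norm x) * (m (norm x) * Yf x))
             - 1/2 * ((lam\<^sup>2 + \<tau>\<^sup>2 * (\<Phi> (norm x) * \<Phi> (norm x))) * (m (norm x) * Sf x)))
          + ramp \<delta> (norm x) * (1/2 * ((m' (norm x) * (x \<bullet> h) / norm x) * gf x + m (norm x) * dg h)
             - N/2 * (2 * (1 / max (norm x) \<delta>) * (- (1 / r\<^sup>2) * (x \<bullet> h) / norm x) * m (norm x) * Sf x
                + 1 / max (norm x) \<delta> * (1 / max (norm x) \<delta>) * ((m' (norm x) * (x \<bullet> h) / norm x) * Sf x + m (norm x) * dS h))
            - \<tau> * (((- (1 / r\<^sup>2) * (x \<bullet> h) / norm x) * \<Phi> (norm x) + 1 / max (norm x) \<delta> * (\<Phi>' (norm x) * (x \<bullet> h) / norm x)) * m (norm x) * Yf x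
                + 1 / max (norm x) \<delta> * \<Phi> (norm x) * ((m' (norm x) * (x \<bullet> h) / norm x) * Yf x + m (norm x) * dY h))
            - (\<tau>\<^sup>2 * \<Phi> (norm x) * (\<Phi>' (norm x) * (x \<bullet> h) / norm x) * m (norm x) * Sf x
               + 1/2 * (lam\<^sup>2 + \<tau>\<^sup>2 * (\<Phi> (norm x) * \<Phi> (norm x))) * ((m' (norm x) * (x \<bullet> h) / norm x) * Sf x + m (norm x) * dS h)))" for h
      obtain D where D: "(T has_derivative D) (at x)" and Dx: "D x = ramp' \<delta> r * r * Tr x + ?th * ET"
      proof
        show "(T has_derivative DT) (at x)"
          unfolding T_def[abs_def] DT_def[abs_def] by (rule bracket_has_derivative[OF Dr Dm Dq DPhi Dg DS DY])
        show "DT x = ramp' \<delta> r * r * Tr x + ?th * ET"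
        proof -
          have xr: "c * (x \<bullet> x) / r = c * r" for c using xx by (metis times_divide_eq_right)
          have c1: "1/2 * (?M' * r * ?g + ?M * (2 * G2)) - N/2 * (2 * (1/r) * (- (1/r\<^sup>2) * r) * ?M * (cmod U)\<^sup>2
                + 1/r * (1/r) * (?M' * r * (cmod U)\<^sup>2 + ?M * (2 * Re (E * cnj U))))
            - \<tau> * (((- (1/r\<^sup>2) * r) * ?P + 1/r * (?P' * r)) * ?M * Re (U * cnj Z)
                + 1/r * ?P * (?M' * r * Re (U * cnj Z) + ?M * Re (E * cnj Z + U * cnj (E + Q + of_real N * E))))
            - (\<tau>\<^sup>2 * ?P * (?P' * r) * ?M * (cmod U)\<^sup>2
               + 1/2 * (lam\<^sup>2 + \<tau>\<^sup>2 * (?P * ?P)) * (?M' * r * (cmod U)\<^sup>2 + ?M * (2 * Re (E * cnj U)))) = ET"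
            unfolding ET_def using r(2) by (simp add: power2_eq_square field_simps)
          have c2: "m r * (1/2 * gf x) - N/2 * (1 / r * (1 / r) * (m r * (cmod U)\<^sup>2))
             - \<tau> * (1 / r * \<Phi> r * (m r * Re (U * cnj Z)))
             - 1/2 * ((lam\<^sup>2 + \<tau>\<^sup>2 * (\<Phi> r * \<Phi> r)) * (m r * (cmod U)\<^sup>2)) = Tr x"
            unfolding Trx by (simp add: power2_eq_square)
          show ?thesis
            unfolding DT_def qx unfolding r_def[symmetric] dgx dSx dYx Sx Yx xr c1 c2 ..
        qed
      qed
      have F: "Re (Form u P H x) = ?M' / r * Re (E * cnj Z) + ?M * ((1 + N) * ?g + G2)
         + \<tau> * ?P / r * (?M * Re (E * cnj Z) - Re (U * cnj (of_real (r * ?M') * Z + of_real ?M * (E + Q + of_real N * E))))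
         - (\<tau>\<^sup>2 * ?P\<^sup>2 + lam\<^sup>2) * ?M * Re (U * cnj Z)"
        using Form_expand(2)[OF x(2), of u P H]
        unfolding G2_def gx r_def[symmetric] Z_def E_def U_def Q_def Hf_def Ef_def .
      have M: "Mul u P x = of_real ?M * Z"
        using Form_expand(1)[OF x(2), of u P] unfolding r_def[symmetric] Z_def E_def U_def Ef_def .
      have CS: "(cmod E)\<^sup>2 / r\<^sup>2 \<le> ?g"
      proof -
        have "cmod E \<le> (\<Sum>c\<in>Basis. \<bar>x \<bullet> c\<bar> * cmod (P c x))"
          unfolding E_def Ef_def by (rule order_trans[OF norm_sum]) simp
        also have "\<dots> \<le> L2_set (\<lambda>c. x \<bullet> c) Basis * L2_set (\<lambda>c. cmod (P c x)) Basis"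
          using L2_set_mult_ineq[of "\<lambda>c. x \<bullet> c" "\<lambda>c. cmod (P c x)" Basis] by simp
        finally have "(cmod E)\<^sup>2 \<le> (L2_set (\<lambda>c. x \<bullet> c) Basis * L2_set (\<lambda>c. cmod (P c x)) Basis)\<^sup>2"
          by (rule power_mono) simp
        also have "\<dots> = r\<^sup>2 * ?g"
          unfolding power_mult_distrib L2_set_def gx
          by (simp add: sum_nonneg r_def power2_norm_eq_inner euclidean_inner[of x x] power2_eq_square[of "_ \<bullet> _"])
        finally show ?thesis using r(2) by (simp add: field_simps)
      qed
      have Lle: "L x \<le> Re (Form u P H x) - (ET + real d * Tr x)"
      proof -
        have o: "N \<ge> 1 \<or> r \<ge> 1/2 \<or> U = 0" using origin unfolding r_def U_def by (meson not_le)
        note I = morawetz_identity[OF r(2), of ?M' E N U ?M ?g G2 \<tau> ?P Q lam ?P', folded Z_def]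
        note B = pointwise_lower_bound[OF r(2,3) CS o v(1)[of x], folded Z_def]
        have "L x = W r * (cmod U)\<^sup>2 + v x * cmod (of_real ?M * Z) - r * ?M / (4 * \<tau> * ?P) * (v x)\<^sup>2"
          unfolding L_def M U_def r_def ..
        then show ?thesis using B I unfolding F[symmetric] Trx[symmetric] ET_def[symmetric] dN by linarith
      qed
      have "?th * L x \<le> ?th * (Re (Form u P H x) - (ET + real d * Tr x))"
        by (rule mult_left_mono[OF Lle ramp_bounds(1)])
      also have "\<dots> = ?th * Re (Form u P H x) - (real d * T x + D x) + ramp' \<delta> r * r * Tr x"
        unfolding Dx Tx by (simp add: algebra_simps)
      finally show ?thesis using D unfolding r_def by blast
    qed
    define T' where "T' x = frechet_derivative T (at x)" for x
    have fe: "finite exc" by (simp add: exc_def)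
    have AE_T: "AE x in lebesgue. (T has_derivative T' x) (at x)"
    proof (rule AE_radial[OF fe])
      fix x :: 'a assume "norm x \<notin> exc" "x \<noteq> 0"
      from good[OF this] obtain D where "(T has_derivative D) (at x)" by blast
      then show "(T has_derivative T' x) (at x)" unfolding T'_def
        by (metis differentiable_def frechet_derivative_works)
    qed
    have div: "integrable lebesgue (\<lambda>x. real d * T x + T' x x)" "(LINT x|lebesgue. real d * T x + T' x x) = 0"
      unfolding d_def by (rule integral_radial_divergence[of T R, OF lT T0 AE_T]; assumption)+
    define \<kappa> where "\<kappa> = (if N \<ge> 1 then CT / \<delta>\<^sup>2 else 0)"
    have \<kappa>: "ramp' \<delta> (norm x) * norm x * Tr x \<le> \<kappa> * indicat_real (cball 0 (2 * \<delta>)) x" if "x \<noteq> 0" for x :: 'a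
    proof (cases "\<delta> < norm x \<and> norm x < 2 * \<delta>")
      case False
      then have "ramp' \<delta> (norm x) = 0" unfolding ramp'_def by auto
      then show ?thesis using CT by (simp add: \<kappa>_def)
    next
      case True
      show ?thesis
      proof (cases "N \<ge> 1")
        case N1: True
        have "\<bar>Tr x\<bar> * (norm x)\<^sup>2 \<le> CT" using Tr_bound[OF that] True \<delta> by auto
        then have "\<bar>Tr x\<bar> * norm x \<le> CT / norm x" using that by (simp add: field_simps power2_eq_square)
        also have "\<dots> \<le> CT / \<delta>" using True \<delta>(1) CT less_trans[OF \<delta>(1), of "norm x"] by (intro divide_left_mono mult_pos_pos) auto
        finally have "1 / \<delta> * (\<bar>Tr x\<bar> * norm x) \<le> 1 / \<delta> * (CT / \<delta>)" using \<delta> by (intro mult_left_mono) auto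
        moreover have "norm x * Tr x \<le> \<bar>Tr x\<bar> * norm x" by (subst mult.commute) (intro mult_right_mono, auto)
        then have "1 / \<delta> * (norm x * Tr x) \<le> 1 / \<delta> * (\<bar>Tr x\<bar> * norm x)" using \<delta> by (intro mult_left_mono) auto
        ultimately have "1 / \<delta> * (norm x * Tr x) \<le> 1 / \<delta> * (CT / \<delta>)" by linarith
        then show ?thesis using True N1 by (simp add: \<kappa>_def ramp'_def power2_eq_square)
      next
        case False
        have z: "u y = 0" if "norm y < 1/2" for y using origin False that by auto
        have x2: "norm x < 1/2" using True \<delta> by linarith
        have "P b x = 0" for b unfolding P_def
        proof (rule pderiv_dir_eqI[where f' = "\<lambda>h. 0"])
          show "(u has_derivative (\<lambda>h. 0)) (at x)"
            by (rule has_derivative_transform_within_open[of "\<lambda>x. 0" _ _ _ "ball 0 (1/2)"]) (use z x2 in auto)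
        qed
        then have "Tr x = 0" using z[OF x2] by (simp add: Tr_def gf_def Sf_def Yf_def)
        then show ?thesis by (simp add: \<kappa>_def False)
      qed
    qed
    have vol: "\<kappa> * measure lborel (cball (0::'a) (2 * \<delta>)) \<le> C * \<delta>"
    proof (cases "N \<ge> 1")
      case True
      then have d3: "d \<ge> 3" using dN by linarith
      have "measure lborel (cball (0::'a) (2 * \<delta>)) = unit_ball_vol (real d) * (2 * \<delta>) ^ d"
        using content_cball[of "2 * \<delta>" "0::'a"] \<delta> by (simp add: d_def)
      also have "\<dots> = unit_ball_vol (real d) * 2 ^ d * (\<delta> ^ 3 * \<delta> ^ (d - 3))"
        using d3 by (simp add: power_mult_distrib flip: power_add)
      also have "\<dots> \<le> unit_ball_vol (real d) * 2 ^ d * (\<delta> ^ 3 * 1)"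
        using \<delta> by (intro mult_left_mono power_le_one) auto
      finally have "\<kappa> * measure lborel (cball (0::'a) (2 * \<delta>)) \<le> \<kappa> * (unit_ball_vol (real d) * 2 ^ d * \<delta> ^ 3)"
        using CT by (intro mult_left_mono) (auto simp: \<kappa>_def)
      also have "\<dots> = C * \<delta>" using True \<delta> by (simp add: \<kappa>_def C_def power2_eq_square power3_eq_cube)
      finally show ?thesis .
    qed (simp add: \<kappa>_def C_def)
    have mr: "(\<lambda>x::'a. ramp \<delta> (norm x)) \<in> borel_measurable lebesgue"
      by (rule continuous_lebesgue_measurable[OF lip_bdd_continuous[OF lr]])
    have ir: "integrable lebesgue (\<lambda>x::'a. ramp \<delta> (norm x) * w x)" if "integrable lebesgue w" for w
    proof (rule Bochner_Integration.integrable_bound[OF that])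
      show "(\<lambda>x::'a. ramp \<delta> (norm x) * w x) \<in> borel_measurable lebesgue" using mr that by measurable
      show "AE x::'a in lebesgue. norm (ramp \<delta> (norm x) * w x) \<le> norm (w x)"
        using ramp_bounds by (intro AE_I2) (auto simp: abs_mult intro!: mult_left_le_one_le)
    qed
    have iRF: "integrable lebesgue (\<lambda>x. Re (Form u P H x))" by (rule integrable_Re[OF iF])
    have iI: "integrable lebesgue (\<lambda>x. \<kappa> * indicat_real (cball (0::'a) (2 * \<delta>)) x)"
      using emeasure_lborel_cball_finite[of "0::'a" "2 * \<delta>"]
      by (intro integrable_mult_right integrable_real_indicator) auto
    have "(LINT x|lebesgue. ramp \<delta> (norm x) * L x) \<le> (LINT x|lebesgue. ramp \<delta> (norm x) * Re (Form u P H x)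
        - (real d * T x + T' x x) + \<kappa> * indicat_real (cball (0::'a) (2 * \<delta>)) x)"
    proof (rule integral_mono_AE)
      show "AE x in lebesgue. ramp \<delta> (norm x) * L x \<le> ramp \<delta> (norm x) * Re (Form u P H x)
        - (real d * T x + T' x x) + \<kappa> * indicat_real (cball (0::'a) (2 * \<delta>)) x"
      proof (rule AE_radial[OF fe])
        fix x :: 'a assume x: "norm x \<notin> exc" "x \<noteq> 0"
        from good[OF this] obtain D where D: "(T has_derivative D) (at x)"
          "ramp \<delta> (norm x) * L x \<le> ramp \<delta> (norm x) * Re (Form u P H x) - (real d * T x + D x) + ramp' \<delta> (norm x) * norm x * Tr x"
          by blast
        have "D = T' x" unfolding T'_def by (rule frechet_derivative_at[OF D(1)])
        then show "ramp \<delta> (norm x) * L x \<le> ramp \<delta> (norm x) * Re (Form u P H x)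
          - (real d * T x + T' x x) + \<kappa> * indicat_real (cball (0::'a) (2 * \<delta>)) x"
          using D(2) \<kappa>[OF x(2)] by simp
      qed
    qed (intro Bochner_Integration.integrable_add Bochner_Integration.integrable_diff ir iL iRF div(1) iI)+
    also have "\<dots> = (LINT x|lebesgue. ramp \<delta> (norm x) * Re (Form u P H x)) - (LINT x|lebesgue. real d * T x + T' x x)
        + (LINT x|lebesgue. \<kappa> * indicat_real (cball (0::'a) (2 * \<delta>)) x)"
      using Bochner_Integration.integral_add[OF Bochner_Integration.integrable_diff[OF ir[OF iRF] div(1)] iI]
        Bochner_Integration.integral_diff[OF ir[OF iRF] div(1)] by linarith
    also have "\<dots> \<le> (LINT x|lebesgue. ramp \<delta> (norm x) * Re (Form u P H x)) + C * \<delta>"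
      using vol unfolding div(2) by simp
    finally show ?thesis .
  qed
  then show "\<exists>C. \<forall>\<delta>. 0 < \<delta> \<longrightarrow> \<delta> \<le> 1/4 \<longrightarrow>
      (LINT x|lebesgue. ramp \<delta> (norm x) * L x) \<le> (LINT x|lebesgue. ramp \<delta> (norm x) * Re (Form u P H x)) + C * \<delta>"
    by blast
qed

end

lemma L2_lim_AE_bounded_mult:
  assumes "L2_lim F f" "w \<in> borel_measurable lebesgue" "AE x in lebesgue. cmod (w x) \<le> C"
  shows "L2_lim (\<lambda>n x. w x * F n x) (\<lambda>x. w x * f x)"
proof -
  have L: "L2_fun (\<lambda>x. F n x - f x)" for n using assms(1) by (simp add: L2_lim_def L2_fun_diff)
  have le: "norm (L2_norm (\<lambda>x. w x * F n x - w x * f x)) \<le> max C 0 * L2_norm (\<lambda>x. F n x - f x)" for n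
  proof -
    have "L2_norm (\<lambda>x. w x * (F n x - f x)) \<le> max C 0 * L2_norm (\<lambda>x. F n x - f x)"
    proof (rule L2_norm_mono[OF L])
      show "(\<lambda>x. w x * (F n x - f x)) \<in> borel_measurable lebesgue"
        by (rule L2_fun_measurable[OF L2_fun_AE_bounded_mult[OF L assms(2,3)]])
      show "AE x in lebesgue. cmod (w x * (F n x - f x)) \<le> max C 0 * cmod (F n x - f x)"
        using assms(3) by eventually_elim (auto simp: norm_mult intro!: mult_right_mono)
    qed simp
    then show ?thesis by (simp add: right_diff_distrib)
  qed
  have "(\<lambda>n. max C 0 * L2_norm (\<lambda>x. F n x - f x)) \<longlonglongrightarrow> max C 0 * 0"
    by (rule tendsto_mult_left) (use assms(1) in \<open>simp add: L2_lim_def\<close>)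
  then have lim: "(\<lambda>n. max C 0 * L2_norm (\<lambda>x. F n x - f x)) \<longlonglongrightarrow> 0" by simp
  have "(\<lambda>n. L2_norm (\<lambda>x. w x * F n x - w x * f x)) \<longlonglongrightarrow> 0"
    by (rule Lim_null_comparison[OF always_eventually[OF allI[OF le]] lim])
  then show ?thesis
    using assms(1) L2_fun_AE_bounded_mult[OF _ assms(2,3)] by (simp add: L2_lim_def)
qed

lemma L2_lim_lip_mult:
  assumes "L2_lim F f" "lip_bdd w"
  shows "L2_lim (\<lambda>n x. w x * F n x) (\<lambda>x. w x * f x)"
  using lip_bddE[OF assms(2)] L2_lim_bounded_mult[OF assms(1) continuous_lebesgue_measurable[OF lip_bdd_continuous[OF assms(2)]]]
  by metis

lemma L2_lim_lip_deriv_mult: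
  assumes "L2_lim F f" "lip_bdd w" "AE x in lebesgue. (w has_derivative w' x) (at x)"
  shows "L2_lim (\<lambda>n x. w' x b * F n x) (\<lambda>x. w' x b * f x)"
  using lip_bdd_derivative[OF assms(2,3)] L2_lim_AE_bounded_mult[OF assms(1)] by blast

context radial_bump
begin

text \<open>Let the cutoff around the origin shrink.\<close>

lemma morawetz_test_function:
  fixes u :: "'a \<Rightarrow> complex" and v :: "'a \<Rightarrow> real"
  assumes u: "test_function u" and origin: "N \<ge> 1 \<or> (\<forall>x. norm x < 1/2 \<longrightarrow> u x = 0)"
    and v: "\<And>x. v x \<ge> 0" "L2_fun (\<lambda>x. complex_of_real (v x))"
    and vi: "integrable lebesgue (\<lambda>x. norm x * m (norm x) / \<Phi> (norm x) * (v x)\<^sup>2)"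
  defines "P \<equiv> \<lambda>b. pderiv_dir b u" and "H \<equiv> \<lambda>c b. pderiv_dir b (pderiv_dir c u)"
  defines "L \<equiv> \<lambda>x. W (norm x) * (cmod (u x))\<^sup>2 + v x * cmod (Mul u P x) - norm x * m (norm x) / (4 * \<tau> * \<Phi> (norm x)) * (v x)\<^sup>2"
  shows "(LINT x|lebesgue. L x) \<le> (LINT x|lebesgue. Re (Form u P H x))"
proof -
  have mc1: "integrable lebesgue L"
    unfolding L_def P_def by (rule morawetz_cutoff(1)[OF u origin v vi])
  have mc2: "\<exists>C. \<forall>\<delta>. 0 < \<delta> \<longrightarrow> \<delta> \<le> 1/4 \<longrightarrow>
      (LINT x|lebesgue. ramp \<delta> (norm x) * L x) \<le> (LINT x|lebesgue. ramp \<delta> (norm x) * Re (Form u P H x)) + C * \<delta>"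
    unfolding L_def P_def H_def by (rule morawetz_cutoff(2)[OF u origin v vi])
  from mc2 obtain C where C0: "\<forall>\<delta>. 0 < \<delta> \<longrightarrow> \<delta> \<le> 1/4 \<longrightarrow>
      (LINT x|lebesgue. ramp \<delta> (norm x) * L x) \<le> (LINT x|lebesgue. ramp \<delta> (norm x) * Re (Form u P H x)) + C * \<delta>"
    by (elim exE)
  note C = C0[rule_format]
  have wu: "weak_grad u P" unfolding P_def by (rule weak_grad_test[OF u])
  have wP: "weak_grad (P b) (H b)" if "b \<in> Basis" for b
    using weak_grad_test[OF test_function_pderiv[OF u that]] unfolding H_def P_def by simp
  have iF: "integrable lebesgue (\<lambda>x. Re (Form u P H x))" by (rule integrable_Re[OF integrable_Form[OF wu wP]])
  define \<delta> where "\<delta> n = 1 / real (Suc (n + 3))" for n :: nat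
  have \<delta>0: "\<delta> n > 0" "\<delta> n \<le> 1/4" for n by (simp_all add: \<delta>_def field_simps)
  have \<delta>lim: "\<delta> \<longlonglongrightarrow> 0" unfolding \<delta>_def using LIMSEQ_ignore_initial_segment[OF LIMSEQ_Suc[OF lim_1_over_n], of 3] by simp
  have lim: "(\<lambda>n. LINT x|lebesgue. ramp (\<delta> n) (norm x) * w x) \<longlonglongrightarrow> (LINT x|lebesgue. w x)"
    if w: "integrable lebesgue w" for w :: "'a \<Rightarrow> real"
  proof (rule integral_dominated_convergence[where w = "\<lambda>x. norm (w x)"])
    show "w \<in> borel_measurable lebesgue" using w by simp
    then show "(\<lambda>x. ramp (\<delta> n) (norm x) * w x) \<in> borel_measurable lebesgue" for n
      using continuous_lebesgue_measurable[OF lip_bdd_continuous[OF lip_bdd_ramp[OF \<delta>0(1)[of n]]]] by measurable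
    show "integrable lebesgue (\<lambda>x. norm (w x))" using w by simp
    show "AE x in lebesgue. norm (ramp (\<delta> n) (norm x) * w x) \<le> norm (w x)" for n
      using ramp_bounds by (intro AE_I2) (auto simp: abs_mult intro!: mult_left_le_one_le)
    show "AE x in lebesgue. (\<lambda>n. ramp (\<delta> n) (norm x) * w x) \<longlonglongrightarrow> w x"
    proof (rule AE_radial[of "{}"])
      fix x :: 'a assume x: "x \<noteq> 0"
      have "\<forall>\<^sub>F n in sequentially. \<delta> n < norm x / 2"
        using order_tendstoD(2)[OF \<delta>lim, of "norm x / 2"] x by simp
      then have "\<forall>\<^sub>F n in sequentially. ramp (\<delta> n) (norm x) * w x = w x"
        by eventually_elim (simp add: ramp_one[OF \<delta>0(1)])
      then show "(\<lambda>n. ramp (\<delta> n) (norm x) * w x) \<longlonglongrightarrow> w x" by (rule tendsto_eventually)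
    qed simp
  qed
  have "(\<lambda>n. (LINT x|lebesgue. ramp (\<delta> n) (norm x) * Re (Form u P H x)) + C * \<delta> n)
     \<longlonglongrightarrow> (LINT x|lebesgue. Re (Form u P H x)) + C * 0"
    by (rule tendsto_add[OF lim[OF iF] tendsto_mult_left[OF \<delta>lim]])
  from LIMSEQ_le[OF lim[OF mc1] this] C[OF \<delta>0] show ?thesis by simp
qed

lemma L2_lim_Mul:
  assumes F: "L2_lim F (f :: 'a \<Rightarrow> complex)" and G: "\<And>b. b \<in> Basis \<Longrightarrow> L2_lim (\<lambda>n. G n b) (g b)"
  shows "L2_lim (\<lambda>n. Mul (F n) (G n)) (Mul f g)"
proof -
  have "L2_lim (\<lambda>n x. (\<Sum>c\<in>Basis. of_real (m (norm x) * (x \<bullet> c)) * G n c x) + of_real (N * m (norm x)) * F n x)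
     (\<lambda>x. (\<Sum>c\<in>Basis. of_real (m (norm x) * (x \<bullet> c)) * g c x) + of_real (N * m (norm x)) * f x)"
    by (intro L2_lim_add L2_lim_sum L2_lim_lip_mult[OF G] L2_lim_lip_mult[OF F] lip_bdd_of_real lip_m_coord
        lip_bdd_mult lip_bdd_const lip_m)
  then show ?thesis by (simp add: Mul_def[abs_def])
qed

lemma L2_lim_dMul:
  assumes F: "L2_lim F (f :: 'a \<Rightarrow> complex)" and G: "\<And>b. b \<in> Basis \<Longrightarrow> L2_lim (\<lambda>n. G n b) (g b)"
    and H: "\<And>b c. b \<in> Basis \<Longrightarrow> c \<in> Basis \<Longrightarrow> L2_lim (\<lambda>n. H n b c) (h b c)" and b: "b \<in> Basis"
  shows "L2_lim (\<lambda>n. dMul (F n) (G n) (H n) b) (dMul f g h b)"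
proof -
  let ?w = "\<lambda>c x::'a. complex_of_real (m (norm x) * (x \<bullet> c))"
  let ?w' = "\<lambda>c (x::'a) h. complex_of_real (m (norm x) * (h \<bullet> c) + m' (norm x) * (x \<bullet> h) / norm x * (x \<bullet> c))"
  have lw: "lip_bdd (?w c)" if "c \<in> Basis" for c by (rule lip_bdd_of_real[OF lip_m_coord[OF that]])
  have dw: "AE x in lebesgue. (?w c has_derivative ?w' c x) (at x)" for c
    by (rule AE_radial[of "{A}"]) (auto intro!: derivative_eq_intros deriv_m)
  let ?k = "\<lambda>x::'a. complex_of_real (N * m (norm x))"
  let ?k' = "\<lambda>(x::'a) h. complex_of_real (N * (m' (norm x) * (x \<bullet> h) / norm x))"
  have lk: "lip_bdd ?k" by (intro lip_bdd_of_real lip_bdd_mult lip_bdd_const lip_m)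
  have dk: "AE x in lebesgue. (?k has_derivative ?k' x) (at x)"
    by (rule AE_radial[of "{A}"]) (auto intro!: derivative_eq_intros deriv_m)
  have "L2_lim (\<lambda>n x. (\<Sum>c\<in>Basis. ?w c x * H n c b x + ?w' c x b * G n c x) + (?k x * G n b x + ?k' x b * F n x))
     (\<lambda>x. (\<Sum>c\<in>Basis. ?w c x * h c b x + ?w' c x b * g c x) + (?k x * g b x + ?k' x b * f x))"
    by (rule L2_lim_add[OF L2_lim_sum[OF L2_lim_add[OF L2_lim_lip_mult[OF H[OF _ b] lw] L2_lim_lip_deriv_mult[OF G lw dw]]]
         L2_lim_add[OF L2_lim_lip_mult[OF G[OF b] lk] L2_lim_lip_deriv_mult[OF F lk dk]]])
  then show ?thesis by (simp add: dMul_def[abs_def])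
qed

lemma integral_Form:
  assumes fg: "weak_grad f g" and gh: "\<And>b. b \<in> Basis \<Longrightarrow> weak_grad (g b) (h b)"
  shows "(LINT x|lebesgue. Form f g h (x::'a)) =
     (\<Sum>b\<in>Basis. LINT x|lebesgue. (g b x - of_real (\<tau> * dphase x b) * f x) *
        (cnj (dMul f g h b x) + of_real (\<tau> * dphase x b) * cnj (Mul f g x)))
     - of_real (lam\<^sup>2) * (LINT x|lebesgue. f x * cnj (Mul f g x))"
proof -
  note M = weak_gradD[OF weak_grad_Mul[OF fg gh]] and F = weak_gradD[OF fg]
  have i: "integrable lebesgue (\<lambda>x. (g b x - of_real (\<tau> * dphase x b) * f x) *
        (cnj (dMul f g h b x) + of_real (\<tau> * dphase x b) * cnj (Mul f g x)))" if "b \<in> Basis" for b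
    by (intro integrable_L2_mult L2_fun_diff L2_fun_add L2_dphase_mult L2_fun_cnj M F that)
  have i2: "integrable lebesgue (\<lambda>x. f x * cnj (Mul f g x))"
    by (intro integrable_L2_mult L2_fun_cnj M F)
  show ?thesis unfolding Form_def
    using i i2 by (simp add: Bochner_Integration.integral_diff Bochner_Integration.integral_sum)
qed

text \<open>Every term is continuous in \<open>f\<close> together with its first and second weak derivatives, so the inequality
  passes from test functions to the limit.\<close>

lemma morawetz_inequality:
  fixes f :: "'a \<Rightarrow> complex" and v :: "'a \<Rightarrow> real"
  assumes fg: "weak_grad f g" and gh: "\<And>b. b \<in> Basis \<Longrightarrow> weak_grad (g b) (h b)"
    and origin: "N \<ge> 1 \<or> (\<forall>x. norm x < 1 \<longrightarrow> f x = 0)"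
    and v: "\<And>x. v x \<ge> 0" "L2_fun (\<lambda>x. complex_of_real (v x))"
    and vi: "integrable lebesgue (\<lambda>x. norm x * m (norm x) / \<Phi> (norm x) * (v x)\<^sup>2)"
  shows "(LINT x|lebesgue. W (norm x) * (cmod (f x))\<^sup>2) + (LINT x|lebesgue. v x * cmod (Mul f g x))
     - (LINT x|lebesgue. norm x * m (norm x) / (4 * \<tau> * \<Phi> (norm x)) * (v x)\<^sup>2) \<le> Re (LINT x|lebesgue. Form f g h x)"
proof -
  obtain u where u: "\<And>n. test_function (u n)" "L2_lim u f"
    "\<And>b. b \<in> Basis \<Longrightarrow> L2_lim (\<lambda>n. pderiv_dir b (u n)) (g b)"
    "\<And>b c. b \<in> Basis \<Longrightarrow> c \<in> Basis \<Longrightarrow> L2_lim (\<lambda>n. pderiv_dir c (pderiv_dir b (u n))) (h b c)"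
    "(\<And>x. norm x < 1 \<Longrightarrow> f x = 0) \<Longrightarrow> \<forall>n x. norm x < 1/2 \<longrightarrow> u n x = 0"
    using weak_grad2_approx[OF fg gh] by metis
  have or: "N \<ge> 1 \<or> (\<forall>x. norm x < 1/2 \<longrightarrow> u n x = 0)" for n using origin u(5) by blast
  let ?P = "\<lambda>n b. pderiv_dir b (u n)" and ?H = "\<lambda>n c b. pderiv_dir b (pderiv_dir c (u n))"
  let ?I = "LINT x|lebesgue. norm x * m (norm x) / (4 * \<tau> * \<Phi> (norm x)) * (v x)\<^sup>2"
  note w = weak_grad_test[OF u(1)] and wP = weak_grad_test[OF test_function_pderiv[OF u(1)]]
  have M: "L2_lim (\<lambda>n. Mul (u n) (?P n)) (Mul f g)" by (rule L2_lim_Mul[OF u(2,3)])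
  have dM: "L2_lim (\<lambda>n. dMul (u n) (?P n) (?H n) b) (dMul f g h b)" if "b \<in> Basis" for b
    by (rule L2_lim_dMul[OF u(2,3,4) that])
  have vi': "integrable lebesgue (\<lambda>x. norm x * m (norm x) / (4 * \<tau> * \<Phi> (norm x)) * (v x)\<^sup>2)"
  proof -
    have "integrable lebesgue (\<lambda>x. (1 / (4 * \<tau>)) * (norm x * m (norm x) / \<Phi> (norm x) * (v x)\<^sup>2))"
      using vi by (rule integrable_mult_right)
    then show ?thesis by (simp add: mult_ac)
  qed
  have step: "(LINT x|lebesgue. W (norm x) * (cmod (u n x))\<^sup>2) + (LINT x|lebesgue. v x * cmod (Mul (u n) (?P n) x)) - ?I
     \<le> Re (LINT x|lebesgue. Form (u n) (?P n) (?H n) x)" for n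
  proof -
    have LM: "L2_fun (Mul (u n) (?P n))" using M by (rule L2_limD)
    have ivM: "integrable lebesgue (\<lambda>x. v x * cmod (Mul (u n) (?P n) x))"
      using integrable_L2_mult_norm[OF v(2) LM] v(1) by simp
    note iW = integrable_W[OF test_function_L2[OF u(1)], of n]
    have "(LINT x|lebesgue. W (norm x) * (cmod (u n x))\<^sup>2) + (LINT x|lebesgue. v x * cmod (Mul (u n) (?P n) x)) - ?I
      = (LINT x|lebesgue. W (norm x) * (cmod (u n x))\<^sup>2 + v x * cmod (Mul (u n) (?P n) x) - norm x * m (norm x) / (4 * \<tau> * \<Phi> (norm x)) * (v x)\<^sup>2)"
      using iW ivM vi' by simp
    also have "\<dots> \<le> (LINT x|lebesgue. Re (Form (u n) (?P n) (?H n) x))"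
      by (rule morawetz_test_function[OF u(1) or v vi])
    also have "\<dots> = Re (LINT x|lebesgue. Form (u n) (?P n) (?H n) x)"
      by (rule integral_Re[OF integrable_Form[OF w wP]])
    finally show ?thesis .
  qed
  have l1: "(\<lambda>n. LINT x|lebesgue. W (norm x) * (cmod (u n x))\<^sup>2) \<longlonglongrightarrow> (LINT x|lebesgue. W (norm x) * (cmod (f x))\<^sup>2)"
  proof -
    have mW: "(\<lambda>x::'a. complex_of_real (W (norm x))) \<in> borel_measurable lebesgue" using W_measurable by measurable
    have bW: "cmod (complex_of_real (W (norm (x::'a)))) \<le> BW" for x using W_bound[of "norm x"] by simp
    have "(\<lambda>n. Re (LINT x|lebesgue. (of_real (W (norm x)) * u n x) * cnj (u n x)))
       \<longlonglongrightarrow> Re (LINT x|lebesgue. (of_real (W (norm x)) * f x) * cnj (f x))"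
      by (rule tendsto_Re[OF L2_lim_integral_mult[OF L2_lim_bounded_mult[OF u(2) mW bW] L2_lim_cnj[OF u(2)]]])
    moreover have "Re (LINT x|lebesgue. (of_real (W (norm x)) * q x) * cnj (q x)) = (LINT x|lebesgue. W (norm x) * (cmod (q x))\<^sup>2)"
      if "L2_fun q" for q :: "'a \<Rightarrow> complex"
    proof -
      have "(\<lambda>x. (of_real (W (norm x)) * q x) * cnj (q x)) = (\<lambda>x. complex_of_real (W (norm x) * (cmod (q x))\<^sup>2))"
        unfolding of_real_mult complex_norm_square by (simp add: mult.assoc)
      then show ?thesis by (simp only: integral_complex_of_real Re_complex_of_real)
    qed
    ultimately show ?thesis using test_function_L2[OF u(1)] L2_limD(1)[OF u(2)] by simp
  qed
  have l2: "(\<lambda>n. LINT x|lebesgue. v x * cmod (Mul (u n) (?P n) x)) \<longlonglongrightarrow> (LINT x|lebesgue. v x * cmod (Mul f g x))"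
  proof -
    have LM: "L2_fun (Mul (u n) (?P n))" "L2_fun (Mul f g)" for n using M by (auto dest: L2_limD)
    have i: "integrable lebesgue (\<lambda>x. v x * cmod (q x))" if "L2_fun q" for q
      using integrable_L2_mult_norm[OF v(2) that] v(1) by simp
    have le: "norm ((LINT x|lebesgue. v x * cmod (Mul (u n) (?P n) x)) - (LINT x|lebesgue. v x * cmod (Mul f g x)))
       \<le> L2_norm (\<lambda>x. complex_of_real (v x)) * L2_norm (\<lambda>x. Mul (u n) (?P n) x - Mul f g x)" for n
    proof -
      have "(LINT x|lebesgue. v x * cmod (Mul (u n) (?P n) x)) - (LINT x|lebesgue. v x * cmod (Mul f g x))
         = (LINT x|lebesgue. v x * cmod (Mul (u n) (?P n) x) - v x * cmod (Mul f g x))"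
        using i[OF LM(1)] i[OF LM(2)] by simp
      also have "norm \<dots> \<le> (LINT x|lebesgue. cmod (complex_of_real (v x)) * cmod (Mul (u n) (?P n) x - Mul f g x))"
      proof (rule Bochner_Integration.integral_norm_bound_integral)
        show "integrable lebesgue (\<lambda>x. v x * cmod (Mul (u n) (?P n) x) - v x * cmod (Mul f g x))"
          using i[OF LM(1)] i[OF LM(2)] by simp
        show "integrable lebesgue (\<lambda>x. cmod (complex_of_real (v x)) * cmod (Mul (u n) (?P n) x - Mul f g x))"
          by (rule integrable_L2_mult_norm[OF v(2) L2_fun_diff[OF LM]])
        show "norm (v x * cmod (Mul (u n) (?P n) x) - v x * cmod (Mul f g x)) \<le> cmod (complex_of_real (v x)) * cmod (Mul (u n) (?P n) x - Mul f g x)" for x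
          unfolding right_diff_distrib[symmetric] real_norm_def abs_mult norm_of_real
          by (intro mult_left_mono norm_triangle_ineq3) auto
      qed
      also have "\<dots> \<le> L2_norm (\<lambda>x. complex_of_real (v x)) * L2_norm (\<lambda>x. Mul (u n) (?P n) x - Mul f g x)"
        by (rule L2_Cauchy_Schwarz[OF v(2) L2_fun_diff[OF LM]])
      finally show ?thesis .
    qed
    have "(\<lambda>n. L2_norm (\<lambda>x. complex_of_real (v x)) * L2_norm (\<lambda>x. Mul (u n) (?P n) x - Mul f g x)) \<longlonglongrightarrow> L2_norm (\<lambda>x. complex_of_real (v x)) * 0"
      by (rule tendsto_mult_left) (use M in \<open>simp add: L2_lim_def\<close>)
    then have z: "(\<lambda>n. L2_norm (\<lambda>x. complex_of_real (v x)) * L2_norm (\<lambda>x. Mul (u n) (?P n) x - Mul f g x)) \<longlonglongrightarrow> 0" by simp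
    show ?thesis
      by (rule LIM_zero_cancel, rule Lim_null_comparison[OF always_eventually[OF allI[OF le]] z])
  qed
  have l3: "(\<lambda>n. Re (LINT x|lebesgue. Form (u n) (?P n) (?H n) x)) \<longlonglongrightarrow> Re (LINT x|lebesgue. Form f g h x)"
  proof -
    have t1: "(\<lambda>n. LINT x|lebesgue. (?P n b x - of_real (\<tau> * dphase x b) * u n x) *
        (cnj (dMul (u n) (?P n) (?H n) b x) + of_real (\<tau> * dphase x b) * cnj (Mul (u n) (?P n) x)))
      \<longlonglongrightarrow> (LINT x|lebesgue. (g b x - of_real (\<tau> * dphase x b) * f x) *
        (cnj (dMul f g h b x) + of_real (\<tau> * dphase x b) * cnj (Mul f g x)))" if b: "b \<in> Basis" for b
      by (rule L2_lim_integral_mult[OF L2_lim_diff[OF u(3)[OF b] L2_lim_dphase_mult[OF u(2) b]]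
          L2_lim_add[OF L2_lim_cnj[OF dM[OF b]] L2_lim_dphase_mult[OF L2_lim_cnj[OF M] b]]])
    have t2: "(\<lambda>n. LINT x|lebesgue. u n x * cnj (Mul (u n) (?P n) x)) \<longlonglongrightarrow> (LINT x|lebesgue. f x * cnj (Mul f g x))"
      by (rule L2_lim_integral_mult[OF u(2) L2_lim_cnj[OF M]])
    have E1: "(LINT x|lebesgue. Form f g h x) =
     (\<Sum>b\<in>Basis. LINT x|lebesgue. (g b x - of_real (\<tau> * dphase x b) * f x) *
        (cnj (dMul f g h b x) + of_real (\<tau> * dphase x b) * cnj (Mul f g x)))
     - of_real (lam\<^sup>2) * (LINT x|lebesgue. f x * cnj (Mul f g x))" by (rule integral_Form[OF fg gh])
    have E2: "(LINT x|lebesgue. Form (u n) (?P n) (?H n) x) =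
     (\<Sum>b\<in>Basis. LINT x|lebesgue. (?P n b x - of_real (\<tau> * dphase x b) * u n x) *
        (cnj (dMul (u n) (?P n) (?H n) b x) + of_real (\<tau> * dphase x b) * cnj (Mul (u n) (?P n) x)))
     - of_real (lam\<^sup>2) * (LINT x|lebesgue. u n x * cnj (Mul (u n) (?P n) x))" for n by (rule integral_Form[OF w wP])
    show ?thesis unfolding E1 E2
      by (rule tendsto_Re[OF tendsto_diff[OF tendsto_sum[OF t1] tendsto_mult_left[OF t2]]])
  qed
  have "(\<lambda>n. (LINT x|lebesgue. W (norm x) * (cmod (u n x))\<^sup>2) + (LINT x|lebesgue. v x * cmod (Mul (u n) (?P n) x)) - ?I)
     \<longlonglongrightarrow> (LINT x|lebesgue. W (norm x) * (cmod (f x))\<^sup>2) + (LINT x|lebesgue. v x * cmod (Mul f g x)) - ?I"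
    by (rule tendsto_diff[OF tendsto_add[OF l1 l2] tendsto_const])
  then show ?thesis by (rule LIMSEQ_le[OF _ l3]) (use step in blast)
qed

end

section \<open>The radial weights of the Carleman estimate\<close>

text \<open>The mean value theorem on both sides of the exceptional point.\<close>

lemma piecewise_MVT_bound:
  fixes f :: "real \<Rightarrow> real"
  assumes tr: "t \<le> r" and cont: "continuous_on {t..r} f"
    and deriv: "\<And>x. t < x \<Longrightarrow> x < r \<Longrightarrow> x \<noteq> A \<Longrightarrow> (f has_real_derivative f' x) (at x)"
    and bound: "\<And>x. t < x \<Longrightarrow> x < r \<Longrightarrow> x \<noteq> A \<Longrightarrow> \<bar>f' x\<bar> \<le> L"
    and L: "L \<ge> 0"
  shows "\<bar>f r - f t\<bar> \<le> L * (r - t)"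
proof -
  have simple: "\<bar>f q - f p\<bar> \<le> L * (q - p)" if pq: "t \<le> p" "p \<le> q" "q \<le> r" and A: "A \<le> p \<or> q \<le> A" for p q
  proof (cases "p = q")
    case False
    then have "p < q" using pq by simp
    moreover have "continuous_on {p..q} f" by (rule continuous_on_subset[OF cont]) (use pq in auto)
    moreover have "f differentiable (at x)" if "p < x" "x < q" for x
      using deriv[of x] that pq A by (auto simp: real_differentiable_def)
    ultimately obtain k z where z: "p < z" "z < q" "(f has_real_derivative k) (at z)" "f q - f p = (q - p) * k"
      using MVT[of p q f] by blast
    have "k = f' z" using z(3) deriv[of z] z(1,2) pq A by (auto intro: DERIV_unique)
    then have "\<bar>k\<bar> \<le> L" using bound[of z] z(1,2) pq A by auto
    then show ?thesis using z(4) \<open>p < q\<close> by (simp add: abs_mult mult.commute mult_right_mono)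
  qed (use L in simp)
  show ?thesis
  proof (cases "t < A \<and> A < r")
    case True
    then have "\<bar>f r - f A\<bar> \<le> L * (r - A)" "\<bar>f A - f t\<bar> \<le> L * (A - t)" by (auto intro!: simple)
    then have "\<bar>f r - f t\<bar> \<le> L * (r - A) + L * (A - t)" by linarith
    then show ?thesis by (simp add: algebra_simps)
  next
    case False
    then show ?thesis using simple[of t r] tr by auto
  qed
qed

locale carleman_weights =
  fixes s l \<kappa> A :: real
  assumes sl: "0 < s - 1/2" "s - 1/2 < l" "l < 2 * s / 3" "2 * s / 3 < 2 / 3"
    and kappa: "0 < \<kappa>" "\<kappa> < 2 * s - 1" "\<kappa> < 1 - l"
    and A1: "A \<ge> 1"
begin

abbreviation a where "a \<equiv> A + 1"
abbreviation K where "K \<equiv> K_const s l \<kappa> A"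
abbreviation Phi where "Phi \<equiv> phase_deriv s l \<kappa> A"

text \<open>The multiplier is \<open>mf r = kf r / (r + 1)\<close>.  For \<open>r \<le> A\<close> the power \<open>2 l\<close> compensates the decay of
  \<open>Phi\<^sup>2\<close>.  For \<open>r > A\<close> the function \<open>kf\<close> is the antiderivative of a multiple of \<open>(r + 1)\<^sup>-\<^sup>2\<^sup>s\<close> that matches at
  \<open>r = A\<close>; it stays below \<open>2 a\<^sup>2\<^sup>l\<close>, while its derivative decays no faster than the weight that is to be gained.\<close>

definition kf :: "real \<Rightarrow> real" where
  "kf r = (if r \<le> A then (r + 1) powr (2 * l) else 2 * a powr (2 * l) - a powr (2 * l + 2 * s - 1) * (r + 1) powr (1 - 2 * s))"

definition kf' :: "real \<Rightarrow> real" where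
  "kf' r = (if r \<le> A then 2 * l * (r + 1) powr (2 * l - 1) else (2 * s - 1) * a powr (2 * l + 2 * s - 1) * (r + 1) powr (- 2 * s))"

definition mf :: "real \<Rightarrow> real" where "mf r = kf r / (r + 1)"

definition mf' :: "real \<Rightarrow> real" where "mf' r = kf' r / (r + 1) - kf r / (r + 1)\<^sup>2"

definition dPhi :: "real \<Rightarrow> real" where
  "dPhi r = (if r \<le> A then (r + 1) powr (- l - 1) * (\<kappa> * (r + 1) powr (- \<kappa>) - l * (2 - (r + 1) powr (- \<kappa>)))
     else - 2 * s * K * (r + 1) powr (- 2 * s - 1))"

lemma basic: "1/2 < s" "s < 1" "0 < l" "l < 2/3" "3 * l < 2 * s" "a \<ge> 2" "\<kappa> < 1"
  using sl kappa A1 by auto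

lemma powr_neg_le_one: "x \<ge> 1 \<Longrightarrow> p \<ge> 0 \<Longrightarrow> x powr (- p) \<le> (1::real)"
  using powr_mono[of "- p" 0 x] by simp

lemma powr_pos_ge_one: "x \<ge> 1 \<Longrightarrow> p \<ge> 0 \<Longrightarrow> 1 \<le> x powr (p::real)"
  using powr_mono[of 0 p x] by simp

lemma K_bounds: "a powr (2 * s - l) \<le> K" "K \<le> 2 * a powr (2 * s - l)" "K > 0"
proof -
  have "a powr (- \<kappa>) \<le> 1" using basic kappa by (intro powr_neg_le_one) auto
  moreover have "0 \<le> a powr (- \<kappa>)" by simp
  ultimately have b: "1 \<le> 2 - a powr (- \<kappa>)" "2 - a powr (- \<kappa>) \<le> 2" by linarith+
  show "a powr (2 * s - l) \<le> K" "K \<le> 2 * a powr (2 * s - l)"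
    using mult_left_mono[OF b(1), of "a powr (2 * s - l)"] mult_left_mono[OF b(2), of "a powr (2 * s - l)"]
    by (simp_all add: K_const_def)
  moreover have "0 < a powr (2 * s - l)" using basic by simp
  ultimately show "K > 0" by linarith
qed

lemma outer_e: "r > A \<Longrightarrow> a powr (2 * l + 2 * s - 1) * (r + 1) powr (1 - 2 * s) \<le> a powr (2 * l)"
proof -
  assume r: "r > A"
  have "(r + 1) powr (1 - 2 * s) \<le> a powr (1 - 2 * s)"
    using r basic by (intro powr_mono2') auto
  then have "a powr (2 * l + 2 * s - 1) * (r + 1) powr (1 - 2 * s) \<le> a powr (2 * l + 2 * s - 1) * a powr (1 - 2 * s)"
    by (intro mult_left_mono) auto
  also have "\<dots> = a powr (2 * l)" by (simp flip: powr_add)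
  finally show ?thesis .
qed

lemma kf_bounds:
  assumes r: "r \<ge> 0"
  shows "1 \<le> kf r" "kf r \<le> 2 * a powr (2 * l)" "0 \<le> kf' r" "kf' r \<le> 4/3 * (kf r / (r + 1))" "kf r \<le> 2 * (r + 1) powr (2 * l)"
proof -
  have a1: "1 \<le> a powr (2 * l)" using basic by (intro powr_pos_ge_one) auto
  have e0: "0 \<le> a powr (2 * l + 2 * s - 1) * (r + 1) powr (1 - 2 * s)" by simp
  show "1 \<le> kf r"
    using powr_pos_ge_one[of "r + 1" "2 * l"] r basic outer_e[of r] a1 by (auto simp: kf_def)
  have mono: "(r + 1) powr (2 * l) \<le> a powr (2 * l)" if "r \<le> A" using that r basic by (intro powr_mono2) auto
  show "kf r \<le> 2 * a powr (2 * l)"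
  proof (cases "r \<le> A")
    case True
    then show ?thesis using mono a1 by (simp add: kf_def)
  next
    case False
    then show ?thesis using e0 by (simp add: kf_def)
  qed
  show "0 \<le> kf' r" using basic by (auto simp: kf'_def)
  show "kf' r \<le> 4/3 * (kf r / (r + 1))"
  proof (cases "r \<le> A")
    case True
    have "(r + 1) powr (2 * l - 1) = (r + 1) powr (2 * l) / (r + 1)" using r by (simp add: powr_diff)
    moreover have "2 * l * ((r + 1) powr (2 * l) / (r + 1)) \<le> 4/3 * ((r + 1) powr (2 * l) / (r + 1))"
      using r basic by (intro mult_right_mono) auto
    ultimately show ?thesis using True by (simp add: kf_def kf'_def)
  next
    case False
    define e where "e = a powr (2 * l + 2 * s - 1) * (r + 1) powr (1 - 2 * s)"
    have e: "0 \<le> e" "e \<le> a powr (2 * l)" using outer_e[of r] False by (auto simp: e_def)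
    have "(r + 1) powr (- 2 * s) = (r + 1) powr (1 - 2 * s) / (r + 1)"
      using r powr_diff[of "r + 1" "1 - 2 * s" 1] by simp
    then have "kf' r = (2 * s - 1) * e / (r + 1)" using False by (simp add: kf'_def e_def)
    also have "\<dots> \<le> (4/3 * kf r) / (r + 1)"
    proof (rule divide_right_mono)
      have "(2 * s - 1) * e \<le> 1 * e" using basic e by (intro mult_right_mono) auto
      also have "\<dots> \<le> kf r" unfolding kf_def e_def[symmetric] using e False by simp
      also have "\<dots> \<le> 4/3 * kf r" using \<open>1 \<le> kf r\<close> by simp
      finally show "(2 * s - 1) * e \<le> 4/3 * kf r" .
    qed (use r in simp)
    finally show ?thesis by simp
  qed
  show "kf r \<le> 2 * (r + 1) powr (2 * l)"
  proof (cases "r \<le> A")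
    case True then show ?thesis by (simp add: kf_def)
  next
    case False
    have "a powr (2 * l) \<le> (r + 1) powr (2 * l)" using False basic by (intro powr_mono2) auto
    moreover have "kf r = 2 * a powr (2 * l) - a powr (2 * l + 2 * s - 1) * (r + 1) powr (1 - 2 * s)"
      using False by (simp add: kf_def)
    ultimately show ?thesis using e0 by linarith
  qed
qed

lemma kf_continuous: "continuous_on {0..} kf"
proof -
  have eq: "a powr (2 * l) = 2 * a powr (2 * l) - a powr (2 * l + 2 * s - 1) * a powr (1 - 2 * s)"
    by (simp flip: powr_add)
  have "continuous_on ({0..A} \<union> {A..}) (\<lambda>r. if r \<le> A then (r + 1) powr (2 * l) else 2 * a powr (2 * l) - a powr (2 * l + 2 * s - 1) * (r + 1) powr (1 - 2 * s))"
    using A1 eq by (intro continuous_on_If) (auto intro!: continuous_intros dest: antisym)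
  moreover have "{0..A} \<union> {A..} = {0..}" using A1 by auto
  ultimately show ?thesis unfolding kf_def[abs_def] by simp
qed

lemma kf_deriv:
  assumes r: "r > 0" "r \<noteq> A"
  shows "(kf has_real_derivative kf' r) (at r)"
proof (cases "r < A")
  case True
  show ?thesis
  proof (rule has_field_derivative_transform_within_open[where S = "{0<..<A}" and f = "\<lambda>r. (r + 1) powr (2 * l)"])
    show "((\<lambda>r. (r + 1) powr (2 * l)) has_real_derivative kf' r) (at r)"
      using r True by (auto intro!: derivative_eq_intros simp: kf'_def)
  qed (use r True in \<open>auto simp: kf_def\<close>)
next
  case False
  show ?thesis
  proof (rule has_field_derivative_transform_within_open[where S = "{A<..}" and f = "\<lambda>r. 2 * a powr (2 * l) - a powr (2 * l + 2 * s - 1) * (r + 1) powr (1 - 2 * s)"])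
    show "((\<lambda>r. 2 * a powr (2 * l) - a powr (2 * l + 2 * s - 1) * (r + 1) powr (1 - 2 * s)) has_real_derivative kf' r) (at r)"
      using r False by (auto intro!: derivative_eq_intros simp: kf'_def algebra_simps)
  qed (use r False in \<open>auto simp: kf_def\<close>)
qed

lemma mf_deriv:
  assumes r: "r > 0" "r \<noteq> A"
  shows "(mf has_real_derivative mf' r) (at r)"
proof -
  have "((\<lambda>r. kf r / (r + 1)) has_real_derivative (kf' r * (r + 1) - kf r * 1) / ((r + 1) * (r + 1))) (at r)"
    by (rule DERIV_divide[OF kf_deriv[OF r]]) (use r in \<open>auto intro!: derivative_eq_intros\<close>)
  moreover have "(kf' r * (r + 1) - kf r * 1) / ((r + 1) * (r + 1)) = mf' r"
    using r by (simp add: mf'_def diff_divide_distrib power2_eq_square)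
  ultimately show ?thesis by (simp add: mf_def[abs_def])
qed

lemma mf'_bound:
  assumes r: "r \<ge> 0"
  shows "\<bar>mf' r\<bar> \<le> 6 * a powr (2 * l) / (r + 1)"
proof -
  note k = kf_bounds[OF r]
  have p: "0 \<le> kf r / (r + 1)" using k r by simp
  have "\<bar>mf' r\<bar> \<le> kf' r / (r + 1) + kf r / (r + 1)\<^sup>2"
    unfolding mf'_def using k r by (intro order_trans[OF abs_triangle_ineq4]) auto
  also have "\<dots> \<le> 4/3 * (kf r / (r + 1)) / (r + 1) + kf r / (r + 1)\<^sup>2"
    using k(4) r by (intro add_right_mono divide_right_mono) auto
  also have "\<dots> = 7/3 * (kf r / (r + 1)) / (r + 1)"
  proof -
    have q: "kf r / (r + 1)\<^sup>2 = (kf r / (r + 1)) / (r + 1)" by (simp add: power2_eq_square)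
    have z: "4/3 * z + z = 7/3 * z" for z :: real by simp
    show ?thesis by (simp only: q add_divide_distrib[symmetric] z)
  qed
  also have "\<dots> \<le> 3 * (2 * a powr (2 * l)) / (r + 1)"
  proof (rule divide_right_mono)
    have "kf r / (r + 1) \<le> kf r / 1" using k r by (intro divide_left_mono) auto
    then have "kf r / (r + 1) \<le> 2 * a powr (2 * l)" using k(2) by simp
    then show "7/3 * (kf r / (r + 1)) \<le> 3 * (2 * a powr (2 * l))" using p by linarith
  qed (use r in simp)
  finally show ?thesis by simp
qed

lemma mf_continuous: "continuous_on {0..} mf"
  unfolding mf_def[abs_def] by (intro continuous_intros kf_continuous) auto

lemma mf_lip_aux:
  assumes t: "t \<ge> 0" "t \<le> r"
  shows "\<bar>mf r - mf t\<bar> \<le> 6 * a powr (2 * l) / (t + 1) * (r - t)"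
proof (rule piecewise_MVT_bound[OF t(2), where A = A and f' = mf'])
  show "continuous_on {t..r} mf" by (rule continuous_on_subset[OF mf_continuous]) (use t in auto)
  show "(mf has_real_derivative mf' x) (at x)" if "t < x" "x \<noteq> A" for x using mf_deriv that t by auto
  show "\<bar>mf' x\<bar> \<le> 6 * a powr (2 * l) / (t + 1)" if "t < x" for x
  proof -
    have "\<bar>mf' x\<bar> \<le> 6 * a powr (2 * l) / (x + 1)" using mf'_bound that t by auto
    also have "\<dots> \<le> 6 * a powr (2 * l) / (t + 1)" using that t by (intro divide_left_mono) auto
    finally show ?thesis .
  qed
  show "0 \<le> 6 * a powr (2 * l) / (t + 1)" using t by simp
qed

lemma mf_lip_ord:
  assumes t: "t \<ge> 0" "t \<le> r"
  shows "\<bar>mf r - mf t\<bar> \<le> 6 * a powr (2 * l) * \<bar>r - t\<bar>" "t * \<bar>mf r - mf t\<bar> \<le> 6 * a powr (2 * l) * \<bar>r - t\<bar>"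
proof -
  let ?C = "6 * a powr (2 * l)"
  have C: "?C \<ge> 0" by simp
  have "?C / (t + 1) * (r - t) \<le> ?C * (r - t)"
    using t C by (intro mult_right_mono) (auto simp: divide_le_eq mult_le_cancel_left1)
  then show "\<bar>mf r - mf t\<bar> \<le> ?C * \<bar>r - t\<bar>" using mf_lip_aux[OF t] t by simp
  have "t * \<bar>mf r - mf t\<bar> \<le> t * (?C / (t + 1) * (r - t))" using mf_lip_aux[OF t] t by (intro mult_left_mono) auto
  also have "\<dots> = (t / (t + 1)) * (?C * (r - t))" by simp
  also have "\<dots> \<le> 1 * (?C * (r - t))" using t C by (intro mult_right_mono mult_nonneg_nonneg) auto
  finally show "t * \<bar>mf r - mf t\<bar> \<le> ?C * \<bar>r - t\<bar>" using t by simp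
qed

lemma Phi_bounds:
  assumes r: "r \<ge> 0"
  shows "0 < Phi r" "Phi r \<le> 2" "r \<le> A \<Longrightarrow> (r + 1) powr (- l) \<le> Phi r"
proof -
  define p where "p = (r + 1) powr (- \<kappa>)"
  have p: "0 < p" "p \<le> 1" using r kappa powr_neg_le_one[of "r + 1" \<kappa>] by (auto simp: p_def)
  have y: "0 < (r + 1) powr (- l)" "(r + 1) powr (- l) \<le> 1" using r basic powr_neg_le_one[of "r + 1" l] by auto
  show lower: "(r + 1) powr (- l) \<le> Phi r" if "r \<le> A"
    using that mult_left_mono[of 1 "2 - p" "(r + 1) powr (- l)"] p y by (simp add: phase_deriv_def p_def)
  show "0 < Phi r"
    using lower y(1) K_bounds(3) r by (cases "r \<le> A") (auto simp: phase_deriv_def)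
  show "Phi r \<le> 2"
  proof (cases "r \<le> A")
    case True
    have "(r + 1) powr (- l) * (2 - p) \<le> 1 * 2" using p y by (intro mult_mono) auto
    then show ?thesis using True by (simp add: phase_deriv_def p_def)
  next
    case False
    have "K * (r + 1) powr (- 2 * s) \<le> (2 * a powr (2 * s - l)) * a powr (- 2 * s)"
      using K_bounds False basic by (intro mult_mono powr_mono2') auto
    also have "\<dots> = 2 * a powr (- l)" by (simp flip: powr_add)
    also have "\<dots> \<le> 2 * 1" using basic by (intro mult_left_mono powr_neg_le_one) auto
    finally show ?thesis using False by (simp add: phase_deriv_def)
  qed
qed

lemma Phi_deriv:
  assumes r: "r > 0" "r \<noteq> A"
  shows "(Phi has_real_derivative dPhi r) (at r)"
proof (cases "r < A")
  case True
  show ?thesis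
  proof (rule has_field_derivative_transform_within_open[where S = "{0<..<A}" and f = "\<lambda>r. (r + 1) powr (- l) * (2 - (r + 1) powr (- \<kappa>))"])
    have e: "(1 + r) powr - l * (1 + r) powr (- \<kappa> - 1) = (1 + r) powr - \<kappa> * (1 + r) powr (- l - 1)"
      by (simp add: algebra_simps flip: powr_add)
    show "((\<lambda>r. (r + 1) powr (- l) * (2 - (r + 1) powr (- \<kappa>))) has_real_derivative dPhi r) (at r)"
      using r True by (auto intro!: derivative_eq_intros simp: dPhi_def e field_simps)
  qed (use r True in \<open>auto simp: phase_deriv_def\<close>)
next
  case False
  show ?thesis
  proof (rule has_field_derivative_transform_within_open[where S = "{A<..}" and f = "\<lambda>r. K * (r + 1) powr (- 2 * s)"])
    show "((\<lambda>r. K * (r + 1) powr (- 2 * s)) has_real_derivative dPhi r) (at r)"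
      using r False by (auto intro!: derivative_eq_intros simp: dPhi_def algebra_simps)
  qed (use r False in \<open>auto simp: phase_deriv_def\<close>)
qed

lemma dPhi_inner: "r \<ge> 0 \<Longrightarrow> r \<le> A \<Longrightarrow> \<bar>dPhi r\<bar> \<le> 3 * (r + 1) powr (- l - 1)"
proof -
  assume r: "r \<ge> 0" "r \<le> A"
  define p where "p = (r + 1) powr (- \<kappa>)"
  have p: "0 < p" "p \<le> 1" using r kappa powr_neg_le_one[of "r + 1" \<kappa>] by (auto simp: p_def)
  have 1: "0 \<le> \<kappa> * p" "\<kappa> * p \<le> 1" using p kappa basic by (auto intro: mult_le_one)
  have 2: "0 \<le> l * (2 - p)" using p basic by simp
  have 3: "l * (2 - p) \<le> l * 2" using p basic by (intro mult_left_mono) auto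
  have "\<bar>\<kappa> * p - l * (2 - p)\<bar> \<le> 3" using 1 2 3 basic by linarith
  then show ?thesis using r by (simp add: dPhi_def p_def abs_mult mult.commute mult_left_mono)
qed

lemma dPhi_bound: "r \<ge> 0 \<Longrightarrow> \<bar>dPhi r\<bar> \<le> 3 + 2 * K"
proof -
  assume r: "r \<ge> 0"
  show ?thesis
  proof (cases "r \<le> A")
    case True
    have "(r + 1) powr (- l - 1) \<le> 1" using r basic powr_neg_le_one[of "r + 1" "l + 1"] by simp
    then show ?thesis using dPhi_inner[OF r True] K_bounds(3) by linarith
  next
    case False
    have "(r + 1) powr (- 2 * s - 1) \<le> 1" using r basic powr_neg_le_one[of "r + 1" "2 * s + 1"] by simp
    then have "(2 * s * K) * (r + 1) powr (- 2 * s - 1) \<le> (2 * K) * 1"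
      using K_bounds(3) basic by (intro mult_mono) auto
    moreover have "\<bar>dPhi r\<bar> = (2 * s * K) * (r + 1) powr (- 2 * s - 1)"
      using False basic K_bounds(3) by (simp add: dPhi_def abs_mult)
    ultimately show ?thesis using K_bounds(3) by linarith
  qed
qed

lemma Phi_lip:
  assumes "r \<ge> 0" "t \<ge> 0"
  shows "\<bar>Phi r - Phi t\<bar> \<le> (3 + 2 * K) * \<bar>r - t\<bar>"
proof -
  have "\<bar>Phi r - Phi t\<bar> \<le> (3 + 2 * K) * (r - t)" if "0 \<le> t" "t \<le> r" for r t
  proof (rule piecewise_MVT_bound[OF that(2), where A = A and f' = dPhi])
    show "continuous_on {t..r} Phi"
      by (rule continuous_on_subset[OF phase_deriv_continuous]) (use that A1 in auto)
    show "(Phi has_real_derivative dPhi x) (at x)" if "t < x" "x \<noteq> A" for x using Phi_deriv that \<open>0 \<le> t\<close> by auto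
    show "\<bar>dPhi x\<bar> \<le> 3 + 2 * K" if "t < x" for x using dPhi_bound that \<open>0 \<le> t\<close> by auto
  qed (use K_bounds in simp)
  from this[of r t] this[of t r] show ?thesis using assms
    by (cases "t \<le> r") (auto simp: abs_minus_commute)
qed

lemma mu_deriv_eq:
  assumes r: "r \<ge> 0"
  shows "mf r + r * mf' r = kf r / (r + 1)\<^sup>2 + r / (r + 1) * kf' r"
proof -
  have y: "r + 1 \<noteq> 0" using r by linarith
  show ?thesis using y by (simp add: mf_def mf'_def power2_eq_square divide_simps) (simp add: algebra_simps)
qed

lemma mu_deriv_bounds:
  assumes r: "r \<ge> 0"
  shows "0 \<le> mf r + r * mf' r" "mf r + r * mf' r \<le> 2 * mf r"
proof -
  note k = kf_bounds[OF r]
  show "0 \<le> mf r + r * mf' r" unfolding mu_deriv_eq[OF r] using k r by simp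
  have "r / (r + 1) * kf' r \<le> r / (r + 1) * (4/3 * (kf r / (r + 1)))"
    using k r by (intro mult_left_mono) auto
  then have "mf r + r * mf' r \<le> kf r / (r + 1)\<^sup>2 + r / (r + 1) * (4/3 * (kf r / (r + 1)))"
    unfolding mu_deriv_eq[OF r] by simp
  also have "\<dots> = (1 + 4/3 * r) * (kf r / (r + 1)\<^sup>2)"
  proof -
    have "r / y * (4/3 * (k / y)) = 4/3 * r * (k / y\<^sup>2)" for y k :: real by (simp add: power2_eq_square)
    from this[of "r + 1" "kf r"] show ?thesis by (simp only: distrib_right mult_1)
  qed
  also have "\<dots> \<le> (2 * (r + 1)) * (kf r / (r + 1)\<^sup>2)" using k r by (intro mult_right_mono) auto
  also have "\<dots> = 2 * mf r"
  proof -
    have "2 * y * (k / y\<^sup>2) = 2 * (k / y)" if "y \<noteq> 0" for y k :: real using that by (simp add: power2_eq_square)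
    from this[of "r + 1" "kf r"] show ?thesis unfolding mf_def using r by linarith
  qed
  finally show "mf r + r * mf' r \<le> 2 * mf r" .
qed

lemma rm_le_kf:
  assumes r: "r \<ge> 0"
  shows "0 \<le> r * mf r" "r * mf r \<le> kf r"
proof -
  note k = kf_bounds[OF r]
  show "0 \<le> r * mf r" using k r by (simp add: mf_def)
  have "r * mf r = (r / (r + 1)) * kf r" by (simp add: mf_def)
  also have "\<dots> \<le> 1 * kf r" using k r by (intro mult_right_mono) auto
  finally show "r * mf r \<le> kf r" by simp
qed

text \<open>This ratio is the price for absorbing the source by the friction; it is compensated by the
  weight \<open>\<langle>x\<rangle>\<^sup>s\<close> in the definition of \<open>F\<close>.  This is where the condition \<open>3 l < 2 s\<close> enters.\<close>

lemma rm_over_Phi: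
  assumes r: "r \<ge> 0"
  shows "r * mf r / Phi r \<le> 2 * (r + 1) powr (2 * s)"
proof (cases "r \<le> A")
  case True
  have "r * mf r / Phi r \<le> (r + 1) powr (2 * l) / (r + 1) powr (- l)"
    using rm_le_kf[OF r] Phi_bounds[OF r] True r kf_bounds[OF r] by (intro frac_le) (auto simp: kf_def)
  also have "\<dots> = (r + 1) powr (3 * l)" using r by (simp flip: powr_diff)
  also have "\<dots> \<le> (r + 1) powr (2 * s)" using r basic by (intro powr_mono) auto
  also have "\<dots> \<le> 2 * (r + 1) powr (2 * s)" by simp
  finally show ?thesis .
next
  case False
  have P: "Phi r = K * (r + 1) powr (- 2 * s)" using False by (simp add: phase_deriv_def)
  have "r * mf r / Phi r \<le> (2 * a powr (2 * l)) / (a powr (2 * s - l) * (r + 1) powr (- 2 * s))"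
    unfolding P using rm_le_kf[OF r] kf_bounds[OF r] K_bounds r basic
    by (intro frac_le mult_right_mono) auto
  also have "\<dots> = 2 * (a powr (3 * l - 2 * s) * (r + 1) powr (2 * s))"
    using r basic by (simp add: powr_minus powr_diff field_simps flip: powr_add)
  also have "\<dots> \<le> 2 * (1 * (r + 1) powr (2 * s))"
    using basic powr_neg_le_one[of a "2 * s - 3 * l"] by (intro mult_left_mono mult_right_mono) auto
  finally show ?thesis by simp
qed

end

section \<open>Coercivity\<close>

context carleman_weights
begin

text \<open>The first two are the lower bounds for the \<open>\<tau>\<^sup>2\<close>-coefficient and the \<open>lam\<^sup>2\<close>-coefficient inside \<open>r \<le> A\<close>, the
  third one is that of the \<open>lam\<^sup>2\<close>-coefficient outside, and \<open>cc\<close> is the resulting constant of the weight that is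
  gained.  None of them depends on \<open>A\<close>.\<close>

definition c0 :: real where "c0 = min 1 (2 * \<kappa>)"
definition c1 :: real where "c1 = min 1 (2 * l)"
definition b0 :: real where "b0 = (2 * s - 1) / 4"
definition cc :: real where "cc = min (c0 / 4) (min (c1 / 4) (b0 / 2))"

lemma consts_pos: "0 < c0" "c0 \<le> 1" "0 < c1" "0 < b0" "0 < cc" "cc \<le> 1/4" "cc \<le> c0 / 4" "cc \<le> c1 / 4" "cc \<le> b0 / 2"
proof -
  show c: "0 < c0" "c0 \<le> 1" "0 < c1" "0 < b0" using basic kappa by (auto simp: c0_def c1_def b0_def)
  show l: "cc \<le> c0 / 4" "cc \<le> c1 / 4" "cc \<le> b0 / 2" unfolding cc_def by (auto simp: min_le_iff_disj)
  show "0 < cc" unfolding cc_def using c by simp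
  show "cc \<le> 1/4" using c(2) l(1) by simp
qed

lemma powr_sub_one: "y > 0 \<Longrightarrow> y powr (p - 1) = y powr p / (y::real)"
  by (simp add: powr_diff)

text \<open>The left-hand side is the derivative of \<open>r mf Phi\<^sup>2\<close>.  With \<open>p = (r + 1)\<^sup>-\<^sup>\<kappa>\<close>, the powers of \<open>r + 1\<close> in \<open>kf Phi\<^sup>2\<close> cancel and
  leave \<open>(2 - p)\<^sup>2\<close>, which is increasing; this is the purpose of the correction \<open>2 - p\<close> in the phase.\<close>

lemma inner_square_bound:
  assumes r: "0 \<le> r" "r \<le> A"
  shows "c0 * (r + 1) powr (- 1 - \<kappa>) \<le> (mf r + r * mf' r) * (Phi r)\<^sup>2 + 2 * r * mf r * Phi r * dPhi r"
proof -
  define y where "y = r + 1"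
  have y: "y \<ge> 1" "y > 0" using r by (auto simp: y_def)
  define p where "p = y powr (- \<kappa>)"
  define P where "P = y powr (- l)"
  define q where "q = y powr (2 * l)"
  have p: "0 < p" "p \<le> 1" using y kappa powr_neg_le_one[of y \<kappa>] by (auto simp: p_def)
  have PPq: "P * P * q = 1" using y by (simp add: P_def q_def flip: powr_add)
  have ePhi: "Phi r = P * (2 - p)" using r by (simp add: phase_deriv_def P_def p_def y_def)
  have edPhi: "dPhi r = P / y * (\<kappa> * p - l * (2 - p))"
    using r y powr_sub_one[of y "- l"] by (simp add: dPhi_def P_def p_def y_def[symmetric])
  have emf: "mf r = q / y" using r by (simp add: mf_def kf_def q_def y_def)
  have emu: "mf r + r * mf' r = q / y\<^sup>2 * (1 + 2 * l * r)"
  proof -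
    have "kf' r = 2 * l * (q / y)" using r y powr_sub_one[of y "2 * l"] by (simp add: kf'_def q_def y_def[symmetric])
    moreover have "kf r = q" using r by (simp add: kf_def q_def y_def)
    ultimately have "mf r + r * mf' r = q / y\<^sup>2 + r / y * (2 * l * (q / y))"
      using mu_deriv_eq[OF r(1)] unfolding y_def[symmetric] by simp
    then show ?thesis by (simp add: power2_eq_square distrib_left)
  qed
  have "(mf r + r * mf' r) * (Phi r)\<^sup>2 + 2 * r * mf r * Phi r * dPhi r
     = (P * P * q) * ((2 - p)\<^sup>2 * (1 + 2 * l * r) + 2 * r * (2 - p) * (\<kappa> * p - l * (2 - p))) / y\<^sup>2"
    unfolding emu unfolding ePhi edPhi emf using y by (simp add: power2_eq_square field_simps)
  also have "\<dots> = ((2 - p)\<^sup>2 + 2 * \<kappa> * r * p * (2 - p)) / y\<^sup>2"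
    unfolding PPq by (simp add: power2_eq_square algebra_simps)
  finally have eq: "(mf r + r * mf' r) * (Phi r)\<^sup>2 + 2 * r * mf r * Phi r * dPhi r = ((2 - p)\<^sup>2 + 2 * \<kappa> * r * p * (2 - p)) / y\<^sup>2" .
  have "c0 * (r + 1) powr (- 1 - \<kappa>) = c0 * (p / y)"
  proof -
    have "- 1 - \<kappa> = - \<kappa> - 1" by simp
    then show ?thesis by (simp only: y_def[symmetric] p_def powr_sub_one[OF y(2)])
  qed
  also have "\<dots> = (c0 * p + c0 * r * p) / y\<^sup>2"
  proof -
    have e: "c0 * p + c0 * r * p = c0 * p * y" by (simp add: y_def algebra_simps)
    show ?thesis unfolding e using y by (simp add: power2_eq_square)
  qed
  also have "\<dots> \<le> ((2 - p)\<^sup>2 + 2 * \<kappa> * r * p * (2 - p)) / y\<^sup>2"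
  proof (rule divide_right_mono)
    have "1 * 1 \<le> (2 - p) * (2 - p)" using p by (intro mult_mono) auto
    then have 1: "1 \<le> (2 - p)\<^sup>2" by (simp add: power2_eq_square)
    have 2: "c0 * p \<le> 1" using p consts_pos by (intro mult_le_one) auto
    have "c0 * (r * p) * 1 \<le> (2 * \<kappa>) * (r * p) * (2 - p)"
      using p r kappa consts_pos by (intro mult_mono mult_right_mono) (auto simp: c0_def)
    then show "c0 * p + c0 * r * p \<le> (2 - p)\<^sup>2 + 2 * \<kappa> * r * p * (2 - p)" using 1 2 by (simp add: mult_ac)
  qed simp
  finally show ?thesis unfolding eq .
qed

text \<open>The errors are of the order of the main term because \<open>\<kappa> < 1 - l\<close>, and the main term dominates the
  weight because \<open>\<kappa> < 2 s - 1\<close>.\<close>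

lemma inner_error_bounds:
  assumes r: "0 \<le> r" "r \<le> A"
  shows "(dPhi r)\<^sup>2 * (r * mf r) / Phi r \<le> 9 * (r + 1) powr (- 1 - \<kappa>)"
    "kf r / (r + 1) ^ 3 \<le> (r + 1) powr (- 1 - \<kappa>)"
    "c1 * (r + 1) powr (- 2 * s) \<le> mf r + r * mf' r"
    "(r + 1) powr (- 2 * s) \<le> (r + 1) powr (- 1 - \<kappa>)"
proof -
  define y where "y = r + 1"
  have y: "y \<ge> 1" "y > 0" using r by (auto simp: y_def)
  have k: "kf r = y powr (2 * l)" using r by (simp add: kf_def y_def)
  have "(dPhi r)\<^sup>2 * (r * mf r) / Phi r \<le> (3 * y powr (- l - 1))\<^sup>2 * y powr (2 * l) / y powr (- l)"
  proof (rule frac_le)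
    have "\<bar>dPhi r\<bar>\<^sup>2 \<le> (3 * y powr (- l - 1))\<^sup>2" using dPhi_inner[OF r] unfolding y_def by (intro power_mono) auto
    then show "(dPhi r)\<^sup>2 * (r * mf r) \<le> (3 * y powr (- l - 1))\<^sup>2 * y powr (2 * l)"
      using rm_le_kf[OF r(1)] k by (intro mult_mono) auto
    show "y powr (- l) \<le> Phi r" using Phi_bounds(3)[OF r] by (simp add: y_def)
  qed (use y in auto)
  also have "\<dots> = 9 * (y powr (- l - 1) * y powr (- l - 1) * y powr (2 * l) * y powr l)"
    using y by (simp add: power2_eq_square powr_minus field_simps)
  also have "\<dots> = 9 * y powr (l - 2)" using y by (simp flip: powr_add)
  also have "\<dots> \<le> 9 * y powr (- 1 - \<kappa>)" using y kappa by (intro mult_left_mono powr_mono) auto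
  finally show "(dPhi r)\<^sup>2 * (r * mf r) / Phi r \<le> 9 * (r + 1) powr (- 1 - \<kappa>)" by (simp add: y_def)
  have "kf r / y ^ 3 = y powr (2 * l - 3)" unfolding k using y powr_realpow[of y 3] by (simp add: powr_diff)
  also have "\<dots> \<le> y powr (- 1 - \<kappa>)" using y kappa basic by (intro powr_mono) auto
  finally show "kf r / (r + 1) ^ 3 \<le> (r + 1) powr (- 1 - \<kappa>)" by (simp add: y_def)
  show "(r + 1) powr (- 2 * s) \<le> (r + 1) powr (- 1 - \<kappa>)" using r kappa by (intro powr_mono) auto
  have "c1 * y powr (- 2 * s) \<le> c1 * y powr (2 * l - 1)"
    using y basic consts_pos by (intro mult_left_mono powr_mono) auto
  also have "\<dots> = y powr (2 * l) / y\<^sup>2 * (c1 * y)" using y powr_sub_one[of y "2 * l"] by (simp add: power2_eq_square)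
  also have "\<dots> \<le> y powr (2 * l) / y\<^sup>2 * (1 + 2 * l * r)"
  proof (rule mult_left_mono)
    have "c1 * r \<le> 2 * l * r" using r by (intro mult_right_mono) (auto simp: c1_def)
    moreover have "c1 \<le> 1" by (simp add: c1_def)
    ultimately show "c1 * y \<le> 1 + 2 * l * r" by (simp add: y_def algebra_simps)
  qed simp
  also have "\<dots> = mf r + r * mf' r"
  proof -
    have "kf' r = 2 * l * (y powr (2 * l) / y)" using r y powr_sub_one[of y "2 * l"] by (simp add: kf'_def y_def[symmetric])
    then have "mf r + r * mf' r = y powr (2 * l) / y\<^sup>2 + r / y * (2 * l * (y powr (2 * l) / y))"
      using mu_deriv_eq[OF r(1)] k unfolding y_def[symmetric] by simp
    then show ?thesis by (simp add: power2_eq_square distrib_left)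
  qed
  finally show "c1 * (r + 1) powr (- 2 * s) \<le> mf r + r * mf' r" by (simp add: y_def)
qed

text \<open>Everything is measured in units of \<open>a\<^sup>2\<^sup>s\<^sup>-\<^sup>1 (r + 1)\<^sup>-\<^sup>2\<^sup>s\<close>.  In these units the \<open>lam\<^sup>2\<close>-coefficient is of size \<open>a\<^sup>2\<^sup>l\<close>
  and all other terms are bounded.\<close>

lemma outer_bounds:
  assumes r: "r > A"
  shows "2 * b0 * (a powr (2 * l) * (a powr (2 * s - 1) * (r + 1) powr (- 2 * s))) \<le> mf r + r * mf' r"
    "- (32 * (a powr (2 * s - 1) * (r + 1) powr (- 2 * s))) \<le> (mf r + r * mf' r) * (Phi r)\<^sup>2 + 2 * r * mf r * Phi r * dPhi r"
    "(dPhi r)\<^sup>2 * (r * mf r) / Phi r \<le> 16 * (a powr (2 * s - 1) * (r + 1) powr (- 2 * s))"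
    "kf r / (r + 1) ^ 3 \<le> 2 * (a powr (2 * s - 1) * (r + 1) powr (- 2 * s))"
proof -
  define y where "y = r + 1"
  have r0: "r \<ge> 0" "r \<ge> 1" using r A1 by auto
  have y: "y \<ge> a" "y \<ge> 1" "y > 0" using r A1 by (auto simp: y_def)
  have a0: "a \<ge> 1" "a > 0" using A1 by auto
  define S where "S = y powr (- 2 * s)"
  have S: "S > 0" using y by (simp add: S_def)
  note k = kf_bounds[OF r0(1)] and rm = rm_le_kf[OF r0(1)]
  have ePhi: "Phi r = K * S" using r by (simp add: phase_deriv_def S_def y_def)
  have edPhi: "dPhi r = - 2 * s * K * (S / y)"
    using r y powr_sub_one[of y "- 2 * s"] by (simp add: dPhi_def S_def y_def[symmetric])
  have rm2: "r * mf r \<le> 2 * a powr (2 * l)" using rm k by linarith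
  have ya: "y powr (- p) \<le> a powr (- p)" if "p \<ge> 0" for p using y a0 that by (intro powr_mono2') auto
  have "2 * b0 * (a powr (2 * l) * (a powr (2 * s - 1) * S)) = 1/2 * kf' r"
  proof -
    have "a powr (2 * l + 2 * s - 1) = a powr (2 * l) * a powr (2 * s - 1)" by (simp add: algebra_simps flip: powr_add)
    then have "kf' r = (2 * s - 1) * (a powr (2 * l) * a powr (2 * s - 1)) * S" using r by (simp add: kf'_def S_def y_def)
    then show ?thesis by (simp add: b0_def)
  qed
  also have "\<dots> \<le> r / (r + 1) * kf' r" using k r0 by (intro mult_right_mono) (auto simp: field_simps)
  also have "\<dots> \<le> mf r + r * mf' r" unfolding mu_deriv_eq[OF r0(1)] using k r0 by simp
  finally show "2 * b0 * (a powr (2 * l) * (a powr (2 * s - 1) * (r + 1) powr (- 2 * s))) \<le> mf r + r * mf' r"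
    by (simp add: S_def y_def)
  have Sy: "S / y \<le> a powr (- 2 * s - 1)"
    using ya[of "2 * s + 1"] basic y powr_sub_one[of y "- 2 * s"] by (simp add: S_def)
  have KK: "K * K \<le> 4 * (a powr (2 * s - l) * a powr (2 * s - l))"
  proof -
    have "K * K \<le> (2 * a powr (2 * s - l)) * (2 * a powr (2 * s - l))" using K_bounds by (intro mult_mono) auto
    then show ?thesis by simp
  qed
  define RM K2 A2 where "RM = r * mf r" and "K2 = K * K" and "A2 = a powr (2 * s - l) * a powr (2 * s - l)"
  have RM: "0 \<le> RM" "RM \<le> 2 * a powr (2 * l)" and K2: "0 \<le> K2" "K2 \<le> 4 * A2" and A2: "0 \<le> A2"
    using rm rm2 KK K_bounds(3) by (simp_all add: RM_def K2_def A2_def)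
  have "4 * s * RM * K2 * (S / y) \<le> 4 * 1 * (2 * a powr (2 * l)) * (4 * A2) * a powr (- 2 * s - 1)"
    using basic RM K2 A2 Sy S y by (intro mult_mono mult_nonneg_nonneg) auto
  then have "4 * s * (r * mf r) * (K * K) * (S / y) \<le> 4 * 1 * (2 * a powr (2 * l)) * (4 * (a powr (2 * s - l) * a powr (2 * s - l))) * a powr (- 2 * s - 1)"
    by (simp only: RM_def K2_def A2_def)
  also have "\<dots> = 32 * (a powr (2 * l) * a powr (2 * s - l) * a powr (2 * s - l) * a powr (- 2 * s - 1))" by simp
  also have "\<dots> = 32 * a powr (2 * s - 1)" by (simp flip: powr_add)
  finally have m: "4 * s * (r * mf r) * (K * K) * (S / y) * S \<le> 32 * a powr (2 * s - 1) * S"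
    using S by (intro mult_right_mono) auto
  have "- (32 * (a powr (2 * s - 1) * S)) \<le> - (4 * s * (r * mf r) * (K * K) * (S / y) * S)" using m by simp
  also have "\<dots> = 2 * r * mf r * Phi r * dPhi r" unfolding ePhi edPhi by (simp add: algebra_simps)
  also have "\<dots> \<le> (mf r + r * mf' r) * (Phi r)\<^sup>2 + 2 * r * mf r * Phi r * dPhi r"
    using mu_deriv_bounds[OF r0(1)] by simp
  finally show "- (32 * (a powr (2 * s - 1) * (r + 1) powr (- 2 * s))) \<le> (mf r + r * mf' r) * (Phi r)\<^sup>2 + 2 * r * mf r * Phi r * dPhi r"
    by (simp add: S_def y_def)
  have yy: "1 / (y * y) \<le> a powr (- 2)"
  proof -
    have "1 / (y * y) = y powr (- 2)" using y powr_realpow[of y 2] by (simp add: powr_minus_divide power2_eq_square)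
    then show ?thesis using ya[of 2] by simp
  qed
  have "(dPhi r)\<^sup>2 * (r * mf r) / Phi r = 4 * (s * s) * K * RM * (1 / (y * y)) * S"
    unfolding ePhi edPhi RM_def[symmetric] using S K_bounds(3) y by (simp add: power2_eq_square field_simps)
  also have "\<dots> \<le> 4 * (1 * 1) * (2 * a powr (2 * s - l)) * (2 * a powr (2 * l)) * a powr (- 2) * S"
    using basic RM K_bounds S yy y by (intro mult_mono mult_nonneg_nonneg) auto
  also have "\<dots> = 16 * (a powr (2 * s - l) * a powr (2 * l) * a powr (- 2)) * S" by simp
  also have "a powr (2 * s - l) * a powr (2 * l) * a powr (- 2) = a powr (2 * s + l - 2)"
    by (simp add: algebra_simps flip: powr_add)
  also have "16 * a powr (2 * s + l - 2) * S \<le> 16 * a powr (2 * s - 1) * S"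
    using a0 basic S by (intro mult_right_mono mult_left_mono powr_mono) auto
  finally show "(dPhi r)\<^sup>2 * (r * mf r) / Phi r \<le> 16 * (a powr (2 * s - 1) * (r + 1) powr (- 2 * s))"
    by (simp add: S_def y_def)
  have "kf r / y ^ 3 \<le> 2 * a powr (2 * l) / y ^ 3" using k y by (intro divide_right_mono) auto
  also have "\<dots> = 2 * a powr (2 * l) * (y powr (2 * s - 3)) * S"
    using y powr_realpow[of y 3] by (simp add: S_def powr_diff powr_minus field_simps flip: powr_add)
  also have "\<dots> \<le> 2 * a powr (2 * l) * a powr (2 * s - 3) * S"
    using ya[of "3 - 2 * s"] basic S by (intro mult_right_mono mult_left_mono) auto
  also have "\<dots> = 2 * a powr (2 * l + 2 * s - 3) * S" by (simp add: mult.assoc flip: powr_add) (simp add: algebra_simps)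
  also have "\<dots> \<le> 2 * a powr (2 * s - 1) * S"
    using a0 basic S by (intro mult_right_mono mult_left_mono powr_mono) auto
  finally show "kf r / (r + 1) ^ 3 \<le> 2 * (a powr (2 * s - 1) * (r + 1) powr (- 2 * s))"
    by (simp add: S_def y_def)
qed

text \<open>The product \<open>N (N - 1)\<close> is nonnegative for \<open>N \<ge> 1\<close> and never below \<open>-1/4\<close>, and \<open>1/r\<^sup>2 \<le> 9/(r + 1)\<^sup>2\<close> for \<open>r \<ge> 1/2\<close>.\<close>

lemma origin_error_bound:
  assumes r: "r > 0" and N: "N \<ge> 1 \<or> r \<ge> 1/2"
  shows "- (9/4 * (kf r / (r + 1) ^ 3)) \<le> min 0 (N * (N - 1)) * (mf r - 1/2 * (mf r + r * mf' r)) / r\<^sup>2"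
proof -
  have r0: "r \<ge> 0" using r by simp
  have k: "0 \<le> kf r" using kf_bounds[OF r0] by simp
  define D where "D = mf r - 1/2 * (mf r + r * mf' r)"
  have D: "0 \<le> D" "D \<le> kf r / (r + 1)" using mu_deriv_bounds[OF r0] by (simp_all add: D_def mf_def)
  show ?thesis
  proof (cases "N \<ge> 1")
    case True
    then have "min 0 (N * (N - 1)) = 0" by simp
    then show ?thesis using k r by simp
  next
    case False
    then have r2: "r \<ge> 1/2" using N by simp
    have "0 \<le> (N - 1/2)\<^sup>2" by simp
    then have m: "- (1/4) \<le> min 0 (N * (N - 1))" by (simp add: power2_eq_square algebra_simps)
    have "r + 1 \<le> 3 * r" using r2 by simp
    then have "(r + 1)\<^sup>2 \<le> (3 * r)\<^sup>2" using r by (intro power_mono) auto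
    then have "1 / r\<^sup>2 \<le> 9 / (r + 1)\<^sup>2" using r by (simp add: divide_simps power_mult_distrib)
    moreover have "0 \<le> kf r / (r + 1)" using D by linarith
    then have "0 \<le> 1/4 * (kf r / (r + 1))" by (rule mult_nonneg_nonneg[rotated]) simp
    ultimately have "1/4 * D * (1 / r\<^sup>2) \<le> 1/4 * (kf r / (r + 1)) * (9 / (r + 1)\<^sup>2)"
      by (intro mult_mono mult_left_mono D) simp_all
    also have "\<dots> = 9/4 * (kf r / (r + 1) ^ 3)"
    proof -
      have "1/4 * (k / y) * (9 / y\<^sup>2) = 9/4 * (k / y ^ 3)" for k y :: real
        by (simp add: power3_eq_cube power2_eq_square)
      then show ?thesis .
    qed
    finally have "- (9/4 * (kf r / (r + 1) ^ 3)) \<le> - (1/4) * (D / r\<^sup>2)" by simp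
    also have "\<dots> \<le> min 0 (N * (N - 1)) * (D / r\<^sup>2)" using m D by (intro mult_right_mono) auto
    finally show ?thesis by (simp add: D_def)
  qed
qed

text \<open>For \<open>r < A\<close> the \<open>\<tau>\<^sup>2\<close>-term beats the errors, which are linear in \<open>\<tau>\<close>, once \<open>\<tau> \<ge> 18 / c0\<close>.  For \<open>r > A\<close> it is itself
  an error, and the \<open>lam\<^sup>2\<close>-term has to beat \<open>16 \<tau>\<^sup>2 + 4 \<tau> + 9/2\<close> and still leave a multiple of \<open>lam\<^sup>2 + \<tau>\<^sup>2\<close>; the number \<open>52\<close> in
  the hypothesis \<open>big\<close> is large enough for this.\<close>

lemma coercive:
  assumes r: "r > 0" "r \<noteq> A" and N: "N \<ge> 1 \<or> r \<ge> 1/2"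
    and tau: "\<tau> \<ge> 1" "\<tau> \<ge> 18 / c0" and lam: "\<delta> > 0" "lam \<ge> \<delta>"
    and big: "52 / (b0 * \<delta>\<^sup>2) * \<tau>\<^sup>2 \<le> a powr (2 * l)"
  shows "cc * (lam\<^sup>2 + \<tau>\<^sup>2) * (r + 1) powr (- 2 * s) \<le>
     1/2 * lam\<^sup>2 * (mf r + r * mf' r) + 1/2 * \<tau>\<^sup>2 * ((mf r + r * mf' r) * (Phi r)\<^sup>2 + 2 * r * mf r * Phi r * dPhi r)
        - \<tau> * (dPhi r)\<^sup>2 * (r * mf r) / (4 * Phi r) + min 0 (N * (N - 1)) * (mf r - 1/2 * (mf r + r * mf' r)) / r\<^sup>2"
proof -
  have r0: "r \<ge> 0" using r by simp
  note cp = consts_pos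
  define S where "S = (r + 1) powr (- 2 * s)"
  have S: "S > 0" using r by (simp add: S_def)
  define M where "M = mf r + r * mf' r"
  define B where "B = M * (Phi r)\<^sup>2 + 2 * r * mf r * Phi r * dPhi r"
  define G where "G = (dPhi r)\<^sup>2 * (r * mf r) / Phi r"
  define J where "J = kf r / (r + 1) ^ 3"
  have eG: "\<tau> * (dPhi r)\<^sup>2 * (r * mf r) / (4 * Phi r) = \<tau> / 4 * G" by (simp add: G_def)
  have o: "- (9/4 * J) \<le> min 0 (N * (N - 1)) * (mf r - 1/2 * M) / r\<^sup>2"
    unfolding J_def M_def by (rule origin_error_bound[OF r(1) N])
  have main: "cc * (lam\<^sup>2 + \<tau>\<^sup>2) * S \<le> 1/2 * lam\<^sup>2 * M + 1/2 * \<tau>\<^sup>2 * B - \<tau> / 4 * G - 9/4 * J"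
  proof (cases "r < A")
    case True
    define X where "X = (r + 1) powr (- 1 - \<kappa>)"
    have X: "X > 0" using r by (simp add: X_def)
    have rA: "r \<le> A" using True by simp
    have b: "c0 * X \<le> B" "G \<le> 9 * X" "J \<le> X" "c1 * S \<le> M" "S \<le> X"
      unfolding B_def M_def G_def J_def X_def S_def
      using inner_square_bound[OF r0 rA] inner_error_bounds[OF r0 rA] by auto
    have "cc * lam\<^sup>2 * S \<le> (c1 / 4) * lam\<^sup>2 * S" using cp S by (intro mult_right_mono) auto
    also have "\<dots> \<le> 1/2 * lam\<^sup>2 * (c1 * S)" using cp S by simp
    also have "\<dots> \<le> 1/2 * lam\<^sup>2 * M" using b(4) by (intro mult_left_mono) auto
    finally have p1: "cc * lam\<^sup>2 * S \<le> 1/2 * lam\<^sup>2 * M" .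
    have "cc * \<tau>\<^sup>2 * S \<le> (c0 / 4) * \<tau>\<^sup>2 * X" using cp S b(5) by (intro mult_mono) auto
    moreover have "9/2 * \<tau> \<le> c0 / 4 * \<tau>\<^sup>2"
    proof -
      have "18 \<le> c0 * \<tau>" using tau cp by (simp add: field_simps)
      then have "18 * \<tau> \<le> c0 * \<tau> * \<tau>" using tau by (intro mult_right_mono) auto
      then show ?thesis by (simp add: power2_eq_square)
    qed
    then have "9/2 * \<tau> * X \<le> c0 / 4 * \<tau>\<^sup>2 * X" using X by (intro mult_right_mono) auto
    moreover have "1/2 * \<tau>\<^sup>2 * (c0 * X) \<le> 1/2 * \<tau>\<^sup>2 * B" using b(1) by (intro mult_left_mono) auto
    moreover have "\<tau> / 4 * G \<le> \<tau> / 4 * (9 * X)" using b(2) tau by (intro mult_left_mono) auto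
    moreover have "9/4 * J \<le> 9/4 * \<tau> * X"
    proof -
      have "1 * X \<le> \<tau> * X" using tau X by (intro mult_right_mono) auto
      then show ?thesis using b(3) by linarith
    qed
    ultimately show ?thesis using p1 by (simp add: algebra_simps)
  next
    case False
    then have rA: "r > A" using r by simp
    define X where "X = a powr (2 * s - 1) * S"
    have a0: "1 \<le> a powr (2 * s - 1)" using basic by (intro powr_pos_ge_one) auto
    have X: "S \<le> X" using mult_right_mono[OF a0, of S] S by (simp add: X_def)
    then have X0: "X > 0" using S by linarith
    note X = X X0
    have b: "2 * b0 * (a powr (2 * l) * X) \<le> M" "- (32 * X) \<le> B" "G \<le> 16 * X" "J \<le> 2 * X"
      unfolding B_def M_def G_def J_def X_def S_def using outer_bounds[OF rA] by auto
    have lam2: "\<delta>\<^sup>2 \<le> lam\<^sup>2" using lam by (intro power_mono) auto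
    have a1: "1 \<le> a powr (2 * l)" using basic by (intro powr_pos_ge_one) auto
    have q1: "52 * \<tau>\<^sup>2 \<le> b0 * (lam\<^sup>2 * a powr (2 * l))"
    proof -
      have "52 * \<tau>\<^sup>2 = b0 * (\<delta>\<^sup>2 * (52 / (b0 * \<delta>\<^sup>2) * \<tau>\<^sup>2))" using cp lam by (simp add: field_simps)
      also have "\<dots> \<le> b0 * (lam\<^sup>2 * a powr (2 * l))" using cp big lam2 by (intro mult_left_mono mult_mono) auto
      finally show ?thesis .
    qed
    have q2: "2 * cc * lam\<^sup>2 \<le> b0 * (lam\<^sup>2 * a powr (2 * l))"
    proof -
      have "2 * cc * lam\<^sup>2 \<le> b0 * (lam\<^sup>2 * 1)" using cp by (simp add: mult_right_mono)
      also have "\<dots> \<le> b0 * (lam\<^sup>2 * a powr (2 * l))" using cp a1 by (intro mult_left_mono) auto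
      finally show ?thesis .
    qed
    have t1: "\<tau> \<le> \<tau>\<^sup>2" "1 \<le> \<tau>\<^sup>2"
      using tau by (auto simp: power2_eq_square intro: mult_left_mono[of 1 \<tau> \<tau>, simplified] order_trans)
    have cc1: "cc * \<tau>\<^sup>2 \<le> \<tau>\<^sup>2" using cp by (simp add: mult_left_le_one_le)
    have key: "cc * (lam\<^sup>2 + \<tau>\<^sup>2) \<le> b0 * (lam\<^sup>2 * a powr (2 * l)) - 16 * \<tau>\<^sup>2 - 4 * \<tau> - 9/2"
      using q1 q2 t1 cc1 by (simp add: algebra_simps)
    have "cc * (lam\<^sup>2 + \<tau>\<^sup>2) * S \<le> cc * (lam\<^sup>2 + \<tau>\<^sup>2) * X" using cp X by (intro mult_left_mono) auto
    also have "\<dots> \<le> (b0 * (lam\<^sup>2 * a powr (2 * l)) - 16 * \<tau>\<^sup>2 - 4 * \<tau> - 9/2) * X"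
      using key X by (intro mult_right_mono) auto
    also have "\<dots> = 1/2 * lam\<^sup>2 * (2 * b0 * (a powr (2 * l) * X)) + 1/2 * \<tau>\<^sup>2 * (- (32 * X)) - \<tau> / 4 * (16 * X) - 9/4 * (2 * X)"
      by (simp add: algebra_simps)
    also have "\<dots> \<le> 1/2 * lam\<^sup>2 * M + 1/2 * \<tau>\<^sup>2 * B - \<tau> / 4 * G - 9/4 * J"
      using b tau by (intro diff_mono add_mono mult_left_mono) auto
    finally show ?thesis .
  qed
  show ?thesis using main o unfolding eG S_def[symmetric] M_def[symmetric] B_def[symmetric] by linarith
qed

lemma radial_weights_concrete:
  assumes tau: "\<tau> \<ge> 1" "\<tau> \<ge> 18 / c0" and lam: "\<delta> > 0" "lam \<ge> \<delta>"
    and big: "52 / (b0 * \<delta>\<^sup>2) * \<tau>\<^sup>2 \<le> a powr (2 * l)" and N: "N \<ge> 1/2"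
  shows "radial_weights mf mf' Phi dPhi (\<lambda>r. cc * (lam\<^sup>2 + \<tau>\<^sup>2) * (r + 1) powr (- 2 * s)) A lam \<tau>
     (2 * a powr (2 * l)) (6 * a powr (2 * l)) 2 (3 + 2 * K) (cc * (lam\<^sup>2 + \<tau>\<^sup>2)) N"
proof
  fix r t :: real
  show "0 \<le> mf r" if "0 \<le> r" using kf_bounds[OF that] that by (simp add: mf_def)
  show "mf r \<le> 2 * a powr (2 * l)" if "0 \<le> r"
  proof -
    have "kf r / (r + 1) \<le> kf r / 1" using kf_bounds[OF that] that by (intro divide_left_mono) auto
    then show ?thesis using kf_bounds[OF that] by (simp add: mf_def)
  qed
  show "r * mf r \<le> 2 * a powr (2 * l)" if "0 \<le> r" using rm_le_kf[OF that] kf_bounds[OF that] by linarith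
  show "\<bar>mf r - mf t\<bar> \<le> 6 * a powr (2 * l) * \<bar>r - t\<bar>" if "0 \<le> r" "0 \<le> t"
    using mf_lip_ord(1)[of t r] mf_lip_ord(1)[of r t] that by (cases "t \<le> r") (auto simp: abs_minus_commute)
  show "t * \<bar>mf r - mf t\<bar> \<le> 6 * a powr (2 * l) * \<bar>r - t\<bar>" if "0 \<le> t" "t \<le> r" by (rule mf_lip_ord(2)[OF that])
  show "(mf has_real_derivative mf' r) (at r)" if "0 < r" "r \<noteq> A" by (rule mf_deriv[OF that])
  show "0 < Phi r" "Phi r \<le> 2" if "0 \<le> r" using Phi_bounds[OF that] by auto
  show "\<bar>Phi r - Phi t\<bar> \<le> (3 + 2 * K) * \<bar>r - t\<bar>" if "0 \<le> r" "0 \<le> t" by (rule Phi_lip[OF that])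
  show "(Phi has_real_derivative dPhi r) (at r)" if "0 < r" "r \<noteq> A" by (rule Phi_deriv[OF that])
  show "0 \<le> mf r + r * mf' r \<and> mf r + r * mf' r \<le> 2 * mf r" if "0 < r" using mu_deriv_bounds[of r] that by simp
  show "\<bar>cc * (lam\<^sup>2 + \<tau>\<^sup>2) * (r + 1) powr (- 2 * s)\<bar> \<le> cc * (lam\<^sup>2 + \<tau>\<^sup>2)" if "0 \<le> r"
  proof -
    have "(r + 1) powr (- 2 * s) \<le> 1" using that basic powr_neg_le_one[of "r + 1" "2 * s"] by simp
    then show ?thesis using consts_pos by (simp add: abs_mult mult_left_le)
  qed
  show "continuous_on {0..} (\<lambda>r. cc * (lam\<^sup>2 + \<tau>\<^sup>2) * (r + 1) powr (- 2 * s))" by (auto intro!: continuous_intros)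
  show "\<tau> > 0" using tau by simp
  show "1/2 \<le> N" by (rule N)
  show "cc * (lam\<^sup>2 + \<tau>\<^sup>2) * (r + 1) powr (- 2 * s) \<le>
     1/2 * lam\<^sup>2 * (mf r + r * mf' r) + 1/2 * \<tau>\<^sup>2 * ((mf r + r * mf' r) * (Phi r)\<^sup>2 + 2 * r * mf r * Phi r * dPhi r)
        - \<tau> * (dPhi r)\<^sup>2 * (r * mf r) / (4 * Phi r) + min 0 (N * (N - 1)) * (mf r - 1/2 * (mf r + r * mf' r)) / r\<^sup>2"
    if "0 < r" "r \<noteq> A" "1 \<le> N \<or> 1/2 \<le> r"
    by (rule coercive[OF that tau lam big])
qed

subsection \<open>The phase\<close>

abbreviation ph where "ph \<equiv> phase s l \<kappa> A"

lemma ph_deriv_within: "r \<ge> 0 \<Longrightarrow> (ph has_real_derivative Phi r) (at r within {0..})"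
  using A1 by (intro phase_has_derivative) auto

lemma ph_deriv: "r > 0 \<Longrightarrow> (ph has_real_derivative Phi r) (at r)"
  using ph_deriv_within[of r] at_within_interior[of r "{0..}"] by (simp add: interior_real_atLeast)

lemma ph_continuous: "continuous_on {0..} ph"
  using ph_deriv_within by (auto simp: continuous_on_eq_continuous_within intro: DERIV_continuous)

lemma ph_lip_ord: "0 \<le> t \<Longrightarrow> t \<le> r \<Longrightarrow> \<bar>ph r - ph t\<bar> \<le> 2 * (r - t)"
proof (rule piecewise_MVT_bound[where A = A and f' = Phi])
  assume t: "0 \<le> t" "t \<le> r"
  show "continuous_on {t..r} ph" by (rule continuous_on_subset[OF ph_continuous]) (use t in auto)
  show "(ph has_real_derivative Phi x) (at x)" if "t < x" for x using ph_deriv that t by auto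
  show "\<bar>Phi x\<bar> \<le> 2" if "t < x" for x using Phi_bounds[of x] that t by auto
qed auto

text \<open>Beyond \<open>A\<close> the derivative is a multiple of \<open>(r + 1)\<^sup>-\<^sup>2\<^sup>s\<close>, which is integrable because \<open>2 s > 1\<close>.\<close>

lemma ph_bounded: "\<exists>B. \<forall>r\<ge>0. \<bar>ph r\<bar> \<le> B"
proof -
  define q where "q r = K / (1 - 2 * s) * (r + 1) powr (1 - 2 * s)" for r
  have dq: "(q has_real_derivative K * (r + 1) powr (- 2 * s)) (at r)" if "r > -1" for r
    unfolding q_def[abs_def] using that basic by (auto intro!: derivative_eq_intros)
  have qb: "\<bar>q r\<bar> \<le> K / (2 * s - 1)" if "r \<ge> 0" for r
  proof -
    have "\<bar>q r\<bar> = K / (2 * s - 1) * (r + 1) powr (1 - 2 * s)"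
      using basic K_bounds(3) by (simp add: q_def abs_mult abs_divide)
    also have "\<dots> \<le> K / (2 * s - 1) * 1"
      using basic K_bounds(3) that powr_neg_le_one[of "r + 1" "2 * s - 1"] by (intro mult_left_mono) auto
    finally show ?thesis by simp
  qed
  have A0: "A \<ge> 0" using A1 by simp
  have out: "ph r - q r = ph A - q A" if r: "r \<ge> A" for r
  proof -
    have "\<bar>(ph r - q r) - (ph A - q A)\<bar> \<le> 0 * (r - A)"
    proof (rule piecewise_MVT_bound[OF r, where A = A and f' = "\<lambda>x. 0"])
      show "continuous_on {A..r} (\<lambda>r. ph r - q r)"
      proof (intro continuous_intros)
        show "continuous_on {A..r} ph" by (rule continuous_on_subset[OF ph_continuous]) (use A0 in auto)
        show "continuous_on {A..r} q" using A0 by (intro DERIV_continuous_on[OF DERIV_subset[OF dq]]) auto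
      qed
      show "((\<lambda>r. ph r - q r) has_real_derivative 0) (at x)" if "A < x" for x
        using DERIV_diff[OF ph_deriv[of x] dq[of x]] that A0 by (simp add: phase_deriv_def)
    qed auto
    then show ?thesis by simp
  qed
  have "\<bar>ph r\<bar> \<le> 2 * A + 2 * (K / (2 * s - 1))" if r: "r \<ge> 0" for r
  proof (cases "r \<le> A")
    case True
    have "\<bar>ph r\<bar> \<le> 2 * r" using ph_lip_ord[of 0 r] r by (simp add: phase_zero)
    moreover have "0 \<le> K / (2 * s - 1)" using basic K_bounds(3) by simp
    ultimately show ?thesis using True by linarith
  next
    case False
    have "\<bar>ph A\<bar> \<le> 2 * A" using ph_lip_ord[of 0 A] A0 by (simp add: phase_zero)
    then show ?thesis using out[of r] qb[OF r] qb[OF A0] False by linarith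
  qed
  then show ?thesis by blast
qed

lemma ph_lip_bdd: "lip_bdd (\<lambda>x::'a::euclidean_space. ph (norm x))"
proof -
  obtain B where "\<forall>r\<ge>0. \<bar>ph r\<bar> \<le> B" using ph_bounded by blast
  moreover have "\<bar>ph r - ph t\<bar> \<le> 2 * \<bar>r - t\<bar>" if "0 \<le> r" "0 \<le> t" for r t
    using ph_lip_ord[of t r] ph_lip_ord[of r t] that by (cases "t \<le> r") (auto simp: abs_minus_commute)
  ultimately show ?thesis by (intro lip_bdd_radial[where B = B and L = 2]) auto
qed

lemma ph_has_derivative:
  fixes x :: "'a::euclidean_space"
  shows "x \<noteq> 0 \<Longrightarrow> ((\<lambda>x. ph (norm x)) has_derivative (\<lambda>h. Phi (norm x) * (x \<bullet> h) / norm x)) (at x)"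
  by (rule radial_has_derivative[OF ph_deriv]) auto

end

section \<open>Combining the estimates\<close>

text \<open>Here \<open>X\<close> and \<open>Nf\<close> are the norms of \<open>\<langle>x\<rangle>\<^sup>-\<^sup>s f\<close> and \<open>f\<close>, \<open>Y2\<close> and \<open>G\<^sup>2\<close> the squared norms of the corresponding
  gradients, \<open>NF\<close> is the norm of the source, \<open>D\<close> the dimension and \<open>q = a\<^sup>2\<^sup>l\<close>.  \<open>E1\<close> is the Morawetz estimate, \<open>E2\<close> and \<open>E3\<close>
  are energy estimates.  If \<open>\<epsilon> h q > 1\<close>, then already \<open>X \<le> Nf\<close> gives the claim; otherwise the products with \<open>\<epsilon> h q\<close> on
  the right-hand side of \<open>E1\<close> can be absorbed.\<close>

lemma combine_weighted_estimates:
  fixes X Y2 G Nf NF h \<tau> lam \<epsilon> q c D :: real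
  assumes nn: "X \<ge> 0" "G \<ge> 0" "Nf \<ge> 0" "NF \<ge> 0" "\<epsilon> > 0" "q \<ge> 1" "c > 0" "D \<ge> 1" "lam > 0" and tau: "\<tau> \<ge> 1"
    and h: "h = 1 / (lam + \<tau>)" and XN: "X \<le> Nf"
    and E1: "c / 2 * (lam\<^sup>2 + \<tau>\<^sup>2) * X\<^sup>2 \<le> NF\<^sup>2 / \<tau> + 2 * D * \<epsilon> * q * Nf * (G + Nf)"
    and E2: "G\<^sup>2 \<le> D * (1 + 2 * \<tau>)\<^sup>2 * Nf\<^sup>2 + lam\<^sup>2 * Nf\<^sup>2 + NF * Nf"
    and E3: "Y2 \<le> D * (1 + 2 * \<tau>)\<^sup>2 * X\<^sup>2 + lam\<^sup>2 * X\<^sup>2 + NF * X"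
  shows "X\<^sup>2 + h\<^sup>2 * Y2 \<le> ((9 * D + 3) * (4 / c * (D + 1) * (9 * D + 5) + 1) + 1) * (h\<^sup>2 * NF\<^sup>2 / \<tau> + \<epsilon> * h * q * Nf\<^sup>2)"
proof -
  have h0: "0 < h" using nn tau by (simp add: h)
  have hl: "h * (lam + \<tau>) = 1" using nn tau by (simp add: h)
  have ht: "h * \<tau> \<le> 1" "h * lam \<le> 1"
  proof -
    have "h * lam + h * \<tau> = 1" using hl by (simp add: distrib_left)
    moreover have "0 < h * lam" "0 < h * \<tau>" using h0 nn tau by simp_all
    ultimately show "h * \<tau> \<le> 1" "h * lam \<le> 1" by linarith+
  qed
  have ht2: "h\<^sup>2 * \<tau>\<^sup>2 \<le> 1" "h\<^sup>2 * lam\<^sup>2 \<le> 1"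
    using power_mono[OF ht(1), of 2] power_mono[OF ht(2), of 2] h0 nn tau by (simp_all add: power_mult_distrib)
  have h1: "h \<le> 1" using order_trans[OF mult_left_mono[OF tau less_imp_le[OF h0]] ht(1)] by simp
  have tt: "(1 + 2 * \<tau>)\<^sup>2 \<le> 9 * \<tau>\<^sup>2" using power_mono[of "1 + 2 * \<tau>" "3 * \<tau>" 2] tau by (simp add: power_mult_distrib)
  have h2t: "h\<^sup>2 \<le> 1 / \<tau>"
  proof -
    have "h\<^sup>2 * \<tau> \<le> h\<^sup>2 * \<tau>\<^sup>2" using tau by (intro mult_left_mono) (auto simp: power2_eq_square)
    then have "h\<^sup>2 * \<tau> \<le> 1" using ht2 by linarith
    then show ?thesis using tau by (simp add: field_simps)
  qed
  have h4: "h\<^sup>2 * (h\<^sup>2 * NF\<^sup>2) \<le> h\<^sup>2 * NF\<^sup>2 / \<tau>"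
    using mult_right_mono[OF h2t, of "h\<^sup>2 * NF\<^sup>2"] by simp
  define P where "P = h\<^sup>2 * NF\<^sup>2 / \<tau>"
  define R where "R = \<epsilon> * h * q * Nf\<^sup>2"
  have P0: "P \<ge> 0" using tau by (simp add: P_def)
  have R0: "R \<ge> 0" using nn h0 by (simp add: R_def)
  \<comment> \<open>shared by \<open>E2\<close> and \<open>E3\<close>: at the scale \<open>h\<close>, a gradient is controlled by the function and the source\<close>
  have energy: "h\<^sup>2 * Z \<le> (9 * D + 2) * V\<^sup>2 + P" if Z: "Z \<le> D * (1 + 2 * \<tau>)\<^sup>2 * V\<^sup>2 + lam\<^sup>2 * V\<^sup>2 + NF * V" and V: "V \<ge> 0" for Z V
  proof -
    have "D * (1 + 2 * \<tau>)\<^sup>2 * V\<^sup>2 \<le> D * (9 * \<tau>\<^sup>2) * V\<^sup>2" using tt nn by (intro mult_right_mono mult_left_mono) auto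
    then have "h\<^sup>2 * Z \<le> h\<^sup>2 * (D * (9 * \<tau>\<^sup>2) * V\<^sup>2 + lam\<^sup>2 * V\<^sup>2 + NF * V)" using Z by (intro mult_left_mono) auto
    also have "\<dots> = 9 * D * V\<^sup>2 * (h\<^sup>2 * \<tau>\<^sup>2) + V\<^sup>2 * (h\<^sup>2 * lam\<^sup>2) + h\<^sup>2 * NF * V" by (simp add: algebra_simps)
    also have "\<dots> \<le> 9 * D * V\<^sup>2 * 1 + V\<^sup>2 * 1 + (V\<^sup>2 + (h\<^sup>2 * NF)\<^sup>2)"
    proof (intro add_mono mult_left_mono ht2)
      have "0 \<le> h\<^sup>2 * NF * V" using nn V by simp
      then show "h\<^sup>2 * NF * V \<le> V\<^sup>2 + (h\<^sup>2 * NF)\<^sup>2"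
        using sum_squares_bound[of V "h\<^sup>2 * NF"] by (simp add: mult_ac)
    qed (use nn in auto)
    also have "(h\<^sup>2 * NF)\<^sup>2 = h\<^sup>2 * (h\<^sup>2 * NF\<^sup>2)" by (simp add: power2_eq_square mult_ac)
    also have "9 * D * V\<^sup>2 * 1 + V\<^sup>2 * 1 + (V\<^sup>2 + h\<^sup>2 * (h\<^sup>2 * NF\<^sup>2)) \<le> (9 * D + 2) * V\<^sup>2 + P"
      using h4 by (simp add: P_def algebra_simps)
    finally show ?thesis .
  qed
  define C2 where "C2 = 4 / c * (D + 1) * (9 * D + 5) + 1"
  have C2: "C2 \<ge> 1" using nn by (simp add: C2_def)
  have X2: "X\<^sup>2 \<le> C2 * (P + R)"
  proof (cases "\<epsilon> * h * q \<le> 1")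
    case False
    have "X\<^sup>2 \<le> Nf\<^sup>2" using XN nn by (intro power_mono) auto
    also have "\<dots> \<le> R" unfolding R_def using False mult_right_mono[of 1 "\<epsilon> * h * q" "Nf\<^sup>2"] by simp
    also have "\<dots> \<le> 1 * (P + R)" using P0 by simp
    also have "\<dots> \<le> C2 * (P + R)" using C2 P0 R0 by (intro mult_right_mono) auto
    finally show ?thesis .
  next
    case True
    have k1: "2 * (h * G * Nf) \<le> (9 * D + 3) * Nf\<^sup>2 + P"
      using sum_squares_bound[of "h * G" Nf] energy[OF E2 nn(3)] by (simp add: power_mult_distrib algebra_simps)
    have k2: "\<epsilon> * h * q * (2 * (h * G * Nf)) \<le> (9 * D + 3) * R + P"
    proof -
      have e0: "0 \<le> \<epsilon> * h * q" using nn h0 by simp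
      have "\<epsilon> * h * q * (2 * (h * G * Nf)) \<le> \<epsilon> * h * q * ((9 * D + 3) * Nf\<^sup>2 + P)"
        by (rule mult_left_mono[OF k1 e0])
      also have "\<dots> = (9 * D + 3) * R + (\<epsilon> * h * q) * P" by (simp add: R_def algebra_simps)
      also have "\<dots> \<le> (9 * D + 3) * R + P" using mult_right_mono[OF True P0] by simp
      finally show ?thesis .
    qed
    have k3: "h\<^sup>2 * (\<epsilon> * q * Nf\<^sup>2) \<le> R"
      unfolding R_def using h1 h0 nn mult_right_mono[of h 1 "h * (\<epsilon> * q * Nf\<^sup>2)"] by (simp add: power2_eq_square mult_ac)
    have "h\<^sup>2 * (2 * D * \<epsilon> * q * Nf * (G + Nf)) = D * (\<epsilon> * h * q * (2 * (h * G * Nf))) + 2 * D * (h\<^sup>2 * (\<epsilon> * q * Nf\<^sup>2))"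
      by (simp add: power2_eq_square algebra_simps)
    also have "\<dots> \<le> D * ((9 * D + 3) * R + P) + 2 * D * R"
      using k2 k3 nn by (intro add_mono mult_left_mono) auto
    finally have k4: "h\<^sup>2 * (2 * D * \<epsilon> * q * Nf * (G + Nf)) \<le> D * (9 * D + 5) * R + D * P" by (simp add: algebra_simps)
    have "1 \<le> 2 * (h\<^sup>2 * (lam\<^sup>2 + \<tau>\<^sup>2))"
    proof -
      have "1 = h\<^sup>2 * (lam + \<tau>)\<^sup>2" using hl by (metis power_mult_distrib power_one)
      also have "\<dots> \<le> h\<^sup>2 * (2 * (lam\<^sup>2 + \<tau>\<^sup>2))"
        using sum_squares_bound[of lam \<tau>] by (intro mult_left_mono) (auto simp: power2_sum)
      finally show ?thesis by (simp add: distrib_left)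
    qed
    then have "c / 4 * X\<^sup>2 * 1 \<le> c / 4 * X\<^sup>2 * (2 * (h\<^sup>2 * (lam\<^sup>2 + \<tau>\<^sup>2)))" using nn by (intro mult_left_mono) auto
    also have "\<dots> = h\<^sup>2 * (c / 2 * (lam\<^sup>2 + \<tau>\<^sup>2) * X\<^sup>2)" by (simp add: algebra_simps)
    also have "\<dots> \<le> h\<^sup>2 * (NF\<^sup>2 / \<tau> + 2 * D * \<epsilon> * q * Nf * (G + Nf))" by (rule mult_left_mono[OF E1]) simp
    also have "\<dots> \<le> P + (D * (9 * D + 5) * R + D * P)" using k4 by (simp add: P_def distrib_left)
    also have "\<dots> \<le> (D + 1) * (9 * D + 5) * (P + R)"
    proof -
      have "(1 + D) * P \<le> (D + 1) * (9 * D + 5) * P"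
        using nn P0 mult_right_mono[of 1 "9 * D + 5" "(D + 1) * P"] by (simp add: algebra_simps)
      moreover have "D * (9 * D + 5) * R \<le> (D + 1) * (9 * D + 5) * R" using nn R0 by (intro mult_right_mono) auto
      ultimately show ?thesis by (simp add: algebra_simps)
    qed
    finally have "X\<^sup>2 \<le> 4 / c * ((D + 1) * (9 * D + 5) * (P + R))" using nn by (simp add: field_simps)
    also have "\<dots> \<le> C2 * (P + R)" 
    proof -
      have "4 / c * ((D + 1) * (9 * D + 5) * (P + R)) = (C2 - 1) * (P + R)" by (simp add: C2_def mult.assoc)
      also have "\<dots> \<le> C2 * (P + R)" using P0 R0 by (intro mult_right_mono) auto
      finally show ?thesis .
    qed
    finally show ?thesis .
  qed
  have "X\<^sup>2 + h\<^sup>2 * Y2 \<le> (9 * D + 3) * X\<^sup>2 + P" using energy[OF E3 nn(1)] by (simp add: algebra_simps)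
  also have "\<dots> \<le> (9 * D + 3) * (C2 * (P + R)) + (P + R)" using X2 nn R0 by (intro add_mono mult_left_mono) auto
  also have "\<dots> = ((9 * D + 3) * C2 + 1) * (P + R)" by (simp add: algebra_simps)
  finally show ?thesis by (simp add: C2_def P_def R_def)
qed

section \<open>The weight $\langle x\rangle^{-s}$\<close>

lemma japanese_pos: "0 < japanese x" "1 \<le> japanese x"
  by (auto simp: japanese_def real_sqrt_gt_zero add_nonneg_pos)

text \<open>The logarithmic derivative of the weight is at most \<open>s < 1\<close> in absolute value.\<close>

lemma japanese_weight:
  assumes "0 < s" "s < 1"
  defines "\<omega> \<equiv> \<lambda>x::'a::euclidean_space. japanese x powr (- s)"
    and "\<omega>' \<equiv> \<lambda>(x::'a) h. - s * norm x / ((norm x)\<^sup>2 + 1) * japanese x powr (- s) * (x \<bullet> h) / norm x"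
  shows "lip_bdd \<omega>" "AE x in lebesgue. (\<omega> has_derivative \<omega>' x) (at x)"
    "\<And>x. 0 < \<omega> x" "\<And>x. \<omega> x \<le> 1" "\<And>x b. b \<in> Basis \<Longrightarrow> \<bar>\<omega>' x b\<bar> \<le> \<omega> x"
proof -
  define k where "k r = sqrt (r\<^sup>2 + 1) powr (- s)" for r :: real
  define k' where "k' r = - s * r / (r\<^sup>2 + 1) * k r" for r :: real
  have \<omega>k: "\<omega> x = k (norm x)" for x by (simp add: \<omega>_def k_def japanese_def)
  have p: "0 < r\<^sup>2 + 1" for r :: real by (simp add: add_nonneg_pos)
  have dk: "(k has_real_derivative k' r) (at r)" for r
  proof -
    have "((\<lambda>r. sqrt (r\<^sup>2 + 1)) has_real_derivative r / sqrt (r\<^sup>2 + 1)) (at r)"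
    proof -
      have d: "((\<lambda>r. r\<^sup>2 + 1) has_real_derivative 2 * r) (at r)"
        using DERIV_add[OF DERIV_power[OF DERIV_ident, where n = 2] DERIV_const[of "1::real"]] by simp
      have d2: "(sqrt has_real_derivative inverse (sqrt (r\<^sup>2 + 1)) / 2) (at (r\<^sup>2 + 1))"
        by (rule DERIV_real_sqrt[OF p])
      show ?thesis
        using DERIV_chain2[where f = sqrt and g = "\<lambda>r. r\<^sup>2 + 1" and x = r, OF d2 d] by (simp add: field_simps)
    qed
    from DERIV_fun_powr[OF this, of "- s"]
    have "(k has_real_derivative - s * sqrt (r\<^sup>2 + 1) powr (- s - 1) * (r / sqrt (r\<^sup>2 + 1))) (at r)"
      using p[of r] unfolding k_def[abs_def] by simp
    moreover have "- s * sqrt (r\<^sup>2 + 1) powr (- s - 1) * (r / sqrt (r\<^sup>2 + 1)) = k' r"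
      using p[of r] by (simp add: k'_def k_def powr_diff)
    ultimately show ?thesis by simp
  qed
  have k1: "0 < k r" "k r \<le> 1" for r
  proof -
    show "0 < k r" using p[of r] by (simp add: k_def)
    have "1 \<le> sqrt (r\<^sup>2 + 1)" by simp
    then show "k r \<le> 1" unfolding k_def using assms p[of r] powr_mono[of "- s" 0 "sqrt (r\<^sup>2 + 1)"] by simp
  qed
  have q: "\<bar>s * r / (r\<^sup>2 + 1)\<bar> \<le> 1" for r
  proof -
    have "s * \<bar>r\<bar> \<le> 1 * \<bar>r\<bar>" using assms by (intro mult_right_mono) auto
    also have "\<dots> \<le> r\<^sup>2 + 1" using sum_squares_bound[of "\<bar>r\<bar>" 1] by simp
    finally show ?thesis using p[of r] assms by (simp add: abs_mult abs_divide)
  qed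
  have k'b: "\<bar>k' r\<bar> \<le> k r" for r
  proof -
    have "\<bar>k' r\<bar> = \<bar>s * r / (r\<^sup>2 + 1)\<bar> * k r" using k1(1)[of r] by (simp add: k'_def abs_mult)
    also have "\<dots> \<le> 1 * k r" using q k1(1)[of r] by (intro mult_right_mono) auto
    finally show ?thesis by simp
  qed
  have lipo: "\<bar>k r - k t\<bar> \<le> 1 * (r - t)" if "t \<le> r" for r t
  proof (rule piecewise_MVT_bound[OF that, where A = 0 and f' = k'])
    show "continuous_on {t..r} k" by (intro DERIV_continuous_on[OF DERIV_subset[OF dk]]) auto
    show "\<bar>k' x\<bar> \<le> 1" for x using k'b[of x] k1(2)[of x] by linarith
  qed (use dk in auto)
  show "lip_bdd \<omega>" unfolding \<omega>k[abs_def]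
  proof (rule lip_bdd_radial[where B = 1 and L = 1])
    show "\<bar>k r\<bar> \<le> 1" for r using k1[of r] by simp
    show "\<bar>k r - k t\<bar> \<le> 1 * \<bar>r - t\<bar>" for r t
      using lipo[of t r] lipo[of r t] by (cases "t \<le> r") (auto simp: abs_minus_commute)
  qed simp
  have \<omega>'k: "\<omega>' x h = k' (norm x) * (x \<bullet> h) / norm x" for x h
    by (simp add: \<omega>'_def k'_def k_def japanese_def)
  show "AE x in lebesgue. (\<omega> has_derivative \<omega>' x) (at x)"
  proof (rule AE_radial[of "{}"])
    fix x :: 'a assume "x \<noteq> 0"
    from radial_has_derivative[OF dk this]
    show "(\<omega> has_derivative \<omega>' x) (at x)" unfolding \<omega>k[abs_def] \<omega>'k[abs_def] .
  qed simp
  show "0 < \<omega> x" "\<omega> x \<le> 1" for x using k1 by (auto simp: \<omega>k)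
  show "\<bar>\<omega>' x b\<bar> \<le> \<omega> x" if "b \<in> Basis" for x b
  proof (cases "x = 0")
    case False
    have "\<bar>\<omega>' x b\<bar> = \<bar>k' (norm x)\<bar> * (\<bar>x \<bullet> b\<bar> / norm x)" by (simp add: \<omega>'k abs_mult)
    also have "\<dots> \<le> k (norm x) * 1"
      using k'b Basis_le_norm[OF that, of x] False k1(1)[of "norm x"] by (intro mult_mono) auto
    finally show ?thesis by (simp add: \<omega>k)
  qed (use k1 in \<open>simp add: \<omega>'k \<omega>k less_imp_le\<close>)
qed

lemma japanese_compare:
  assumes "0 < s" "s < 1"
  shows "(norm x + 1) powr (2 * s) \<le> 2 * japanese x powr (2 * s)"
    "1/2 * (japanese x powr (- s))\<^sup>2 \<le> (norm x + 1) powr (- 2 * s)"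
proof -
  let ?y = "norm x + 1"
  have j: "0 < japanese x" by (rule japanese_pos)
  have y: "0 < ?y" by (simp add: add_nonneg_pos)
  have "?y\<^sup>2 \<le> 2 * (japanese x)\<^sup>2"
  proof -
    have "(japanese x)\<^sup>2 = (norm x)\<^sup>2 + 1" unfolding japanese_def by (rule real_sqrt_pow2) simp
    then show ?thesis using sum_squares_bound[of "norm x" 1] by (simp add: power2_sum)
  qed
  then have "(?y\<^sup>2) powr s \<le> (2 * (japanese x)\<^sup>2) powr s" using assms by (intro powr_mono2) auto
  moreover have "(z\<^sup>2) powr s = z powr (2 * s)" if "z > 0" for z :: real
    using that by (simp add: powr_powr flip: powr_numeral)
  ultimately have "?y powr (2 * s) \<le> 2 powr s * japanese x powr (2 * s)" using j y by (simp add: powr_mult)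
  also have "\<dots> \<le> 2 * japanese x powr (2 * s)"
    using assms powr_mono[of s 1 "2::real"] by (intro mult_right_mono) auto
  finally show 1: "?y powr (2 * s) \<le> 2 * japanese x powr (2 * s)" .
  have "(japanese x powr (- s))\<^sup>2 = japanese x powr (- 2 * s)" using j by (simp add: power2_eq_square flip: powr_add)
  then have "1/2 * (japanese x powr (- s))\<^sup>2 = 1 / (2 * japanese x powr (2 * s))" by (simp add: powr_minus_divide)
  also have "\<dots> \<le> 1 / ?y powr (2 * s)" using 1 y j by (intro divide_left_mono) auto
  finally show "1/2 * (japanese x powr (- s))\<^sup>2 \<le> ?y powr (- 2 * s)" by (simp add: powr_minus_divide)
qed

text \<open>The term with \<open>\<i> \<epsilon>\<close> is purely imaginary when tested against a real weight times \<open>cnj f\<close>, so the energy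
  estimates do not see it.\<close>

lemma weighted_source_pairing:
  fixes f F p :: "'a::euclidean_space \<Rightarrow> complex" and \<omega> \<rho> :: "'a \<Rightarrow> real"
  assumes f: "L2_fun f" and F: "L2_fun F" and \<rho>: "lip_bdd \<rho>" "\<And>x. 0 \<le> \<rho> x" "\<And>x. \<rho> x \<le> 1"
    and \<omega>: "lip_bdd \<omega>" "\<And>x. 0 \<le> \<omega> x" "\<And>x. \<omega> x \<le> 1"
    and p: "\<And>x. p x = of_real (\<omega> x) * F x + of_real (lam\<^sup>2) * f x - \<sigma> * \<i> * of_real \<epsilon> * f x" and \<sigma>: "\<sigma> \<in> {1, -1}"
  shows "Re (LINT x|lebesgue. p x * of_real ((\<rho> x)\<^sup>2) * cnj (f x))
    \<le> lam\<^sup>2 * (L2_norm (\<lambda>x. of_real (\<rho> x) * f x))\<^sup>2 + L2_norm F * L2_norm (\<lambda>x. of_real (\<rho> x) * f x)"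
proof -
  let ?w = "\<lambda>x. of_real (\<rho> x) * f x"
  have Lw: "L2_fun ?w" by (rule L2_fun_lip_mult[OF f lip_bdd_of_real[OF \<rho>(1)]])
  have Lp: "L2_fun (\<lambda>x. of_real (\<rho> x) * p x)"
    unfolding p by (intro L2_fun_lip_mult lip_bdd_of_real \<rho> \<omega> L2_fun_add L2_fun_diff L2_fun_cmult F f)
  have i: "integrable lebesgue (\<lambda>x. (of_real (\<rho> x) * p x) * cnj (?w x))"
    by (rule integrable_L2_mult[OF Lp L2_fun_cnj[OF Lw]])
  have e: "(\<lambda>x. p x * of_real ((\<rho> x)\<^sup>2) * cnj (f x)) = (\<lambda>x. (of_real (\<rho> x) * p x) * cnj (?w x))"
    by (simp add: fun_eq_iff power2_eq_square mult_ac)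
  have "Re (LINT x|lebesgue. (of_real (\<rho> x) * p x) * cnj (?w x)) = (LINT x|lebesgue. Re ((of_real (\<rho> x) * p x) * cnj (?w x)))"
    by (rule integral_Re[OF i, symmetric])
  also have "\<dots> \<le> (LINT x|lebesgue. lam\<^sup>2 * (cmod (?w x))\<^sup>2 + cmod (F x) * cmod (?w x))"
  proof (rule integral_mono)
    show "integrable lebesgue (\<lambda>x. Re ((of_real (\<rho> x) * p x) * cnj (?w x)))" by (rule integrable_Re[OF i])
    show "integrable lebesgue (\<lambda>x. lam\<^sup>2 * (cmod (?w x))\<^sup>2 + cmod (F x) * cmod (?w x))"
      using L2_fun_integrable[OF Lw] integrable_L2_mult_norm[OF F Lw] by simp
    fix x
    have sq: "?w x * cnj (?w x) = of_real ((cmod (?w x))\<^sup>2)" by (simp only: complex_norm_square)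
    have "(of_real (\<rho> x) * p x) * cnj (?w x) = of_real (\<rho> x * \<omega> x) * (F x * cnj (?w x))
       + of_real (lam\<^sup>2) * (?w x * cnj (?w x)) - \<sigma> * \<i> * of_real \<epsilon> * (?w x * cnj (?w x))"
      by (simp add: p algebra_simps)
    moreover have "Re (of_real u * P + of_real b * of_real t - \<sigma> * \<i> * of_real \<epsilon> * of_real t) = u * Re P + b * t" for u b t P
      using \<sigma> by auto
    ultimately have "Re ((of_real (\<rho> x) * p x) * cnj (?w x)) = \<rho> x * \<omega> x * Re (F x * cnj (?w x)) + lam\<^sup>2 * (cmod (?w x))\<^sup>2"
      by (simp only: sq)
    also have "\<dots> \<le> 1 * (cmod (F x) * cmod (?w x)) + lam\<^sup>2 * (cmod (?w x))\<^sup>2"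
    proof (rule add_right_mono)
      have "Re (F x * cnj (?w x)) \<le> cmod (F x) * cmod (?w x)"
        using complex_Re_le_cmod[of "F x * cnj (?w x)"] by (simp add: norm_mult)
      then have "\<rho> x * \<omega> x * Re (F x * cnj (?w x)) \<le> \<rho> x * \<omega> x * (cmod (F x) * cmod (?w x))"
        using \<rho>(2) \<omega>(2) by (intro mult_left_mono) auto
      also have "\<dots> \<le> 1 * (cmod (F x) * cmod (?w x))"
        using \<rho> \<omega> by (intro mult_right_mono mult_le_one) auto
      finally show "\<rho> x * \<omega> x * Re (F x * cnj (?w x)) \<le> 1 * (cmod (F x) * cmod (?w x))" .
    qed
    finally show "Re ((of_real (\<rho> x) * p x) * cnj (?w x)) \<le> lam\<^sup>2 * (cmod (?w x))\<^sup>2 + cmod (F x) * cmod (?w x)" by simp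
  qed
  also have "\<dots> = lam\<^sup>2 * (L2_norm ?w)\<^sup>2 + (LINT x|lebesgue. cmod (F x) * cmod (?w x))"
    unfolding L2_norm_sq using L2_fun_integrable[OF Lw] integrable_L2_mult_norm[OF F Lw] by simp
  also have "\<dots> \<le> lam\<^sup>2 * (L2_norm ?w)\<^sup>2 + L2_norm F * L2_norm ?w"
    using L2_Cauchy_Schwarz[OF F Lw] by simp
  finally show ?thesis unfolding e .
qed

section \<open>Estimates for solutions\<close>

lemma L2_norm_sum_le:
  "finite I \<Longrightarrow> (\<And>i. i \<in> I \<Longrightarrow> L2_fun (f i)) \<Longrightarrow> L2_norm (\<lambda>x. \<Sum>i\<in>I. f i x) \<le> (\<Sum>i\<in>I. L2_norm (f i))"
proof (induction I rule: finite_induct)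
  case empty
  show ?case by (simp add: L2_norm_def)
next
  case (insert i I)
  have "L2_norm (\<lambda>x. f i x + (\<Sum>i\<in>I. f i x)) \<le> L2_norm (f i) + L2_norm (\<lambda>x. \<Sum>i\<in>I. f i x)"
    using insert by (intro L2_norm_triangle L2_fun_sum) auto
  then show ?case using insert by simp
qed

context radial_bump
begin

text \<open>The multiplier is bounded because \<open>r m\<close> is; only the term with \<open>\<epsilon>\<close> needs this crude bound.\<close>

lemma L2_norm_Mul_le:
  fixes f :: "'a \<Rightarrow> complex"
  assumes fg: "weak_grad f g"
  shows "L2_norm (Mul f g) \<le> Bm * (DIM('a) * (sqrt (\<Sum>b\<in>Basis. (L2_norm (g b))\<^sup>2) + L2_norm f))"
proof -
  note D = weak_gradD[OF fg]
  let ?G = "sqrt (\<Sum>b\<in>Basis. (L2_norm (g b))\<^sup>2)"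
  have G0: "0 \<le> ?G" by (intro real_sqrt_ge_zero sum_nonneg) simp
  have m1: "(\<lambda>x::'a. complex_of_real (m (norm x) * (x \<bullet> c))) \<in> borel_measurable lebesgue" if "c \<in> Basis" for c
    by (rule continuous_lebesgue_measurable[OF lip_bdd_continuous[OF lip_bdd_of_real[OF lip_m_coord[OF that]]]])
  have m2: "(\<lambda>x::'a. complex_of_real (N * m (norm x))) \<in> borel_measurable lebesgue"
    by (rule continuous_lebesgue_measurable[OF lip_bdd_continuous[OF lip_bdd_of_real[OF lip_bdd_mult[OF lip_bdd_const lip_m]]]])
  have b1: "cmod (complex_of_real (m (norm x) * (x \<bullet> c))) \<le> Bm" if "c \<in> Basis" for c x :: 'a
  proof -
    have "cmod (complex_of_real (m (norm x) * (x \<bullet> c))) = m (norm x) * \<bar>x \<bullet> c\<bar>"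
      using m_nonneg[of "norm x"] by (simp add: abs_mult del: of_real_mult)
    also have "\<dots> \<le> m (norm x) * norm x"
      using Basis_le_norm[OF that, of x] m_nonneg[of "norm x"] by (intro mult_left_mono) auto
    also have "\<dots> \<le> Bm" using rm_le[of "norm x"] by (simp add: mult.commute)
    finally show ?thesis .
  qed
  have b2: "cmod (complex_of_real (N * m (norm (x::'a)))) \<le> N * Bm" for x
    using m_nonneg[of "norm x"] m_le[of "norm x"] N_nonneg by (simp add: abs_mult mult_left_mono del: of_real_mult)
  have L1: "L2_fun (\<lambda>x. of_real (m (norm x) * (x \<bullet> c)) * g c x)" if "c \<in> Basis" for c
    by (rule L2_fun_bounded_mult[OF D(2)[OF that] m1[OF that] b1[OF that]])
  have L2: "L2_fun (\<lambda>x. of_real (N * m (norm x)) * f x)"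
    by (rule L2_fun_bounded_mult[OF D(1) m2 b2])
  have n1: "L2_norm (\<lambda>x. of_real (m (norm x) * (x \<bullet> c)) * g c x) \<le> Bm * ?G" if c: "c \<in> Basis" for c
  proof -
    have "L2_norm (\<lambda>x. of_real (m (norm x) * (x \<bullet> c)) * g c x) \<le> Bm * L2_norm (g c)"
      by (rule L2_norm_mono[OF D(2)[OF c] L2_fun_measurable[OF L1[OF c]] AE_I2 Bm_nonneg])
        (use b1[OF c] in \<open>auto simp: norm_mult simp del: of_real_mult intro!: mult_right_mono\<close>)
    also have "L2_norm (g c) \<le> ?G"
      by (rule real_le_rsqrt) (rule member_le_sum[OF c], auto)
    finally show ?thesis using Bm_nonneg by (simp add: mult_left_mono)
  qed
  have n2: "L2_norm (\<lambda>x. of_real (N * m (norm x)) * f x) \<le> (N * Bm) * L2_norm f"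
    by (rule L2_norm_mono[OF D(1) L2_fun_measurable[OF L2] AE_I2])
      (use b2 N_nonneg Bm_nonneg in \<open>auto simp: norm_mult simp del: of_real_mult intro!: mult_right_mono\<close>)
  have "L2_norm (Mul f g) \<le> L2_norm (\<lambda>x. \<Sum>c\<in>Basis. of_real (m (norm x) * (x \<bullet> c)) * g c x) + L2_norm (\<lambda>x. of_real (N * m (norm x)) * f x)"
    unfolding Mul_def[abs_def] by (rule L2_norm_triangle[OF L2_fun_sum[OF L1] L2])
  also have "\<dots> \<le> (\<Sum>c\<in>Basis. L2_norm (\<lambda>x::'a. of_real (m (norm x) * (x \<bullet> c)) * g c x)) + (N * Bm) * L2_norm f"
    by (rule add_mono[OF L2_norm_sum_le[OF finite_Basis L1] n2])
  also have "\<dots> \<le> (\<Sum>c\<in>(Basis::'a set). Bm * ?G) + (DIM('a) * Bm) * L2_norm f"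
  proof (rule add_mono[OF sum_mono[OF n1]])
    have "N \<le> DIM('a)" using N_def by simp
    then show "(N * Bm) * L2_norm f \<le> (DIM('a) * Bm) * L2_norm f"
      using Bm_nonneg by (intro mult_right_mono) auto
  qed
  finally show ?thesis by (simp add: algebra_simps)
qed

text \<open>The Morawetz inequality with \<open>v = \<omega> |F|\<close>: the integral of \<open>v |M f|\<close> on its left-hand side cancels the
  pairing of the source with \<open>M f\<close> on the right.\<close>

lemma carleman_weighted_estimate:
  fixes f :: "'a \<Rightarrow> complex"
  assumes fg: "weak_grad f g" and gh: "\<And>b. b \<in> Basis \<Longrightarrow> weak_grad (g b) (h b)"
    and origin: "N \<ge> 1 \<or> (\<forall>x. norm x < 1 \<longrightarrow> f x = 0)"
    and \<phi>: "lip_bdd \<phi>" "AE x in lebesgue. (\<phi> has_derivative dphase x) (at x)"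
    and eq: "has_conj_laplacian \<tau> \<phi> f p" and F: "L2_fun F"
    and \<omega>: "lip_bdd \<omega>" "\<And>x. 0 \<le> \<omega> x" and \<omega>m: "\<And>x. norm x * m (norm x) / \<Phi> (norm x) * (\<omega> x)\<^sup>2 \<le> 4"
    and p: "\<And>x. p x = of_real (\<omega> x) * F x + of_real (lam\<^sup>2) * f x - \<sigma> * \<i> * of_real \<epsilon> * f x"
    and \<sigma>: "cmod \<sigma> = 1" and \<epsilon>: "\<epsilon> \<ge> 0"
  shows "(LINT x|lebesgue. W (norm x) * (cmod (f x))\<^sup>2)
    \<le> (L2_norm F)\<^sup>2 / \<tau> + \<epsilon> * L2_norm f * L2_norm (Mul f g)"
proof -
  note D = weak_gradD[OF fg] and M = weak_grad_Mul[OF fg gh]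
  note LM = weak_gradD(1)[OF M]
  have L\<omega>F: "L2_fun (\<lambda>x. of_real (\<omega> x) * F x)" by (rule L2_fun_lip_mult[OF F lip_bdd_of_real[OF \<omega>(1)]])
  have Lp: "L2_fun p" unfolding p[abs_def] by (intro L2_fun_diff L2_fun_add L\<omega>F L2_fun_cmult D)
  define v where "v x = \<omega> x * cmod (F x)" for x
  have v0: "0 \<le> v x" for x using \<omega>(2) by (simp add: v_def)
  have vL: "L2_fun (\<lambda>x. complex_of_real (v x))"
  proof (rule L2_fun_bound[OF L\<omega>F, where C = 1])
    have "(\<lambda>x. complex_of_real (cmod (of_real (\<omega> x) * F x))) \<in> borel_measurable lebesgue"
      using L2_fun_measurable[OF L\<omega>F] by measurable
    then show "(\<lambda>x. complex_of_real (v x)) \<in> borel_measurable lebesgue"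
      using \<omega>(2) by (simp add: v_def norm_mult)
  qed (simp add: v_def norm_mult)
  let ?q = "\<lambda>x::'a. norm x * m (norm x) / \<Phi> (norm x) * (v x)\<^sup>2"
  have q0: "0 \<le> ?q x" for x
    using m_nonneg[of "norm x"] Phi_pos[of "norm x"] by simp
  have q4: "?q x \<le> 4 * (cmod (F x))\<^sup>2" for x
  proof -
    have "?q x = norm x * m (norm x) / \<Phi> (norm x) * (\<omega> x)\<^sup>2 * (cmod (F x))\<^sup>2" by (simp add: v_def power_mult_distrib)
    also have "\<dots> \<le> 4 * (cmod (F x))\<^sup>2" by (rule mult_right_mono[OF \<omega>m]) simp
    finally show ?thesis .
  qed
  have vi: "integrable lebesgue ?q"
  proof (rule Bochner_Integration.integrable_bound)
    show "integrable lebesgue (\<lambda>x. 4 * (cmod (F x))\<^sup>2)" using L2_fun_integrable[OF F] by simp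
    have m1: "(\<lambda>x::'a. m (norm x)) \<in> borel_measurable lebesgue" and m2: "(\<lambda>x::'a. \<Phi> (norm x)) \<in> borel_measurable lebesgue"
      by (intro continuous_lebesgue_measurable lip_bdd_continuous lip_m lip_Phi)+
    have m3: "(\<lambda>x::'a. norm x) \<in> borel_measurable lebesgue"
      by (intro continuous_lebesgue_measurable continuous_intros)
    have m4: "v \<in> borel_measurable lebesgue"
    proof -
      have "(\<lambda>x. Re (complex_of_real (v x))) \<in> borel_measurable lebesgue"
        using L2_fun_measurable[OF vL] by measurable
      then show ?thesis by simp
    qed
    show "?q \<in> borel_measurable lebesgue" using m1 m2 m3 m4 by measurable
    show "AE x in lebesgue. norm (?q x) \<le> norm (4 * (cmod (F x))\<^sup>2)"
    proof (rule AE_I2)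
      fix x :: 'a
      have "norm (?q x) = ?q x" "norm (4 * (cmod (F x))\<^sup>2) = 4 * (cmod (F x))\<^sup>2"
        by (simp_all only: real_norm_def) (simp_all only: abs_of_nonneg[OF q0], simp)
      then show "norm (?q x) \<le> norm (4 * (cmod (F x))\<^sup>2)" using q4[of x] by (simp only:)
    qed
  qed
  have I: "(LINT x|lebesgue. norm x * m (norm x) / (4 * \<tau> * \<Phi> (norm x)) * (v x)\<^sup>2) \<le> (L2_norm F)\<^sup>2 / \<tau>"
  proof -
    have "(LINT x|lebesgue. norm x * m (norm x) / (4 * \<tau> * \<Phi> (norm x)) * (v x)\<^sup>2) = (LINT x|lebesgue. 1 / (4 * \<tau>) * ?q x)"
      by (simp add: mult_ac)
    also have "\<dots> = 1 / (4 * \<tau>) * (LINT x|lebesgue. ?q x)" by (rule integral_mult_right_zero)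
    also have "\<dots> \<le> 1 / (4 * \<tau>) * (LINT x|lebesgue. 4 * (cmod (F x))\<^sup>2)"
      using tau_pos by (intro mult_left_mono integral_mono vi q4) (use L2_fun_integrable[OF F] in auto)
    also have "\<dots> = (L2_norm F)\<^sup>2 / \<tau>" using tau_pos by (simp add: L2_norm_sq)
    finally show ?thesis .
  qed
  have ivM: "integrable lebesgue (\<lambda>x. v x * cmod (Mul f g x))"
    using integrable_L2_mult_norm[OF vL LM] v0 by simp
  have ifM: "integrable lebesgue (\<lambda>x. cmod (f x) * cmod (Mul f g x))"
    by (rule integrable_L2_mult_norm[OF D(1) LM])
  have LMc: "L2_fun (\<lambda>x. cnj (Mul f g x))" by (rule L2_fun_cnj[OF LM])
  have ip: "integrable lebesgue (\<lambda>x. p x * cnj (Mul f g x))" by (rule integrable_L2_mult[OF Lp LMc])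
  have iff: "integrable lebesgue (\<lambda>x. f x * cnj (Mul f g x))" by (rule integrable_L2_mult[OF D(1) LMc])
  have "(LINT x|lebesgue. Form f g h x) = (LINT x|lebesgue. p x * cnj (Mul f g x)) - of_real (lam\<^sup>2) * (LINT x|lebesgue. f x * cnj (Mul f g x))"
  proof -
    have E: "(\<Sum>b\<in>Basis. LINT x|lebesgue. (g b x - of_real (\<tau> * dphase x b) * f x) *
        (cnj (dMul f g h b x) + of_real (\<tau> * dphase x b) * cnj (Mul f g x))) = (LINT x|lebesgue. p x * cnj (Mul f g x))"
      by (rule weak_conjugated_equation[OF \<phi> fg eq Lp weak_grad_cnj[OF M]])
    show ?thesis unfolding E[symmetric] by (rule integral_Form[OF fg gh])
  qed
  also have "\<dots> = (LINT x|lebesgue. p x * cnj (Mul f g x) - of_real (lam\<^sup>2) * (f x * cnj (Mul f g x)))"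
    using ip iff by simp
  finally have eF: "(LINT x|lebesgue. Form f g h x) = (LINT x|lebesgue. p x * cnj (Mul f g x) - of_real (lam\<^sup>2) * (f x * cnj (Mul f g x)))" .
  have "Re (LINT x|lebesgue. Form f g h x) \<le> cmod (LINT x|lebesgue. Form f g h x)" by (rule complex_Re_le_cmod)
  also have "\<dots> \<le> (LINT x|lebesgue. v x * cmod (Mul f g x) + \<epsilon> * (cmod (f x) * cmod (Mul f g x)))"
    unfolding eF
  proof (rule Bochner_Integration.integral_norm_bound_integral)
    show "integrable lebesgue (\<lambda>x. p x * cnj (Mul f g x) - of_real (lam\<^sup>2) * (f x * cnj (Mul f g x)))"
      using ip iff by simp
    show "integrable lebesgue (\<lambda>x. v x * cmod (Mul f g x) + \<epsilon> * (cmod (f x) * cmod (Mul f g x)))"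
      using ivM ifM by simp
    fix x
    have "p x * cnj (Mul f g x) - of_real (lam\<^sup>2) * (f x * cnj (Mul f g x))
      = (of_real (\<omega> x) * F x - \<sigma> * \<i> * of_real \<epsilon> * f x) * cnj (Mul f g x)" by (simp add: p algebra_simps)
    then have "cmod (p x * cnj (Mul f g x) - of_real (lam\<^sup>2) * (f x * cnj (Mul f g x)))
      = cmod (of_real (\<omega> x) * F x - \<sigma> * \<i> * of_real \<epsilon> * f x) * cmod (Mul f g x)" by (simp only: norm_mult complex_mod_cnj)
    also have "\<dots> \<le> (cmod (of_real (\<omega> x) * F x) + cmod (\<sigma> * \<i> * of_real \<epsilon> * f x)) * cmod (Mul f g x)"
      by (intro mult_right_mono norm_triangle_ineq4) simp
    also have "\<dots> = v x * cmod (Mul f g x) + \<epsilon> * (cmod (f x) * cmod (Mul f g x))"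
      using \<sigma> \<epsilon> \<omega>(2)[of x] by (simp add: v_def norm_mult algebra_simps)
    finally show "cmod (p x * cnj (Mul f g x) - of_real (lam\<^sup>2) * (f x * cnj (Mul f g x))) \<le> v x * cmod (Mul f g x) + \<epsilon> * (cmod (f x) * cmod (Mul f g x))" .
  qed
  also have "\<dots> = (LINT x|lebesgue. v x * cmod (Mul f g x)) + \<epsilon> * (LINT x|lebesgue. cmod (f x) * cmod (Mul f g x))"
    using ivM ifM by simp
  also have "\<dots> \<le> (LINT x|lebesgue. v x * cmod (Mul f g x)) + \<epsilon> * (L2_norm f * L2_norm (Mul f g))"
    by (intro add_left_mono mult_left_mono L2_Cauchy_Schwarz D(1) LM \<epsilon>)
  finally have "Re (LINT x|lebesgue. Form f g h x) \<le> (LINT x|lebesgue. v x * cmod (Mul f g x)) + \<epsilon> * (L2_norm f * L2_norm (Mul f g))" .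
  moreover have "(LINT x|lebesgue. W (norm x) * (cmod (f x))\<^sup>2) + (LINT x|lebesgue. v x * cmod (Mul f g x))
     - (LINT x|lebesgue. norm x * m (norm x) / (4 * \<tau> * \<Phi> (norm x)) * (v x)\<^sup>2) \<le> Re (LINT x|lebesgue. Form f g h x)"
    by (rule morawetz_inequality[OF fg gh origin v0 vL vi])
  moreover have "\<epsilon> * (L2_norm f * L2_norm (Mul f g)) = \<epsilon> * L2_norm f * L2_norm (Mul f g)" by simp
  ultimately show ?thesis using I by linarith
qed

end

context bump
begin

text \<open>The constant \<open>1 + 2 \<tau>\<close> bounds \<open>|\<partial>\<^sub>b \<rho>| / \<rho> + \<tau> |\<partial>\<^sub>b \<phi>|\<close>.\<close>

lemma weighted_energy_estimate:
  fixes f :: "'a \<Rightarrow> complex"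
  assumes \<phi>: "lip_bdd \<phi>" "AE x in lebesgue. (\<phi> has_derivative \<phi>' x) (at x)" and \<phi>'b: "\<And>x b. b \<in> Basis \<Longrightarrow> \<bar>\<phi>' x b\<bar> \<le> 2"
    and \<rho>: "lip_bdd \<rho>" "AE x in lebesgue. (\<rho> has_derivative \<rho>' x) (at x)" "\<And>x. 0 \<le> \<rho> x" "\<And>x. \<rho> x \<le> 1"
      "\<And>x b. b \<in> Basis \<Longrightarrow> \<bar>\<rho>' x b\<bar> \<le> \<rho> x"
    and \<omega>: "lip_bdd \<omega>" "\<And>x. 0 \<le> \<omega> x" "\<And>x. \<omega> x \<le> 1"
    and fg: "weak_grad f g" and eq: "has_conj_laplacian \<tau> \<phi> f p" and F: "L2_fun F"
    and p: "\<And>x. p x = of_real (\<omega> x) * F x + of_real (lam\<^sup>2) * f x - \<sigma> * \<i> * of_real \<epsilon> * f x" and \<sigma>: "\<sigma> \<in> {1, -1}"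
    and tau: "\<tau> \<ge> 0"
  defines "X \<equiv> L2_norm (\<lambda>x. of_real (\<rho> x) * f x)"
  shows "(\<Sum>b\<in>Basis. (L2_norm (\<lambda>x. of_real (\<rho> x) * g b x + of_real (\<rho>' x b) * f x))\<^sup>2)
    \<le> real DIM('a) * (1 + 2 * \<tau>)\<^sup>2 * X\<^sup>2 + lam\<^sup>2 * X\<^sup>2 + L2_norm F * X"
proof -
  note D = weak_gradD[OF fg]
  have Lp: "L2_fun p" unfolding p[abs_def]
    by (intro L2_fun_diff L2_fun_add L2_fun_lip_mult[OF F lip_bdd_of_real[OF \<omega>(1)]] L2_fun_cmult D)
  have K: "AE x in lebesgue. \<bar>\<rho>' x b + \<tau> * \<phi>' x b * \<rho> x\<bar> \<le> (1 + 2 * \<tau>) * \<bar>\<rho> x\<bar>" if b: "b \<in> Basis" for b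
  proof (rule AE_I2)
    fix x
    have "\<bar>\<rho>' x b + \<tau> * \<phi>' x b * \<rho> x\<bar> \<le> \<bar>\<rho>' x b\<bar> + \<tau> * \<bar>\<phi>' x b\<bar> * \<rho> x"
      using abs_triangle_ineq[of "\<rho>' x b" "\<tau> * \<phi>' x b * \<rho> x"] tau \<rho>(3)[of x] by (simp add: abs_mult)
    also have "\<dots> \<le> \<rho> x + \<tau> * 2 * \<rho> x"
      using tau \<rho>(3,5) \<phi>'b b by (intro add_mono mult_right_mono mult_left_mono) auto
    finally show "\<bar>\<rho>' x b + \<tau> * \<phi>' x b * \<rho> x\<bar> \<le> (1 + 2 * \<tau>) * \<bar>\<rho> x\<bar>"
      using \<rho>(3)[of x] by (simp add: algebra_simps)
  qed
  show ?thesis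
    using conjugated_energy_estimate[OF \<phi> \<rho>(1,2) fg eq Lp K]
      weighted_source_pairing[OF D(1) F \<rho>(1,3,4) \<omega> p \<sigma>] unfolding X_def by linarith
qed

end

section \<open>The Carleman estimate\<close>

context carleman_weights
begin

text \<open>The square root of the constant of \<open>combine_weighted_estimates\<close>; the factor \<open>2\<close> accounts for \<open>a\<^sup>l \<le> 2 A\<^sup>l\<close>.\<close>

definition carleman_const :: "real \<Rightarrow> real" where
  "carleman_const D = 2 * sqrt ((9 * D + 3) * (4 / cc * (D + 1) * (9 * D + 5) + 1) + 1)"

lemma carleman_const_pos: "D \<ge> 1 \<Longrightarrow> carleman_const D > 0"
  using consts_pos(5) by (auto simp: carleman_const_def intro!: add_nonneg_pos mult_nonneg_nonneg)

lemma morawetz_weight_bound: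
  fixes x :: "'a::euclidean_space"
  shows "norm x * mf (norm x) / Phi (norm x) * (japanese x powr (- s))\<^sup>2 \<le> 4"
proof -
  have s: "0 < s" "s < 1" using basic by auto
  have j: "0 < japanese x" by (rule japanese_pos)
  have "norm x * mf (norm x) / Phi (norm x) \<le> 4 * japanese x powr (2 * s)"
    using rm_over_Phi[of "norm x"] japanese_compare(1)[OF s, of x] by simp
  then have "norm x * mf (norm x) / Phi (norm x) * (japanese x powr (- s))\<^sup>2 \<le> 4 * japanese x powr (2 * s) * (japanese x powr (- s))\<^sup>2"
    by (rule mult_right_mono) simp
  also have "4 * japanese x powr (2 * s) * (japanese x powr (- s))\<^sup>2 = 4"
    using j by (simp add: power2_eq_square flip: powr_add)
  finally show ?thesis .
qed

text \<open>The energy estimate is used with the weight \<open>\<langle>x\<rangle>\<^sup>-\<^sup>s\<close> for the left-hand side and with the weight \<open>1\<close> for the gradient in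
  \<open>M f\<close>; the alternative in \<open>origin\<close> matches the two parts of the theorem.\<close>

lemma carleman_estimate:
  fixes f F p :: "'a::euclidean_space \<Rightarrow> complex" and \<psi> :: "'a \<Rightarrow> complex"
  assumes bump: "bump \<psi>" and dim: "DIM('a) \<ge> 2"
    and tau: "\<tau> \<ge> 1" "\<tau> \<ge> 18 / c0" and lam: "\<delta> > 0" "lam \<ge> \<delta>"
    and big: "52 / (b0 * \<delta>\<^sup>2) * \<tau>\<^sup>2 \<le> a powr (2 * l)"
    and \<epsilon>: "\<epsilon> > 0" and \<sigma>: "\<sigma> \<in> {1, -1}"
    and fg: "weak_grad f g" and gh: "\<And>b. b \<in> Basis \<Longrightarrow> weak_grad (g b) (h b)"
    and origin: "DIM('a) \<ge> 3 \<or> (\<forall>x. norm x < 1 \<longrightarrow> f x = 0)"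
    and eq: "has_conj_laplacian \<tau> (\<lambda>x. ph (norm x)) f p"
    and F_def: "F = (\<lambda>x. of_real (japanese x powr s) * (p x - of_real (lam\<^sup>2) * f x + \<sigma> * \<i> * of_real \<epsilon> * f x))"
    and F: "L2_fun F"
  defines "hh \<equiv> 1 / (lam + \<tau>)"
  shows "H1h_norm hh (\<lambda>x. of_real (japanese x powr (- s)) * f x)
    \<le> carleman_const DIM('a) * hh * \<tau> powr (- 1/2) * L2_norm F + carleman_const DIM('a) * A powr l * (\<epsilon> * hh) powr (1/2) * L2_norm f"
proof -
  interpret bump \<psi> by (rule bump)
  let ?N = "(real DIM('a) - 1) / 2"
  have N: "?N \<ge> 1/2" using dim by simp
  interpret M: radial_bump \<psi> mf mf' Phi dPhi "\<lambda>r. cc * (lam\<^sup>2 + \<tau>\<^sup>2) * (r + 1) powr (- 2 * s)" A lam \<tau>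
    "2 * a powr (2 * l)" "6 * a powr (2 * l)" 2 "3 + 2 * K" "cc * (lam\<^sup>2 + \<tau>\<^sup>2)" ?N
    by (intro radial_bump.intro bump radial_weights_concrete[OF tau lam big N] radial_bump_axioms.intro) simp
  note D = weak_gradD[OF fg]
  have s: "0 < s" "s < 1" using basic by auto
  define \<omega> where "\<omega> x = japanese x powr (- s)" for x :: 'a
  define \<omega>' where "\<omega>' x h = - s * norm x / ((norm x)\<^sup>2 + 1) * japanese x powr (- s) * (x \<bullet> h) / norm x" for x h :: 'a
  have \<omega>: "lip_bdd \<omega>" "AE x in lebesgue. (\<omega> has_derivative \<omega>' x) (at x)"
    "\<And>x. 0 < \<omega> x" "\<And>x. \<omega> x \<le> 1" "\<And>x b. b \<in> Basis \<Longrightarrow> \<bar>\<omega>' x b\<bar> \<le> \<omega> x"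
    unfolding \<omega>_def[abs_def] \<omega>'_def[abs_def] by (fact japanese_weight[OF s])+
  have \<omega>0: "0 \<le> \<omega> x" for x using \<omega>(3)[of x] by simp
  have p: "p x = of_real (\<omega> x) * F x + of_real (lam\<^sup>2) * f x - \<sigma> * \<i> * of_real \<epsilon> * f x" for x
  proof -
    have "complex_of_real (\<omega> x) * of_real (japanese x powr s) = 1"
      using japanese_pos(1)[of x] by (simp add: \<omega>_def flip: of_real_mult powr_add)
    then have "of_real (\<omega> x) * F x = p x - of_real (lam\<^sup>2) * f x + \<sigma> * \<i> * of_real \<epsilon> * f x"
      by (simp add: F_def mult.assoc[symmetric])
    then show ?thesis by simp
  qed
  have \<phi>: "lip_bdd (\<lambda>x::'a. ph (norm x))" by (rule ph_lip_bdd)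
  have d\<phi>: "AE x::'a in lebesgue. ((\<lambda>x. ph (norm x)) has_derivative M.dphase x) (at x)"
    by (rule AE_radial[of "{}"]) (auto simp: M.dphase_def[abs_def] intro: ph_has_derivative)
  define X where "X = L2_norm (\<lambda>x. of_real (\<omega> x) * f x)"
  define Y2 where "Y2 = (\<Sum>b\<in>Basis. (L2_norm (\<lambda>x. of_real (\<omega> x) * g b x + of_real (\<omega>' x b) * f x))\<^sup>2)"
  define G where "G = sqrt (\<Sum>b\<in>Basis. (L2_norm (g b))\<^sup>2)"
  let ?q = "a powr (2 * l)" and ?D = "real DIM('a)"
  have G2: "G\<^sup>2 = (\<Sum>b\<in>Basis. (L2_norm (g b))\<^sup>2)" unfolding G_def by (intro real_sqrt_pow2 sum_nonneg) simp
  have G0: "0 \<le> G" unfolding G_def by (intro real_sqrt_ge_zero sum_nonneg) simp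
  have L\<omega>f: "L2_fun (\<lambda>x. of_real (\<omega> x) * f x)" by (rule L2_fun_lip_mult[OF D(1) lip_bdd_of_real[OF \<omega>(1)]])
  have XN: "X \<le> L2_norm f"
    using L2_norm_mono[OF D(1) L2_fun_measurable[OF L\<omega>f], of 1] \<omega>0 \<omega>(4)
    by (simp add: X_def norm_mult mult_left_le_one_le)
  have E3: "Y2 \<le> ?D * (1 + 2 * \<tau>)\<^sup>2 * X\<^sup>2 + lam\<^sup>2 * X\<^sup>2 + L2_norm F * X"
    unfolding Y2_def X_def
    by (rule weighted_energy_estimate[OF \<phi> d\<phi> M.dphase_bound \<omega>(1,2) \<omega>0 \<omega>(4,5) \<omega>(1) \<omega>0 \<omega>(4) fg eq F p \<sigma>]) (use tau in auto)
  have E2: "G\<^sup>2 \<le> ?D * (1 + 2 * \<tau>)\<^sup>2 * (L2_norm f)\<^sup>2 + lam\<^sup>2 * (L2_norm f)\<^sup>2 + L2_norm F * L2_norm f"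
    using weighted_energy_estimate[OF \<phi> d\<phi> M.dphase_bound, where \<rho> = "\<lambda>x. 1" and \<rho>' = "\<lambda>x h. 0",
        OF _ lip_bdd_const _ _ _ _ \<omega>(1) \<omega>0 \<omega>(4) fg eq F p \<sigma>] tau
    unfolding G2 by simp
  have E1: "cc / 2 * (lam\<^sup>2 + \<tau>\<^sup>2) * X\<^sup>2 \<le> (L2_norm F)\<^sup>2 / \<tau> + 2 * ?D * \<epsilon> * ?q * L2_norm f * (G + L2_norm f)"
  proof -
    have or: "?N \<ge> 1 \<or> (\<forall>x. norm x < 1 \<longrightarrow> f x = 0)" using origin by auto
    have c: "0 \<le> cc * (lam\<^sup>2 + \<tau>\<^sup>2)" using consts_pos by simp
    have "cc / 2 * (lam\<^sup>2 + \<tau>\<^sup>2) * X\<^sup>2 = (LINT x|lebesgue. cc / 2 * (lam\<^sup>2 + \<tau>\<^sup>2) * (cmod (of_real (\<omega> x) * f x))\<^sup>2)"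
      unfolding X_def L2_norm_sq by simp
    also have "\<dots> \<le> (LINT x|lebesgue. cc * (lam\<^sup>2 + \<tau>\<^sup>2) * (norm x + 1) powr (- 2 * s) * (cmod (f x))\<^sup>2)"
    proof (rule integral_mono)
      show "integrable lebesgue (\<lambda>x. cc / 2 * (lam\<^sup>2 + \<tau>\<^sup>2) * (cmod (of_real (\<omega> x) * f x))\<^sup>2)"
        using L2_fun_integrable[OF L\<omega>f] by simp
      show "integrable lebesgue (\<lambda>x. cc * (lam\<^sup>2 + \<tau>\<^sup>2) * (norm x + 1) powr (- 2 * s) * (cmod (f x))\<^sup>2)"
        by (rule M.integrable_W[OF D(1)])
      show "cc / 2 * (lam\<^sup>2 + \<tau>\<^sup>2) * (cmod (of_real (\<omega> x) * f x))\<^sup>2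
        \<le> cc * (lam\<^sup>2 + \<tau>\<^sup>2) * (norm x + 1) powr (- 2 * s) * (cmod (f x))\<^sup>2" for x :: 'a
      proof -
        have "cc / 2 * (lam\<^sup>2 + \<tau>\<^sup>2) * (cmod (of_real (\<omega> x) * f x))\<^sup>2
          = cc * (lam\<^sup>2 + \<tau>\<^sup>2) * (1/2 * (\<omega> x)\<^sup>2) * (cmod (f x))\<^sup>2" by (simp add: norm_mult power_mult_distrib)
        also have "\<dots> \<le> cc * (lam\<^sup>2 + \<tau>\<^sup>2) * (norm x + 1) powr (- 2 * s) * (cmod (f x))\<^sup>2"
          unfolding \<omega>_def using japanese_compare(2)[OF s, of x] c by (intro mult_right_mono mult_left_mono) auto
        finally show ?thesis .
      qed
    qed
    also have "\<dots> \<le> (L2_norm F)\<^sup>2 / \<tau> + \<epsilon> * L2_norm f * L2_norm (M.Mul f g)"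
    proof (rule M.carleman_weighted_estimate[OF fg gh or \<phi> d\<phi> eq F \<omega>(1) \<omega>0 _ p])
      show "norm x * mf (norm x) / Phi (norm x) * (\<omega> x)\<^sup>2 \<le> 4" for x
        unfolding \<omega>_def by (rule morawetz_weight_bound)
    qed (use \<epsilon> \<sigma> in auto)
    also have "\<dots> \<le> (L2_norm F)\<^sup>2 / \<tau> + \<epsilon> * L2_norm f * (2 * ?q * (?D * (G + L2_norm f)))"
      unfolding G_def using \<epsilon> by (intro add_left_mono mult_left_mono M.L2_norm_Mul_le[OF fg]) auto
    finally show ?thesis by (simp only: mult_ac)
  qed
  have q1: "1 \<le> ?q" using basic by (intro powr_pos_ge_one) auto
  have D1: "1 \<le> ?D" using dim by simp
  have lam0: "lam > 0" using lam by simp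
  have hh0: "hh > 0" using lam0 tau by (simp add: hh_def)
  have key: "X\<^sup>2 + hh\<^sup>2 * Y2 \<le> ((9 * ?D + 3) * (4 / cc * (?D + 1) * (9 * ?D + 5) + 1) + 1)
      * (hh\<^sup>2 * (L2_norm F)\<^sup>2 / \<tau> + \<epsilon> * hh * ?q * (L2_norm f)\<^sup>2)"
    by (rule combine_weighted_estimates[OF _ G0 _ _ \<epsilon> q1 consts_pos(5) D1 lam0 tau(1) _ XN E1 E2 E3]) (auto simp: X_def hh_def)
  have wg: "weak_grad (\<lambda>x. of_real (\<omega> x) * f x) (\<lambda>b x. of_real (\<omega> x) * g b x + of_real (\<omega>' x b) * f x)"
  proof (rule weak_grad_lip_mult[OF fg lip_bdd_of_real[OF \<omega>(1)], where w' = "\<lambda>x h. of_real (\<omega>' x h)"])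
    show "AE x in lebesgue. ((\<lambda>x. complex_of_real (\<omega> x)) has_derivative (\<lambda>h. of_real (\<omega>' x h))) (at x)"
      using \<omega>(2) by eventually_elim (rule has_derivative_of_real)
  qed
  let ?u = "hh * \<tau> powr (- 1/2) * L2_norm F" and ?w = "A powr l * (\<epsilon> * hh) powr (1/2) * L2_norm f"
  have u2: "hh\<^sup>2 * (L2_norm F)\<^sup>2 / \<tau> = ?u\<^sup>2"
  proof -
    have "(\<tau> powr (- 1/2))\<^sup>2 = 1 / \<tau>" using tau by (simp add: power2_eq_square powr_minus_divide flip: powr_add)
    then show ?thesis by (simp add: power_mult_distrib)
  qed
  have w2: "\<epsilon> * hh * ?q * (L2_norm f)\<^sup>2 \<le> 4 * ?w\<^sup>2"
  proof -
    have "?q \<le> (2 * A) powr (2 * l)" using A1 basic by (intro powr_mono2) auto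
    also have "\<dots> = 2 powr (2 * l) * (A powr l)\<^sup>2"
      using A1 by (simp add: powr_mult power2_eq_square flip: powr_add)
    also have "2 powr (2 * l) * (A powr l)\<^sup>2 \<le> 4 * (A powr l)\<^sup>2"
      using basic powr_mono[of "2 * l" 2 "2::real"] by (intro mult_right_mono) auto
    finally have q: "?q \<le> 4 * (A powr l)\<^sup>2" .
    have e: "((\<epsilon> * hh) powr (1/2))\<^sup>2 = \<epsilon> * hh"
      using \<epsilon> hh0 by (simp add: power2_eq_square flip: powr_add)
    have "\<epsilon> * hh * ?q * (L2_norm f)\<^sup>2 \<le> \<epsilon> * hh * (4 * (A powr l)\<^sup>2) * (L2_norm f)\<^sup>2"
      using \<epsilon> hh0 q by (intro mult_right_mono mult_left_mono) auto
    also have "\<dots> = 4 * ?w\<^sup>2" by (simp add: power_mult_distrib e)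
    finally show ?thesis .
  qed
  have uw: "0 \<le> ?u" "0 \<le> ?w" using hh0 by simp_all
  let ?C = "(9 * ?D + 3) * (4 / cc * (?D + 1) * (9 * ?D + 5) + 1) + 1"
  have C0: "0 \<le> ?C" using consts_pos(5) by (intro add_nonneg_nonneg mult_nonneg_nonneg) auto
  have "H1h_norm hh (\<lambda>x. of_real (japanese x powr (- s)) * f x) = sqrt (X\<^sup>2 + hh\<^sup>2 * Y2)"
    unfolding H1h_norm_def X_def Y2_def \<omega>_def[symmetric]
    using L2_norm_weak_partial[OF weak_gradD(3,2)[OF wg]] by simp
  also have "\<dots> \<le> sqrt (?C * (2 * (?u + ?w))\<^sup>2)"
  proof (rule real_sqrt_le_mono)
    have "hh\<^sup>2 * (L2_norm F)\<^sup>2 / \<tau> + \<epsilon> * hh * ?q * (L2_norm f)\<^sup>2 \<le> ?u\<^sup>2 + 4 * ?w\<^sup>2" using u2 w2 by simp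
    also have "\<dots> \<le> (2 * (?u + ?w))\<^sup>2"
    proof -
      have "x\<^sup>2 + 4 * y\<^sup>2 \<le> (2 * (x + y))\<^sup>2" if "0 \<le> x" "0 \<le> y" for x y :: real
        using mult_nonneg_nonneg[OF that] by (simp add: power2_eq_square algebra_simps)
      then show ?thesis using uw by blast
    qed
    finally show "X\<^sup>2 + hh\<^sup>2 * Y2 \<le> ?C * (2 * (?u + ?w))\<^sup>2"
      using order_trans[OF key mult_left_mono[OF _ C0]] by blast
  qed
  also have "\<dots> = carleman_const ?D * (?u + ?w)"
    using uw by (simp add: carleman_const_def real_sqrt_mult)
  finally show ?thesis by (simp add: distrib_left mult.assoc)
qed

end

section \<open>Choice of the parameters and cutoff\<close>

text \<open>The exponent \<open>2 / (1 + 2 l - 2 s)\<close> multiplied by \<open>2 l\<close> is at least \<open>2\<close> because \<open>s > 1/2\<close>, so \<open>A\<^sup>2\<^sup>l\<close> grows at least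
  like \<open>\<tau>\<^sup>2\<close>; the factor \<open>A0\<close> provides the constant.\<close>

lemma carleman_parameters_exist:
  fixes s l \<kappa> \<delta> :: real
  assumes sl: "0 < s - 1/2" "s - 1/2 < l" "l < 2 * s / 3" "2 * s / 3 < 2 / 3"
    and kappa: "0 < \<kappa>" "\<kappa> < 2 * s - 1" "\<kappa> < 1 - l" and \<delta>: "\<delta> > 0"
  shows "\<exists>A0 \<tau>0. A0 > 0 \<and> \<tau>0 > 0 \<and> (\<forall>\<tau>\<ge>\<tau>0. \<forall>A. A = A0 * \<tau> powr (2 / (1 + 2 * l - 2 * s)) \<longrightarrow>
     carleman_weights s l \<kappa> A \<and> 1 \<le> \<tau> \<and> 18 / carleman_weights.c0 \<kappa> \<le> \<tau> \<and>
     52 / (carleman_weights.b0 s * \<delta>\<^sup>2) * \<tau>\<^sup>2 \<le> (A + 1) powr (2 * l))"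
proof -
  define M where "M = max 1 (52 / (carleman_weights.b0 s * \<delta>\<^sup>2))"
  define A0 where "A0 = M powr (1 / (2 * l))"
  define e where "e = 2 / (1 + 2 * l - 2 * s)"
  have l: "0 < l" and d: "0 < 1 + 2 * l - 2 * s" using sl by auto
  have M: "M \<ge> 1" by (simp add: M_def)
  have A0: "A0 \<ge> 1" unfolding A0_def using M l powr_mono[of 0 "1 / (2 * l)" M] by simp
  have e0: "0 \<le> e" unfolding e_def using d by simp
  have e2: "2 \<le> e * (2 * l)" unfolding e_def using d sl by (simp add: field_simps)
  have main: "carleman_weights s l \<kappa> A \<and> 1 \<le> \<tau> \<and> 18 / carleman_weights.c0 \<kappa> \<le> \<tau> \<and>
     52 / (carleman_weights.b0 s * \<delta>\<^sup>2) * \<tau>\<^sup>2 \<le> (A + 1) powr (2 * l)"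
    if t: "max 1 (18 / carleman_weights.c0 \<kappa>) \<le> \<tau>" and A: "A = A0 * \<tau> powr e" for \<tau> A
  proof -
    have t1: "1 \<le> \<tau>" using t by simp
    have te: "1 \<le> \<tau> powr e" using powr_mono[of 0 e \<tau>] e0 t1 by simp
    have A1: "1 \<le> A" unfolding A using mult_mono[OF A0 te] A0 by simp
    have "carleman_weights s l \<kappa> A" by (rule carleman_weights.intro[OF sl kappa A1])
    moreover have "52 / (carleman_weights.b0 s * \<delta>\<^sup>2) * \<tau>\<^sup>2 \<le> (A + 1) powr (2 * l)"
    proof -
      have "52 / (carleman_weights.b0 s * \<delta>\<^sup>2) * \<tau>\<^sup>2 \<le> M * \<tau> powr (e * (2 * l))"
      proof (rule mult_mono)
        show "\<tau>\<^sup>2 \<le> \<tau> powr (e * (2 * l))" using powr_mono[OF e2 t1] t1 powr_numeral[of \<tau> "Num.Bit0 Num.One"] by simp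
      qed (use M in \<open>auto simp: M_def\<close>)
      also have "M = A0 powr (2 * l)" unfolding A0_def using M l by (simp add: powr_powr)
      also have "A0 powr (2 * l) * \<tau> powr (e * (2 * l)) = A powr (2 * l)"
        unfolding A using A0 t1 by (simp add: powr_mult powr_powr)
      also have "\<dots> \<le> (A + 1) powr (2 * l)" using A1 l by (intro powr_mono2) auto
      finally show ?thesis .
    qed
    ultimately show ?thesis using t by simp
  qed
  show ?thesis
  proof (intro exI conjI)
    show "0 < A0" using A0 by simp
    show "0 < max 1 (18 / carleman_weights.c0 \<kappa>)" by simp
    show "\<forall>\<tau>\<ge>max 1 (18 / carleman_weights.c0 \<kappa>). \<forall>A. A = A0 * \<tau> powr (2 / (1 + 2 * l - 2 * s)) \<longrightarrow>
     carleman_weights s l \<kappa> A \<and> 1 \<le> \<tau> \<and> 18 / carleman_weights.c0 \<kappa> \<le> \<tau> \<and>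
     52 / (carleman_weights.b0 s * \<delta>\<^sup>2) * \<tau>\<^sup>2 \<le> (A + 1) powr (2 * l)"
      using main unfolding e_def by blast
  qed
qed

lemma sobolev_H2_weak_grad:
  assumes "sobolev_H 2 f"
  obtains g h where "weak_grad f g" "\<And>b. b \<in> Basis \<Longrightarrow> weak_grad (g b) (h b)"
proof -
  have H: "L2_fun f" "\<forall>b\<in>Basis. \<exists>g. has_weak_partial b f g \<and> L2_fun g \<and>
      (\<forall>c\<in>Basis. \<exists>k. has_weak_partial c g k \<and> L2_fun k)"
    using assms by (simp_all add: numeral_2_eq_2)
  obtain g where g: "\<And>b. b \<in> Basis \<Longrightarrow> has_weak_partial b f (g b) \<and> L2_fun (g b) \<and>
      (\<forall>c\<in>Basis. \<exists>k. has_weak_partial c (g b) k \<and> L2_fun k)" using H(2) by metis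
  then obtain h where h: "\<And>b c. b \<in> Basis \<Longrightarrow> c \<in> Basis \<Longrightarrow> has_weak_partial c (g b) (h b c) \<and> L2_fun (h b c)"
    by metis
  show ?thesis by (rule that[of g h]) (use g h H(1) in \<open>simp_all add: weak_grad_def\<close>)
qed

lemma const_minus_test_function:
  fixes \<eta> :: "'a::euclidean_space \<Rightarrow> complex"
  assumes "test_function \<eta>"
  shows "lip_bdd (\<lambda>x. c - \<eta> x)"
    and "AE x in lebesgue. ((\<lambda>x. c - \<eta> x) has_derivative (\<lambda>h. - pderiv_dir h \<eta> x)) (at x)"
proof -
  show "lip_bdd (\<lambda>x. c - \<eta> x)" by (rule lip_bdd_diff[OF lip_bdd_const test_function_lip_bdd[OF assms]])
  show "AE x in lebesgue. ((\<lambda>x. c - \<eta> x) has_derivative (\<lambda>h. - pderiv_dir h \<eta> x)) (at x)"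
  proof (rule AE_I2)
    fix x
    have "(\<eta> has_derivative (\<lambda>h. pderiv_dir h \<eta> x)) (at x)"
      using smooth_fun_differentiable[OF test_function_smooth[OF assms]]
      unfolding pderiv_dir_def by (simp add: frechet_derivative_works[symmetric])
    from has_derivative_diff[OF has_derivative_const this]
    show "((\<lambda>x. c - \<eta> x) has_derivative (\<lambda>h. - pderiv_dir h \<eta> x)) (at x)" by simp
  qed
qed

context bump
begin

text \<open>The factor \<open>1 - \<psi>\<close> and its derivatives are bounded and Lipschitz, so it preserves $H^2$.\<close>

lemma weak_grad_exterior:
  fixes f :: "'a \<Rightarrow> complex"
  assumes fg: "weak_grad f g" and gh: "\<And>b. b \<in> Basis \<Longrightarrow> weak_grad (g b) (h b)"
  obtains g' h' where "weak_grad (\<lambda>x. (1 - \<psi> x) * f x) g'" "\<And>b. b \<in> Basis \<Longrightarrow> weak_grad (g' b) (h' b)"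
proof -
  let ?g = "\<lambda>b x. (1 - \<psi> x) * g b x + - pderiv_dir b \<psi> x * f x"
  note w = const_minus_test_function[OF test_psi, of 1]
  have "weak_grad (\<lambda>x. (1 - \<psi> x) * f x) ?g" by (rule weak_grad_lip_mult[OF fg w])
  moreover have "\<exists>k. weak_grad (?g b) k" if b: "b \<in> Basis" for b
  proof -
    note v = const_minus_test_function[OF test_function_pderiv[OF test_psi b], of 0]
    show ?thesis using weak_grad_add[OF weak_grad_lip_mult[OF gh[OF b] w] weak_grad_lip_mult[OF fg v]] by auto
  qed
  then obtain h' where "\<And>b. b \<in> Basis \<Longrightarrow> weak_grad (?g b) (h' b)" by metis
  ultimately show ?thesis by (rule that)
qed

lemma exterior_norm_bound:
  obtains B where "B \<ge> 1" "\<And>f :: 'a \<Rightarrow> complex. L2_fun f \<Longrightarrow> L2_norm (\<lambda>x. (1 - \<psi> x) * f x) \<le> B * L2_norm f"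
proof -
  note w = const_minus_test_function(1)[OF test_psi, of 1]
  obtain B where B: "\<And>x. cmod (1 - \<psi> x) \<le> B" using lip_bddE[OF w] by metis
  show ?thesis
  proof (rule that[of "max 1 B"])
    fix f :: "'a \<Rightarrow> complex" assume f: "L2_fun f"
    have B': "cmod (1 - \<psi> x) \<le> max 1 B" for x using B[of x] by simp
    show "L2_norm (\<lambda>x. (1 - \<psi> x) * f x) \<le> max 1 B * L2_norm f"
      by (rule L2_norm_mono[OF f L2_fun_measurable[OF L2_fun_lip_mult[OF f w]] AE_I2])
        (use B' in \<open>auto simp: norm_mult intro: mult_right_mono\<close>)
  qed simp
qed

end

theorem proposition2p2:
  fixes \<psi> :: "'a::euclidean_space \<Rightarrow> complex" and s l \<kappa> \<delta> :: real
  assumes dim: "DIM('a) \<ge> 2"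
    and sl: "0 < s - 1/2" "s - 1/2 < l" "l < 2 * s / 3" "2 * s / 3 < 2 / 3"
    and kappa: "0 < \<kappa>" "\<kappa> < 2 * s - 1" "\<kappa> < 1 - l"
    and psi: "test_function \<psi>" "\<And>x. norm x \<le> 1 \<Longrightarrow> \<psi> x = 1"
    and delta: "\<delta> > 0"
  shows "\<exists>C A0 \<tau>0. C > 0 \<and> A0 > 0 \<and> \<tau>0 > 0 \<and>
    (\<forall>\<tau>\<ge>\<tau>0. \<forall>lam\<ge>\<delta>. \<forall>\<epsilon>. 0 < \<epsilon> \<longrightarrow> \<epsilon> \<le> 1 \<longrightarrow> (\<forall>\<sigma>\<in>{1, -1 :: complex}.
      let A = A0 * \<tau> powr (2 / (1 + 2 * l - 2 * s));
          \<phi> = (\<lambda>x::'a. phase s l \<kappa> A (norm x));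
          h = 1 / (lam + \<tau>)
      in
        (\<forall>f p F. sobolev_H 2 f \<longrightarrow>
           has_conj_laplacian \<tau> \<phi> (\<lambda>x. (1 - \<psi> x) * f x) p \<longrightarrow>
           F = (\<lambda>x. of_real (japanese x powr s) *
                  (p x - of_real (lam\<^sup>2) * ((1 - \<psi> x) * f x)
                       + \<sigma> * \<i> * of_real \<epsilon> * ((1 - \<psi> x) * f x))) \<longrightarrow>
           L2_fun F \<longrightarrow>
           H1h_norm h (\<lambda>x. of_real (japanese x powr (- s)) * ((1 - \<psi> x) * f x))
             \<le> C * h * \<tau> powr (- 1/2) * L2_norm F
                + C * A powr l * (\<epsilon> * h) powr (1/2) * L2_norm f) \<and>
        (DIM('a) \<ge> 3 \<longrightarrow>
          (\<forall>f p F. sobolev_H 2 f \<longrightarrow>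
             has_conj_laplacian \<tau> \<phi> f p \<longrightarrow>
             F = (\<lambda>x. of_real (japanese x powr s) *
                    (p x - of_real (lam\<^sup>2) * f x + \<sigma> * \<i> * of_real \<epsilon> * f x)) \<longrightarrow>
             L2_fun F \<longrightarrow>
             H1h_norm h (\<lambda>x. of_real (japanese x powr (- s)) * f x)
               \<le> C * h * \<tau> powr (- 1/2) * L2_norm F
                  + C * A powr l * (\<epsilon> * h) powr (1/2) * L2_norm f))))"
proof -
  have bump: "bump \<psi>" using psi by unfold_locales
  obtain B where B: "B \<ge> 1" "\<And>f :: 'a \<Rightarrow> complex. L2_fun f \<Longrightarrow> L2_norm (\<lambda>x. (1 - \<psi> x) * f x) \<le> B * L2_norm f"
    using bump.exterior_norm_bound[OF bump] by blast
  obtain A0 \<tau>0 where A0: "A0 > 0" "\<tau>0 > 0" and par: "\<And>\<tau> A. \<tau>0 \<le> \<tau> \<Longrightarrow> A = A0 * \<tau> powr (2 / (1 + 2 * l - 2 * s)) \<Longrightarrow>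
     carleman_weights s l \<kappa> A \<and> 1 \<le> \<tau> \<and> 18 / carleman_weights.c0 \<kappa> \<le> \<tau> \<and>
     52 / (carleman_weights.b0 s * \<delta>\<^sup>2) * \<tau>\<^sup>2 \<le> (A + 1) powr (2 * l)"
    using carleman_parameters_exist[OF sl kappa delta] by blast
  define C1 where "C1 = carleman_weights.carleman_const s l \<kappa> DIM('a)"
  have C1: "C1 > 0"
  proof -
    have "carleman_weights s l \<kappa> 1" by (rule carleman_weights.intro[OF sl kappa]) simp
    then show ?thesis unfolding C1_def using dim by (intro carleman_weights.carleman_const_pos) auto
  qed
  have C1B: "C1 \<le> C1 * B" using B(1) C1 by simp
  \<comment> \<open>the estimate for \<open>u = f\<close> and \<open>u = (1 - \<psi>) f\<close> at once\<close>
  have est: "H1h_norm (1 / (lam + \<tau>)) (\<lambda>x. of_real (japanese x powr (- s)) * u x)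
      \<le> C1 * (1 / (lam + \<tau>)) * \<tau> powr (- 1/2) * L2_norm F
        + C1 * A powr l * (\<epsilon> * (1 / (lam + \<tau>))) powr (1/2) * L2_norm u"
    if t: "\<tau>0 \<le> \<tau>" and lam: "\<delta> \<le> lam" and \<epsilon>: "0 < \<epsilon>" and \<sigma>: "\<sigma> \<in> {1, -1}"
      and A: "A = A0 * \<tau> powr (2 / (1 + 2 * l - 2 * s))"
      and u: "weak_grad u g" "\<And>b. b \<in> Basis \<Longrightarrow> weak_grad (g b) (h b)"
      and origin: "DIM('a) \<ge> 3 \<or> (\<forall>x. norm x < 1 \<longrightarrow> u x = 0)"
      and eq: "has_conj_laplacian \<tau> (\<lambda>x. phase s l \<kappa> A (norm x)) u p"
      and F: "F = (\<lambda>x. of_real (japanese x powr s) * (p x - of_real (lam\<^sup>2) * u x + \<sigma> * \<i> * of_real \<epsilon> * u x))" "L2_fun F"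
    for \<tau> lam \<epsilon> \<sigma> A and u p F :: "'a \<Rightarrow> complex" and g h
  proof -
    note P = par[OF t A]
    show ?thesis unfolding C1_def
      by (rule carleman_weights.carleman_estimate[OF _ bump dim _ _ delta lam _ \<epsilon> \<sigma> u origin eq F]) (use P in auto)
  qed
  have H2: "H1h_norm (1 / (lam + \<tau>)) (\<lambda>x. of_real (japanese x powr (- s)) * f x)
      \<le> C1 * B * (1 / (lam + \<tau>)) * \<tau> powr (- 1/2) * L2_norm F
        + C1 * B * A powr l * (\<epsilon> * (1 / (lam + \<tau>))) powr (1/2) * L2_norm f"
    if t: "\<tau>0 \<le> \<tau>" and lam: "\<delta> \<le> lam" and \<epsilon>: "0 < \<epsilon>" and \<sigma>: "\<sigma> \<in> {1, -1}"
      and A: "A = A0 * \<tau> powr (2 / (1 + 2 * l - 2 * s))" and d3: "DIM('a) \<ge> 3" and f: "sobolev_H 2 f"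
      and eq: "has_conj_laplacian \<tau> (\<lambda>x. phase s l \<kappa> A (norm x)) f p"
      and F: "F = (\<lambda>x. of_real (japanese x powr s) * (p x - of_real (lam\<^sup>2) * f x + \<sigma> * \<i> * of_real \<epsilon> * f x))" "L2_fun F"
    for \<tau> lam \<epsilon> \<sigma> A and f p F :: "'a \<Rightarrow> complex"
  proof -
    obtain g h where u: "weak_grad f g" "\<And>b. b \<in> Basis \<Longrightarrow> weak_grad (g b) (h b)"
      using sobolev_H2_weak_grad[OF f] by blast
    have lt: "0 \<le> 1 / (lam + \<tau>)" using lam delta t A0 by simp
    have "H1h_norm (1 / (lam + \<tau>)) (\<lambda>x. of_real (japanese x powr (- s)) * f x)
      \<le> C1 * (1 / (lam + \<tau>)) * \<tau> powr (- 1/2) * L2_norm F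
        + C1 * A powr l * (\<epsilon> * (1 / (lam + \<tau>))) powr (1/2) * L2_norm f"
      by (rule est[OF t lam \<epsilon> \<sigma> A u disjI1[OF d3] eq F])
    also have "\<dots> \<le> C1 * B * (1 / (lam + \<tau>)) * \<tau> powr (- 1/2) * L2_norm F
        + C1 * B * A powr l * (\<epsilon> * (1 / (lam + \<tau>))) powr (1/2) * L2_norm f"
      using lt by (intro add_mono mult_right_mono C1B) auto
    finally show ?thesis .
  qed
  have H1: "H1h_norm (1 / (lam + \<tau>)) (\<lambda>x. of_real (japanese x powr (- s)) * ((1 - \<psi> x) * f x))
      \<le> C1 * B * (1 / (lam + \<tau>)) * \<tau> powr (- 1/2) * L2_norm F
        + C1 * B * A powr l * (\<epsilon> * (1 / (lam + \<tau>))) powr (1/2) * L2_norm f"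
    if t: "\<tau>0 \<le> \<tau>" and lam: "\<delta> \<le> lam" and \<epsilon>: "0 < \<epsilon>" and \<sigma>: "\<sigma> \<in> {1, -1}"
      and A: "A = A0 * \<tau> powr (2 / (1 + 2 * l - 2 * s))" and f: "sobolev_H 2 f"
      and eq: "has_conj_laplacian \<tau> (\<lambda>x. phase s l \<kappa> A (norm x)) (\<lambda>x. (1 - \<psi> x) * f x) p"
      and F: "F = (\<lambda>x. of_real (japanese x powr s) *
         (p x - of_real (lam\<^sup>2) * ((1 - \<psi> x) * f x) + \<sigma> * \<i> * of_real \<epsilon> * ((1 - \<psi> x) * f x)))" "L2_fun F"
    for \<tau> lam \<epsilon> \<sigma> A and f p F :: "'a \<Rightarrow> complex"
  proof -
    obtain g h where u: "weak_grad f g" "\<And>b. b \<in> Basis \<Longrightarrow> weak_grad (g b) (h b)"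
      using sobolev_H2_weak_grad[OF f] by blast
    obtain g' h' where u': "weak_grad (\<lambda>x. (1 - \<psi> x) * f x) g'" "\<And>b. b \<in> Basis \<Longrightarrow> weak_grad (g' b) (h' b)"
      using bump.weak_grad_exterior[OF bump u] by blast
    have lt: "0 \<le> 1 / (lam + \<tau>)" using lam delta t A0 by simp
    have origin: "\<forall>x. norm x < 1 \<longrightarrow> (1 - \<psi> x) * f x = 0" using psi(2) by simp
    let ?q = "A powr l * (\<epsilon> * (1 / (lam + \<tau>))) powr (1/2)"
    have "H1h_norm (1 / (lam + \<tau>)) (\<lambda>x. of_real (japanese x powr (- s)) * ((1 - \<psi> x) * f x))
      \<le> C1 * (1 / (lam + \<tau>)) * \<tau> powr (- 1/2) * L2_norm F
        + C1 * A powr l * (\<epsilon> * (1 / (lam + \<tau>))) powr (1/2) * L2_norm (\<lambda>x. (1 - \<psi> x) * f x)"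
      by (rule est[OF t lam \<epsilon> \<sigma> A u' disjI2[OF origin] eq F])
    also have "C1 * A powr l * (\<epsilon> * (1 / (lam + \<tau>))) powr (1/2) * L2_norm (\<lambda>x. (1 - \<psi> x) * f x)
      = C1 * ?q * L2_norm (\<lambda>x. (1 - \<psi> x) * f x)" by simp
    also have "C1 * (1 / (lam + \<tau>)) * \<tau> powr (- 1/2) * L2_norm F + C1 * ?q * L2_norm (\<lambda>x. (1 - \<psi> x) * f x)
      \<le> C1 * B * (1 / (lam + \<tau>)) * \<tau> powr (- 1/2) * L2_norm F + C1 * ?q * (B * L2_norm f)"
      using lt C1 by (intro add_mono mult_right_mono mult_left_mono C1B B(2) weak_gradD(1)[OF u(1)]) auto
    also have "C1 * ?q * (B * L2_norm f) = C1 * B * A powr l * (\<epsilon> * (1 / (lam + \<tau>))) powr (1/2) * L2_norm f" by simp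
    finally show ?thesis .
  qed
  show ?thesis
    unfolding Let_def
    by (intro exI[of _ "C1 * B"] exI[of _ A0] exI[of _ \<tau>0] conjI allI impI ballI A0 mult_pos_pos C1
        H1[OF _ _ _ _ refl] H2[OF _ _ _ _ refl]) (use B in auto)
qed

end
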